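(* Let $Q=(q_{ij})_{i,j\in\mathcal{S}}$ be a quasi-stochastic matrix with positive left and right eigenvectors $\mathsf{u},\mathsf{v}$, and let $F=(F_{ij})_{i,j\in\mathcal{S}}$ be a matrix of proper distribution functions on $\mathbb{R}$. Suppose that $\sum_{n\ge 1}q_{ii}^{(n)}=\infty$ for some $i\in\mathcal{S}$, that $\mu:=\sum_{i,j\in\mathcal{S}}\mathsf{u}_i q_{ij}\mathsf{v}_j\int x\,F_{ij}(dx)>0$, and that $Q\otimes F$ is nonarithmetic. Let $g:\mathcal{S}\times\mathbb{R}\to\mathbb{R}$ be $\mathsf{u}$-directly Riemann integrable. Then $\mathbb{V}*g=((\mathbb{V}*g)_i)_{i\in\mathcal{S}}$ has bounded components, i.e. $$\sup_{t\in\mathbb{R}}|(\mathbb{V}*g)_i(t)|<\infty\quad\text{for all }i\in\mathcal{S},$$ and, furthermore, $$\lim_{t\to\infty}(\mathbb{V}*g)_i(t)=\frac{\mathsf{v}_i}{\mu}\sum_{j\in\mathcal{S}}\mathsf{u}_j\int g_j(x)\,dx\quad\text{and}\quad\lim_{t\to-\infty}(\mathbb{V}*g)_i(t)=0$$ for all $i\in\mathcal{S}$. If $Q\otimes F$ is even spread out, then these assertions remain valid for all measurable functions $g:\mathcal{S}\times\mathbb{R}\to\mathbb{R}$ such that, with $g_i:=g(i,\cdot)$: each $g_i$ is bounded with $\lim_{|x|\to\infty}g_i(x)=0$; $\sum_{i\in\mathcal{S}}\mathsf{u}_i\|g_i\|_\infty<\infty$; and $\sum_{i\in\mathcal{S}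}\mathsf{u}_i\|g_i\|_1<\infty$.
   Context: $\mathcal{S}=\{1,\dots,m\}$ for some $m\in\mathbb{N}$, or $\mathcal{S}=\mathbb{N}$. A matrix $Q=(q_{ij})_{i,j\in\mathcal{S}}$ is called quasi-stochastic if it is an irreducible nonnegative matrix with maximal eigenvalue $1$ for which there exist positive left and right eigenvectors $\mathsf{u}=(\mathsf{u}_i)_{i\in\mathcal{S}}$, $\mathsf{v}=(\mathsf{v}_i)_{i\in\mathcal{S}}$ (all entries strictly positive), unique up to scaling, i.e. $\mathsf{u}^\top Q=\mathsf{u}^\top$ and $Q\mathsf{v}=\mathsf{v}$. (For infinite $\mathcal{S}$, "maximal eigenvalue $1$" is understood to mean only that such positive eigenvectors for the eigenvalue $1$ exist and are unique up to scaling, so that e.g. every irreducible recurrent stochastic matrix is included.) Fix such $\mathsf{u},\mathsf{v}$ (if $\sum_i\mathsf{u}_i<\infty$ and $\sum_i \mathsf{u}_i\mathsf{v}_i<\infty$ they may be normalized by $\sum_i\mathsf{u}_i=\sum_i\mathsf{u}_i\mathsf{v}_i=1$). Write $Q^n=(q_{ij}^{(n)})$; all entries are finite. Distribution functions are identified with their probability measures. $Q\otimes F(t):=(q_{ij}F_{ij}(t))_{i,j}$. The convolution powers are $(Q\otimes F)^{*0}(t)=$ identity matrix for $t\ge0$ and zero matrix for $t<0$, and $(Q\otimes F)^{*n}_{ij}(t)=\sum_{k\in\mathcal{S}}\int_{\mathbb{R}}(Q\otimes F)^{*(n-1)}_{kj}(t-x)\,q_{ik}F_{ik}(dx)$ for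 $n\ge1$. When $q_{ij}^{(n)}>0$, $F_{ij}^{*n}$ denotes the distribution function with $(Q\otimes F)^{*n}_{ij}=q_{ij}^{(n)}F_{ij}^{*n}$. The matrix renewal measure associated with $Q\otimes F$ is $\mathbb{V}=(\mathbb{V}_{ij})_{i,j}$, the matrix of measures on $\mathbb{R}$ determined by $\mathbb{V}((t,t+h])=\sum_{n\ge0}\big((Q\otimes F)^{*n}(t+h)-(Q\otimes F)^{*n}(t)\big)$, $t\in\mathbb{R}$, $h>0$. For $g:\mathcal{S}\times\mathbb{R}\to\mathbb{R}$ put $g_i:=g(i,\cdot)$ and $(\mathbb{V}*g)_i(t):=\sum_{j\in\mathcal{S}}\int_{\mathbb{R}}g_j(t-x)\,\mathbb{V}_{ij}(dx)$. In the definition of $\mu$ it is understood that the double sum/integral is well-defined (possibly $+\infty$), i.e. $\sum_{i,j}\mathsf{u}_iq_{ij}\mathsf{v}_j\int x^{-}F_{ij}(dx)<\infty$ or the same with $x^+$; if $\mu=\infty$, then $1/\mu:=0$. $Q\otimes F$ is called $d$-arithmetic if $d$ is the maximal positive number such that, for some function $\gamma:\mathcal{S}\to[0,d)$, $F_{ij}(\gamma(j)-\gamma(i)+d\mathbb{Z})=1$ for all $i,j\in\mathcal{S}$ with $\mathsf{u}_iq_{ij}\mathsf{v}_j>0$. If no such $d$ exists, $Q\otimes F$ is called nonarithmetic. $Q\otimes F$ is called spread out if $F_{ij}^{*n}$ is nonsingular with respect to Lebesgue measure for some $n\in\mathbb{N}$ and some $i,j\in\mathcal{S}$ with $\mathsf{u}_iq_{ij}^{(n)}\mathsf{v}_j>0$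 (this implies nonarithmetic). A measurable $g:\mathcal{S}\times\mathbb{R}\to\mathbb{R}$ is called $\mathsf{u}$-directly Riemann integrable if each $g_i$ is Lebesgue-almost everywhere continuous and $\sum_{i\in\mathcal{S}}\mathsf{u}_i\sum_{n\in\mathbb{Z}}\sup_{n\varepsilon<x\le(n+1)\varepsilon}|g_i(x)|<\infty$ for some $\varepsilon>0$. $\|\cdot\|_\infty$ denotes the sup-norm and $\|\cdot\|_1$ the $L^1$-norm with respect to Lebesgue measure. *)

theory Defs
  imports "HOL-Probability.Probability"
begin

section \<open>Quasi-stochastic matrices\<close>

text \<open>
  The state space is a countable index type: up to relabelling either \<open>{1, ..., m}\<close>
  with \<open>m \<ge> 1\<close>, or the natural numbers.
\<close>

fun mat_power :: "('s \<Rightarrow> 's \<Rightarrow> real) \<Rightarrow> nat \<Rightarrow> 's \<Rightarrow> 's \<Rightarrow> real" where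
  "mat_power q 0 i j = (if i = j then 1 else 0)"
| "mat_power q (Suc n) i j = (\<Sum>\<^sub>\<infinity>k. q i k * mat_power q n k j)"

definition irreducible_matrix :: "('s \<Rightarrow> 's \<Rightarrow> real) \<Rightarrow> bool" where
  "irreducible_matrix q \<longleftrightarrow> (\<forall>i j. \<exists>n\<ge>1. mat_power q n i j > 0)"

definition positive_left_eigenvector :: "('s \<Rightarrow> 's \<Rightarrow> real) \<Rightarrow> ('s \<Rightarrow> real) \<Rightarrow> bool" where
  "positive_left_eigenvector q u \<longleftrightarrow>
     (\<forall>i. u i > 0) \<and> (\<forall>j. ((\<lambda>i. u i * q i j) has_sum u j) UNIV)"

definition positive_right_eigenvector :: "('s \<Rightarrow> 's \<Rightarrow> real) \<Rightarrow> ('s \<Rightarrow> real) \<Rightarrow> bool" where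
  "positive_right_eigenvector q v \<longleftrightarrow>
     (\<forall>i. v i > 0) \<and> (\<forall>i. ((\<lambda>j. q i j * v j) has_sum v i) UNIV)"

text \<open>Only meaningful for finite index types.\<close>

definition complex_eigenvalue :: "('s \<Rightarrow> 's \<Rightarrow> real) \<Rightarrow> complex \<Rightarrow> bool" where
  "complex_eigenvalue q z \<longleftrightarrow>
     (\<exists>x. x \<noteq> (\<lambda>_. 0) \<and> (\<forall>i. (\<Sum>j\<in>UNIV. of_real (q i j) * x j) = z * x i))"

text \<open>
  The maximal (Perron-Frobenius) eigenvalue is required to be 1 for a finite state space.
  For an infinite one this requirement only means that positive eigenvectors for the
  eigenvalue 1 exist and are unique up to scaling.
\<close>

definition quasi_stochastic :: "('s \<Rightarrow> 's \<Rightarrow> real) \<Rightarrow> bool" where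
  "quasi_stochastic q \<longleftrightarrow>
     (\<forall>i j. q i j \<ge> 0) \<and> irreducible_matrix q \<and>
     (finite (UNIV :: 's set) \<longrightarrow>
        complex_eigenvalue q 1 \<and> (\<forall>z. complex_eigenvalue q z \<longrightarrow> cmod z \<le> 1)) \<and>
     (\<exists>u. positive_left_eigenvector q u \<and>
        (\<forall>u'. positive_left_eigenvector q u' \<longrightarrow> (\<exists>c. \<forall>i. u' i = c * u i))) \<and>
     (\<exists>v. positive_right_eigenvector q v \<and>
        (\<forall>v'. positive_right_eigenvector q v' \<longrightarrow> (\<exists>c. \<forall>i. v' i = c * v i)))"


section \<open>Convolution powers and the matrix renewal measure\<close>

text \<open>
  Distribution functions are represented by their probability measures \<open>F i j\<close>
  on the Borel sets of the real line.
\<close>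

fun conv_power ::
  "('s \<Rightarrow> 's \<Rightarrow> real) \<Rightarrow> ('s \<Rightarrow> 's \<Rightarrow> real measure) \<Rightarrow> nat \<Rightarrow> 's \<Rightarrow> 's \<Rightarrow> real \<Rightarrow> real" where
  "conv_power q F 0 i j t = (if i = j \<and> 0 \<le> t then 1 else 0)"
| "conv_power q F (Suc n) i j t =
     (\<Sum>\<^sub>\<infinity>k. q i k * (LINT x|F i k. conv_power q F n k j (t - x)))"

text \<open>
  The measure \<open>(\<Sum>n. (Q \<otimes> F)\<^sup>*\<^sup>n)\<close>, each convolution power being identified with its
  Stieltjes measure. Its values on intervals are computed in
  \<open>emeasure_renewal_measure_Ioc\<close> below.
\<close>

definition renewal_measure ::
  "('s \<Rightarrow> 's \<Rightarrow> real) \<Rightarrow> ('s \<Rightarrow> 's \<Rightarrow> real measure) \<Rightarrow> 's \<Rightarrow> 's \<Rightarrow> real measure" where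
  "renewal_measure q F i j =
     measure_of UNIV (sets borel)
       (\<lambda>A. \<Sum>n. emeasure (interval_measure (conv_power q F n i j)) A)"

definition renewal_conv ::
  "('s \<Rightarrow> 's \<Rightarrow> real) \<Rightarrow> ('s \<Rightarrow> 's \<Rightarrow> real measure) \<Rightarrow> ('s \<Rightarrow> real \<Rightarrow> real) \<Rightarrow> 's \<Rightarrow> real \<Rightarrow> real" where
  "renewal_conv q F g i t = (\<Sum>\<^sub>\<infinity>j. LINT x|renewal_measure q F i j. g j (t - x))"

text \<open>
  Absolute convergence of the integrals and of the series in \<open>renewal_conv q F g i t\<close>,
  which would otherwise be silently set to 0.
\<close>

definition renewal_conv_exists ::
  "('s \<Rightarrow> 's \<Rightarrow> real) \<Rightarrow> ('s \<Rightarrow> 's \<Rightarrow> real measure) \<Rightarrow> ('s \<Rightarrow> real \<Rightarrow> real) \<Rightarrow> 's \<Rightarrow> real \<Rightarrow> bool" where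
  "renewal_conv_exists q F g i t \<longleftrightarrow>
     (\<forall>j. integrable (renewal_measure q F i j) (\<lambda>x. g j (t - x))) \<and>
     (\<lambda>j. LINT x|renewal_measure q F i j. \<bar>g j (t - x)\<bar>) summable_on UNIV"


section \<open>Drift, lattice type, spread-out matrices\<close>

definition drift_pos ::
  "('s \<Rightarrow> 's \<Rightarrow> real) \<Rightarrow> ('s \<Rightarrow> real) \<Rightarrow> ('s \<Rightarrow> real) \<Rightarrow> ('s \<Rightarrow> 's \<Rightarrow> real measure) \<Rightarrow> ennreal" where
  "drift_pos q u v F =
     (\<Sum>\<^sub>\<infinity>(i, j). ennreal (u i * q i j * v j) * (\<integral>\<^sup>+x. ennreal (max x 0) \<partial>F i j))"

definition drift_neg ::
  "('s \<Rightarrow> 's \<Rightarrow> real) \<Rightarrow> ('s \<Rightarrow> real) \<Rightarrow> ('s \<Rightarrow> real) \<Rightarrow> ('s \<Rightarrow> 's \<Rightarrow> real measure) \<Rightarrow> ennreal" where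
  "drift_neg q u v F =
     (\<Sum>\<^sub>\<infinity>(i, j). ennreal (u i * q i j * v j) * (\<integral>\<^sup>+x. ennreal (max (- x) 0) \<partial>F i j))"

definition drift_exists ::
  "('s \<Rightarrow> 's \<Rightarrow> real) \<Rightarrow> ('s \<Rightarrow> real) \<Rightarrow> ('s \<Rightarrow> real) \<Rightarrow> ('s \<Rightarrow> 's \<Rightarrow> real measure) \<Rightarrow> bool" where
  "drift_exists q u v F \<longleftrightarrow> drift_neg q u v F < \<infinity> \<or> drift_pos q u v F < \<infinity>"

definition drift ::
  "('s \<Rightarrow> 's \<Rightarrow> real) \<Rightarrow> ('s \<Rightarrow> real) \<Rightarrow> ('s \<Rightarrow> real) \<Rightarrow> ('s \<Rightarrow> 's \<Rightarrow> real measure) \<Rightarrow> ereal" where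
  "drift q u v F = enn2ereal (drift_pos q u v F) - enn2ereal (drift_neg q u v F)"

definition lattice_span ::
  "('s \<Rightarrow> 's \<Rightarrow> real) \<Rightarrow> ('s \<Rightarrow> real) \<Rightarrow> ('s \<Rightarrow> real) \<Rightarrow> ('s \<Rightarrow> 's \<Rightarrow> real measure) \<Rightarrow> real \<Rightarrow> bool" where
  "lattice_span q u v F d \<longleftrightarrow> d > 0 \<and>
     (\<exists>\<gamma>. (\<forall>i. \<gamma> i \<in> {0..<d}) \<and>
        (\<forall>i j. u i * q i j * v j > 0 \<longrightarrow>
           measure (F i j) (range (\<lambda>k::int. \<gamma> j - \<gamma> i + d * of_int k)) = 1))"

definition d_arithmetic ::
  "('s \<Rightarrow> 's \<Rightarrow> real) \<Rightarrow> ('s \<Rightarrow> real) \<Rightarrow> ('s \<Rightarrow> real) \<Rightarrow> ('s \<Rightarrow> 's \<Rightarrow> real measure) \<Rightarrow> real \<Rightarrow> bool" where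
  "d_arithmetic q u v F d \<longleftrightarrow>
     lattice_span q u v F d \<and> (\<forall>d'. lattice_span q u v F d' \<longrightarrow> d' \<le> d)"

definition nonarithmetic ::
  "('s \<Rightarrow> 's \<Rightarrow> real) \<Rightarrow> ('s \<Rightarrow> real) \<Rightarrow> ('s \<Rightarrow> real) \<Rightarrow> ('s \<Rightarrow> 's \<Rightarrow> real measure) \<Rightarrow> bool" where
  "nonarithmetic q u v F \<longleftrightarrow> \<not> (\<exists>d. d_arithmetic q u v F d)"

definition normalized_conv_power ::
  "('s \<Rightarrow> 's \<Rightarrow> real) \<Rightarrow> ('s \<Rightarrow> 's \<Rightarrow> real measure) \<Rightarrow> nat \<Rightarrow> 's \<Rightarrow> 's \<Rightarrow> real measure" where
  "normalized_conv_power q F n i j =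
     interval_measure (\<lambda>t. conv_power q F n i j t / mat_power q n i j)"

definition lebesgue_singular :: "real measure \<Rightarrow> bool" where
  "lebesgue_singular M \<longleftrightarrow>
     (\<exists>A\<in>sets borel. emeasure lborel A = 0 \<and> emeasure M (- A) = 0)"

definition spread_out ::
  "('s \<Rightarrow> 's \<Rightarrow> real) \<Rightarrow> ('s \<Rightarrow> real) \<Rightarrow> ('s \<Rightarrow> real) \<Rightarrow> ('s \<Rightarrow> 's \<Rightarrow> real measure) \<Rightarrow> bool" where
  "spread_out q u v F \<longleftrightarrow>
     (\<exists>n\<ge>1. \<exists>i j. u i * mat_power q n i j * v j > 0 \<and>
        \<not> lebesgue_singular (normalized_conv_power q F n i j))"


section \<open>Classes of integrands\<close>

definition measurable_family :: "('s \<Rightarrow> real \<Rightarrow> real) \<Rightarrow> bool" where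
  "measurable_family g \<longleftrightarrow>
     (\<lambda>(i, x). g i x) \<in> borel_measurable (count_space UNIV \<Otimes>\<^sub>M borel)"

definition directly_Riemann_integrable :: "('s \<Rightarrow> real) \<Rightarrow> ('s \<Rightarrow> real \<Rightarrow> real) \<Rightarrow> bool" where
  "directly_Riemann_integrable u g \<longleftrightarrow>
     measurable_family g \<and>
     (\<forall>i. AE x in lborel. isCont (g i) x) \<and>
     (\<exists>\<epsilon>>0. (\<Sum>\<^sub>\<infinity>i. ennreal (u i) *
        (\<Sum>\<^sub>\<infinity>n::int. SUP x\<in>{of_int n * \<epsilon><..(of_int n + 1) * \<epsilon>}. ennreal \<bar>g i x\<bar>)) < \<infinity>)"

definition weighted_bounded_L1 :: "('s \<Rightarrow> real) \<Rightarrow> ('s \<Rightarrow> real \<Rightarrow> real) \<Rightarrow> bool" where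
  "weighted_bounded_L1 u g \<longleftrightarrow>
     measurable_family g \<and>
     (\<forall>i. bounded (range (g i)) \<and> (g i \<longlongrightarrow> 0) at_infinity) \<and>
     (\<Sum>\<^sub>\<infinity>i. ennreal (u i) * (SUP x. ennreal \<bar>g i x\<bar>)) < \<infinity> \<and>
     (\<Sum>\<^sub>\<infinity>i. ennreal (u i) * (\<integral>\<^sup>+x. ennreal \<bar>g i x\<bar> \<partial>lborel)) < \<infinity>"


section \<open>Consistency of the definition of the renewal measure\<close>

lemma mat_power_bounds:
  assumes q: "\<And>i j. q i j \<ge> 0" and v: "positive_right_eigenvector q v"
  shows "0 \<le> mat_power q n i j \<and> mat_power q n i j \<le> v i / v j"
    and "(\<lambda>k. q i k * mat_power q n k j) summable_on UNIV"
proof -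
  have vpos: "v i > 0" for i
    using v by (auto simp: positive_right_eigenvector_def)
  have v_sum: "((\<lambda>k. q i k * v k) has_sum v i) UNIV" for i
    using v by (auto simp: positive_right_eigenvector_def)
  have dom: "((\<lambda>k. q i k * (v k / v j)) has_sum v i / v j) UNIV" for i j
    using has_sum_cmult_left[OF v_sum[of i], of "1 / v j"] by simp
  have sm: "(\<lambda>k. q i k * m k) summable_on UNIV"
    if "\<And>k. 0 \<le> m k \<and> m k \<le> v k / v j" for m i j
    by (rule summable_on_comparison_test[OF has_sum_imp_summable[OF dom[of i j]]])
       (use that q in \<open>auto intro!: mult_left_mono simp del: times_divide_eq_right\<close>)
  have *: "0 \<le> mat_power q n i j \<and> mat_power q n i j \<le> v i / v j" for n i j
  proof (induction n arbitrary: i)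
    case 0
    then show ?case using vpos[of i] vpos[of j] by (auto simp: less_imp_le)
  next
    case (Suc n)
    have "(\<Sum>\<^sub>\<infinity>k. q i k * mat_power q n k j) \<le> (\<Sum>\<^sub>\<infinity>k. q i k * (v k / v j))"
      by (rule infsum_mono[OF sm has_sum_imp_summable[OF dom]])
         (use Suc q in \<open>auto intro!: mult_left_mono simp del: times_divide_eq_right\<close>)
    also have "\<dots> = v i / v j" using dom[of i j] by (rule infsumI)
    finally show ?case using Suc q by (auto intro!: infsum_nonneg)
  qed
  then show "0 \<le> mat_power q n i j \<and> mat_power q n i j \<le> v i / v j" .
  show "(\<lambda>k. q i k * mat_power q n k j) summable_on UNIV"
    by (rule sm) (use * in auto)
qed

lemma conv_power_props:
  assumes q: "\<And>i j. q i j \<ge> 0" and v: "positive_right_eigenvector q v"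
    and F: "\<And>i j. real_distribution (F i j)"
  shows "0 \<le> conv_power q F n i j t \<and> conv_power q F n i j t \<le> mat_power q n i j"
    and "mono (conv_power q F n i j)"
    and "continuous (at_right t) (conv_power q F n i j)"
proof -
  note bnd = mat_power_bounds(1)[of q v, OF q v] and sm = mat_power_bounds(2)[of q v, OF q v]
  have "(\<forall>i j t. 0 \<le> conv_power q F n i j t \<and> conv_power q F n i j t \<le> mat_power q n i j) \<and>
        (\<forall>i j. mono (conv_power q F n i j)) \<and>
        (\<forall>i j t. (conv_power q F n i j \<longlongrightarrow> conv_power q F n i j t) (at_right t))"
  proof (induction n)
    case 0
    have "((\<lambda>t::real. if i = j \<and> 0 \<le> t then 1 else 0 :: real) \<longlongrightarrow> (if i = j \<and> 0 \<le> t then 1 else 0))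
            (at_right t)" for i j :: 'a and t
    proof (rule tendsto_eventually, cases "0 \<le> t")
      case True
      then show "\<forall>\<^sub>F x in at_right t. (if i = j \<and> 0 \<le> x then 1 else 0 :: real) =
                   (if i = j \<and> 0 \<le> t then 1 else 0)"
        by (auto simp: eventually_at_right_field intro!: exI[of _ "t + 1"])
    next
      case False
      then show "\<forall>\<^sub>F x in at_right t. (if i = j \<and> 0 \<le> x then 1 else 0 :: real) =
                   (if i = j \<and> 0 \<le> t then 1 else 0)"
        by (auto simp: eventually_at_right_field intro!: exI[of _ 0])
    qed
    then show ?case by (auto simp: mono_def fun_eq_iff)
  next
    case (Suc n)
    define G where "G = conv_power q F n"
    define m where "m = mat_power q n"
    have G: "0 \<le> G i j t" "G i j t \<le> m i j" for i j t using Suc by (auto simp: G_def m_def)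
    have Gmono: "G i j s \<le> G i j t" if "s \<le> t" for i j s t
      using Suc that by (auto simp: G_def mono_def)
    have Gcont: "(G i j \<longlongrightarrow> G i j t) (at_right t)" for i j t using Suc by (auto simp: G_def)
    have Gmeas [measurable]: "G i j \<in> borel_measurable borel" for i j
      by (rule borel_measurable_mono) (auto simp: mono_def Gmono)
    have sets [measurable_cong]: "sets (F i j) = sets borel" for i j
      using F[of i j] by (simp add: real_distribution_def real_distribution_axioms_def)
    have prob: "prob_space (F i j)" for i j
      using F[of i j] by (simp add: real_distribution_def)
    define H where "H i k j t = (LINT x|F i k. G k j (t - x))" for i k j t
    have int: "integrable (F i k) (\<lambda>x. G k j (t - x))" for i k j t
      by (rule finite_measure.integrable_const_bound[where B = "m k j"])
         (use G prob in \<open>auto simp: prob_space_def\<close>)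
    have H0: "0 \<le> H i k j t" for i k j t unfolding H_def by (simp add: G)
    have H1: "H i k j t \<le> m k j" for i k j t
    proof -
      interpret prob_space "F i k" by (rule prob)
      have "H i k j t \<le> (LINT x|F i k. m k j)"
        unfolding H_def by (rule integral_mono[OF int]) (auto simp: G)
      then show ?thesis by (simp add: prob_space)
    qed
    have Hmono: "H i k j s \<le> H i k j t" if "s \<le> t" for i k j s t
      unfolding H_def by (rule integral_mono[OF int int]) (use that in \<open>auto intro!: Gmono\<close>)
    have Hcont: "(H i k j \<longlongrightarrow> H i k j t) (at_right t)" for i k j t
    proof (rule tendsto_at_right_sequentially[of t "t + 1"])
      fix S :: "nat \<Rightarrow> real"
      assume S: "\<And>n. t < S n" "S \<longlonglongrightarrow> t"
      interpret prob_space "F i k" by (rule prob)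
      show "(\<lambda>n. H i k j (S n)) \<longlonglongrightarrow> H i k j t"
        unfolding H_def
      proof (rule integral_dominated_convergence[where w = "\<lambda>_. m k j"])
        show "AE x in F i k. (\<lambda>n. G k j (S n - x)) \<longlonglongrightarrow> G k j (t - x)"
        proof (rule AE_I2)
          fix x
          have "filterlim (\<lambda>n. S n - x) (at_right (t - x)) sequentially"
            using S by (auto simp: filterlim_at intro!: tendsto_intros always_eventually)
          then show "(\<lambda>n. G k j (S n - x)) \<longlonglongrightarrow> G k j (t - x)"
            using filterlim_compose[OF Gcont] by blast
        qed
      qed (auto simp: G)
    qed auto
    have C: "conv_power q F (Suc n) i j t = (\<Sum>\<^sub>\<infinity>k. q i k * H i k j t)" for i j t
      by (simp add: H_def G_def)
    have sm1: "(\<lambda>k. q i k * m k j) summable_on UNIV" for i j unfolding m_def by (rule sm)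
    have sm2: "(\<lambda>k. q i k * H i k j t) summable_on UNIV" for i j t
      by (rule summable_on_comparison_test[OF sm1[of i j]])
         (use q H0 H1 in \<open>auto intro!: mult_left_mono\<close>)
    have M: "mat_power q (Suc n) i j = (\<Sum>\<^sub>\<infinity>k. q i k * m k j)" for i j
      by (simp add: m_def)
    have "0 \<le> conv_power q F (Suc n) i j t \<and> conv_power q F (Suc n) i j t \<le> mat_power q (Suc n) i j"
      for i j t
      unfolding C M using q H0 H1
      by (auto intro!: infsum_nonneg infsum_mono sm1 sm2 mult_left_mono)
    moreover have "mono (conv_power q F (Suc n) i j)" for i j
      unfolding mono_def C using q Hmono
      by (auto intro!: infsum_mono sm2 mult_left_mono)
    moreover have "(conv_power q F (Suc n) i j \<longlongrightarrow> conv_power q F (Suc n) i j t) (at_right t)"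
      for i j t
    proof -
      have uc: "uniform_limit UNIV (\<lambda>X t. \<Sum>k\<in>X. q i k * H i k j t)
              (\<lambda>t. \<Sum>\<^sub>\<infinity>k. q i k * H i k j t) (finite_subsets_at_top UNIV)"
        by (rule Weierstrass_m_test_general[OF _ sm1[of i j]])
           (use q H0 H1 in \<open>auto intro!: mult_left_mono simp: abs_mult\<close>)
      have g: "((\<lambda>X. \<Sum>k\<in>X. q i k * H i k j t) \<longlongrightarrow> (\<Sum>\<^sub>\<infinity>k. q i k * H i k j t))
              (finite_subsets_at_top UNIV)"
        using has_sum_infsum[OF sm2[of i j t]] unfolding has_sum_def .
      have f: "\<forall>\<^sub>F X in finite_subsets_at_top UNIV.
          ((\<lambda>t. \<Sum>k\<in>X. q i k * H i k j t) \<longlongrightarrow> (\<Sum>k\<in>X. q i k * H i k j t)) (at_right t)"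
        by (intro always_eventually allI tendsto_intros Hcont)
      have "((\<lambda>t. \<Sum>\<^sub>\<infinity>k. q i k * H i k j t) \<longlongrightarrow> (\<Sum>\<^sub>\<infinity>k. q i k * H i k j t)) (at_right t)"
        by (rule swap_uniform_limit'[OF f g uc])
           (rule eventuallyI, rule UNIV_I, rule finite_subsets_at_top_neq_bot)
      then show ?thesis unfolding C .
    qed
    ultimately show ?case by blast
  qed
  then show "0 \<le> conv_power q F n i j t \<and> conv_power q F n i j t \<le> mat_power q n i j"
    "mono (conv_power q F n i j)" "continuous (at_right t) (conv_power q F n i j)"
    by (auto simp: continuous_within)
qed

lemma sets_renewal_measure [simp, measurable_cong]:
  "sets (renewal_measure q F i j) = sets borel"
  using sets.sets_measure_of_eq[of borel] by (simp add: renewal_measure_def)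

lemma emeasure_renewal_measure:
  assumes "A \<in> sets borel"
  shows "emeasure (renewal_measure q F i j) A =
           (\<Sum>n. emeasure (interval_measure (conv_power q F n i j)) A)"
proof (rule emeasure_measure_of[OF renewal_measure_def])
  show "countably_additive (sets (renewal_measure q F i j))
          (\<lambda>A. \<Sum>n. emeasure (interval_measure (conv_power q F n i j)) A)"
    unfolding countably_additive_def
  proof (intro allI impI)
    fix A :: "nat \<Rightarrow> real set"
    assume A: "range A \<subseteq> sets (renewal_measure q F i j)" "disjoint_family A"
    let ?e = "\<lambda>n. emeasure (interval_measure (conv_power q F n i j))"
    have "(\<Sum>m. \<Sum>n. ?e n (A m)) = (\<Sum>n. \<Sum>m. ?e n (A m))"
      using nn_integral_suminf[of "\<lambda>n m. ?e n (A m)" "count_space UNIV"]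
      by (simp add: nn_integral_count_space_nat)
    also have "\<dots> = (\<Sum>n. ?e n (\<Union>(range A)))"
      using A by (intro suminf_cong suminf_emeasure) auto
    finally show "(\<Sum>m. \<Sum>n. ?e n (A m)) = (\<Sum>n. ?e n (\<Union>(range A)))" .
  qed
qed (use assms in \<open>auto simp: positive_def\<close>)

lemma emeasure_renewal_measure_Ioc:
  assumes "\<And>i j. q i j \<ge> 0" "positive_right_eigenvector q v"
    and "\<And>i j. real_distribution (F i j)" and "h > 0"
  shows "emeasure (renewal_measure q F i j) {t<..t + h} =
           (\<Sum>n. ennreal (conv_power q F n i j (t + h) - conv_power q F n i j t))"
proof -
  note p = conv_power_props[of q v F, OF assms(1-3)]
  have "emeasure (interval_measure (conv_power q F n i j)) {t<..t + h} =
          ennreal (conv_power q F n i j (t + h) - conv_power q F n i j t)" for n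
    using p(2)[of n i j] \<open>h > 0\<close>
    by (intro emeasure_interval_measure_Ioc p(3)) (auto simp: mono_def)
  then show ?thesis by (simp add: emeasure_renewal_measure)
qed

end

theory Submission
  imports Defs
begin

text \<open>
  Fix a state \<open>r\<close>. Excursions of the Markov random walk away from \<open>r\<close> factor \<open>\<V>\<^sub>r\<^sub>j\<close> as the
  convolution of the ordinary renewal measure \<open>U\<close> of the return law \<open>H\<close> with the occupation
  measure of \<open>j\<close> during one excursion. By recurrence and the uniqueness of \<open>u\<close>, \<open>H\<close> has mass 1 and the
  occupation measure has mass \<open>u\<^sub>j / u\<^sub>r\<close>; the drift of \<open>H\<close> is \<open>\<mu> / (u\<^sub>r v\<^sub>r)\<close>, and \<open>H\<close> inherits the
  nonarithmetic and the spread-out property. The theorem thus follows from the renewal theorem for \<open>U\<close> by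
  dominated convergence over the occupation measures.

  Blackwell's theorem for \<open>U\<close> rests on a quantitative Choquet-Deny argument: the translates of
  \<open>x \<mapsto> U f (x)\<close> are asymptotically harmonic, and by the orthogonality of martingale increments
  every asymptotically harmonic bounded Lipschitz function has \<open>H\<close>-almost every point as an
  asymptotic period, hence is slowly varying. Its limits are then read off from the identity
  \<open>1{t \<ge> 0} + P(X \<le> t) 1{t < 0} = H * 1{t \<ge> 0} + P(X > t) 1{t \<ge> 0}\<close>, in which the two tails
  integrate to the negative and the positive part of the mean; the same identity shows that \<open>U\<close> is
  locally finite. In the spread-out case some convolution power of \<open>H\<close> dominates a
  multiple of Lebesgue measure on an interval, and splitting that part off leaves a geometric
  series plus a smooth convolution of \<open>U\<close>.
\<close>

section \<open>Convolution operators and potentials\<close>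

text \<open>Measures act on nonnegative functions with values in \<open>ennreal\<close>: Fubini and
  monotone convergence then apply to infinite potentials as well, at the price that identities with
  differences are stated additively. The obstacle is that displacements may be negative, so that
  even local finiteness of the renewal measure is unclear. It is proved by contradiction: truncated
  potentials, divided by their own growing mass near 0, are asymptotically harmonic, hence slowly
  varying, and the tail identity at 0 would force a truncated right tail to weigh no more than the
  left tail. Harmonicity is used for sequences of functions instead of a limit function, which
  avoids compactness; the same lemma serves truncated potentials (indexed by the number of summands)
  and translates of the full potential (indexed by positions tending to either end). The test
  functions are tents: Lipschitz, which makes the set of periods closed, and compactly supported,
  which makes the harmonic defect vanish far out.\<close>

definition mconv :: "real measure \<Rightarrow> (real \<Rightarrow> ennreal) \<Rightarrow> real \<Rightarrow> ennreal" where
  "mconv M f t = (\<integral>\<^sup>+x. f (t - x) \<partial>M)"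

lemma finite_borel_measureI:
  "finite_measure M \<Longrightarrow> sets M = sets borel \<Longrightarrow> finite_borel_measure M"
  by (simp add: finite_borel_measure_def finite_borel_measure_axioms_def)

lemma real_distribution_finite_borel: "real_distribution M \<Longrightarrow> finite_borel_measure M"
  by (simp add: finite_borel_measure_def finite_borel_measure_axioms_def real_distribution_def
      real_distribution_axioms_def prob_space_def)

lemma (in finite_borel_measure) mconv_measurable [measurable]:
  assumes [measurable]: "f \<in> borel_measurable borel"
  shows "mconv M f \<in> borel_measurable borel"
proof -
  note [measurable_cong] = M_is_borel
  show ?thesis unfolding mconv_def by measurable
qed

lemma mconv_commute:
  assumes M: "finite_borel_measure M" and N: "finite_borel_measure N"
    and [measurable]: "f \<in> borel_measurable borel"
  shows "mconv M (mconv N f) = mconv N (mconv M f)"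
proof
  fix t
  interpret M: finite_borel_measure M by fact
  interpret N: finite_borel_measure N by fact
  note [measurable_cong] = M.M_is_borel N.M_is_borel
  interpret pair_sigma_finite M N ..
  have "mconv M (mconv N f) t = (\<integral>\<^sup>+x. \<integral>\<^sup>+y. f (t - x - y) \<partial>N \<partial>M)" by (simp add: mconv_def)
  also have "\<dots> = (\<integral>\<^sup>+y. \<integral>\<^sup>+x. f (t - x - y) \<partial>M \<partial>N)"
    by (rule Fubini'[symmetric]) measurable
  also have "\<dots> = mconv N (mconv M f) t" by (simp add: mconv_def algebra_simps)
  finally show "mconv M (mconv N f) t = mconv N (mconv M f) t" .
qed

lemma mconv_shift: "mconv M (\<lambda>x. f (x + s)) t = mconv M f (t + s)"
  by (simp add: mconv_def algebra_simps)

lemma mconv_mono: "(\<And>x. f x \<le> g x) \<Longrightarrow> mconv M f t \<le> mconv M g t"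
  unfolding mconv_def by (intro nn_integral_mono) auto

lemma (in finite_borel_measure) mconv_suminf:
  assumes [measurable]: "\<And>n. f n \<in> borel_measurable borel"
  shows "mconv M (\<lambda>x. \<Sum>n. f n x) t = (\<Sum>n. mconv M (f n) t)"
proof -
  note [measurable_cong] = M_is_borel
  show ?thesis unfolding mconv_def by (rule nn_integral_suminf) measurable
qed

lemma (in finite_borel_measure) mconv_add:
  assumes [measurable]: "f \<in> borel_measurable borel" "g \<in> borel_measurable borel"
  shows "mconv M (\<lambda>x. f x + g x) t = mconv M f t + mconv M g t"
proof -
  note [measurable_cong] = M_is_borel
  show ?thesis unfolding mconv_def by (rule nn_integral_add) measurable
qed

lemma (in finite_borel_measure) mconv_sum:
  assumes "\<And>n. n \<in> A \<Longrightarrow> f n \<in> borel_measurable borel"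
  shows "mconv M (\<lambda>x. \<Sum>n\<in>A. f n x) t = (\<Sum>n\<in>A. mconv M (f n) t)"
proof -
  note [measurable_cong] = M_is_borel
  show ?thesis unfolding mconv_def
  proof (rule nn_integral_sum)
    fix n assume "n \<in> A"
    then have [measurable]: "f n \<in> borel_measurable borel" by (rule assms)
    show "(\<lambda>x. f n (t - x)) \<in> borel_measurable M" by measurable
  qed
qed

lemma (in finite_borel_measure) mconv_cmult:
  assumes [measurable]: "f \<in> borel_measurable borel"
  shows "mconv M (\<lambda>x. c * f x) t = c * mconv M f t"
proof -
  note [measurable_cong] = M_is_borel
  show ?thesis unfolding mconv_def by (rule nn_integral_cmult) measurable
qed

lemma mconv_const: "sets M = sets borel \<Longrightarrow> mconv M (\<lambda>_. c) t = c * emeasure M UNIV"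
  using sets_eq_imp_space_eq[of M borel] by (simp add: mconv_def)

lemma mconv_density:
  assumes [measurable]: "f \<in> borel_measurable borel" "g \<in> borel_measurable borel"
  shows "mconv (density lborel g) f t = (\<integral>\<^sup>+s. g s * f (t - s) \<partial>lborel)"
  unfolding mconv_def by (rule nn_integral_density) measurable

lemma nn_integral_lborel_reflect:
  fixes f :: "real \<Rightarrow> ennreal"
  assumes [measurable]: "f \<in> borel_measurable borel"
  shows "(\<integral>\<^sup>+s. f (t - s) \<partial>lborel) = (\<integral>\<^sup>+s. f s \<partial>lborel)"
  using nn_integral_real_affine[of f "-1" t] by (simp add: assms)

text \<open>The substitution s -> t - s exchanges the factors. It turns a tail function from an
  integrand into the density of a measure, which is finite if the tail has finite integral.\<close>

lemma mconv_density_swap: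
  assumes [measurable]: "f \<in> borel_measurable borel" "g \<in> borel_measurable borel"
  shows "mconv (density lborel g) f t = mconv (density lborel f) g t"
proof -
  have "mconv (density lborel g) f t = (\<integral>\<^sup>+s. g s * f (t - s) \<partial>lborel)"
    by (rule mconv_density) measurable
  also have "\<dots> = (\<integral>\<^sup>+s. g (t - s) * f (t - (t - s)) \<partial>lborel)"
    by (rule nn_integral_lborel_reflect[symmetric]) measurable
  also have "\<dots> = mconv (density lborel f) g t"
    by (subst mconv_density) (auto simp: mult.commute)
  finally show ?thesis .
qed

lemma finite_borel_density:
  assumes [measurable]: "g \<in> borel_measurable borel" and "(\<integral>\<^sup>+s. g s \<partial>lborel) < \<infinity>"
  shows "finite_borel_measure (density lborel g)"
  by (intro finite_borel_measureI finite_measureI)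
     (use assms in \<open>auto simp: emeasure_density\<close>)

lemma nn_integral_mconv_lborel:
  assumes M: "finite_borel_measure M" and [measurable]: "f \<in> borel_measurable borel"
  shows "(\<integral>\<^sup>+t. mconv M f t \<partial>lborel) = emeasure M UNIV * (\<integral>\<^sup>+t. f t \<partial>lborel)"
proof -
  interpret M: finite_borel_measure M by fact
  note [measurable_cong] = M.M_is_borel
  interpret pair_sigma_finite lborel M ..
  have "(\<integral>\<^sup>+t. mconv M f t \<partial>lborel) = (\<integral>\<^sup>+x. \<integral>\<^sup>+t. f (t - x) \<partial>lborel \<partial>M)"
    unfolding mconv_def by (rule Fubini'[symmetric]) measurable
  also have "\<dots> = (\<integral>\<^sup>+x. \<integral>\<^sup>+t. f t \<partial>lborel \<partial>M)"
    using nn_integral_real_affine[of f 1 "- _"] by simp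
  finally show ?thesis using M.borel_UNIV by (simp add: mult.commute)
qed

section \<open>Convolution powers and the renewal potential\<close>

definition mpow :: "real measure \<Rightarrow> nat \<Rightarrow> (real \<Rightarrow> ennreal) \<Rightarrow> real \<Rightarrow> ennreal" where
  "mpow M n = mconv M ^^ n"

lemma mpow_0 [simp]: "mpow M 0 f = f" by (simp add: mpow_def)
lemma mpow_Suc: "mpow M (Suc n) f = mconv M (mpow M n f)" by (simp add: mpow_def)
lemma mpow_Suc': "mpow M (Suc n) f = mpow M n (mconv M f)"
  by (simp add: mpow_def funpow_Suc_right del: funpow.simps)
lemma mpow_add: "mpow M (m + n) f = mpow M m (mpow M n f)" by (simp add: mpow_def funpow_add)

text \<open>This is \<open>f\<close> convolved with the renewal measure of \<open>M\<close>. The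
  measure itself is never formed, so the value \<infinity> is allowed.\<close>

definition rpot :: "real measure \<Rightarrow> (real \<Rightarrow> ennreal) \<Rightarrow> real \<Rightarrow> ennreal" where
  "rpot M f t = (\<Sum>n. mpow M n f t)"

lemma mpow_shift: "mpow M n (\<lambda>x. f (x + s)) t = mpow M n f (t + s)"
proof (induction n arbitrary: t)
  case (Suc n)
  have "mpow M n (\<lambda>x. f (x + s)) = (\<lambda>x. mpow M n f (x + s))" using Suc by auto
  then show ?case by (simp add: mpow_Suc mconv_shift)
qed simp

lemma mpow_mono: "(\<And>x. f x \<le> g x) \<Longrightarrow> mpow M n f t \<le> mpow M n g t"
  by (induction n arbitrary: t) (auto simp: mpow_Suc intro: mconv_mono)

context finite_borel_measure begin

lemma mpow_measurable [measurable]: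
  assumes [measurable]: "f \<in> borel_measurable borel"
  shows "mpow M n f \<in> borel_measurable borel"
  by (induction n) (auto simp: mpow_Suc assms)

lemma rpot_measurable [measurable]:
  assumes [measurable]: "f \<in> borel_measurable borel"
  shows "rpot M f \<in> borel_measurable borel"
  unfolding rpot_def by measurable

lemma mpow_suminf:
  assumes [measurable]: "\<And>n. f n \<in> borel_measurable borel"
  shows "mpow M k (\<lambda>x. \<Sum>n. f n x) t = (\<Sum>n. mpow M k (f n) t)"
proof (induction k arbitrary: t)
  case (Suc k)
  have "mpow M k (\<lambda>x. \<Sum>n. f n x) = (\<lambda>x. \<Sum>n. mpow M k (f n) x)" using Suc by auto
  then show ?case by (simp add: mpow_Suc mconv_suminf)
qed simp

lemma mpow_add_fun:
  assumes [measurable]: "f \<in> borel_measurable borel" "g \<in> borel_measurable borel"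
  shows "mpow M k (\<lambda>x. f x + g x) t = mpow M k f t + mpow M k g t"
proof (induction k arbitrary: t)
  case (Suc k)
  have "mpow M k (\<lambda>x. f x + g x) = (\<lambda>x. mpow M k f x + mpow M k g x)" using Suc by auto
  then show ?case by (simp add: mpow_Suc mconv_add)
qed simp

lemma mpow_cmult:
  assumes [measurable]: "f \<in> borel_measurable borel"
  shows "mpow M k (\<lambda>x. c * f x) t = c * mpow M k f t"
proof (induction k arbitrary: t)
  case (Suc k)
  have "mpow M k (\<lambda>x. c * f x) = (\<lambda>x. c * mpow M k f x)" using Suc by auto
  then show ?case by (simp add: mpow_Suc mconv_cmult)
qed simp

lemma mpow_sum:
  assumes [measurable]: "\<And>n. f n \<in> borel_measurable borel"
  shows "mpow M k (\<lambda>x. \<Sum>n\<in>A. f n x) t = (\<Sum>n\<in>A. mpow M k (f n) t)"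
proof (induction k arbitrary: t)
  case (Suc k)
  have "mpow M k (\<lambda>x. \<Sum>n\<in>A. f n x) = (\<lambda>x. \<Sum>n\<in>A. mpow M k (f n) x)" using Suc by auto
  then show ?case by (simp add: mpow_Suc mconv_sum)
qed simp

lemma mpow_mconv_commute:
  assumes N: "finite_borel_measure N" and [measurable]: "f \<in> borel_measurable borel"
  shows "mpow M n (mconv N f) = mconv N (mpow M n f)"
proof (induction n)
  case (Suc n)
  then show ?case
    by (simp add: mpow_Suc mconv_commute[OF finite_borel_measure_axioms N])
qed simp

text \<open>Convolutions commute with every power, and monotone convergence passes this to the
  series. It serves to move smoothing kernels and occupation measures past the renewal
  measure.\<close>

lemma rpot_mconv_commute:
  assumes N: "finite_borel_measure N" and [measurable]: "f \<in> borel_measurable borel"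
  shows "rpot M (mconv N f) t = mconv N (rpot M f) t"
proof -
  have "mconv N (\<lambda>x. \<Sum>n. mpow M n f x) t = (\<Sum>n. mconv N (mpow M n f) t)"
    by (rule finite_borel_measure.mconv_suminf[OF N]) measurable
  then show ?thesis unfolding rpot_def[abs_def] by (simp add: mpow_mconv_commute[OF N])
qed

lemma rpot_suminf:
  assumes [measurable]: "\<And>n. f n \<in> borel_measurable borel"
  shows "rpot M (\<lambda>x. \<Sum>n. f n x) t = (\<Sum>n. rpot M (f n) t)"
proof -
  have "(\<Sum>k. \<Sum>n. mpow M k (f n) t) = (\<Sum>n. \<Sum>k. mpow M k (f n) t)"
    using nn_integral_suminf[of "\<lambda>n k. mpow M k (f n) t" "count_space UNIV"]
    by (simp add: nn_integral_count_space_nat)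
  then show ?thesis by (simp add: rpot_def mpow_suminf)
qed

lemma rpot_cmult:
  assumes [measurable]: "f \<in> borel_measurable borel"
  shows "rpot M (\<lambda>x. c * f x) t = c * rpot M f t"
  by (simp add: rpot_def mpow_cmult)

lemma rpot_unfold:
  assumes [measurable]: "f \<in> borel_measurable borel"
  shows "rpot M f t = f t + mconv M (rpot M f) t"
proof -
  have "rpot M f t = mpow M 0 f t + (\<Sum>n. mpow M (Suc n) f t)"
    unfolding rpot_def using suminf_offset[of "\<lambda>n. mpow M n f t" 1] by simp
  also have "(\<Sum>n. mpow M (Suc n) f t) = mconv M (rpot M f) t"
    unfolding rpot_def[abs_def] by (subst mconv_suminf) (auto simp: mpow_Suc)
  finally show ?thesis by simp
qed

end

lemma rpot_mono: "(\<And>x. f x \<le> g x) \<Longrightarrow> rpot M f t \<le> rpot M g t"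
  unfolding rpot_def by (intro suminf_le mpow_mono) auto

text \<open>The infimum \<open>d\<close> of the positive elements decides: if it is 0, arbitrarily
  small steps make \<open>P\<close> dense, hence everything; if it is positive, it is attained, and
  division with remainder leaves only its multiples.\<close>

lemma closed_subgroup_real:
  fixes P :: "real set"
  assumes cl: "closed P" and zero: "0 \<in> P" and diff: "\<And>x y. x \<in> P \<Longrightarrow> y \<in> P \<Longrightarrow> x - y \<in> P"
    and ne: "P \<noteq> UNIV"
  shows "\<exists>d>0. P \<subseteq> range (\<lambda>k::int. d * of_int k)"
proof -
  have neg: "- x \<in> P" if "x \<in> P" for x using diff[OF zero that] by simp
  have add: "x + y \<in> P" if "x \<in> P" "y \<in> P" for x y using diff[OF that(1) neg[OF that(2)]] by simp
  have natmul: "real n * x \<in> P" if "x \<in> P" for n x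
    by (induction n) (auto simp: zero algebra_simps intro: add that)
  have intmul: "of_int k * x \<in> P" if "x \<in> P" for k x
  proof (cases "k \<ge> 0")
    case True
    then show ?thesis using natmul[OF that, of "nat k"] by simp
  next
    case False
    then show ?thesis using neg[OF natmul[OF that, of "nat (- k)"]] by simp
  qed
  define Q where "Q = {x\<in>P. x > 0}"
  have bdd: "bdd_below Q" by (auto simp: Q_def intro: bdd_belowI[of _ 0])
  show ?thesis
  proof (cases "Q = {}")
    case True
    have "x = 0" if "x \<in> P" for x
      using that neg[OF that] True by (cases x "0::real" rule: linorder_cases) (auto simp: Q_def)
    \<comment> \<open>Here \<open>P = {0}\<close>, which lies in every lattice; the span 1 is an
      arbitrary choice.\<close>
    then show ?thesis by (intro exI[of _ 1]) (auto intro: image_eqI[of _ _ 0])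
  next
    case False
    define d where "d = Inf Q"
    have dle: "d \<le> x" if "x \<in> Q" for x unfolding d_def using bdd that by (rule cInf_lower[rotated])
    have d0: "d \<ge> 0" unfolding d_def by (rule cInf_greatest[OF False]) (auto simp: Q_def)
    have approx: "\<exists>x\<in>Q. x < d + e" if "e > 0" for e
      using cInf_lessD[OF False, of "d + e"] that by (auto simp: d_def)
    \<comment> \<open>Rounding \<open>x\<close> down to a multiple of \<open>z\<close> misses it by
      less than \<open>z\<close>.\<close>
    have red: "\<exists>y\<in>P. \<bar>x - y\<bar> < e \<and> y \<le> x" if "z \<in> Q" "z < e" for x e z
    proof -
      define k where "k = \<lfloor>x / z\<rfloor>"
      have z: "z > 0" "z \<in> P" using that by (auto simp: Q_def)
      have "of_int k * z \<le> x" "x < (of_int k + 1) * z"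
        using z floor_divide_lower[of z x] floor_divide_upper[of z x] by (auto simp: k_def)
      then show ?thesis using intmul[OF z(2), of k] that
        by (intro bexI[of _ "of_int k * z"]) (auto simp: algebra_simps)
    qed
    show ?thesis
    proof (cases "d = 0")
      case True
      have "x \<in> closure P" for x
        unfolding closure_approachable
      proof (intro allI impI)
        fix e :: real assume "e > 0"
        from approx[OF this] True obtain z where "z \<in> Q" "z < e" by auto
        from red[OF this, of x] obtain y where "y \<in> P" "\<bar>x - y\<bar> < e" by auto
        then show "\<exists>y\<in>P. dist y x < e" by (auto simp: dist_real_def abs_minus_commute)
      qed
      then have "P = UNIV" using cl closure_closed[of P] by auto
      with ne show ?thesis by simp
    next
      case False
      then have dpos: "d > 0" using d0 by simp
      have "d \<in> closure P" unfolding closure_approachable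
      proof (intro allI impI)
        fix e :: real assume "e > 0"
        from approx[OF this] obtain z where "z \<in> Q" "z < d + e" by auto
        then show "\<exists>y\<in>P. dist y d < e" using dle[of z]
          by (intro bexI[of _ z]) (auto simp: dist_real_def Q_def)
      qed
      then have dP: "d \<in> P" using cl closure_closed[of P] by auto
      have "x \<in> range (\<lambda>k::int. d * of_int k)" if "x \<in> P" for x
      proof -
        define k where "k = \<lfloor>x / d\<rfloor>"
        have k: "of_int k * d \<le> x" "x < (of_int k + 1) * d"
          using dpos floor_divide_lower[of d x] floor_divide_upper[of d x] by (auto simp: k_def)
        have "x - of_int k * d \<in> P" by (intro diff that intmul dP)
        then have "d \<le> x - of_int k * d" if "x - of_int k * d > 0"
          using dle[of "x - of_int k * d"] that by (simp add: Q_def)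
        with k(2) have "\<not> (x - of_int k * d > 0)" by (auto simp: distrib_right)
        with k(1) have "x = of_int k * d" by linarith
        then have "x = d * of_int k" by (simp add: mult.commute)
        then show ?thesis by blast
      qed
      then show ?thesis using dpos by auto
    qed
  qed
qed

lemma abs_diff_less_half:
  "\<bar>a - b\<bar> \<le> c \<Longrightarrow> \<bar>b - d\<bar> < e / 2 \<Longrightarrow> c < e / 2 \<Longrightarrow> \<bar>a - d\<bar> < (e::real)"
  by linarith

section \<open>Asymptotically harmonic functions\<close>

text \<open>Bounded pointwise convergence to 0 is a notion of smallness that averaging against a
  probability measure preserves, by dominated convergence.\<close>

definition null_seq :: "(nat \<Rightarrow> real \<Rightarrow> real) \<Rightarrow> bool" where
  "null_seq h \<longleftrightarrow> (\<forall>k. h k \<in> borel_measurable borel) \<and> (\<exists>B. \<forall>k x. \<bar>h k x\<bar> \<le> B) \<and>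
     (\<forall>x. (\<lambda>k. h k x) \<longlonglongrightarrow> 0)"

lemma null_seq_add: "null_seq f \<Longrightarrow> null_seq g \<Longrightarrow> null_seq (\<lambda>k x. f k x + g k x)"
proof -
  assume f: "null_seq f" and g: "null_seq g"
  obtain B where B: "\<bar>f k x\<bar> \<le> B" for k x using f by (auto simp: null_seq_def)
  obtain B' where B': "\<bar>g k x\<bar> \<le> B'" for k x using g by (auto simp: null_seq_def)
  have "\<bar>f k x + g k x\<bar> \<le> B + B'" for k x using B[of k x] B'[of k x] by linarith
  moreover have "(\<lambda>k. f k x + g k x) \<longlonglongrightarrow> 0" for x
    using f g tendsto_add[of "\<lambda>k. f k x" 0 sequentially "\<lambda>k. g k x" 0] by (auto simp: null_seq_def)
  moreover have "(\<lambda>x. f k x + g k x) \<in> borel_measurable borel" for k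
    using f g by (intro borel_measurable_add) (auto simp: null_seq_def)
  ultimately show ?thesis unfolding null_seq_def by blast
qed

lemma null_seq_cmult_bounded:
  assumes f: "null_seq f" and [measurable]: "\<And>k. w k \<in> borel_measurable borel"
    and w: "\<And>k x. \<bar>w k x\<bar> \<le> C"
  shows "null_seq (\<lambda>k x. w k x * f k x)"
proof -
  obtain B where B: "\<bar>f k x\<bar> \<le> B" for k x using f by (auto simp: null_seq_def)
  have [measurable]: "f k \<in> borel_measurable borel" for k using f by (auto simp: null_seq_def)
  have "\<bar>w k x * f k x\<bar> \<le> C * B" for k x
    unfolding abs_mult using B[of k x] w[of k x] by (intro mult_mono) auto
  moreover have "(\<lambda>k. w k x * f k x) \<longlonglongrightarrow> 0" for x
  proof (rule Lim_null_comparison)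
    show "\<forall>\<^sub>F k in sequentially. norm (w k x * f k x) \<le> C * \<bar>f k x\<bar>"
      using w by (auto simp: abs_mult intro!: always_eventually mult_right_mono)
    show "(\<lambda>k. C * \<bar>f k x\<bar>) \<longlonglongrightarrow> 0"
      using f tendsto_mult_right_zero[of "\<lambda>k. \<bar>f k x\<bar>" sequentially C]
      by (auto simp: null_seq_def tendsto_rabs_zero)
  qed
  ultimately show ?thesis by (auto simp: null_seq_def)
qed

lemma null_seq_abs:
  assumes f: "null_seq f"
  shows "null_seq (\<lambda>k x. \<bar>f k x\<bar>)"
proof -
  have [measurable]: "f k \<in> borel_measurable borel" for k using f by (auto simp: null_seq_def)
  show ?thesis using f by (auto simp: null_seq_def tendsto_rabs_zero)
qed

section \<open>Averages of bounded real functions\<close>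

definition avg :: "real measure \<Rightarrow> (real \<Rightarrow> real) \<Rightarrow> real \<Rightarrow> real" where
  "avg M f x = (LINT z|M. f (x - z))"

context real_distribution begin

lemma sets_eq_borel: "sets M = sets borel" by (simp add: events_eq_borel)

lemma prob_UNIV [simp]: "prob UNIV = 1" using prob_space by simp

lemma avg_measurable [measurable]:
  assumes [measurable]: "f \<in> borel_measurable borel"
  shows "avg M f \<in> borel_measurable borel"
proof -
  note [measurable_cong] = sets_eq_borel
  show ?thesis unfolding avg_def by measurable
qed

lemma avg_integrable:
  assumes [measurable]: "f \<in> borel_measurable borel" and "\<And>x. \<bar>f x\<bar> \<le> (B::real)"
  shows "integrable M (\<lambda>z. f (x - z))"
proof -
  note [measurable_cong] = sets_eq_borel
  show ?thesis by (rule integrable_const_bound[of _ B]) (use assms(2) in auto)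
qed

lemma avg_bounded:
  assumes "f \<in> borel_measurable borel" "\<And>x. \<bar>f x\<bar> \<le> B"
  shows "\<bar>avg M f x\<bar> \<le> B"
proof -
  have "\<bar>avg M f x\<bar> \<le> (LINT z|M. \<bar>f (x - z)\<bar>)" unfolding avg_def by (rule integral_abs_bound)
  also have "\<dots> \<le> (LINT z|M. B)"
    by (rule integral_mono) (use assms avg_integrable[OF assms, of x] in auto)
  finally show ?thesis by (simp add: prob_space)
qed

lemma avg_mono:
  assumes "f \<in> borel_measurable borel" "\<And>x. \<bar>f x\<bar> \<le> B"
    "g \<in> borel_measurable borel" "\<And>x. \<bar>g x\<bar> \<le> B'" "\<And>x. f x \<le> g x"
  shows "avg M f x \<le> avg M g x"
  unfolding avg_def by (intro integral_mono avg_integrable[of f B] avg_integrable[of g B'] assms)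

lemma avg_add:
  assumes "f \<in> borel_measurable borel" "\<And>x. \<bar>f x\<bar> \<le> B"
    "g \<in> borel_measurable borel" "\<And>x. \<bar>g x\<bar> \<le> B'"
  shows "avg M (\<lambda>x. f x + g x) x = avg M f x + avg M g x"
  unfolding avg_def by (intro Bochner_Integration.integral_add avg_integrable[of f B] avg_integrable[of g B'] assms)

lemma avg_minus:
  assumes "f \<in> borel_measurable borel" "\<And>x. \<bar>f x\<bar> \<le> B"
    "g \<in> borel_measurable borel" "\<And>x. \<bar>g x\<bar> \<le> B'"
  shows "avg M (\<lambda>x. f x - g x) x = avg M f x - avg M g x"
  unfolding avg_def by (intro Bochner_Integration.integral_diff avg_integrable[of f B] avg_integrable[of g B'] assms)

lemma null_seq_avg:
  assumes f: "null_seq f"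
  shows "null_seq (\<lambda>k. avg M (f k))"
proof -
  note [measurable_cong] = sets_eq_borel
  obtain B where B: "\<bar>f k x\<bar> \<le> B" for k x using f by (auto simp: null_seq_def)
  have [measurable]: "f k \<in> borel_measurable borel" for k using f by (auto simp: null_seq_def)
  have "(\<lambda>k. avg M (f k) x) \<longlonglongrightarrow> (LINT z|M. 0)" for x
    unfolding avg_def
    by (rule integral_dominated_convergence[where w = "\<lambda>_. B"])
       (use f B in \<open>auto simp: null_seq_def\<close>)
  moreover have "\<bar>avg M (f k) x\<bar> \<le> B" for k x by (rule avg_bounded) (use B in auto)
  ultimately show ?thesis by (auto simp: null_seq_def)
qed

end

lemma abs_diff_sq_le:
  fixes a b c d :: real
  assumes "\<bar>a\<bar> \<le> c" "\<bar>b\<bar> \<le> c"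
  shows "a\<^sup>2 \<le> b\<^sup>2 + 2 * c * \<bar>a - b\<bar>"
proof -
  have "a\<^sup>2 - b\<^sup>2 = (a - b) * (a + b)" by (simp add: power2_eq_square algebra_simps)
  also have "\<dots> \<le> \<bar>a - b\<bar> * \<bar>a + b\<bar>" by (metis abs_ge_self abs_mult)
  also have "\<dots> \<le> \<bar>a - b\<bar> * (2 * c)" using assms by (intro mult_left_mono) auto
  finally show ?thesis by (simp add: mult.commute)
qed

section \<open>Orthogonality of martingale increments\<close>

locale asymptotically_harmonic = real_distribution +
  fixes u :: "nat \<Rightarrow> real \<Rightarrow> real" and C :: real
  assumes u_meas [measurable]: "\<And>k. u k \<in> borel_measurable borel"
    and u_bdd: "\<And>k x. \<bar>u k x\<bar> \<le> C"
    and u_harm: "\<And>x. (\<lambda>k. u k x - avg M (u k) x) \<longlonglongrightarrow> 0"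
begin

text \<open>\<open>e k\<close> is the defect of harmonicity. \<open>D k x\<close> is the mean
  squared increment of \<open>u k\<close> over one step of the walk from \<open>x\<close>, the
  conditional variance of a martingale increment if the defect is 0.\<close>

definition "e k x = u k x - avg M (u k) x"
definition "D k x = (LINT z|M. (u k (x - z) - u k x)\<^sup>2)"

lemma C_nonneg: "C \<ge> 0" using u_bdd[of 0 0] by linarith

lemma e_meas [measurable]: "e k \<in> borel_measurable borel"
  unfolding e_def by measurable

lemma avg_u_bdd: "\<bar>avg M (u k) x\<bar> \<le> C" by (rule avg_bounded[OF u_meas u_bdd])

lemma e_bdd: "\<bar>e k x\<bar> \<le> 2 * C"
  using u_bdd[of k x] avg_u_bdd[of k x] by (auto simp: e_def)

lemma null_e: "null_seq e"
  using u_harm e_bdd unfolding null_seq_def e_def[symmetric] by auto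

lemma sq_bdd: "\<bar>(u k x - u k y)\<^sup>2\<bar> \<le> 4 * C\<^sup>2"
proof -
  have "\<bar>u k x - u k y\<bar> \<le> 2 * C" using u_bdd[of k x] u_bdd[of k y] by linarith
  then have "\<bar>u k x - u k y\<bar>\<^sup>2 \<le> (2 * C)\<^sup>2" by (intro power_mono) auto
  then show ?thesis by (simp add: power_mult_distrib)
qed

lemma D_meas [measurable]: "D k \<in> borel_measurable borel"
proof -
  note [measurable_cong] = sets_eq_borel
  show ?thesis unfolding D_def by measurable
qed

lemma D_int: "integrable M (\<lambda>z. (u k (x - z) - u k x)\<^sup>2)"
proof -
  note [measurable_cong] = sets_eq_borel
  show ?thesis by (rule integrable_const_bound[of _ "4 * C\<^sup>2"]) (use sq_bdd in auto)
qed

lemma D_nonneg: "0 \<le> D k x" unfolding D_def by simp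

lemma D_bdd: "\<bar>D k x\<bar> \<le> 4 * C\<^sup>2"
proof -
  have "D k x \<le> (LINT z|M. 4 * C\<^sup>2)"
    unfolding D_def by (rule integral_mono[OF D_int]) (use sq_bdd[of k] in auto)
  then show ?thesis using D_nonneg[of k x] by (simp add: prob_space)
qed

lemma usq_bdd: "\<bar>(u k x)\<^sup>2\<bar> \<le> C\<^sup>2"
  using power_mono[OF u_bdd[of k x], of 2] by simp

text \<open>Expand the square and insert \<open>avg M (u k) x = u k x - e k x\<close>. Up to the
  defect, \<open>D k\<close> has the form \<open>avg M w - w\<close> with \<open>w\<close> the
  square of \<open>u k\<close>, which telescopes in \<open>sum_avg_D\<close>.\<close>

lemma D_eq: "D k x = avg M (\<lambda>x. (u k x)\<^sup>2) x - (u k x)\<^sup>2 + 2 * u k x * e k x"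
proof -
  have i1: "integrable M (\<lambda>z. u k (x - z))" by (rule avg_integrable[OF u_meas u_bdd])
  have i2: "integrable M (\<lambda>z. (u k (x - z))\<^sup>2)"
    by (rule avg_integrable[of "\<lambda>x. (u k x)\<^sup>2" "C\<^sup>2"]) (use usq_bdd in auto)
  have "D k x = (LINT z|M. (u k (x - z))\<^sup>2 - 2 * u k x * u k (x - z) + (u k x)\<^sup>2)"
    unfolding D_def by (simp add: power2_eq_square algebra_simps)
  also have "\<dots> = avg M (\<lambda>x. (u k x)\<^sup>2) x - 2 * u k x * avg M (u k) x + (u k x)\<^sup>2"
    using i1 i2 by (simp add: avg_def prob_space)
  finally show ?thesis by (simp add: e_def power2_eq_square algebra_simps)
qed

text \<open>The error in \<open>D_le\<close>. Increments of \<open>u k\<close> are bounded by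
  \<open>2 * C\<close>, so replacing their square by the square of their average costs
  \<open>2 * (2 * C)\<close> times the defects at \<open>x - z\<close> and \<open>x\<close>, the
  former averaged over \<open>z\<close>.\<close>

definition "eta k x = 4 * C * (avg M (\<lambda>x. \<bar>e k x\<bar>) x + \<bar>e k x\<bar>)"

lemma null_eta: "null_seq eta"
proof -
  have "null_seq (\<lambda>k x. avg M (\<lambda>x. \<bar>e k x\<bar>) x + \<bar>e k x\<bar>)"
    by (intro null_seq_add null_seq_abs null_e null_seq_avg)
  then show ?thesis unfolding eta_def
    by (rule null_seq_cmult_bounded[where C = "\<bar>4 * C\<bar>"]) auto
qed

text \<open>Jensen's inequality for the almost harmonic functions \<open>x \<mapsto> u k (x - z) - u k x\<close>, averaged over \<open>z\<close>.\<close>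

lemma D_le: "D k x \<le> avg M (D k) x + eta k x"
proof -
  note [measurable_cong] = sets_eq_borel
  define w where "w = (\<lambda>z y. u k (y - z) - u k y)"
  have w_bdd: "\<bar>w z y\<bar> \<le> 2 * C" for z y
    using u_bdd[of k "y - z"] u_bdd[of k y] unfolding w_def by linarith
  have [measurable]: "w z \<in> borel_measurable borel" for z unfolding w_def by measurable
  have avg_w: "avg M (w z) y = w z y - (e k (y - z) - e k y)" for z y
  proof -
    have "avg M (w z) y = avg M (\<lambda>y. u k (y - z)) y - avg M (u k) y"
      unfolding w_def[abs_def] by (rule avg_minus[of _ C _ C]) (use u_bdd in auto)
    also have "avg M (\<lambda>y. u k (y - z)) y = avg M (u k) (y - z)"
      by (simp add: avg_def algebra_simps)
    finally show ?thesis by (simp add: w_def e_def)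
  qed
  have jensen: "(avg M (w z) y)\<^sup>2 \<le> avg M (\<lambda>y. (w z y)\<^sup>2) y" for z y
  proof -
    have int: "integrable M (\<lambda>a. w z (y - a))" by (rule avg_integrable[of "w z" "2*C"]) (use w_bdd in auto)
    have int2: "integrable M (\<lambda>a. (w z (y - a))\<^sup>2)"
      using power_mono[OF w_bdd abs_ge_zero, of _ _ 2]
      by (intro avg_integrable[of "\<lambda>y. (w z y)\<^sup>2" "(2*C)\<^sup>2"]) auto
    have "0 \<le> variance (\<lambda>a. w z (y - a))" by simp
    also have "\<dots> = avg M (\<lambda>y. (w z y)\<^sup>2) y - (avg M (w z) y)\<^sup>2"
      unfolding avg_def by (rule variance_eq[OF int int2])
    finally show ?thesis by simp
  qed
  have step: "(w z x)\<^sup>2 \<le> avg M (\<lambda>y. (w z y)\<^sup>2) x + 4 * C * (\<bar>e k (x - z)\<bar> + \<bar>e k x\<bar>)" for z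
  proof -
    have "(w z x)\<^sup>2 \<le> (avg M (w z) x)\<^sup>2 + 2 * (2 * C) * \<bar>w z x - avg M (w z) x\<bar>"
      by (rule abs_diff_sq_le[OF w_bdd avg_bounded]) (use w_bdd in auto)
    also have "\<bar>w z x - avg M (w z) x\<bar> \<le> \<bar>e k (x - z)\<bar> + \<bar>e k x\<bar>"
      by (simp add: avg_w)
    finally show ?thesis using jensen[of z x] C_nonneg by (simp add: mult_left_mono)
  qed
  interpret P: pair_sigma_finite M M ..
  have W_int: "integrable M (\<lambda>z. avg M (\<lambda>y. (w z y)\<^sup>2) x)"
  proof (rule integrable_const_bound[of _ "4 * C\<^sup>2"])
    show "(\<lambda>z. avg M (\<lambda>y. (w z y)\<^sup>2) x) \<in> borel_measurable M"
      unfolding avg_def w_def by measurable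
    show "AE z in M. norm (avg M (\<lambda>y. (w z y)\<^sup>2) x) \<le> 4 * C\<^sup>2"
      using avg_bounded[of "\<lambda>y. (w _ y)\<^sup>2" "4 * C\<^sup>2"] sq_bdd[of k] by (auto simp: w_def)
  qed
  have e_int: "integrable M (\<lambda>z. \<bar>e k (x - z)\<bar>)"
    by (rule avg_integrable[of "\<lambda>x. \<bar>e k x\<bar>" "2 * C"]) (use e_bdd in auto)
  have "D k x = (LINT z|M. (w z x)\<^sup>2)" by (simp add: D_def w_def)
  also have "\<dots> \<le> (LINT z|M. avg M (\<lambda>y. (w z y)\<^sup>2) x + 4 * C * (\<bar>e k (x - z)\<bar> + \<bar>e k x\<bar>))"
  proof (rule integral_mono)
    show "integrable M (\<lambda>z. (w z x)\<^sup>2)" using D_int[of k x] by (simp add: w_def)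
    show "integrable M (\<lambda>z. avg M (\<lambda>y. (w z y)\<^sup>2) x + 4 * C * (\<bar>e k (x - z)\<bar> + \<bar>e k x\<bar>))"
      using W_int e_int by simp
  qed (rule step)
  also have "\<dots> = (LINT z|M. avg M (\<lambda>y. (w z y)\<^sup>2) x) + eta k x"
    using W_int e_int by (simp add: eta_def avg_def prob_space algebra_simps)
  also have "(LINT z|M. avg M (\<lambda>y. (w z y)\<^sup>2) x) = (LINT z|M. LINT y|M. (w z (x - y))\<^sup>2)"
    by (simp add: avg_def)
  \<comment> \<open>Exchanging the increment \<open>z\<close> with the step \<open>y\<close>
    recovers \<open>D k\<close> at the moved point \<open>x - y\<close>.\<close>
  also have "\<dots> = (LINT y|M. LINT z|M. (w z (x - y))\<^sup>2)"
  proof (rule P.Fubini_integral[symmetric])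
    interpret PP: prob_space "M \<Otimes>\<^sub>M M" by (rule prob_space_pair) unfold_locales
    show "integrable (M \<Otimes>\<^sub>M M) (\<lambda>(z, y). (w z (x - y))\<^sup>2)"
    proof (rule PP.integrable_const_bound[of _ "4 * C\<^sup>2"])
      show "AE p in M \<Otimes>\<^sub>M M. norm (case p of (z, y) \<Rightarrow> (w z (x - y))\<^sup>2) \<le> 4 * C\<^sup>2"
        using sq_bdd[of k] by (auto simp: w_def)
      show "(\<lambda>(z, y). (w z (x - y))\<^sup>2) \<in> borel_measurable (M \<Otimes>\<^sub>M M)"
        unfolding w_def by measurable
    qed
  qed
  also have "\<dots> = avg M (D k) x" by (simp add: avg_def D_def w_def)
  finally show ?thesis .
qed

lemma avg_pow_meas [measurable]:
  "f \<in> borel_measurable borel \<Longrightarrow> (avg M ^^ n) f \<in> borel_measurable borel"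
  by (induction n) auto

lemma avg_pow_bdd:
  "f \<in> borel_measurable borel \<Longrightarrow> (\<And>x. \<bar>f x\<bar> \<le> B) \<Longrightarrow> \<bar>(avg M ^^ n) f x\<bar> \<le> B"
proof (induction n arbitrary: x)
  case (Suc n)
  then show ?case using avg_bounded[of "(avg M ^^ n) f" B x] by auto
qed auto

text \<open>\<open>D k\<close> is subharmonic up to a null sequence. This survives iteration because
  averaging preserves null sequences.\<close>

lemma D_le_pow: "\<exists>r. null_seq r \<and> (\<forall>k x. D k x \<le> (avg M ^^ n) (D k) x + r k x)"
proof (induction n)
  case 0
  show ?case by (rule exI[of _ "\<lambda>_ _. 0"]) (auto simp: null_seq_def)
next
  case (Suc n)
  then obtain r where r: "null_seq r" "\<And>k x. D k x \<le> (avg M ^^ n) (D k) x + r k x" by auto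
  have [measurable]: "r k \<in> borel_measurable borel" for k using r by (auto simp: null_seq_def)
  obtain B where B: "\<bar>r k x\<bar> \<le> B" for k x using r by (auto simp: null_seq_def)
  have "D k x \<le> (avg M ^^ Suc n) (D k) x + (avg M (r k) x + eta k x)" for k x
  proof -
    have b: "\<bar>(avg M ^^ n) (D k) x + r k x\<bar> \<le> 4 * C\<^sup>2 + B" for x
      using avg_pow_bdd[of "D k" "4 * C\<^sup>2" n x] D_bdd[of k] B[of k x] by fastforce
    have "avg M (D k) x \<le> avg M (\<lambda>x. (avg M ^^ n) (D k) x + r k x) x"
      by (rule avg_mono[OF _ D_bdd _ b]) (use r in auto)
    also have "\<dots> = avg M ((avg M ^^ n) (D k)) x + avg M (r k) x"
      by (rule avg_add[OF _ _ _ B]) (auto intro!: avg_pow_bdd D_bdd)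
    finally show ?thesis using D_le[of k x] by simp
  qed
  moreover have "null_seq (\<lambda>k x. avg M (r k) x + eta k x)"
    by (intro null_seq_add null_seq_avg r null_eta)
  ultimately show ?case by blast
qed

text \<open>\<open>D_eq\<close> telescopes under iteration. The boundary terms stay between
  \<open>- C\<^sup>2\<close> and \<open>C\<^sup>2\<close> for all \<open>N\<close>: the mean squares
  of the increments add up to a bounded quantity, as for orthogonal martingale increments.\<close>

lemma sum_avg_D:
  "\<exists>r. null_seq r \<and> (\<forall>k x. (\<Sum>n<N. (avg M ^^ n) (D k) x) =
        (avg M ^^ N) (\<lambda>x. (u k x)\<^sup>2) x - (u k x)\<^sup>2 + r k x)"
proof (induction N)
  case 0
  show ?case by (rule exI[of _ "\<lambda>_ _. 0"]) (auto simp: null_seq_def)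
next
  case (Suc N)
  then obtain r where r: "null_seq r" "\<And>k x. (\<Sum>n<N. (avg M ^^ n) (D k) x) =
        (avg M ^^ N) (\<lambda>x. (u k x)\<^sup>2) x - (u k x)\<^sup>2 + r k x" by auto
  define q where "q k x = 2 * u k x * e k x" for k x
  have q: "null_seq q"
    unfolding q_def by (rule null_seq_cmult_bounded[OF null_e, where C = "2 * C"]) (use u_bdd in \<open>auto simp: abs_mult\<close>)
  then obtain B where B: "\<bar>q k x\<bar> \<le> B" for k x by (auto simp: null_seq_def)
  have [measurable]: "q k \<in> borel_measurable borel" for k using q by (auto simp: null_seq_def)
  have pow: "(avg M ^^ n) (D k) = (\<lambda>x. (avg M ^^ n) (avg M (\<lambda>x. (u k x)\<^sup>2)) x -
      (avg M ^^ n) (\<lambda>x. (u k x)\<^sup>2) x + (avg M ^^ n) (q k) x)" for n k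
  proof (induction n)
    case 0
    show ?case by (auto simp: D_eq q_def)
  next
    case (Suc n)
    let ?a = "(avg M ^^ n) (avg M (\<lambda>x. (u k x)\<^sup>2))" and ?b = "(avg M ^^ n) (\<lambda>x. (u k x)\<^sup>2)"
      and ?c = "(avg M ^^ n) (q k)"
    have ba: "\<bar>?a x\<bar> \<le> C\<^sup>2" for x
      by (intro avg_pow_bdd avg_bounded usq_bdd) auto
    have bb: "\<bar>?b x\<bar> \<le> C\<^sup>2" for x
      by (intro avg_pow_bdd usq_bdd) auto
    have bc: "\<bar>?c x\<bar> \<le> B" for x by (rule avg_pow_bdd) (auto intro!: B)
    have bab: "\<bar>?a x - ?b x\<bar> \<le> C\<^sup>2 + C\<^sup>2" for x using ba[of x] bb[of x] by linarith
    have "avg M (\<lambda>x. ?a x - ?b x + ?c x) x = avg M ?a x - avg M ?b x + avg M ?c x" for x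
      by (subst avg_add[OF _ bab _ bc], measurable) (subst avg_minus[OF _ ba _ bb], auto)
    moreover have "(avg M ^^ n) (D k) = (\<lambda>x. ?a x - ?b x + ?c x)" using Suc by blast
    ultimately show ?case by (simp only: funpow.simps o_apply)
  qed
  have "null_seq (\<lambda>k x. r k x + (avg M ^^ N) (q k) x)"
  proof (rule null_seq_add[OF r(1)])
    show "null_seq (\<lambda>k. (avg M ^^ N) (q k))"
      by (induction N) (auto intro: q null_seq_avg)
  qed
  moreover have "(\<Sum>n<Suc N. (avg M ^^ n) (D k) x) =
        (avg M ^^ Suc N) (\<lambda>x. (u k x)\<^sup>2) x - (u k x)\<^sup>2 + (r k x + (avg M ^^ N) (q k) x)" for k x
    using r(2)[of k x] fun_cong[OF pow[of N k], of x]
    by (simp add: funpow_Suc_right del: funpow.simps)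
  ultimately show ?case by blast
qed

text \<open>For fixed \<open>N\<close>, subharmonicity bounds \<open>N * D k x\<close> by the sum in
  \<open>sum_avg_D\<close>, hence by \<open>C\<^sup>2\<close> plus an error that vanishes in
  \<open>k\<close>; and \<open>N\<close> is arbitrary.\<close>

lemma D_tendsto_0: "(\<lambda>k. D k x) \<longlonglongrightarrow> 0"
proof -
  have "\<exists>r. r \<longlonglongrightarrow> 0 \<and> (\<forall>k. real N * D k x \<le> C\<^sup>2 + r k)" for N
  proof -
    obtain r where r: "null_seq r" "\<And>k x. (\<Sum>n<N. (avg M ^^ n) (D k) x) =
        (avg M ^^ N) (\<lambda>x. (u k x)\<^sup>2) x - (u k x)\<^sup>2 + r k x" using sum_avg_D[of N] by auto
    have "\<forall>n. \<exists>r. null_seq r \<and> (\<forall>k x. D k x \<le> (avg M ^^ n) (D k) x + r k x)"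
      using D_le_pow by blast
    then obtain s where s: "\<And>n. null_seq (s n)" "\<And>n k x. D k x \<le> (avg M ^^ n) (D k) x + s n k x"
      by metis
    have "real N * D k x \<le> C\<^sup>2 + (r k x + (\<Sum>n<N. s n k x))" for k
    proof -
      have "real N * D k x = (\<Sum>n<N. D k x)" by simp
      also have "\<dots> \<le> (\<Sum>n<N. (avg M ^^ n) (D k) x + s n k x)" by (intro sum_mono s)
      also have "\<dots> = (avg M ^^ N) (\<lambda>x. (u k x)\<^sup>2) x - (u k x)\<^sup>2 + r k x + (\<Sum>n<N. s n k x)"
        by (simp add: sum.distrib r)
      also have "(avg M ^^ N) (\<lambda>x. (u k x)\<^sup>2) x \<le> C\<^sup>2"
        using avg_pow_bdd[of "\<lambda>x. (u k x)\<^sup>2" "C\<^sup>2" N x] usq_bdd[of k] by fastforce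
      finally show ?thesis by (simp add: add.assoc) (smt (verit) zero_le_power2)
    qed
    moreover have "(\<lambda>k. r k x + (\<Sum>n<N. s n k x)) \<longlonglongrightarrow> 0 + (\<Sum>n<N. 0)"
      using r(1) s(1) by (intro tendsto_add tendsto_sum) (auto simp: null_seq_def)
    ultimately show ?thesis by (intro exI[of _ "\<lambda>k. r k x + (\<Sum>n<N. s n k x)"]) auto
  qed
  note * = this
  show ?thesis
  proof (rule LIMSEQ_I)
    fix d :: real assume d: "d > 0"
    obtain N :: nat where N: "C\<^sup>2 + 1 < real N * d" using d reals_Archimedean3 by blast
    obtain r where r: "r \<longlonglongrightarrow> 0" "\<And>k. real N * D k x \<le> C\<^sup>2 + r k" using *[of N] by auto
    obtain n0 where n0: "\<And>k. k \<ge> n0 \<Longrightarrow> norm (r k - 0) < 1" using LIMSEQ_D[OF r(1), of 1] by auto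
    have "norm (D k x - 0) < d" if "k \<ge> n0" for k
    proof -
      have "real N * D k x < real N * d" using n0[OF that] r(2)[of k] N by auto
      then show ?thesis using D_nonneg[of k x] by (simp add: mult_less_cancel_left)
    qed
    then show "\<exists>n0. \<forall>k\<ge>n0. norm (D k x - 0) < d" by blast
  qed
qed


text \<open>The asymptotic periods form a closed subgroup that has full measure by \<open>D_tendsto_0\<close>.\<close>

lemma increments_tendsto_0:
  assumes lip: "\<And>k x y. \<bar>u k x - u k y\<bar> \<le> L * \<bar>x - y\<bar>"
    and nonar: "\<And>d. d > 0 \<Longrightarrow> prob (range (\<lambda>k::int. d * of_int k)) < 1"
  shows "(\<lambda>k. u k (x - p) - u k x) \<longlonglongrightarrow> 0"
proof -
  note [measurable_cong] = sets_eq_borel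
  define P where "P = {p. \<forall>x. (\<lambda>k. u k (x - p) - u k x) \<longlonglongrightarrow> 0}"
  have L: "L \<ge> 0" using lip[of 0 0 1] abs_ge_zero[of "u 0 0 - u 0 1"] by simp
  have zero: "0 \<in> P" by (auto simp: P_def)
  have diff: "p - q \<in> P" if "p \<in> P" "q \<in> P" for p q
  proof -
    have lim: "(\<lambda>k. u k (x + q - r) - u k (x + q)) \<longlonglongrightarrow> 0" if "r \<in> P" for x r
      using that by (simp add: P_def)
    have "(\<lambda>k. (u k (x + q - p) - u k (x + q)) - (u k (x + q - q) - u k (x + q))) \<longlonglongrightarrow> 0 - 0" for x
      by (intro tendsto_diff lim that)
    then show ?thesis by (auto simp: P_def algebra_simps)
  qed
  \<comment> \<open>The common Lipschitz constant makes the set of periods closed;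
    \<open>L + 1\<close> in the denominator below avoids division by 0.\<close>
  have "closure P \<subseteq> P"
  proof
    fix p assume p: "p \<in> closure P"
    have "(\<lambda>k. u k (x - p) - u k x) \<longlonglongrightarrow> 0" for x
    proof (rule LIMSEQ_I)
      fix e :: real assume e: "e > 0"
      then have "e / (2 * (L + 1)) > 0" using L by simp
      with p obtain q where q: "q \<in> P" "dist q p < e / (2 * (L + 1))"
        unfolding closure_approachable by blast
      have "L * \<bar>q - p\<bar> \<le> (L + 1) * \<bar>q - p\<bar>" by (intro mult_right_mono) auto
      also have "\<dots> < e / 2" using q(2) L by (simp add: dist_real_def field_simps)
      finally have Lq: "L * \<bar>q - p\<bar> < e / 2" .
      from q(1) have "(\<lambda>k. u k (x - q) - u k x) \<longlonglongrightarrow> 0" by (auto simp: P_def)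
      from LIMSEQ_D[OF this, of "e/2"] e obtain n0
        where n0: "\<And>k. k \<ge> n0 \<Longrightarrow> \<bar>u k (x - q) - u k x\<bar> < e / 2" by auto
      have "norm (u k (x - p) - u k x - 0) < e" if "k \<ge> n0" for k
      proof -
        have "\<bar>u k (x - p) - u k (x - q)\<bar> \<le> L * \<bar>q - p\<bar>" using lip[of k "x - p" "x - q"] by simp
        from abs_diff_less_half[OF this n0[OF that] Lq] show ?thesis by simp
      qed
      then show "\<exists>n0. \<forall>k\<ge>n0. norm (u k (x - p) - u k x - 0) < e" by blast
    qed
    then show "p \<in> P" by (simp add: P_def)
  qed
  then have cl: "closed P" by (metis closure_subset_eq)
  \<comment> \<open>Points of the support are periods: \<open>D k x\<close> controls the squared
    increment averaged over a small ball around \<open>z\<close>, and the Lipschitz bound compares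
    it with the increment at \<open>z\<close> itself.\<close>
  have pos_imp: "z \<in> P" if z: "\<And>d. d > 0 \<Longrightarrow> prob (ball z d) > 0" for z
  proof -
    have "(\<lambda>k. u k (x - z) - u k x) \<longlonglongrightarrow> 0" for x
    proof (rule LIMSEQ_I)
      fix e :: real assume e: "e > 0"
      define d where "d = e / (2 * (L + 1))"
      define m where "m = prob (ball z d)"
      have d: "d > 0" using e L by (simp add: d_def)
      then have m: "m > 0" unfolding m_def by (rule z)
      have "L * d \<le> (L + 1) * d" using d by (intro mult_right_mono) auto
      also have "\<dots> = e / 2" using L by (simp add: d_def field_simps)
      finally have "(L * d)\<^sup>2 \<le> (e / 2)\<^sup>2" using L d by (intro power_mono) auto
      then have Ld: "2 * (L * d)\<^sup>2 \<le> e\<^sup>2 / 2" by (simp add: power_divide)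
      have key: "m * (u k (x - z) - u k x)\<^sup>2 \<le> 2 * D k x + 2 * (L * d)\<^sup>2 * m" for k
      proof -
        let ?a = "u k (x - z) - u k x"
        have pw: "indicator (ball z d) y * ?a\<^sup>2 \<le>
            2 * (u k (x - y) - u k x)\<^sup>2 + 2 * (L * d)\<^sup>2 * indicator (ball z d) y" for y
        proof (cases "y \<in> ball z d")
          case True
          let ?b = "u k (x - y) - u k x"
          have "L * \<bar>z - y\<bar> \<le> L * d" using True L by (intro mult_left_mono) (auto simp: dist_real_def)
          then have "\<bar>?a - ?b\<bar> \<le> L * d"
            using lip[of k "x - z" "x - y"] by (simp add: abs_minus_commute)
          then have "(?a - ?b)\<^sup>2 \<le> (L * d)\<^sup>2"
            using abs_le_square_iff[of "?a - ?b" "L * d"] by simp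
          moreover have "?a\<^sup>2 \<le> 2 * ?b\<^sup>2 + 2 * (?a - ?b)\<^sup>2"
          proof -
            have "2 * ?b\<^sup>2 + 2 * (?a - ?b)\<^sup>2 - ?a\<^sup>2 = (?a - 2 * ?b)\<^sup>2"
              by (simp add: power2_eq_square algebra_simps)
            then show ?thesis using zero_le_power2[of "?a - 2 * ?b"] by linarith
          qed
          ultimately have "?a\<^sup>2 \<le> 2 * ?b\<^sup>2 + 2 * (L * d)\<^sup>2" by linarith
          then show ?thesis using True by simp
        qed simp
        have i1: "integrable M (\<lambda>y. indicator (ball z d) y * ?a\<^sup>2)"
          by (rule integrable_const_bound[of _ "?a\<^sup>2"]) (auto simp: indicator_def)
        have i2: "integrable M (\<lambda>y. 2 * (L * d)\<^sup>2 * indicator (ball z d) y)"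
          by (rule integrable_const_bound[of _ "2 * (L * d)\<^sup>2"]) (auto simp: indicator_def)
        have "m * ?a\<^sup>2 = (LINT y|M. indicator (ball z d) y * ?a\<^sup>2)"
          by (simp add: m_def)
        also have "\<dots> \<le> (LINT y|M. 2 * (u k (x - y) - u k x)\<^sup>2 + 2 * (L * d)\<^sup>2 * indicator (ball z d) y)"
          using D_int[of k x] i2 by (intro integral_mono i1 pw) auto
        also have "\<dots> = 2 * D k x + 2 * (L * d)\<^sup>2 * m"
          using D_int[of k x] i2 by (simp add: D_def m_def)
        finally show ?thesis .
      qed
      \<comment> \<open>Below this value of \<open>D k x\<close>, the term \<open>2 * D k x\<close>
        takes less than half of \<open>m * e\<^sup>2\<close>, and the Lipschitz error
        \<open>2 * (L * d)\<^sup>2 * m\<close> at most the other half.\<close>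
      have "m * e\<^sup>2 / 4 > 0" using m e by simp
      from LIMSEQ_D[OF D_tendsto_0[of x] this] obtain n0
        where n0: "\<And>k. k \<ge> n0 \<Longrightarrow> \<bar>D k x\<bar> < m * e\<^sup>2 / 4" by auto
      have "norm (u k (x - z) - u k x - 0) < e" if "k \<ge> n0" for k
      proof -
        have "m * (u k (x - z) - u k x)\<^sup>2 < m * (e\<^sup>2 / 2) + 2 * (L * d)\<^sup>2 * m"
          using key[of k] n0[OF that] by simp
        also have "\<dots> \<le> m * (e\<^sup>2 / 2) + (e\<^sup>2 / 2) * m"
          using Ld m by (intro add_left_mono mult_right_mono) auto
        finally have "(u k (x - z) - u k x)\<^sup>2 < e\<^sup>2" using m by (simp add: algebra_simps)
        then show ?thesis using e power_less_imp_less_base[of "\<bar>u k (x - z) - u k x\<bar>" 2 e] by simp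
      qed
      then show "\<exists>n0. \<forall>k\<ge>n0. norm (u k (x - z) - u k x - 0) < e" by blast
    qed
    then show "z \<in> P" by (simp add: P_def)
  qed
  \<comment> \<open>Off the support every point has a null ball around it; countably many of these
    cover the complement of \<open>P\<close>, which therefore is null.\<close>
  define FF where "FF = {B. \<exists>z d. B = ball z d \<and> prob (ball z d) = 0 \<and> d > (0::real)}"
  obtain FF' where FF': "FF' \<subseteq> FF" "countable FF'" "\<Union>FF' = \<Union>FF"
    by (rule Lindelof[of FF]) (auto simp: FF_def)
  have sub: "- P \<subseteq> \<Union>FF"
  proof
    fix z assume "z \<in> - P"
    then obtain d where "d > 0" "\<not> prob (ball z d) > 0" using pos_imp by auto
    then show "z \<in> \<Union>FF" by (intro UnionI[of "ball z d"]) (auto simp: FF_def less_le)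
  qed
  have "emeasure M (\<Union>FF') = 0"
  proof -
    have "(\<Union>B\<in>FF'. B) \<in> null_sets M"
      using FF' by (intro null_sets_UN') (auto simp: FF_def null_sets_def emeasure_eq_measure)
    then show ?thesis by auto
  qed
  moreover have "emeasure M (- P) \<le> emeasure M (\<Union>FF')"
  proof (rule emeasure_mono)
    have "open (\<Union>FF')" using FF'(1) by (auto simp: FF_def)
    then show "\<Union>FF' \<in> sets M" by (simp add: sets_eq_borel)
  qed (use sub FF'(3) in simp)
  ultimately have "emeasure M (- P) = 0" by simp
  then have "AE x in M. x \<in> P"
    using cl by (intro AE_I[of _ _ "- P"]) auto
  have "P = UNIV"
  proof (rule ccontr)
    assume "P \<noteq> UNIV"
    from closed_subgroup_real[OF cl zero diff this] obtain d
      where d: "d > 0" "P \<subseteq> range (\<lambda>k::int. d * of_int k)" by auto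
    have "prob (range (\<lambda>k::int. d * of_int k)) = 1"
    proof (subst prob_eq_1)
      show "range (\<lambda>k::int. d * of_int k) \<in> events"
        unfolding sets_eq_borel by (rule sets.countable) auto
      show "AE x in M. x \<in> range (\<lambda>k::int. d * of_int k)"
        using \<open>AE x in M. x \<in> P\<close> d(2) by (auto elim!: eventually_mono)
    qed
    with nonar[OF d(1)] show False by simp
  qed
  then show ?thesis by (auto simp: P_def)
qed

end

section \<open>Local finiteness of the renewal measure\<close>

definition tent :: "real \<Rightarrow> real \<Rightarrow> real" where "tent d x = max 0 (d - \<bar>x\<bar>)"

lemma tent_nonneg [simp]: "0 \<le> tent d x" by (simp add: tent_def)

lemma tent_measurable [measurable]: "tent d \<in> borel_measurable borel"
  unfolding tent_def[abs_def] by measurable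

text \<open>Outside the support \<open>tent d x\<close> vanishes, so the Lipschitz term can be
  localised by indicators. Summed along the walk it gives a Lipschitz constant proportional to the
  number of visits to bounded intervals.\<close>

lemma tent_lipschitz:
  "tent d x \<le> tent d y + \<bar>x - y\<bar> * (indicator {-d..d} x + indicator {-d..d} y)"
proof -
  have 1: "tent d x \<le> tent d y + \<bar>x - y\<bar>" by (simp add: tent_def max_def) linarith
  have 2: "x \<notin> {-d..d} \<Longrightarrow> tent d x = 0" by (auto simp: tent_def)
  show ?thesis
  proof (cases "x \<in> {-d..d}")
    case True
    have "\<bar>x - y\<bar> * 1 \<le> \<bar>x - y\<bar> * (indicator {-d..d} x + indicator {-d..d} y)"
      using True by (intro mult_left_mono) auto
    with 1 show ?thesis by (simp only: mult_1_right)
  qed (simp add: 2)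
qed

lemma ennreal_tent_le: "ennreal (tent d x) \<le> ennreal d * indicator {-d..d} x"
proof (cases "x \<in> {-d..d}")
  case True
  then show ?thesis by (auto simp: tent_def intro!: ennreal_leI)
next
  case False
  then have "tent d x = 0" by (auto simp: tent_def)
  then show ?thesis by simp
qed

lemma tent_integral:
  assumes d: "d > 0"
  shows "0 < (\<integral>\<^sup>+x. ennreal (tent d x) \<partial>lborel)" "(\<integral>\<^sup>+x. ennreal (tent d x) \<partial>lborel) < \<infinity>"
proof -
  have "(\<integral>\<^sup>+x. ennreal (tent d x) \<partial>lborel) \<le> (\<integral>\<^sup>+x. ennreal d * indicator {-d..d} x \<partial>lborel)"
    by (intro nn_integral_mono ennreal_tent_le)
  also have "\<dots> = ennreal d * emeasure lborel {-d..d}"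
    by (subst nn_integral_cmult_indicator) auto
  also have "\<dots> < \<infinity>" using d by (simp add: ennreal_mult_less_top)
  finally show "(\<integral>\<^sup>+x. ennreal (tent d x) \<partial>lborel) < \<infinity>" .
  have "0 < ennreal (d/2) * emeasure lborel {-d/2..d/2}"
    using d by (simp add: ennreal_zero_less_mult_iff)
  also have "\<dots> = (\<integral>\<^sup>+x. ennreal (d/2) * indicator {-d/2..d/2} x \<partial>lborel)"
    by (subst nn_integral_cmult_indicator) auto
  also have "\<dots> \<le> (\<integral>\<^sup>+x. ennreal (tent d x) \<partial>lborel)"
    using d by (intro nn_integral_mono) (auto simp: indicator_def tent_def intro!: ennreal_leI)
  finally show "0 < (\<integral>\<^sup>+x. ennreal (tent d x) \<partial>lborel)" .
qed

lemma indicator_cover: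
  assumes "b < a + real m"
  shows "(indicator {a..b} x :: ennreal) \<le> (\<Sum>j<m. indicator {a + real j..a + real j + 1} x)"
proof (cases "x \<in> {a..b}")
  case True
  define j where "j = nat \<lfloor>x - a\<rfloor>"
  have "0 \<le> x - a" using True by simp
  then have j: "real j \<le> x - a" "x - a < real j + 1" unfolding j_def by linarith+
  have "j < m" using j assms True by auto
  have "(indicator {a..b} x :: ennreal) = indicator {a + real j..a + real j + 1} x"
    using True j by (auto simp: indicator_def)
  also have "\<dots> \<le> (\<Sum>j<m. indicator {a + real j..a + real j + 1} x)"
    using \<open>j < m\<close> by (intro member_le_sum) auto
  finally show ?thesis .
qed auto

text \<open>Truncated potentials of bounded functions are finite before anything is known about
  \<open>rpot\<close>.\<close>

definition psum :: "real measure \<Rightarrow> nat \<Rightarrow> (real \<Rightarrow> ennreal) \<Rightarrow> real \<Rightarrow> ennreal" where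
  "psum M N f t = (\<Sum>n<N. mpow M n f t)"

lemma rpot_eq_SUP_psum: "rpot M f t = (SUP N. psum M N f t)"
  unfolding rpot_def psum_def by (rule suminf_eq_SUP)

lemma psum_tendsto_rpot: "(\<lambda>N. psum M N f t) \<longlonglongrightarrow> rpot M f t"
  unfolding rpot_def psum_def by (rule summable_LIMSEQ) simp

lemma psum_le_rpot: "psum M N f t \<le> rpot M f t"
  unfolding rpot_eq_SUP_psum by (rule SUP_upper) simp

lemma psum_incseq: "N \<le> N' \<Longrightarrow> psum M N f t \<le> psum M N' f t"
  unfolding psum_def by (rule sum_mono2) auto

lemma psum_mono: "(\<And>x. f x \<le> g x) \<Longrightarrow> psum M N f t \<le> psum M N g t"
  unfolding psum_def by (intro sum_mono mpow_mono) auto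

lemma psum_shift: "psum M N (\<lambda>x. f (x + s)) t = psum M N f (t + s)"
  by (simp add: psum_def mpow_shift)

context finite_borel_measure begin

lemma psum_measurable [measurable]:
  assumes [measurable]: "f \<in> borel_measurable borel"
  shows "psum M N f \<in> borel_measurable borel"
  unfolding psum_def by measurable

lemma psum_add:
  assumes [measurable]: "f \<in> borel_measurable borel" "g \<in> borel_measurable borel"
  shows "psum M N (\<lambda>x. f x + g x) t = psum M N f t + psum M N g t"
  by (simp add: psum_def mpow_add_fun sum.distrib)

lemma psum_cmult:
  assumes [measurable]: "f \<in> borel_measurable borel"
  shows "psum M N (\<lambda>x. c * f x) t = c * psum M N f t"
  by (simp add: psum_def mpow_cmult sum_distrib_left)

lemma psum_sum:
  assumes [measurable]: "\<And>n. f n \<in> borel_measurable borel"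
  shows "psum M N (\<lambda>x. \<Sum>n\<in>A. f n x) t = (\<Sum>n\<in>A. psum M N (f n) t)"
  unfolding psum_def by (simp add: mpow_sum) (rule sum.swap)

lemma psum_Suc:
  assumes [measurable]: "f \<in> borel_measurable borel"
  shows "psum M (Suc N) f t = f t + mconv M (psum M N f) t"
proof -
  have "mconv M (psum M N f) t = (\<Sum>n<N. mpow M (Suc n) f t)"
    unfolding psum_def[abs_def] by (subst mconv_sum) (auto simp: mpow_Suc)
  then show ?thesis
    unfolding psum_def by (subst sum.lessThan_Suc_shift) simp
qed

end

context real_distribution begin

lemma emeasure_UNIV [simp]: "emeasure M UNIV = 1"
  using emeasure_space_1 by simp

lemma mconv_const1 [simp]: "mconv M (\<lambda>_. c) t = c"
  by (simp add: mconv_const sets_eq_borel)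

lemma mpow_const [simp]: "mpow M n (\<lambda>_. c) = (\<lambda>_. c)"
  by (induction n) (auto simp: mpow_Suc)

text \<open>For \<open>t\<close> in \<open>{0..1}\<close>, translation by \<open>t\<close> maps the
  interval into \<open>{-1..1}\<close>; for other \<open>t\<close> the first summand vanishes and
  the rest is an average of values with one summand less. So the mass near 0 dominates that of every
  unit interval.\<close>

lemma psum_max_principle:
  "psum M N (indicator {0..1}) t \<le> psum M N (indicator {-1..1}) 0"
proof (induction N arbitrary: t)
  case (Suc N)
  show ?case
  proof (cases "t \<in> {0..1}")
    case True
    have "psum M (Suc N) (indicator {0..1}) (0 + t) = psum M (Suc N) (\<lambda>x. indicator {0..1} (x + t)) 0"
      by (rule psum_shift[symmetric])
    also have "\<dots> \<le> psum M (Suc N) (indicator {-1..1}) 0"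
      by (rule psum_mono) (use True in \<open>auto simp: indicator_def\<close>)
    finally show ?thesis by simp
  next
    case False
    have "psum M (Suc N) (indicator {0..1}) t = mconv M (psum M N (indicator {0..1})) t"
      using False by (subst psum_Suc) auto
    also have "\<dots> \<le> mconv M (\<lambda>_. psum M N (indicator {-1..1}) 0) t" by (rule mconv_mono) (rule Suc)
    also have "\<dots> \<le> psum M (Suc N) (indicator {-1..1}) 0" by (simp add: psum_incseq)
    finally show ?thesis .
  qed
qed (simp add: psum_def)

lemma psum_Icc_le:
  assumes "b < a + real m"
  shows "psum M N (indicator {a..b}) t \<le> of_nat m * psum M N (indicator {-1..1}) 0"
proof -
  have "psum M N (indicator {a..b}) t \<le> psum M N (\<lambda>x. \<Sum>j<m. indicator {a + real j..a + real j + 1} x) t"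
    by (rule psum_mono) (rule indicator_cover[OF assms])
  also have "\<dots> = (\<Sum>j<m. psum M N (indicator {a + real j..a + real j + 1}) t)"
    by (rule psum_sum) measurable
  also have "\<dots> \<le> (\<Sum>j<m. psum M N (indicator {-1..1}) 0)"
  proof (rule sum_mono)
    fix j
    have "psum M N (indicator {a + real j..a + real j + 1}) t =
        psum M N (\<lambda>x. indicator {0..1} (x + - (a + real j))) t"
      by (rule arg_cong[where f = "\<lambda>f. psum M N f t"]) (auto simp: indicator_def fun_eq_iff)
    also have "\<dots> \<le> psum M N (indicator {-1..1}) 0" unfolding psum_shift by (rule psum_max_principle)
    finally show "psum M N (indicator {a + real j..a + real j + 1}) t \<le> psum M N (indicator {-1..1}) 0" .
  qed
  finally show ?thesis by simp
qed

lemma psum_finite: "(\<And>x. f x \<le> ennreal c) \<Longrightarrow> psum M N f t < \<infinity>"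
proof -
  assume "\<And>x. f x \<le> ennreal c"
  then have "psum M N f t \<le> psum M N (\<lambda>_. ennreal c) t" by (rule psum_mono)
  also have "\<dots> = of_nat N * ennreal c" by (simp add: psum_def)
  also have "\<dots> = ennreal (real N) * ennreal c" by (simp add: ennreal_of_nat_eq_real_of_nat)
  also have "\<dots> < \<infinity>" unfolding infinity_ennreal_def by (simp only: ennreal_mult_less_top) auto
  finally show ?thesis .
qed

lemma psum_tent_le:
  assumes "d > 0" "2 * d < real m"
  shows "psum M N (\<lambda>x. ennreal (tent d x)) t \<le> ennreal (d * real m) * psum M N (indicator {-1..1}) 0"
proof -
  have "psum M N (\<lambda>x. ennreal (tent d x)) t \<le> psum M N (\<lambda>x. ennreal d * indicator {-d..d} x) t"
    by (intro psum_mono ennreal_tent_le)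
  also have "\<dots> = ennreal d * psum M N (indicator {-d..d}) t" by (rule psum_cmult) measurable
  also have "\<dots> \<le> ennreal d * (of_nat m * psum M N (indicator {-1..1}) 0)"
    using assms by (intro mult_left_mono psum_Icc_le) auto
  finally show ?thesis using assms by (simp add: ennreal_mult ennreal_of_nat_eq_real_of_nat mult.assoc)
qed

text \<open>Each of the two intervals from \<open>tent_lipschitz\<close> is covered by
  \<open>m\<close> unit intervals, whence \<open>2 * real m\<close>.\<close>

lemma psum_tent_lipschitz:
  assumes "d > 0" "2 * d < real m"
  shows "psum M N (\<lambda>x. ennreal (tent d x)) x \<le> psum M N (\<lambda>x. ennreal (tent d x)) y +
    ennreal (2 * real m * \<bar>x - y\<bar>) * psum M N (indicator {-1..1}) 0"
proof -
  let ?I = "indicator {-d..d} :: real \<Rightarrow> ennreal" and ?B = "psum M N (indicator {-1..1}) 0"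
  have "psum M N (\<lambda>x. ennreal (tent d x)) (0 + x) = psum M N (\<lambda>z. ennreal (tent d (z + x))) 0"
    by (rule psum_shift[symmetric])
  also have "\<dots> \<le> psum M N (\<lambda>z. ennreal (tent d (z + y)) + ennreal \<bar>x - y\<bar> * (?I (z + x) + ?I (z + y))) 0"
  proof (rule psum_mono)
    fix z
    have "ennreal (tent d (z + x)) \<le> ennreal (tent d (z + y) + \<bar>x - y\<bar> *
        (indicator {-d..d} (z + x) + indicator {-d..d} (z + y)))"
      using tent_lipschitz[of d "z + x" "z + y"] by (intro ennreal_leI) simp
    also have "\<dots> = ennreal (tent d (z + y)) + ennreal \<bar>x - y\<bar> * (?I (z + x) + ?I (z + y))"
      by (simp add: ennreal_mult ennreal_indicator[symmetric])
    finally show "ennreal (tent d (z + x)) \<le> ennreal (tent d (z + y)) + ennreal \<bar>x - y\<bar> * (?I (z + x) + ?I (z + y))" .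
  qed
  also have "\<dots> = psum M N (\<lambda>z. ennreal (tent d (z + y))) 0 + ennreal \<bar>x - y\<bar> *
      (psum M N (\<lambda>z. ?I (z + x)) 0 + psum M N (\<lambda>z. ?I (z + y)) 0)"
    by (simp add: psum_add psum_cmult)
  also have "\<dots> = psum M N (\<lambda>x. ennreal (tent d x)) y + ennreal \<bar>x - y\<bar> * (psum M N ?I x + psum M N ?I y)"
    by (simp add: psum_shift[where f = "?I"] psum_shift[where f = "\<lambda>x. ennreal (tent d x)"])
  also have "\<dots> \<le> psum M N (\<lambda>x. ennreal (tent d x)) y + ennreal \<bar>x - y\<bar> * (of_nat m * ?B + of_nat m * ?B)"
    using assms by (intro add_left_mono mult_left_mono add_mono psum_Icc_le) auto
  also have "of_nat m * ?B + of_nat m * ?B = ennreal (2 * real m) * ?B"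
  proof -
    have "ennreal (2 * real m) = of_nat m + of_nat m"
      by (simp add: ennreal_of_nat_eq_real_of_nat ennreal_plus[symmetric] del: ennreal_plus)
    then show ?thesis by (simp only: distrib_right)
  qed
  also have "ennreal \<bar>x - y\<bar> * (ennreal (2 * real m) * ?B) = ennreal (2 * real m * \<bar>x - y\<bar>) * ?B"
  proof -
    have "ennreal (2 * real m * \<bar>x - y\<bar>) = ennreal \<bar>x - y\<bar> * ennreal (2 * real m)"
      by (subst ennreal_mult[symmetric]) (auto simp: mult.commute)
    then show ?thesis by (simp only: mult.assoc)
  qed
  finally show ?thesis by simp
qed

lemma ennreal_avg:
  assumes [measurable]: "g \<in> borel_measurable borel" and g: "\<And>x. 0 \<le> g x" "\<And>x. g x \<le> B"
  shows "mconv M (\<lambda>x. ennreal (g x)) t = ennreal (avg M g t)"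
  unfolding mconv_def avg_def
  by (rule nn_integral_eq_integral[OF avg_integrable[of g B]]) (use g in \<open>auto simp: abs_of_nonneg\<close>)

end

text \<open>On the scale of a fixed finite measure a slowly varying sequence is asymptotically
  constant and leaves the integral by dominated convergence.\<close>

lemma slowly_varying_integral:
  fixes u :: "nat \<Rightarrow> real \<Rightarrow> real"
  assumes G: "finite_borel_measure G" and [measurable]: "\<And>k. u k \<in> borel_measurable borel"
    and bdd: "\<And>k x. \<bar>u k x\<bar> \<le> C"
    and sv: "\<And>p. (\<lambda>k. u k (x - p) - u k x) \<longlonglongrightarrow> 0"
  shows "(\<lambda>k. (LINT s|G. u k (x - s)) - measure G UNIV * u k x) \<longlonglongrightarrow> 0"
proof -
  interpret finite_borel_measure G by fact
  note [measurable_cong] = M_is_borel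
  have int: "integrable G (\<lambda>s. u k (x - s))" for k
    by (rule integrable_const_bound[of _ C]) (use bdd in auto)
  have "(\<lambda>k. LINT s|G. u k (x - s) - u k x) \<longlonglongrightarrow> (LINT s|G. 0)"
  proof (rule integral_dominated_convergence[where w = "\<lambda>_. 2 * C"])
    show "AE s in G. norm (u k (x - s) - u k x) \<le> 2 * C" for k
    proof (rule AE_I2)
      fix s show "norm (u k (x - s) - u k x) \<le> 2 * C"
        using bdd[of k "x - s"] bdd[of k x] unfolding real_norm_def by linarith
    qed
    show "AE s in G. (\<lambda>k. u k (x - s) - u k x) \<longlonglongrightarrow> 0" by (rule AE_I2) (rule sv)
    show "integrable G (\<lambda>s. 2 * C)" by simp
  qed measurable
  then show ?thesis using int borel_UNIV by simp
qed

section \<open>Tail functions and the mean of a jump\<close>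

context real_distribution begin

definition "tail_pos t = (if 0 \<le> t then emeasure M {t<..} else 0)"
definition "tail_neg t = (if t < 0 then emeasure M {..t} else 0)"
definition "mean_pos = (\<integral>\<^sup>+t. tail_pos t \<partial>lborel)"
definition "mean_neg = (\<integral>\<^sup>+t. tail_neg t \<partial>lborel)"

lemma cdf_measurable [measurable]: "(\<lambda>t. emeasure M {..t}) \<in> borel_measurable borel"
proof -
  have "(\<lambda>t. measure M {..t}) \<in> borel_measurable borel"
    by (rule borel_measurable_mono) (auto intro!: monoI finite_measure_mono)
  then show ?thesis unfolding emeasure_eq_measure by measurable
qed

lemma emeasure_tail: "emeasure M {t<..} = 1 - emeasure M {..t}"
proof -
  have "- {..t} = {t<..}" by auto
  then show ?thesis using emeasure_compl[of "{..t}" M] by (simp add: Compl_eq_Diff_UNIV)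
qed

lemma tail_pos_measurable [measurable]: "tail_pos \<in> borel_measurable borel"
  unfolding tail_pos_def[abs_def] emeasure_tail by measurable

lemma tail_neg_measurable [measurable]: "tail_neg \<in> borel_measurable borel"
  unfolding tail_neg_def[abs_def] by measurable

lemma tail_pos_le1: "tail_pos t \<le> 1"
  by (auto simp: tail_pos_def emeasure_eq_measure)

lemma mconv_indicator_nonneg: "mconv M (indicator {0..}) t = emeasure M {..t}"
proof -
  have "(\<lambda>x. indicator {0..} (t - x) :: ennreal) = indicator {..t}"
    by (auto simp: indicator_def fun_eq_iff)
  then show ?thesis by (simp add: mconv_def)
qed

text \<open>For \<open>t \<ge> 0\<close> both sides are 1; for \<open>t < 0\<close> both are the
  distribution function at \<open>t\<close>.\<close>

lemma tail_identity:
  "indicator {0..} t + tail_neg t = mconv M (indicator {0..}) t + tail_pos t"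
proof -
  have "emeasure M {..t} + emeasure M {t<..} = emeasure M ({..t} \<union> {t<..})"
    by (rule plus_emeasure) auto
  also have "{..t} \<union> {t<..} = UNIV" by auto
  finally show ?thesis
    by (auto simp: mconv_indicator_nonneg tail_neg_def tail_pos_def indicator_def)
qed

text \<open>A truncated right tail, so that the mean of the jump may be infinite.\<close>

lemma tail_truncation:
  assumes "y < mean_pos"
  obtains h where "h \<in> borel_measurable borel" "\<And>t. h t \<le> tail_pos t"
    "y < (\<integral>\<^sup>+t. h t \<partial>lborel)" "(\<integral>\<^sup>+t. h t \<partial>lborel) < \<infinity>"
proof -
  define h where "h K t = tail_pos t * indicator {..real K} t" for K :: nat and t
  have [measurable]: "h K \<in> borel_measurable borel" for K unfolding h_def by measurable
  have "incseq h" by (auto simp: h_def incseq_def le_fun_def indicator_def)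
  have "(SUP K. h K t) = tail_pos t" for t
  proof (rule antisym)
    show "(SUP K. h K t) \<le> tail_pos t" by (intro SUP_least) (auto simp: h_def indicator_def)
    obtain K :: nat where "t \<le> real K" using real_arch_simple by blast
    then have "tail_pos t = h K t" by (simp add: h_def)
    then show "tail_pos t \<le> (SUP K. h K t)" by (metis SUP_upper UNIV_I)
  qed
  then have "mean_pos = (\<integral>\<^sup>+t. (SUP K. h K t) \<partial>lborel)" by (simp add: mean_pos_def)
  also have "\<dots> = (SUP K. \<integral>\<^sup>+t. h K t \<partial>lborel)"
    by (rule nn_integral_monotone_convergence_SUP) (use \<open>incseq h\<close> in auto)
  finally obtain K where K: "y < (\<integral>\<^sup>+t. h K t \<partial>lborel)" using assms by (auto simp: less_SUP_iff)
  have "(\<integral>\<^sup>+t. h K t \<partial>lborel) \<le> (\<integral>\<^sup>+t. indicator {0..real K} t \<partial>lborel)"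
    by (intro nn_integral_mono) (auto simp: h_def indicator_def tail_pos_def emeasure_eq_measure)
  also have "\<dots> < \<infinity>" by simp
  finally show ?thesis by (intro that[of "h K"] K) (auto simp: h_def indicator_def)
qed

text \<open>The layer-cake formula, by Fubini on the region 0 \<le> t < x.\<close>

lemma mean_pos_eq: "mean_pos = (\<integral>\<^sup>+x. ennreal (max x 0) \<partial>M)"
proof -
  note [measurable_cong] = sets_eq_borel
  interpret pair_sigma_finite lborel M ..
  have "tail_pos t = (\<integral>\<^sup>+x. indicator {0..} t * indicator {t<..} x \<partial>M)" for t
    by (subst nn_integral_cmult) (auto simp: tail_pos_def split: split_indicator)
  moreover have "(indicator {t<..} x :: ennreal) = (if t < x then 1 else 0)" for t x :: real
    by (simp add: indicator_def)
  ultimately have "mean_pos = (\<integral>\<^sup>+t. \<integral>\<^sup>+x. indicator {0..} t * (if t < x then 1 else 0) \<partial>M \<partial>lborel)"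
    by (simp add: mean_pos_def)
  also have "\<dots> = (\<integral>\<^sup>+x. \<integral>\<^sup>+t. indicator {0..} t * (if t < x then 1 else 0) \<partial>lborel \<partial>M)"
    by (rule Fubini'[symmetric]) measurable
  also have "\<dots> = (\<integral>\<^sup>+x. emeasure lborel {0..<x} \<partial>M)"
  proof (rule nn_integral_cong)
    fix x :: real
    have "(\<lambda>t. indicator {0..} t * (if t < x then 1 else 0) :: ennreal) = indicator {0..<x}"
      by (auto simp: indicator_def fun_eq_iff)
    then show "(\<integral>\<^sup>+t. indicator {0..} t * (if t < x then 1 else 0) \<partial>lborel) = emeasure lborel {0..<x}"
      by simp
  qed
  also have "\<dots> = (\<integral>\<^sup>+x. ennreal (max x 0) \<partial>M)"
    by (intro nn_integral_cong) (auto simp: max_def)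
  finally show ?thesis .
qed

lemma mean_neg_eq: "mean_neg = (\<integral>\<^sup>+x. ennreal (max (- x) 0) \<partial>M)"
proof -
  note [measurable_cong] = sets_eq_borel
  interpret pair_sigma_finite lborel M ..
  have "tail_neg t = (\<integral>\<^sup>+x. indicator {..<0} t * indicator {..t} x \<partial>M)" for t
    by (subst nn_integral_cmult) (auto simp: tail_neg_def split: split_indicator)
  moreover have "(indicator {..t} x :: ennreal) = (if x \<le> t then 1 else 0)" for t x :: real
    by (simp add: indicator_def)
  ultimately have "mean_neg = (\<integral>\<^sup>+t. \<integral>\<^sup>+x. indicator {..<0} t * (if x \<le> t then 1 else 0) \<partial>M \<partial>lborel)"
    by (simp add: mean_neg_def)
  also have "\<dots> = (\<integral>\<^sup>+x. \<integral>\<^sup>+t. indicator {..<0} t * (if x \<le> t then 1 else 0) \<partial>lborel \<partial>M)"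
    by (rule Fubini'[symmetric]) measurable
  also have "\<dots> = (\<integral>\<^sup>+x. emeasure lborel {x..<0} \<partial>M)"
  proof (rule nn_integral_cong)
    fix x :: real
    have "(\<lambda>t. indicator {..<0} t * (if x \<le> t then 1 else 0) :: ennreal) = indicator {x..<0}"
      by (auto simp: indicator_def fun_eq_iff)
    then show "(\<integral>\<^sup>+t. indicator {..<0} t * (if x \<le> t then 1 else 0) \<partial>lborel) = emeasure lborel {x..<0}"
      by simp
  qed
  also have "\<dots> = (\<integral>\<^sup>+x. ennreal (max (- x) 0) \<partial>M)"
    by (intro nn_integral_cong) (auto simp: max_def)
  finally show ?thesis .
qed

end

section \<open>The renewal identity for tents and local finiteness\<close>

locale renewal_walk = real_distribution +
  assumes nonar: "\<And>d. d > 0 \<Longrightarrow> prob (range (\<lambda>k::int. d * of_int k)) < 1"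

locale tent_walk = renewal_walk +
  fixes d :: real
  assumes d_pos: "d > 0" and mean_neg_finite: "mean_neg < \<infinity>"
begin

definition "f x = ennreal (tent d x)"
definition "mass = (\<integral>\<^sup>+x. f x \<partial>lborel)"
text \<open>The Heaviside step smeared with the tent: the distribution function of the tent density,
  rising from 0 to \<open>mass\<close> on \<open>{-d..d}\<close>.\<close>

definition "ramp = mconv (density lborel f) (indicator {0..})"

lemma f_meas [measurable]: "f \<in> borel_measurable borel" unfolding f_def[abs_def] by measurable

lemma f_le: "f x \<le> ennreal d" by (simp add: f_def tent_def ennreal_leI)

lemma f_zero: "d \<le> \<bar>x\<bar> \<Longrightarrow> f x = 0" by (simp add: f_def tent_def)

lemma mass_pos: "0 < mass" and mass_finite: "mass < \<infinity>"
  using tent_integral[OF d_pos] by (auto simp: mass_def f_def)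

lemma finite_borel_f: "finite_borel_measure (density lborel f)"
  by (rule finite_borel_density) (use mass_finite in \<open>auto simp: mass_def\<close>)

lemma ramp_meas [measurable]: "ramp \<in> borel_measurable borel"
  unfolding ramp_def by (rule finite_borel_measure.mconv_measurable[OF finite_borel_f]) measurable

lemma ramp_eq: "ramp t = (\<integral>\<^sup>+s. f s * indicator {..t} s \<partial>lborel)"
  unfolding ramp_def by (subst mconv_density) (auto intro!: nn_integral_cong simp: indicator_def)

lemma ramp_le: "ramp t \<le> mass"
  unfolding ramp_eq mass_def by (intro nn_integral_mono) (auto simp: indicator_def)

lemma ramp_left: "t < - d \<Longrightarrow> ramp t = 0"
proof -
  assume "t < - d"
  then have *: "f s * indicator {..t} s = 0" for s
    using f_zero[of s] d_pos by (cases "s \<le> t") auto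
  show ?thesis by (simp only: ramp_eq * nn_integral_const) simp
qed

lemma ramp_right: "t \<ge> d \<Longrightarrow> ramp t = mass"
proof -
  assume "d \<le> t"
  then have "f s * indicator {..t} s = f s" for s
    using f_zero[of s] d_pos by (cases "s \<le> t") auto
  then show ?thesis by (simp add: ramp_eq mass_def)
qed

text \<open>\<open>ramp (x + t)\<close> can exceed \<open>ramp (x + s)\<close> only where the first
  has left its zero part and the second has not reached \<open>mass\<close>, a bounded range of
  \<open>x\<close>. This will make the limit of the iterated ramp independent of the
  position.\<close>

lemma ramp_diff: "ramp (x + t) \<le> ramp (x + s) + mass * indicator {- d - t..d - s} x"
  using ramp_left[of "x + t"] ramp_right[of "x + s"] ramp_le[of "x + t"]
  by (cases "x \<in> {- d - t..d - s}") (auto simp: add_increasing)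

lemma finite_borel_tail_neg: "finite_borel_measure (density lborel tail_neg)"
  by (rule finite_borel_density) (use mean_neg_finite in \<open>auto simp: mean_neg_def\<close>)

text \<open>Smear \<open>tail_identity\<close> with the tent, apply the n-th power and sum over n <
  \<open>N\<close>: the ramp telescopes, and the tails become measures acting on the truncated
  potential. Only a part \<open>h\<close> of the right tail with finite integral is made into a
  measure, since the whole tail may have infinite integral.\<close>

lemma smeared_identity:
  assumes [measurable]: "h \<in> borel_measurable borel" and h: "\<And>t. h t \<le> tail_pos t"
    and hfin: "(\<integral>\<^sup>+t. h t \<partial>lborel) < \<infinity>"
  shows "ramp t + mconv (density lborel tail_neg) (psum M N f) t =
     mpow M N ramp t + mconv (density lborel h) (psum M N f) t +
     psum M N (mconv (density lborel f) (\<lambda>t. tail_pos t - h t)) t"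
proof -
  let ?TN = "density lborel tail_neg" and ?Th = "density lborel h" and ?Tf = "density lborel f"
  interpret f: finite_borel_measure ?Tf by (rule finite_borel_f)
  interpret N: finite_borel_measure ?TN by (rule finite_borel_tail_neg)
  have Hfin: "finite_borel_measure ?Th" by (rule finite_borel_density) (use hfin in auto)
  interpret H: finite_borel_measure ?Th by fact
  define rest where "rest t = tail_pos t - h t" for t
  have [measurable]: "rest \<in> borel_measurable borel" unfolding rest_def[abs_def] by measurable
  define R where "R = mconv ?Tf rest"
  have [measurable]: "R \<in> borel_measurable borel" unfolding R_def by measurable
  have pw: "indicator {0..} t + tail_neg t = mconv M (indicator {0..}) t + (h t + rest t)" for t
    using tail_identity[of t] h[of t] by (simp add: rest_def add_diff_inverse_ennreal)
  have sm: "mconv ?Tf (\<lambda>t. indicator {0..} t + tail_neg t) t =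
      mconv ?Tf (\<lambda>t. mconv M (indicator {0..}) t + (h t + rest t)) t" for t
    unfolding pw ..
  have base: "ramp t + mconv ?TN f t = mconv M ramp t + (mconv ?Th f t + R t)" for t
  proof -
    have "mconv ?Tf tail_neg t = mconv ?TN f t" "mconv ?Tf h t = mconv ?Th f t" for t
      by (rule mconv_density_swap; measurable)+
    moreover have "mconv ?Tf (mconv M (indicator {0..})) = mconv M ramp"
      unfolding ramp_def by (rule mconv_commute[OF finite_borel_f finite_borel_measure_M]) measurable
    ultimately show ?thesis
      using sm[of t] by (simp add: f.mconv_add ramp_def[symmetric] R_def[symmetric])
  qed
  have "mpow M n (\<lambda>t. ramp t + mconv ?TN f t) t = mpow M n (\<lambda>t. mconv M ramp t + (mconv ?Th f t + R t)) t" for n t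
    unfolding base ..
  then have step: "mpow M n ramp t + mconv ?TN (mpow M n f) t =
      mpow M (Suc n) ramp t + (mconv ?Th (mpow M n f) t + mpow M n R t)" for n t
    by (simp add: mpow_add_fun mpow_mconv_commute[OF finite_borel_tail_neg]
       mpow_mconv_commute[OF Hfin] mpow_Suc')
  have ps: "psum M (Suc n) g = (\<lambda>x. psum M n g x + mpow M n g x)" for n g
    by (auto simp: psum_def)
  have p0: "psum M 0 g = (\<lambda>_. 0)" for g by (auto simp: psum_def)
  have "ramp t + mconv ?TN (psum M N f) t =
     mpow M N ramp t + mconv ?Th (psum M N f) t + psum M N R t"
  proof (induction N)
    case 0
    show ?case by (simp add: p0 mconv_const)
  next
    case (Suc N)
    have "ramp t + mconv ?TN (psum M (Suc N) f) t = 
        (ramp t + mconv ?TN (psum M N f) t) + mconv ?TN (mpow M N f) t"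
      by (simp add: ps N.mconv_add add.assoc)
    also have "\<dots> = mconv ?Th (psum M N f) t + psum M N R t + (mpow M N ramp t + mconv ?TN (mpow M N f) t)"
      unfolding Suc by (simp add: add_ac)
    also have "\<dots> = mpow M (Suc N) ramp t + mconv ?Th (psum M (Suc N) f) t + psum M (Suc N) R t"
      unfolding step by (simp add: ps H.mconv_add add_ac)
    finally show ?case .
  qed
  then show ?thesis by (simp add: R_def rest_def[abs_def])
qed

definition "ball_mass N = psum M N (indicator {-1..1}) 0"
text \<open>A number of unit intervals that exceeds the length of the support of the tent; the
  summand 1 makes the inequality strict.\<close>

definition "cover = nat \<lceil>2 * d\<rceil> + 1"

lemma cover: "2 * d < real cover"
  using real_nat_ceiling_ge[of "2 * d"] unfolding cover_def by simp

lemma psum_f_le: "psum M N f t \<le> ennreal (d * real cover) * ball_mass N"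
  using psum_tent_le[OF d_pos cover] unfolding f_def[abs_def] ball_mass_def .

lemma psum_f_lipschitz:
  "psum M N f x \<le> psum M N f y + ennreal (2 * real cover * \<bar>x - y\<bar>) * ball_mass N"
  using psum_tent_lipschitz[OF d_pos cover] unfolding f_def[abs_def] ball_mass_def .

lemma psum_f_finite: "psum M N f t < \<infinity>" by (rule psum_finite) (rule f_le)

lemma mconv_finite_integral:
  assumes G: "finite_borel_measure G" and [measurable]: "w \<in> borel_measurable borel"
    and w: "\<And>x. 0 \<le> w x" "\<And>x. w x \<le> B"
  shows "mconv G (\<lambda>x. ennreal (w x)) t = ennreal (LINT s|G. w (t - s))"
proof -
  interpret finite_borel_measure G by fact
  note [measurable_cong] = M_is_borel
  show ?thesis unfolding mconv_def
    by (rule nn_integral_eq_integral[OF integrable_const_bound[of _ B]]) (use w in auto)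
qed

lemma renewal_inequality:
  assumes [measurable]: "h \<in> borel_measurable borel" and h: "\<And>t. h t \<le> tail_pos t"
    and hfin: "(\<integral>\<^sup>+t. h t \<partial>lborel) < \<infinity>"
  shows "mconv (density lborel h) (psum M N f) t \<le> mass + mconv (density lborel tail_neg) (psum M N f) t"
proof -
  have "mconv (density lborel h) (psum M N f) t \<le> ramp t + mconv (density lborel tail_neg) (psum M N f) t"
    unfolding smeared_identity[OF assms] by (simp add: add_increasing add_increasing2)
  then show ?thesis using ramp_le[of t] by (meson add_right_mono order_trans)
qed

text \<open>If the mass near 0 diverged, the truncated potentials divided by it would be bounded,
  Lipschitz with a common constant and asymptotically harmonic, hence slowly varying. At 0,
  \<open>renewal_inequality\<close> would then bound (truncated right tail mass - left tail mass)
  times \<open>u k 0\<close> by a null sequence, although the difference is positive and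
  \<open>u k 0 \<ge> 1\<close>.\<close>

lemma rpot_unit_ball_finite:
  assumes d2: "d \<ge> 2" and drift: "mean_neg < mean_pos"
  shows "rpot M (indicator {-1..1}) 0 < \<infinity>"
proof (rule ccontr)
  assume "\<not> rpot M (indicator {-1..1}) 0 < \<infinity>"
  then have inf: "rpot M (indicator {-1..1}) 0 = \<top>"
    using top.not_eq_extremum infinity_ennreal_def by metis
  \<comment> \<open>With \<open>Suc N\<close> the summand for n = 0 is always present, so that
    \<open>b N \<ge> 1\<close>.\<close>
  define b where "b N = enn2real (ball_mass (Suc N))" for N
  define pr where "pr N x = enn2real (psum M (Suc N) f x)" for N x
  define u where "u N x = pr N x / b N" for N x
  define K where "K = d * real cover"
  have K: "K \<ge> 0" using d_pos by (simp add: K_def)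
  have bm_fin: "ball_mass N < \<infinity>" for N
    unfolding ball_mass_def by (rule psum_finite[of _ 1]) (auto simp: indicator_def)
  have b: "ennreal (b N) = ball_mass (Suc N)" for N using bm_fin[of "Suc N"] by (simp add: b_def)
  have "ball_mass 1 \<le> ball_mass (Suc N)" for N unfolding ball_mass_def by (rule psum_incseq) simp
  moreover have "ball_mass 1 = 1" by (simp add: ball_mass_def psum_def)
  ultimately have "1 \<le> ennreal (b N)" for N by (simp add: b)
  then have b1: "1 \<le> b N" for N by (simp add: ennreal_ge_1)
  then have b0: "0 < b N" for N using order_less_le_trans[OF zero_less_one] by blast
  have "(\<lambda>N. ball_mass N) \<longlonglongrightarrow> \<top>"
    using psum_tendsto_rpot[of M "indicator {-1..1}" 0] inf by (simp add: ball_mass_def)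
  then have "(\<lambda>N. ennreal (b N)) \<longlonglongrightarrow> \<top>" unfolding b by (rule LIMSEQ_Suc)
  then have b_top: "filterlim b at_top sequentially" by (simp add: ennreal_tendsto_top_eq_at_top)
  then have c_b: "(\<lambda>N. c / b N) \<longlonglongrightarrow> 0" for c :: real
    by (rule real_tendsto_divide_at_top[OF tendsto_const])
  have pr: "ennreal (pr N x) = psum M (Suc N) f x" for N x
    using psum_f_finite[of "Suc N" x] by (simp add: pr_def)
  have pr0: "0 \<le> pr N x" for N x by (simp add: pr_def)
  have prK: "pr N x \<le> K * b N" for N x
  proof -
    have "ennreal (pr N x) \<le> ennreal (K * b N)"
      using psum_f_le[of "Suc N" x] K b0[of N] by (simp add: pr b[symmetric] K_def[symmetric] ennreal_mult)
    then show ?thesis using K b0[of N] by (subst (asm) ennreal_le_iff) auto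
  qed
  have prm [measurable]: "pr N \<in> borel_measurable borel" for N unfolding pr_def[abs_def] by measurable
  have [measurable]: "u N \<in> borel_measurable borel" for N unfolding u_def[abs_def] by measurable
  have uK: "\<bar>u N x\<bar> \<le> K" for N x
    using prK[of N x] pr0[of N x] b0[of N] by (simp add: u_def field_simps)
  have lip: "\<bar>u N x - u N y\<bar> \<le> (2 * real cover) * \<bar>x - y\<bar>" for N x y
  proof -
    have le: "pr N x \<le> pr N y + 2 * real cover * \<bar>x - y\<bar> * b N" for x y
    proof -
      have "ennreal (pr N x) \<le> ennreal (pr N y + 2 * real cover * \<bar>x - y\<bar> * b N)"
        using psum_f_lipschitz[of "Suc N" x y] b0[of N] pr0[of N y]
        by (simp add: pr b[symmetric] ennreal_mult)
      then show ?thesis using pr0[of N y] b0[of N] by (subst (asm) ennreal_le_iff) auto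
    qed
    have "\<bar>pr N x - pr N y\<bar> \<le> 2 * real cover * \<bar>x - y\<bar> * b N"
      using le[of x y] le[of y x] by (simp add: abs_le_iff abs_minus_commute)
    then show ?thesis using b0[of N] unfolding u_def
      by (simp add: diff_divide_distrib[symmetric] abs_div_pos[symmetric] field_simps)
  qed
  \<comment> \<open>The defect of \<open>pr N\<close> is the tent minus the term
    \<open>mpow M (Suc N) f\<close>, both of which lie between 0 and \<open>d\<close>.\<close>
  have harm: "\<bar>u N x - avg M (u N) x\<bar> \<le> d / b N" for N x
  proof -
    have m_le: "mpow M (Suc N) f x \<le> ennreal d"
      using mpow_mono[of f "\<lambda>_. ennreal d" M "Suc N" x] f_le by simp
    define mp where "mp = enn2real (mpow M (Suc N) f x)"
    have mp: "ennreal mp = mpow M (Suc N) f x"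
      using le_less_trans[OF m_le ennreal_less_top] by (simp add: mp_def)
    have mp_bd: "0 \<le> mp" "mp \<le> d"
      using m_le d_pos by (simp_all add: mp_def enn2real_leI)
    have "mconv M (\<lambda>x. ennreal (pr N x)) x = ennreal (avg M (pr N) x)"
      by (rule ennreal_avg[OF _ pr0 prK]) measurable
    then have av: "mconv M (psum M (Suc N) f) x = ennreal (avg M (pr N) x)" by (simp add: pr)
    have av0: "0 \<le> avg M (pr N) x" unfolding avg_def by (simp add: pr0)
    have "psum M (Suc N) f x + mpow M (Suc N) f x = psum M (Suc (Suc N)) f x" by (simp add: psum_def)
    also have "\<dots> = f x + mconv M (psum M (Suc N) f) x" by (rule psum_Suc) measurable
    finally have "ennreal (pr N x + mp) = ennreal (tent d x + avg M (pr N) x)"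
      using pr0[of N x] mp_bd av0 by (simp add: pr mp av f_def)
    then have "pr N x + mp = tent d x + avg M (pr N) x"
      using pr0[of N x] mp_bd av0 by (subst (asm) ennreal_inj) auto
    moreover have "0 \<le> tent d x" "tent d x \<le> d" using d_pos by (auto simp: tent_def)
    ultimately have "\<bar>pr N x - avg M (pr N) x\<bar> \<le> d" using mp_bd by linarith
    moreover have "u N x - avg M (u N) x = (pr N x - avg M (pr N) x) / b N"
      by (simp add: u_def avg_def diff_divide_distrib)
    ultimately show ?thesis using b0[of N] by (simp add: divide_right_mono)
  qed
  interpret ah: asymptotically_harmonic M u K
  proof unfold_locales
    show "(\<lambda>N. u N x - avg M (u N) x) \<longlonglongrightarrow> 0" for x
      by (rule Lim_null_comparison[OF _ c_b[of d]]) (use harm in auto)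
  qed (use uK in auto)
  have sv: "(\<lambda>k. u k (x - p) - u k x) \<longlonglongrightarrow> 0" for x p
    by (rule ah.increments_tendsto_0[OF lip nonar])
  obtain h where h: "h \<in> borel_measurable borel" "\<And>t. h t \<le> tail_pos t"
    "mean_neg < (\<integral>\<^sup>+t. h t \<partial>lborel)" "(\<integral>\<^sup>+t. h t \<partial>lborel) < \<infinity>"
    using tail_truncation[OF drift] by blast
  note [measurable] = h(1)
  let ?TN = "density lborel tail_neg" and ?Th = "density lborel h"
  have Th: "finite_borel_measure ?Th" by (rule finite_borel_density) (use h in auto)
  define A where "A k = (LINT s|?Th. u k (0 - s)) - measure ?Th UNIV * u k 0" for k
  define B where "B k = (LINT s|?TN. u k (0 - s)) - measure ?TN UNIV * u k 0" for k
  have A: "A \<longlonglongrightarrow> 0"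
    using slowly_varying_integral[OF Th, of u K 0] uK sv[of 0] unfolding A_def[abs_def] by simp
  have B: "B \<longlonglongrightarrow> 0"
    using slowly_varying_integral[OF finite_borel_tail_neg, of u K 0] uK sv[of 0]
    unfolding B_def[abs_def] by simp
  define hb where "hb = measure ?Th UNIV"
  define nb where "nb = measure ?TN UNIV"
  have hb_nb: "nb < hb"
  proof -
    have "ennreal hb = (\<integral>\<^sup>+t. h t \<partial>lborel)" "ennreal nb = mean_neg"
      using h(4) mean_neg_finite unfolding hb_def nb_def measure_def
      by (auto simp: emeasure_density mean_neg_def)
    then have "ennreal nb < ennreal hb" using h(3) by simp
    then show ?thesis by (simp add: nb_def ennreal_less_iff)
  qed
  have ineq: "(LINT s|?Th. u k (0 - s)) \<le> enn2real mass / b k + (LINT s|?TN. u k (0 - s))" for k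
  proof -
    have c1: "mconv ?Th (psum M (Suc k) f) 0 = ennreal (LINT s|?Th. pr k (0 - s))"
      using mconv_finite_integral[OF Th prm pr0 prK, where t = 0] by (simp add: pr)
    have c2: "mconv ?TN (psum M (Suc k) f) 0 = ennreal (LINT s|?TN. pr k (0 - s))"
      using mconv_finite_integral[OF finite_borel_tail_neg prm pr0 prK, where t = 0] by (simp add: pr)
    have nn: "0 \<le> (LINT s|G. pr k (0 - s))" for G by (simp add: pr0)
    have "ennreal (LINT s|?Th. pr k (0 - s)) \<le> ennreal (enn2real mass + (LINT s|?TN. pr k (0 - s)))"
      using renewal_inequality[OF h(1,2,4), of "Suc k" 0] mass_finite nn[of ?TN]
      by (simp add: c1[simplified] c2[simplified] ennreal_plus)
    then have "(LINT s|?Th. pr k (0 - s)) \<le> enn2real mass + (LINT s|?TN. pr k (0 - s))"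
      using nn[of ?TN] by (subst (asm) ennreal_le_iff) auto
    then show ?thesis using b0[of k] unfolding u_def by (simp add: field_simps)
  qed
  \<comment> \<open>Since \<open>d \<ge> 2\<close>, the tent is at least 1 on
    \<open>{-1..1}\<close>.\<close>
  have u1: "1 \<le> u k 0" for k
  proof -
    have "ball_mass (Suc k) \<le> psum M (Suc k) f 0"
      unfolding ball_mass_def using d2
      by (intro psum_mono) (auto simp: indicator_def f_def tent_def ennreal_ge_1)
    then have "b k \<le> pr k 0" by (simp add: b[symmetric] pr[symmetric] pr0)
    then show ?thesis using b0[of k] by (simp add: u_def)
  qed
  have "hb - nb \<le> enn2real mass / b k - A k + B k" for k
  proof -
    have "(hb - nb) * 1 \<le> (hb - nb) * u k 0" using hb_nb u1[of k] by (intro mult_left_mono) auto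
    also have "\<dots> \<le> enn2real mass / b k - A k + B k"
      using ineq[of k] by (simp add: A_def B_def hb_def nb_def algebra_simps)
    finally show ?thesis by simp
  qed
  moreover have "(\<lambda>k. enn2real mass / b k - A k + B k) \<longlonglongrightarrow> 0 - 0 + 0"
    by (intro tendsto_intros A B c_b)
  ultimately have "hb - nb \<le> 0 - 0 + 0" by (intro LIMSEQ_le_const) auto
  with hb_nb show False by simp
qed

end

lemma (in renewal_walk) potential_finite:
  assumes "mean_neg < mean_pos" "mean_neg < \<infinity>"
  shows "rpot M (indicator {-1..1}) 0 < \<infinity>"
proof -
  interpret tent_walk M 2 by unfold_locales (use assms in auto)
  show ?thesis by (rule rpot_unit_ball_finite) (use assms in auto)
qed

section \<open>Blackwell's theorem\<close>

lemma (in finite_borel_measure) mconv_SUP_psum: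
  assumes G: "finite_borel_measure G" and [measurable]: "f \<in> borel_measurable borel"
  shows "mconv G (rpot M f) t = (SUP N. mconv G (psum M N f) t)"
    and "(\<lambda>N. mconv G (psum M N f) t) \<longlonglongrightarrow> mconv G (rpot M f) t"
proof -
  interpret G: finite_borel_measure G by fact
  have eq: "mconv G (psum M N f) t = (\<Sum>n<N. mconv G (mpow M n f) t)" for N
    unfolding psum_def[abs_def] by (rule G.mconv_sum) measurable
  have "mconv G (rpot M f) t = (\<Sum>n. mconv G (mpow M n f) t)"
    unfolding rpot_def[abs_def] by (rule G.mconv_suminf) measurable
  then show "mconv G (rpot M f) t = (SUP N. mconv G (psum M N f) t)"
    "(\<lambda>N. mconv G (psum M N f) t) \<longlonglongrightarrow> mconv G (rpot M f) t"
    using summable_LIMSEQ[of "\<lambda>n. mconv G (mpow M n f) t"]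
    by (simp_all add: eq suminf_eq_SUP)
qed

lemma (in real_distribution) rpot_Icc_le:
  assumes "b < a + real m"
  shows "rpot M (indicator {a..b}) t \<le> of_nat m * rpot M (indicator {-1..1}) 0"
  unfolding rpot_eq_SUP_psum[of M "indicator {a..b}"]
proof (rule SUP_least)
  fix N
  have "psum M N (indicator {a..b}) t \<le> of_nat m * psum M N (indicator {-1..1}) 0"
    by (rule psum_Icc_le[OF assms])
  also have "\<dots> \<le> of_nat m * rpot M (indicator {-1..1}) 0"
    by (intro mult_left_mono psum_le_rpot) simp
  finally show "psum M N (indicator {a..b}) t \<le> of_nat m * rpot M (indicator {-1..1}) 0" .
qed

lemma filterlim_abs_at_bot: "filterlim (abs :: real \<Rightarrow> real) at_top at_bot"
  by (rule filterlim_at_top_mono[OF filterlim_uminus_at_top_at_bot]) (auto intro: always_eventually)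

locale transient_tent_walk = tent_walk +
  assumes drift: "mean_neg < mean_pos"
begin

definition "b = enn2real (rpot M (indicator {-1..1}) 0)"
definition "u x = enn2real (rpot M f x)"
definition "K = d * real cover * b"

lemma b: "ennreal b = rpot M (indicator {-1..1}) 0"
  using potential_finite[OF drift mean_neg_finite] by (simp add: b_def)

lemma b_nonneg: "0 \<le> b" by (simp add: b_def)

lemma K_nonneg: "0 \<le> K" using d_pos b_nonneg by (simp add: K_def)

lemma rpot_f_le: "rpot M f x \<le> ennreal K"
  unfolding rpot_eq_SUP_psum[of M f]
proof (rule SUP_least)
  fix N
  have "psum M N f x \<le> ennreal (d * real cover) * ball_mass N" by (rule psum_f_le)
  also have "\<dots> \<le> ennreal (d * real cover) * ennreal b"
    unfolding b ball_mass_def by (intro mult_left_mono psum_le_rpot) simp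
  also have "\<dots> = ennreal K" using d_pos b_nonneg by (simp add: K_def ennreal_mult)
  finally show "psum M N f x \<le> ennreal K" .
qed

lemma u: "ennreal (u x) = rpot M f x"
  using le_less_trans[OF rpot_f_le ennreal_less_top] by (simp add: u_def)

lemma u_nonneg: "0 \<le> u x" by (simp add: u_def)

lemma u_le: "u x \<le> K"
  unfolding u_def using rpot_f_le K_nonneg by (intro enn2real_leI) auto

lemma u_bdd: "\<bar>u x\<bar> \<le> K" using u_nonneg u_le by simp

lemma u_meas [measurable]: "u \<in> borel_measurable borel" unfolding u_def[abs_def] by measurable

lemma u_lipschitz: "\<bar>u x - u y\<bar> \<le> (2 * real cover * b) * \<bar>x - y\<bar>"
proof -
  have le: "u x \<le> u y + 2 * real cover * \<bar>x - y\<bar> * b" for x y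
  proof -
    have "rpot M f x \<le> rpot M f y + ennreal (2 * real cover * \<bar>x - y\<bar>) * ennreal b"
      unfolding rpot_eq_SUP_psum[of M f x]
    proof (rule SUP_least)
      fix N
      have "psum M N f x \<le> psum M N f y + ennreal (2 * real cover * \<bar>x - y\<bar>) * ball_mass N"
        by (rule psum_f_lipschitz)
      also have "\<dots> \<le> rpot M f y + ennreal (2 * real cover * \<bar>x - y\<bar>) * ennreal b"
        unfolding b ball_mass_def by (intro add_mono mult_left_mono psum_le_rpot) simp
      finally show "psum M N f x \<le> rpot M f y + ennreal (2 * real cover * \<bar>x - y\<bar>) * ennreal b" .
    qed
    also have "\<dots> = ennreal (u y + 2 * real cover * \<bar>x - y\<bar> * b)"
      using u_nonneg b_nonneg by (simp add: u[symmetric] ennreal_mult)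
    finally show ?thesis using u_nonneg[of y] b_nonneg by (simp only: u[symmetric]) (subst (asm) ennreal_le_iff, auto)
  qed
  show ?thesis using le[of x y] le[of y x] by (simp add: abs_le_iff abs_minus_commute mult_ac)
qed

text \<open>This is the renewal equation: the defect of harmonicity is exactly the tent, which has
  bounded support.\<close>

lemma u_unfold: "u x - avg M u x = tent d x"
proof -
  have "mconv M (\<lambda>x. ennreal (u x)) x = ennreal (avg M u x)"
    by (rule ennreal_avg[OF _ u_nonneg u_le]) measurable
  then have "rpot M f x = f x + ennreal (avg M u x)"
    using rpot_unfold[OF f_meas, of x] by (simp add: u[abs_def])
  moreover have "0 \<le> avg M u x" unfolding avg_def by (simp add: u_nonneg)
  ultimately have "ennreal (u x) = ennreal (tent d x + avg M u x)" by (simp add: u f_def)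
  then show ?thesis using u_nonneg[of x] \<open>0 \<le> avg M u x\<close> by (subst (asm) ennreal_inj) auto
qed

text \<open>As \<open>\<bar>t k\<bar>\<close> grows, \<open>t k + x\<close> leaves the support of
  the tent for each fixed \<open>x\<close>, so the translates are asymptotically harmonic in either
  direction.\<close>

lemma u_slowly_varying:
  assumes t: "filterlim (\<lambda>k. \<bar>t k\<bar>) at_top sequentially"
  shows "(\<lambda>k. u (t k + (x - p)) - u (t k + x)) \<longlonglongrightarrow> 0"
proof -
  interpret ah: asymptotically_harmonic M "\<lambda>k x. u (t k + x)" K
  proof unfold_locales
    fix x
    have "u (t k + x) - avg M (\<lambda>x. u (t k + x)) x = tent d (t k + x)" for k
      using u_unfold[of "t k + x"] by (simp add: avg_def algebra_simps)
    moreover have "(\<lambda>k. tent d (t k + x)) \<longlonglongrightarrow> 0"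
    proof (rule tendsto_eventually)
      have "\<forall>\<^sub>F k in sequentially. d + \<bar>x\<bar> \<le> \<bar>t k\<bar>" using t by (simp add: filterlim_at_top)
      then show "\<forall>\<^sub>F k in sequentially. tent d (t k + x) = 0"
        by eventually_elim (simp add: tent_def max_def, linarith)
    qed
    ultimately show "(\<lambda>k. u (t k + x) - avg M (\<lambda>x. u (t k + x)) x) \<longlonglongrightarrow> 0" by simp
  qed (use u_bdd in auto)
  show ?thesis
  proof (rule ah.increments_tendsto_0[OF _ nonar])
    show "\<bar>u (t k + x) - u (t k + y)\<bar> \<le> (2 * real cover * b) * \<bar>x - y\<bar>" for k x y
      using u_lipschitz[of "t k + x" "t k + y"] by simp
  qed
qed

lemma u_integral:
  assumes t: "filterlim (\<lambda>k. \<bar>t k\<bar>) at_top sequentially" and G: "finite_borel_measure G"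
  shows "(\<lambda>k. (LINT s|G. u (t k - s)) - measure G UNIV * u (t k)) \<longlonglongrightarrow> 0"
  using slowly_varying_integral[OF G, of "\<lambda>k x. u (t k + x)" K 0] u_slowly_varying[OF t, of 0] u_bdd
  by simp

lemma mconv_u: "finite_borel_measure G \<Longrightarrow> mconv G (rpot M f) t = ennreal (LINT s|G. u (t - s))"
  using mconv_finite_integral[OF _ u_meas u_nonneg u_le, of G t] by (simp add: u)

definition "TN = density lborel tail_neg"

lemma TN: "finite_borel_measure TN" unfolding TN_def by (rule finite_borel_tail_neg)

lemma TN_mass: "ennreal (measure TN UNIV) = mean_neg"
  using mean_neg_finite unfolding TN_def measure_def
  by (auto simp: emeasure_density mean_neg_def)

lemma u_integral_nonneg: "0 \<le> (LINT s|G. u (t - s))" by (simp add: u_nonneg)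

text \<open>The renewal inequality bounds the difference of the tail masses times
  \<open>u (t k)\<close> by \<open>mass\<close> up to a null sequence, and truncations of the right
  tail can be made as heavy as desired.\<close>

lemma tendsto_0_infinite_mean:
  assumes t: "filterlim (\<lambda>k. \<bar>t k\<bar>) at_top sequentially" and inf: "mean_pos = \<infinity>"
  shows "(\<lambda>k. u (t k)) \<longlonglongrightarrow> 0"
proof (rule LIMSEQ_I)
  fix r :: real assume r: "r > 0"
  define ms where "ms = enn2real mass"
  have ms: "ennreal ms = mass" "ms > 0"
    using mass_finite mass_pos by (auto simp: ms_def enn2real_positive_iff)
  \<comment> \<open>The excess \<open>2 * ms / r\<close> over the left tail mass is chosen so that
    the bound \<open>ms + ms\<close> below forces \<open>u (t k) < r\<close>.\<close>
  define y where "y = measure TN UNIV + 2 * ms / r"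
  have "ennreal y < mean_pos" using inf by simp
  from tail_truncation[OF this] obtain h where h: "h \<in> borel_measurable borel" "\<And>t. h t \<le> tail_pos t"
    "ennreal y < (\<integral>\<^sup>+t. h t \<partial>lborel)" "(\<integral>\<^sup>+t. h t \<partial>lborel) < \<infinity>" by blast
  note [measurable] = h(1)
  define Th where "Th = density lborel h"
  have Th: "finite_borel_measure Th" unfolding Th_def by (rule finite_borel_density) (use h in auto)
  define A where "A k = (LINT s|Th. u (t k - s)) - measure Th UNIV * u (t k)" for k
  define B where "B k = (LINT s|TN. u (t k - s)) - measure TN UNIV * u (t k)" for k
  have AB: "A \<longlonglongrightarrow> 0" "B \<longlonglongrightarrow> 0"
    using u_integral[OF t Th] u_integral[OF t TN] by (simp_all add: A_def[abs_def] B_def[abs_def])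
  have "ennreal (measure Th UNIV) = (\<integral>\<^sup>+t. h t \<partial>lborel)"
    using h(4) unfolding Th_def measure_def by (auto simp: emeasure_density)
  then have "ennreal y < ennreal (measure Th UNIV)" using h(3) by simp
  then have yh: "y < measure Th UNIV"
    using ms r by (subst (asm) ennreal_less_iff) (auto simp: y_def)
  have ineq: "(LINT s|Th. u (t k - s)) \<le> ms + (LINT s|TN. u (t k - s))" for k
  proof -
    have "mconv Th (rpot M f) (t k) \<le> mass + mconv TN (rpot M f) (t k)"
      unfolding mconv_SUP_psum(1)[OF Th f_meas]
    proof (rule SUP_least)
      fix N
      have "mconv Th (psum M N f) (t k) \<le> mass + mconv TN (psum M N f) (t k)"
        unfolding Th_def TN_def by (rule renewal_inequality[OF h(1,2,4)])
      also have "\<dots> \<le> mass + mconv TN (rpot M f) (t k)"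
        by (intro add_left_mono mconv_mono psum_le_rpot)
      finally show "mconv Th (psum M N f) (t k) \<le> mass + mconv TN (rpot M f) (t k)" .
    qed
    also have "\<dots> = ennreal (ms + (LINT s|TN. u (t k - s)))"
      using ms u_integral_nonneg by (simp add: mconv_u[OF TN])
    finally show ?thesis unfolding mconv_u[OF Th]
      using ms u_integral_nonneg[of TN "t k"] by (subst (asm) ennreal_le_iff) auto
  qed
  have "(\<lambda>k. B k - A k) \<longlonglongrightarrow> 0" using tendsto_diff[OF AB(2,1)] by simp
  from LIMSEQ_D[OF this ms(2)] obtain n0 where n0: "\<And>k. k \<ge> n0 \<Longrightarrow> \<bar>B k - A k\<bar> < ms" by auto
  have "norm (u (t k) - 0) < r" if "k \<ge> n0" for k
  proof -
    have "2 * ms / r * u (t k) \<le> (measure Th UNIV - measure TN UNIV) * u (t k)"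
      using yh u_nonneg[of "t k"] by (intro mult_right_mono) (auto simp: y_def)
    also have "\<dots> < ms + ms" using ineq[of k] n0[OF that] by (simp add: A_def B_def left_diff_distrib)
    finally have "u (t k) < r" using ms(2) r by (simp add: field_simps)
    then show ?thesis using u_nonneg[of "t k"] by simp
  qed
  then show "\<exists>n0. \<forall>k\<ge>n0. norm (u (t k) - 0) < r" by blast
qed

text \<open>For finite mean the limit \<open>l\<close> of \<open>H\<^sup>n * ramp\<close> does not depend on the starting point,
  and it has to vanish because it is minus the nonnegative limit of a multiple of \<open>u\<close> at \<open>-\<infinity>\<close>.\<close>

lemma finite_mean_limits:
  assumes fin: "mean_pos < \<infinity>"
  defines "m \<equiv> enn2real mean_pos - enn2real mean_neg"
  shows "filterlim t at_top sequentially \<Longrightarrow> (\<lambda>k. u (t k)) \<longlonglongrightarrow> enn2real mass / m"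
    and "filterlim t at_bot sequentially \<Longrightarrow> (\<lambda>k. u (t k)) \<longlonglongrightarrow> 0"
proof -
  define ms where "ms = enn2real mass"
  have ms: "ennreal ms = mass" "ms > 0"
    using mass_finite mass_pos by (auto simp: ms_def enn2real_positive_iff)
  define TP where "TP = density lborel tail_pos"
  have TP: "finite_borel_measure TP"
    unfolding TP_def by (rule finite_borel_density) (use fin in \<open>auto simp: mean_pos_def\<close>)
  have TP_mass: "ennreal (measure TP UNIV) = mean_pos"
    using fin unfolding TP_def measure_def by (auto simp: emeasure_density mean_pos_def)
  have m: "m = measure TP UNIV - measure TN UNIV" unfolding m_def TP_mass[symmetric] TN_mass[symmetric] by simp
  have "ennreal (measure TN UNIV) < ennreal (measure TP UNIV)" using drift by (simp add: TP_mass TN_mass)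
  then have m_pos: "m > 0" by (simp add: m ennreal_less_iff)
  define r where "r t = enn2real (ramp t)" for t
  have r: "ennreal (r t) = ramp t" for t
    using le_less_trans[OF ramp_le mass_finite] by (simp add: r_def)
  have r0: "0 \<le> r t" for t by (simp add: r_def)
  \<comment> \<open>The limit of the iterated ramp: \<open>smeared_identity\<close> with the whole
    right tail as \<open>h\<close>, solved for that term and with \<open>N\<close> tending to
    infinity.\<close>
  define l where "l t = r t + (LINT s|TN. u (t - s)) - (LINT s|TP. u (t - s))" for t
  have pw_fin: "mpow M N ramp t < \<infinity>" for N t
    using le_less_trans[OF mpow_mono[of ramp "\<lambda>_. mass" M N t] ] ramp_le mass_finite by simp
  have l_lim: "(\<lambda>N. enn2real (mpow M N ramp t)) \<longlonglongrightarrow> l t" for t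
  proof -
    \<comment> \<open>In \<open>ennreal\<close> the difference
      \<open>tail_pos t - tail_pos t\<close> is 0 only for finite values.\<close>
    have tp1: "tail_pos s \<noteq> \<top>" for s using tail_pos_le1[of s] by (auto simp: top_unique)
    have eq: "ramp t + mconv TN (psum M N f) t = mpow M N ramp t + mconv TP (psum M N f) t" for N
    proof -
      have "psum M N (mconv (density lborel f) (\<lambda>t. tail_pos t - tail_pos t)) t = 0"
      proof -
        have "mconv (density lborel f) (\<lambda>t. tail_pos t - tail_pos t) = (\<lambda>_. 0)"
          by (simp add: tp1 mconv_const fun_eq_iff)
        then show ?thesis by (simp add: psum_def)
      qed
      then show ?thesis
        using smeared_identity[of tail_pos t N] fin by (simp add: TN_def TP_def mean_pos_def)
    qed
    have lim: "(\<lambda>N. enn2real (mconv G (psum M N f) t)) \<longlonglongrightarrow> (LINT s|G. u (t - s))"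
      if G: "finite_borel_measure G" for G
    proof -
      have fin: "mconv G (psum M N f) t < \<top>" for N
        using mconv_mono[of "psum M N f" "rpot M f" G t] psum_le_rpot mconv_u[OF G, of t]
        by (auto intro: le_less_trans)
      have "(\<lambda>N. ennreal (enn2real (mconv G (psum M N f) t))) \<longlonglongrightarrow> ennreal (LINT s|G. u (t - s))"
        using mconv_SUP_psum(2)[OF G f_meas, of t] by (simp add: mconv_u[OF G] fin)
      then show ?thesis by (simp add: u_integral_nonneg)
    qed
    have finG: "mconv G (psum M N f) t < \<top>" if "finite_borel_measure G" for G N
      using mconv_mono[of "psum M N f" "rpot M f" G t] psum_le_rpot mconv_u[OF that, of t]
      by (auto intro: le_less_trans)
    have "enn2real (mpow M N ramp t) = r t + enn2real (mconv TN (psum M N f) t) - enn2real (mconv TP (psum M N f) t)" for N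
    proof -
      have "ennreal (r t + enn2real (mconv TN (psum M N f) t)) =
          ennreal (enn2real (mpow M N ramp t) + enn2real (mconv TP (psum M N f) t))"
        using eq[of N] finG[OF TN] finG[OF TP] pw_fin[of N t] r0[of t] by (simp add: r)
      then show ?thesis using r0[of t] by (subst (asm) ennreal_inj) auto
    qed
    then show ?thesis unfolding l_def by (simp only:) (intro tendsto_intros lim TN TP)
  qed
  have l0: "0 \<le> l t" for t by (rule LIMSEQ_le_const[OF l_lim]) auto
  \<comment> \<open>By \<open>ramp_diff\<close> the iterated ramps at \<open>t\<close> and
    \<open>s\<close> differ at most by the weight of a bounded interval under the
    \<open>N\<close>-th power. That weight is an increment of a convergent sequence and tends to
    0.\<close>
  have l_le: "l t \<le> l s" for s t
  proof -
    let ?I = "indicator {- d - t..d - s} :: real \<Rightarrow> ennreal"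
    define a where "a N = enn2real (psum M N ?I 0)" for N
    define n where "n = nat \<lceil>d - s + d + t\<rceil> + 1"
    have "d - s < (- d - t) + real n" 
      using real_nat_ceiling_ge[of "d - s + d + t"] unfolding n_def by simp
    from rpot_Icc_le[OF this, of 0] have "rpot M ?I 0 \<le> ennreal (real n * b)"
      using b_nonneg by (simp add: b[symmetric] ennreal_mult ennreal_of_nat_eq_real_of_nat)
    then have If: "rpot M ?I 0 < \<top>" by (rule le_less_trans) simp
    have psf: "psum M N ?I 0 < \<top>" for N using psum_le_rpot If by (rule le_less_trans)
    have "(\<lambda>N. ennreal (a N)) \<longlonglongrightarrow> ennreal (enn2real (rpot M ?I 0))"
      using psum_tendsto_rpot[of M ?I 0] psf If by (simp add: a_def)
    then have a: "a \<longlonglongrightarrow> enn2real (rpot M ?I 0)" by (simp add: a_def[abs_def])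
    have "enn2real (mpow M N ramp t) \<le> enn2real (mpow M N ramp s) + ms * (a (Suc N) - a N)" for N
    proof -
      have pS: "psum M (Suc N) ?I 0 = psum M N ?I 0 + mpow M N ?I 0" by (simp add: psum_def)
      have mf: "mpow M N ?I 0 < \<top>" using psf[of "Suc N"] by (simp add: pS)
      have aS: "a (Suc N) = a N + enn2real (mpow M N ?I 0)"
        unfolding a_def pS by (rule enn2real_plus) (use psf mf in auto)
      then have mI: "mpow M N ?I 0 = ennreal (a (Suc N) - a N)" using mf by simp
      have aa: "a N \<le> a (Suc N)" by (simp add: aS)
      have "mpow M N ramp t \<le> mpow M N (\<lambda>x. ramp (x + s) + mass * ?I x) 0"
        using mpow_mono[of "\<lambda>x. ramp (x + t)" "\<lambda>x. ramp (x + s) + mass * ?I x" M N 0] ramp_diff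
        by (simp add: mpow_shift)
      also have "\<dots> = mpow M N ramp s + mass * mpow M N ?I 0"
        by (simp add: mpow_add_fun mpow_cmult mpow_shift)
      finally have "ennreal (enn2real (mpow M N ramp t)) \<le>
          ennreal (enn2real (mpow M N ramp s) + ms * (a (Suc N) - a N))"
        using pw_fin ms(2) aa by (simp add: ms(1)[symmetric] mI ennreal_mult)
      then show ?thesis using ms(2) aa by (subst (asm) ennreal_le_iff) auto
    qed
    moreover have "(\<lambda>N. enn2real (mpow M N ramp s) + ms * (a (Suc N) - a N)) \<longlonglongrightarrow>
        l s + ms * (enn2real (rpot M ?I 0) - enn2real (rpot M ?I 0))"
      by (intro tendsto_intros l_lim a LIMSEQ_Suc)
    ultimately show ?thesis using LIMSEQ_le[OF l_lim[of t]] by fastforce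
  qed
  have l_const: "l t = l 0" for t using l_le[of t 0] l_le[of 0 t] by simp
  \<comment> \<open>Slow variation replaces both tail integrals in \<open>l (t k)\<close> by tail
    mass times \<open>u (t k)\<close>; the masses differ by \<open>m\<close>.\<close>
  have key: "(\<lambda>k. m * u (t k) - (r (t k) - l 0)) \<longlonglongrightarrow> 0"
    if t: "filterlim (\<lambda>k. \<bar>t k\<bar>) at_top sequentially" for t
  proof -
    have "(\<lambda>k. ((LINT s|TN. u (t k - s)) - measure TN UNIV * u (t k)) -
      ((LINT s|TP. u (t k - s)) - measure TP UNIV * u (t k))) \<longlonglongrightarrow> 0 - 0"
      by (intro tendsto_diff u_integral t TN TP)
    moreover have "((LINT s|TN. u (t k - s)) - measure TN UNIV * u (t k)) -
      ((LINT s|TP. u (t k - s)) - measure TP UNIV * u (t k)) = m * u (t k) - (r (t k) - l 0)" for k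
      unfolding l_const[of "t k", symmetric] by (simp add: l_def m algebra_simps)
    ultimately show ?thesis by simp
  qed
  have r_bot: "(\<lambda>k. r (t k)) \<longlonglongrightarrow> 0" if "filterlim t at_bot sequentially" for t
  proof (rule tendsto_eventually)
    have "\<forall>\<^sub>F k in sequentially. t k \<le> - d - 1" using that by (simp add: filterlim_at_bot)
    then show "\<forall>\<^sub>F k in sequentially. r (t k) = 0"
      by eventually_elim (simp add: r_def ramp_left)
  qed
  have r_top: "(\<lambda>k. r (t k)) \<longlonglongrightarrow> ms" if "filterlim t at_top sequentially" for t
  proof (rule tendsto_eventually)
    have "\<forall>\<^sub>F k in sequentially. d \<le> t k" using that by (simp add: filterlim_at_top)
    then show "\<forall>\<^sub>F k in sequentially. r (t k) = ms"
      by eventually_elim (simp add: r_def ms_def ramp_right)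
  qed
  have bot: "(\<lambda>k. m * u (t k)) \<longlonglongrightarrow> - l 0" if "filterlim t at_bot sequentially" for t
  proof -
    have "filterlim (\<lambda>k. \<bar>t k\<bar>) at_top sequentially"
      using filterlim_compose[OF filterlim_abs_at_bot that] .
    from tendsto_add[OF key[OF this] tendsto_diff[OF r_bot[OF that] tendsto_const[of "l 0"]]]
    show ?thesis by simp
  qed
  \<comment> \<open>Far to the left the ramp vanishes, so \<open>m * u (t k)\<close> tends to
    \<open>- l 0\<close>, which is therefore nonnegative.\<close>
  have l00: "l 0 = 0"
  proof -
    have fl: "filterlim (\<lambda>k. - real k) at_bot sequentially"
      by (simp add: filterlim_uminus_at_bot filterlim_real_sequentially)
    have "0 \<le> - l 0" by (rule LIMSEQ_le_const[OF bot[OF fl]]) (use u_nonneg m_pos in auto)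
    with l0[of 0] show ?thesis by simp
  qed
  show "(\<lambda>k. u (t k)) \<longlonglongrightarrow> 0" if "filterlim t at_bot sequentially"
  proof -
    have "(\<lambda>k. (m * u (t k)) / m) \<longlonglongrightarrow> - l 0 / m" by (intro tendsto_divide bot that tendsto_const) (use m_pos in auto)
    then show ?thesis using m_pos by (simp add: l00)
  qed
  show "(\<lambda>k. u (t k)) \<longlonglongrightarrow> enn2real mass / m" if "filterlim t at_top sequentially"
  proof -
    have "filterlim (\<lambda>k. \<bar>t k\<bar>) at_top sequentially"
      using filterlim_compose[OF filterlim_abs_real that] .
    from tendsto_add[OF key[OF this] r_top[OF that]]
    have "(\<lambda>k. m * u (t k)) \<longlonglongrightarrow> ms" by (simp add: l00)
    then have "(\<lambda>k. (m * u (t k)) / m) \<longlonglongrightarrow> ms / m" by (intro tendsto_divide tendsto_const) (use m_pos in auto)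
    then show ?thesis using m_pos by (simp add: ms_def)
  qed
qed

text \<open>The inverse in \<open>ennreal\<close> sends \<infinity> to 0, so one formula covers
  finite and infinite mean.\<close>

lemma rpot_tent_limits:
  shows "filterlim t at_top sequentially \<Longrightarrow>
      (\<lambda>k. rpot M f (t k)) \<longlonglongrightarrow> inverse (mean_pos - mean_neg) * mass"
    and "filterlim t at_bot sequentially \<Longrightarrow> (\<lambda>k. rpot M f (t k)) \<longlonglongrightarrow> 0"
proof -
  have c: "inverse (mean_pos - mean_neg) * mass =
      ennreal (if mean_pos < \<infinity> then enn2real mass / (enn2real mean_pos - enn2real mean_neg) else 0)"
  proof (cases "mean_pos < \<infinity>")
    case True
    have "ennreal (enn2real mean_neg) < ennreal (enn2real mean_pos)"
      using True mean_neg_finite drift by simp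
    then have lt: "enn2real mean_neg < enn2real mean_pos" by (simp add: ennreal_less_iff)
    have "mean_pos - mean_neg = ennreal (enn2real mean_pos) - ennreal (enn2real mean_neg)"
      using True mean_neg_finite by simp
    also have "\<dots> = ennreal (enn2real mean_pos - enn2real mean_neg)"
      by (rule ennreal_minus) simp
    finally have "inverse (mean_pos - mean_neg) = ennreal (inverse (enn2real mean_pos - enn2real mean_neg))"
      using lt by (simp add: inverse_ennreal)
    moreover have "mass = ennreal (enn2real mass)" using mass_finite by simp
    ultimately have "inverse (mean_pos - mean_neg) * mass =
        ennreal (inverse (enn2real mean_pos - enn2real mean_neg)) * ennreal (enn2real mass)" by simp
    also have "\<dots> = ennreal (enn2real mass / (enn2real mean_pos - enn2real mean_neg))"
      using lt by (subst ennreal_mult[symmetric]) (auto simp: divide_inverse mult.commute)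
    finally show ?thesis using True by simp
  next
    case False
    then have "mean_pos = \<top>" using top.not_eq_extremum infinity_ennreal_def by metis
    then show ?thesis using mean_neg_finite by (simp add: ennreal_top_minus)
  qed
  have at: "filterlim t at_top sequentially \<Longrightarrow> filterlim (\<lambda>k. \<bar>t k\<bar>) at_top sequentially"
    "filterlim t at_bot sequentially \<Longrightarrow> filterlim (\<lambda>k. \<bar>t k\<bar>) at_top sequentially" for t :: "nat \<Rightarrow> real"
    using filterlim_compose[OF filterlim_abs_real] filterlim_compose[OF filterlim_abs_at_bot] by auto
  have inf: "mean_pos = \<infinity>" if "\<not> mean_pos < \<infinity>"
    using that top.not_eq_extremum infinity_ennreal_def by metis
  show "(\<lambda>k. rpot M f (t k)) \<longlonglongrightarrow> inverse (mean_pos - mean_neg) * mass"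
    if "filterlim t at_top sequentially"
    unfolding c u[symmetric]
    using finite_mean_limits(1)[OF _ that] tendsto_0_infinite_mean[OF at(1)[OF that]] inf
    by (intro tendsto_ennrealI) auto
  have "(\<lambda>k. ennreal (u (t k))) \<longlonglongrightarrow> ennreal 0" if "filterlim t at_bot sequentially"
    using finite_mean_limits(2)[OF _ that] tendsto_0_infinite_mean[OF at(2)[OF that]] inf
    by (intro tendsto_ennrealI) auto
  then show "(\<lambda>k. rpot M f (t k)) \<longlonglongrightarrow> 0" if "filterlim t at_bot sequentially"
    using that by (simp add: u)
qed

end

section \<open>The key renewal theorem\<close>

text \<open>Sums over states are integrals over counting measure, so that dominated convergence for
  integrals applies to them.\<close>

abbreviation csum :: "('a \<Rightarrow> ennreal) \<Rightarrow> ennreal" where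
  "csum f \<equiv> (\<integral>\<^sup>+j. f j \<partial>count_space UNIV)"

text \<open>Numbers outside the range of \<open>to_nat\<close> contribute 0, which treats finite and
  infinite state spaces alike.\<close>

lemma csum_eq_suminf:
  fixes f :: "'a::countable \<Rightarrow> ennreal"
  shows "csum f = (\<Sum>n. if n \<in> range (to_nat :: 'a \<Rightarrow> nat) then f (from_nat n) else 0)"
proof -
  have "bij_betw (to_nat :: 'a \<Rightarrow> nat) UNIV (range (to_nat :: 'a \<Rightarrow> nat))" by (simp add: bij_betw_def)
  from nn_integral_bij_count_space[OF this, of "\<lambda>n. f (from_nat n)"]
  have "csum f = (\<integral>\<^sup>+n. f (from_nat n) \<partial>count_space (range (to_nat :: 'a \<Rightarrow> nat)))" by simp
  also have "\<dots> = (\<integral>\<^sup>+n. f (from_nat n) * indicator (range (to_nat :: 'a \<Rightarrow> nat)) n \<partial>count_space UNIV)"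
    by (rule nn_integral_count_space_indicator) simp
  also have "\<dots> = (\<Sum>n. if n \<in> range (to_nat :: 'a \<Rightarrow> nat) then f (from_nat n) else 0)"
    by (subst nn_integral_count_space_nat) (auto intro!: suminf_cong simp: indicator_def)
  finally show ?thesis .
qed

lemma infsum_nat_ennreal: "(\<Sum>\<^sub>\<infinity>n. f n) = (\<Sum>n. f n)" for f :: "nat \<Rightarrow> ennreal"
proof -
  have "(f has_sum (\<Sum>\<^sub>\<infinity>n. f n)) UNIV" by (intro has_sum_infsum nonneg_summable_on_complete) simp
  then show ?thesis using has_sum_imp_sums sums_unique by blast
qed

lemma infsum_eq_csum:
  fixes f :: "'a::countable \<Rightarrow> ennreal"
  shows "(\<Sum>\<^sub>\<infinity>j. f j) = csum f"
proof -
  have "(\<Sum>\<^sub>\<infinity>j. f j) = (\<Sum>\<^sub>\<infinity>j. f (from_nat (to_nat (j :: 'a))))" by simp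
  also have "\<dots> = (\<Sum>\<^sub>\<infinity>n\<in>range (to_nat :: 'a \<Rightarrow> nat). f (from_nat n))"
    by (subst infsum_reindex) (auto simp: o_def)
  also have "\<dots> = (\<Sum>\<^sub>\<infinity>n. if n \<in> range (to_nat :: 'a \<Rightarrow> nat) then f (from_nat n) else 0)"
    by (rule infsum_cong_neutral) auto
  finally show ?thesis by (simp add: infsum_nat_ennreal csum_eq_suminf)
qed

text \<open>Open balls make the sets where the upper envelope exceeds a value, or the lower one
  stays below it, open. The envelopes of an arbitrary \<open>g\<close> are thus measurable.\<close>

definition sup_ball :: "real \<Rightarrow> (real \<Rightarrow> ennreal) \<Rightarrow> real \<Rightarrow> ennreal" where
  "sup_ball d g x = (SUP y\<in>ball x d. g y)"

definition inf_ball :: "real \<Rightarrow> (real \<Rightarrow> ennreal) \<Rightarrow> real \<Rightarrow> ennreal" where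
  "inf_ball d g x = (INF y\<in>ball x d. g y)"

lemma sup_ball_measurable [measurable]: "sup_ball d g \<in> borel_measurable borel"
proof (rule borel_measurableI_greater)
  fix a
  have "{x. a < sup_ball d g x} = (\<Union>y\<in>{y. a < g y}. ball y d)"
    by (auto simp: sup_ball_def less_SUP_iff dist_commute)
  then have "open {x. a < sup_ball d g x}" by auto
  then show "{x \<in> space borel. a < sup_ball d g x} \<in> sets borel" by simp
qed

lemma inf_ball_measurable [measurable]: "inf_ball d g \<in> borel_measurable borel"
proof (rule borel_measurableI_less)
  fix a
  have "{x. inf_ball d g x < a} = (\<Union>y\<in>{y. g y < a}. ball y d)"
    by (auto simp: inf_ball_def INF_less_iff dist_commute)
  then have "open {x. inf_ball d g x < a}" by auto
  then show "{x \<in> space borel. inf_ball d g x < a} \<in> sets borel" by simp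
qed

lemma sup_ball_tendsto:
  assumes cont: "isCont g x" and pos: "\<And>n. d n > 0" and d: "d \<longlonglongrightarrow> 0"
  shows "(\<lambda>n. sup_ball (d n) g x) \<longlonglongrightarrow> g x"
proof (rule order_tendstoI)
  fix a assume a: "a < g x"
  have "g x \<le> sup_ball (d n) g x" for n unfolding sup_ball_def by (rule SUP_upper) (use pos in auto)
  from less_le_trans[OF a this] show "\<forall>\<^sub>F n in sequentially. a < sup_ball (d n) g x"
    by (rule always_eventually[OF allI])
next
  fix a assume "g x < a"
  then obtain a' where a': "g x < a'" "a' < a" using dense by blast
  have "\<forall>\<^sub>F y in at x. g y < a'" using order_tendstoD(2)[OF isContD[OF cont] a'(1)] .
  then obtain r where r: "r > 0" "\<And>y. y \<noteq> x \<Longrightarrow> dist y x < r \<Longrightarrow> g y < a'"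
    unfolding eventually_at by auto
  then have r': "g y < a'" if "dist x y < r" for y using a' that by (cases "y = x") (auto simp: dist_commute)
  have "\<forall>\<^sub>F n in sequentially. d n < r" using order_tendstoD(2)[OF d r(1)] .
  then show "\<forall>\<^sub>F n in sequentially. sup_ball (d n) g x < a"
  proof eventually_elim
    case (elim n)
    have "sup_ball (d n) g x \<le> a'"
      unfolding sup_ball_def by (rule SUP_least) (use r' elim in \<open>auto intro: less_imp_le\<close>)
    then show ?case using a' by simp
  qed
qed

lemma inf_ball_tendsto:
  assumes cont: "isCont g x" and pos: "\<And>n. d n > 0" and d: "d \<longlonglongrightarrow> 0"
  shows "(\<lambda>n. inf_ball (d n) g x) \<longlonglongrightarrow> g x"
proof (rule order_tendstoI)
  fix a assume a: "g x < a"
  have "inf_ball (d n) g x \<le> g x" for n unfolding inf_ball_def by (rule INF_lower) (use pos in auto)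
  from le_less_trans[OF this a] show "\<forall>\<^sub>F n in sequentially. inf_ball (d n) g x < a"
    by (rule always_eventually[OF allI])
next
  fix a assume "a < g x"
  then obtain a' where a': "a < a'" "a' < g x" using dense by blast
  have "\<forall>\<^sub>F y in at x. a' < g y" using order_tendstoD(1)[OF isContD[OF cont] a'(2)] .
  then obtain r where r: "r > 0" "\<And>y. y \<noteq> x \<Longrightarrow> dist y x < r \<Longrightarrow> a' < g y"
    unfolding eventually_at by auto
  then have r': "a' < g y" if "dist x y < r" for y using a' that by (cases "y = x") (auto simp: dist_commute)
  have "\<forall>\<^sub>F n in sequentially. d n < r" using order_tendstoD(2)[OF d r(1)] .
  then show "\<forall>\<^sub>F n in sequentially. a < inf_ball (d n) g x"
  proof eventually_elim
    case (elim n)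
    have "a' \<le> inf_ball (d n) g x"
      unfolding inf_ball_def by (rule INF_greatest) (use r' elim in \<open>auto intro: less_imp_le\<close>)
    then show ?case using a' by simp
  qed
qed

lemma mult_less_cancel_left_ennreal: "c * a < c * b \<Longrightarrow> a < (b::ennreal)"
proof (rule ccontr)
  assume "c * a < c * b" "\<not> a < b"
  then show False using mult_left_mono[of b a c] by (simp add: not_less leD)
qed

lemma mconv_tendsto:
  assumes G: "finite_borel_measure G" and [measurable]: "f \<in> borel_measurable borel"
    and bdd: "\<And>x. f x \<le> K" and K: "K < \<infinity>"
    and lim: "\<And>x. (\<lambda>k. f (t k - x)) \<longlonglongrightarrow> y"
  shows "(\<lambda>k. mconv G f (t k)) \<longlonglongrightarrow> y * emeasure G UNIV"
proof -
  interpret finite_borel_measure G by fact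
  note [measurable_cong] = M_is_borel
  have "(\<lambda>k. \<integral>\<^sup>+x. f (t k - x) \<partial>G) \<longlonglongrightarrow> (\<integral>\<^sup>+x. y \<partial>G)"
  proof (rule nn_integral_dominated_convergence[where w = "\<lambda>_. K"])
    have "emeasure G UNIV < \<top>"
      by (metis emeasure_finite top.not_eq_extremum infinity_ennreal_def)
    then show "(\<integral>\<^sup>+x. K \<partial>G) < \<infinity>" using K borel_UNIV by (simp add: ennreal_mult_less_top)
  qed (use bdd lim in auto)
  then show ?thesis using borel_UNIV by (simp add: mconv_def)
qed

locale drift_walk = renewal_walk +
  assumes mean_neg_finite: "mean_neg < \<infinity>" and drift: "mean_neg < mean_pos"
begin

definition "B = rpot M (indicator {-1..1}) 0"
definition "rate = inverse (mean_pos - mean_neg)"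

text \<open>Pairs the two directions of escape with their limiting renewal densities, so that the limits at
  \<open>\<infinity>\<close> and \<open>-\<infinity>\<close> are treated by the same arguments.\<close>

definition direction :: "real filter \<Rightarrow> ennreal \<Rightarrow> bool" where
  "direction E c \<longleftrightarrow> (E = at_top \<and> c = rate) \<or> (E = at_bot \<and> c = 0)"

lemma B_finite: "B < \<infinity>" unfolding B_def by (rule potential_finite[OF drift mean_neg_finite])

lemma rate_finite: "rate < \<infinity>"
proof -
  have "mean_pos - mean_neg \<noteq> 0" using drift mean_neg_finite by (simp add: diff_eq_0_iff_ennreal not_le)
  then show ?thesis
    using top.not_eq_extremum[of "inverse (mean_pos - mean_neg)"] by (auto simp: rate_def)
qed

lemma direction_finite: "direction E c \<Longrightarrow> c < \<infinity>"
  using rate_finite by (auto simp: direction_def)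

lemma direction_shift:
  assumes E: "direction E c" and t: "filterlim t E sequentially"
  shows "filterlim (\<lambda>k. t k - x) E sequentially"
proof (cases "E = at_top")
  case True
  then show ?thesis using filterlim_tendsto_add_at_top[OF tendsto_const[of "-x"], of t sequentially] t by simp
next
  case False
  then have "E = at_bot" using E by (simp add: direction_def)
  then have t: "filterlim t at_bot sequentially" using t by simp
  have "\<forall>\<^sub>F k in sequentially. t k - x \<le> Z" for Z
  proof -
    have "\<forall>\<^sub>F k in sequentially. t k \<le> Z + x" using t by (simp add: filterlim_at_bot)
    then show ?thesis by eventually_elim simp
  qed
  then show ?thesis using \<open>E = at_bot\<close> by (simp add: filterlim_at_bot)
qed

lemma rpot_Icc_le_B: "b < a + real m \<Longrightarrow> rpot M (indicator {a..b}) t \<le> of_nat m * B"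
  unfolding B_def by (rule rpot_Icc_le)

lemma tent_limit:
  assumes E: "direction E c" and t: "filterlim t E sequentially" and d: "d > 0"
  shows "(\<lambda>k. rpot M (\<lambda>x. ennreal (tent d x)) (t k)) \<longlonglongrightarrow> c * (\<integral>\<^sup>+x. ennreal (tent d x) \<partial>lborel)"
    and "\<exists>K<\<infinity>. \<forall>x. rpot M (\<lambda>x. ennreal (tent d x)) x \<le> K"
proof -
  interpret transient_tent_walk M d by unfold_locales (use d mean_neg_finite drift in auto)
  have f: "f = (\<lambda>x. ennreal (tent d x))" by (auto simp: f_def)
  show "(\<lambda>k. rpot M (\<lambda>x. ennreal (tent d x)) (t k)) \<longlonglongrightarrow> c * (\<integral>\<^sup>+x. ennreal (tent d x) \<partial>lborel)"
    using rpot_tent_limits[of t] E t by (auto simp: direction_def rate_def mass_def f)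
  show "\<exists>K<\<infinity>. \<forall>x. rpot M (\<lambda>x. ennreal (tent d x)) x \<le> K"
    using rpot_f_le by (intro exI[of _ "ennreal K"]) (auto simp: f)
qed

lemma density_tent_limit:
  assumes E: "direction E c" and t: "filterlim t E sequentially" and d: "d > 0"
    and [measurable]: "h \<in> borel_measurable borel" and h: "(\<integral>\<^sup>+x. h x \<partial>lborel) < \<infinity>"
  shows "(\<lambda>k. rpot M (mconv (density lborel (\<lambda>x. ennreal (tent d x))) h) (t k)) \<longlonglongrightarrow>
      (\<integral>\<^sup>+x. ennreal (tent d x) \<partial>lborel) * (c * (\<integral>\<^sup>+x. h x \<partial>lborel))"
proof -
  let ?f = "\<lambda>x. ennreal (tent d x)" and ?h = "density lborel h"
  have H: "finite_borel_measure ?h" by (rule finite_borel_density) (use h in auto)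
  have "mconv (density lborel ?f) h = mconv ?h ?f"
    by (rule ext, rule mconv_density_swap) measurable
  then have eq: "rpot M (mconv (density lborel ?f) h) t = mconv ?h (rpot M ?f) t" for t
    by (simp add: rpot_mconv_commute[OF H])
  obtain K where K: "K < \<infinity>" "\<And>x. rpot M ?f x \<le> K" using tent_limit(2)[OF E t d] by blast
  have "(\<lambda>k. mconv ?h (rpot M ?f) (t k)) \<longlonglongrightarrow> (c * (\<integral>\<^sup>+x. ?f x \<partial>lborel)) * emeasure ?h UNIV"
    by (rule mconv_tendsto[OF H _ K(2,1)]) (auto intro!: tent_limit(1)[OF E _ d] direction_shift[OF E t])
  then show ?thesis by (simp add: eq emeasure_density mult_ac)
qed

text \<open>A sandwich: the upper envelope of radius \<open>d n\<close>, smeared with a tent of the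
  same radius, is at least \<open>m n * g\<close>, and the smeared lower envelope is at most that.
  The limits for smeared functions are known; as the radius shrinks, the integrals of both envelopes
  tend to that of \<open>g\<close> by continuity almost everywhere and domination.\<close>

lemma dominated_limit:
  assumes E: "direction E c" and t: "filterlim t E sequentially"
    and [measurable]: "g \<in> borel_measurable borel" "W \<in> borel_measurable borel"
    and e: "e > 0" and W: "\<And>x. sup_ball e g x \<le> W x" "(\<integral>\<^sup>+x. W x \<partial>lborel) < \<infinity>"
    and cont: "AE x in lborel. isCont g x"
  shows "(\<lambda>k. rpot M g (t k)) \<longlonglongrightarrow> c * (\<integral>\<^sup>+x. g x \<partial>lborel)"
proof -
  define d where "d n = e / real (Suc n)" for n
  have d: "d n > 0" "d n \<le> e" for n using e by (auto simp: d_def field_simps)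
  have d0: "d \<longlonglongrightarrow> 0" unfolding d_def[abs_def] by (rule lim_const_over_n[THEN LIMSEQ_Suc])
  have sup_le: "sup_ball (d n) g x \<le> W x" for n x
  proof -
    have "sup_ball (d n) g x \<le> sup_ball e g x"
      unfolding sup_ball_def by (rule SUP_subset_mono) (use d(2)[of n] in auto)
    then show ?thesis using W(1) by (rule order_trans)
  qed
  have inf_le: "inf_ball (d n) g x \<le> W x" for n x
  proof -
    have "inf_ball (d n) g x \<le> g x" unfolding inf_ball_def by (rule INF_lower) (use d in auto)
    also have "g x \<le> sup_ball (d n) g x" unfolding sup_ball_def by (rule SUP_upper) (use d in auto)
    finally show ?thesis using sup_le by (rule order_trans)
  qed
  have fin: "(\<integral>\<^sup>+x. sup_ball (d n) g x \<partial>lborel) < \<infinity>" "(\<integral>\<^sup>+x. inf_ball (d n) g x \<partial>lborel) < \<infinity>" for n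
    using le_less_trans[OF nn_integral_mono[of lborel "sup_ball (d n) g" W] W(2)]
      le_less_trans[OF nn_integral_mono[of lborel "inf_ball (d n) g" W] W(2)] sup_le inf_le by auto
  have c: "c < \<top>" using direction_finite[OF E] by simp
  have "(\<lambda>n. \<integral>\<^sup>+x. sup_ball (d n) g x \<partial>lborel) \<longlonglongrightarrow> (\<integral>\<^sup>+x. g x \<partial>lborel)"
    by (rule nn_integral_dominated_convergence[where w = W])
       (use W(2) sup_le cont sup_ball_tendsto[OF _ d(1) d0] in \<open>auto elim!: eventually_mono\<close>)
  then have up: "(\<lambda>n. c * (\<integral>\<^sup>+x. sup_ball (d n) g x \<partial>lborel)) \<longlonglongrightarrow> c * (\<integral>\<^sup>+x. g x \<partial>lborel)"
    by (rule ennreal_tendsto_cmult[OF c])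
  have "(\<lambda>n. \<integral>\<^sup>+x. inf_ball (d n) g x \<partial>lborel) \<longlonglongrightarrow> (\<integral>\<^sup>+x. g x \<partial>lborel)"
    by (rule nn_integral_dominated_convergence[where w = W])
       (use W(2) inf_le cont inf_ball_tendsto[OF _ d(1) d0] in \<open>auto elim!: eventually_mono\<close>)
  then have lo: "(\<lambda>n. c * (\<integral>\<^sup>+x. inf_ball (d n) g x \<partial>lborel)) \<longlonglongrightarrow> c * (\<integral>\<^sup>+x. g x \<partial>lborel)"
    by (rule ennreal_tendsto_cmult[OF c])
  \<comment> \<open>The bounds are compared after multiplication by the mass of the tent, which is
    positive and finite and cancels from strict inequalities.\<close>
  define m where "m n = (\<integral>\<^sup>+x. ennreal (tent (d n) x) \<partial>lborel)" for n
  have m: "0 < m n" "m n < \<top>" for n using tent_integral[OF d(1)[of n]] by (auto simp: m_def)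
  have m_mono: "m n * a < m n * b" if "a < b" for n a b
    using ennreal_mult_strict_left_mono[OF that m(1) m(2)] .
  let ?D = "\<lambda>n. density lborel (\<lambda>x. ennreal (tent (d n) x))"
  have ball: "x - s \<in> ball x (d n)" if "tent (d n) s \<noteq> 0" for n x s
    using that by (auto simp: tent_def dist_real_def max_def split: if_splits)
  have smear_up: "m n * g x \<le> mconv (?D n) (sup_ball (d n) g) x" for n x
  proof -
    have "m n * g x = (\<integral>\<^sup>+s. ennreal (tent (d n) s) * g x \<partial>lborel)"
      unfolding m_def by (subst nn_integral_multc) auto
    also have "\<dots> \<le> (\<integral>\<^sup>+s. ennreal (tent (d n) s) * sup_ball (d n) g (x - s) \<partial>lborel)"
    proof (rule nn_integral_mono)
      fix s
      have "g x \<le> sup_ball (d n) g (x - s)" if "tent (d n) s \<noteq> 0"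
        unfolding sup_ball_def using ball[OF that, of x] by (intro SUP_upper) (simp add: dist_commute)
      then show "ennreal (tent (d n) s) * g x \<le> ennreal (tent (d n) s) * sup_ball (d n) g (x - s)"
        by (cases "tent (d n) s = 0") (auto intro: mult_left_mono)
    qed
    finally show ?thesis by (subst mconv_density) auto
  qed
  have smear_lo: "mconv (?D n) (inf_ball (d n) g) x \<le> m n * g x" for n x
  proof -
    have "(\<integral>\<^sup>+s. ennreal (tent (d n) s) * inf_ball (d n) g (x - s) \<partial>lborel)
        \<le> (\<integral>\<^sup>+s. ennreal (tent (d n) s) * g x \<partial>lborel)"
    proof (rule nn_integral_mono)
      fix s
      have "inf_ball (d n) g (x - s) \<le> g x" if "tent (d n) s \<noteq> 0"
        unfolding inf_ball_def using ball[OF that, of x] by (intro INF_lower) (simp add: dist_commute)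
      then show "ennreal (tent (d n) s) * inf_ball (d n) g (x - s) \<le> ennreal (tent (d n) s) * g x"
        by (cases "tent (d n) s = 0") (auto intro: mult_left_mono)
    qed
    also have "\<dots> = m n * g x"
      unfolding m_def by (subst nn_integral_multc) auto
    finally show ?thesis by (subst mconv_density) auto
  qed
  have smear_up': "m n * rpot M g x \<le> rpot M (mconv (?D n) (sup_ball (d n) g)) x" for n x
  proof -
    have "m n * rpot M g x = rpot M (\<lambda>x. m n * g x) x" by (simp add: rpot_cmult)
    also have "\<dots> \<le> rpot M (mconv (?D n) (sup_ball (d n) g)) x" by (rule rpot_mono) (rule smear_up)
    finally show ?thesis .
  qed
  have smear_lo': "rpot M (mconv (?D n) (inf_ball (d n) g)) x \<le> m n * rpot M g x" for n x
  proof -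
    have "rpot M (mconv (?D n) (inf_ball (d n) g)) x \<le> rpot M (\<lambda>x. m n * g x) x"
      by (rule rpot_mono) (rule smear_lo)
    also have "\<dots> = m n * rpot M g x" by (simp add: rpot_cmult)
    finally show ?thesis .
  qed
  show ?thesis
  proof (rule order_tendstoI)
    fix a assume "a < c * (\<integral>\<^sup>+x. g x \<partial>lborel)"
    from order_tendstoD(1)[OF lo this] obtain n where "a < c * (\<integral>\<^sup>+x. inf_ball (d n) g x \<partial>lborel)"
      by (auto simp: eventually_sequentially)
    then have "m n * a < m n * (c * (\<integral>\<^sup>+x. inf_ball (d n) g x \<partial>lborel))" by (rule m_mono)
    from order_tendstoD(1)[OF density_tent_limit[OF E t d(1) inf_ball_measurable fin(2), of n, folded m_def] this]
    show "\<forall>\<^sub>F k in sequentially. a < rpot M g (t k)"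
    proof eventually_elim
      case (elim k)
      from less_le_trans[OF elim smear_lo'[of n "t k"]]
      show ?case by (rule mult_less_cancel_left_ennreal)
    qed
  next
    fix a assume "c * (\<integral>\<^sup>+x. g x \<partial>lborel) < a"
    from order_tendstoD(2)[OF up this] obtain n where "c * (\<integral>\<^sup>+x. sup_ball (d n) g x \<partial>lborel) < a"
      by (auto simp: eventually_sequentially)
    then have "m n * (c * (\<integral>\<^sup>+x. sup_ball (d n) g x \<partial>lborel)) < m n * a" by (rule m_mono)
    from order_tendstoD(2)[OF density_tent_limit[OF E t d(1) sup_ball_measurable fin(1), of n, folded m_def] this]
    show "\<forall>\<^sub>F k in sequentially. rpot M g (t k) < a"
    proof eventually_elim
      case (elim k)
      from le_less_trans[OF smear_up'[of n "t k"] elim]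
      show ?case by (rule mult_less_cancel_left_ennreal)
    qed
  qed
qed

end

text \<open>Induction over the generation of measurable functions from indicators by multiples, sums
  and increasing limits. It identifies functionals with integrals in \<open>mpow_split\<close> and
  \<open>ex_measure\<close>.\<close>

lemma functional_eq_nn_integral:
  fixes L :: "(real \<Rightarrow> ennreal) \<Rightarrow> ennreal"
  assumes M: "sets M = sets borel"
    and ind: "\<And>A. A \<in> sets borel \<Longrightarrow> L (indicator A) = emeasure M A"
    and add: "\<And>f g. f \<in> borel_measurable borel \<Longrightarrow> g \<in> borel_measurable borel \<Longrightarrow>
      L (\<lambda>x. f x + g x) = L f + L g"
    and cmult: "\<And>c f. f \<in> borel_measurable borel \<Longrightarrow> L (\<lambda>x. c * f x) = c * L f"
    and SUP: "\<And>F. (\<And>n. F n \<in> borel_measurable borel) \<Longrightarrow> incseq F \<Longrightarrow>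
      L (\<lambda>x. SUP n. F n x) = (SUP n. L (F n))"
    and f: "f \<in> borel_measurable borel"
  shows "L f = (\<integral>\<^sup>+x. f x \<partial>M)"
  using f
proof (induction rule: borel_measurable_induct)
  case (cong f g)
  then have "f = g" by auto
  with cong show ?case by simp
next
  case (set A)
  then show ?case using M by (simp add: ind)
next
  case (mult u c)
  then have "u \<in> borel_measurable M" using M measurable_cong_sets by blast
  with mult show ?case by (simp add: cmult nn_integral_cmult)
next
  case (add u v)
  then have "u \<in> borel_measurable M" "v \<in> borel_measurable M" using M measurable_cong_sets by blast+
  with add show ?case by (simp add: assms(3) nn_integral_add)
next
  case (seq U)
  then have "U n \<in> borel_measurable M" for n using M measurable_cong_sets by blast
  with seq show ?case by (simp add: SUP image_comp nn_integral_monotone_convergence_SUP SUP_apply)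
qed

lemma csum_commute:
  fixes L :: "(real \<Rightarrow> ennreal) \<Rightarrow> ennreal" and F :: "'a::countable \<Rightarrow> real \<Rightarrow> ennreal"
  assumes L: "\<And>F. (\<And>n. F n \<in> borel_measurable borel) \<Longrightarrow> L (\<lambda>x. \<Sum>n. F n x) = (\<Sum>n. L (F n))"
    and zero: "L (\<lambda>_. 0) = 0" and F: "\<And>j. F j \<in> borel_measurable borel"
  shows "L (\<lambda>x. csum (\<lambda>j. F j x)) = csum (\<lambda>j. L (F j))"
proof -
  define F' where "F' n = (if n \<in> range (to_nat :: 'a \<Rightarrow> nat) then F (from_nat n) else (\<lambda>_. 0))" for n
  have "(\<lambda>x. csum (\<lambda>j. F j x)) = (\<lambda>x. \<Sum>n. F' n x)"
    by (auto simp: csum_eq_suminf F'_def fun_eq_iff intro!: suminf_cong)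
  moreover have "csum (\<lambda>j. L (F j)) = (\<Sum>n. L (F' n))"
    by (auto simp: csum_eq_suminf F'_def zero intro!: suminf_cong)
  moreover have "F' n \<in> borel_measurable borel" for n by (auto simp: F'_def F)
  ultimately show ?thesis by (simp add: L)
qed

lemma measurable_csum [measurable]:
  fixes F :: "'a::countable \<Rightarrow> 'b \<Rightarrow> ennreal"
  assumes [measurable]: "\<And>j. F j \<in> borel_measurable N"
  shows "(\<lambda>x. csum (\<lambda>j. F j x)) \<in> borel_measurable N"
  unfolding csum_eq_suminf by measurable

lemma nn_integral_csum:
  fixes F :: "'a::countable \<Rightarrow> real \<Rightarrow> ennreal"
  assumes "\<And>j. F j \<in> borel_measurable borel"
  shows "(\<integral>\<^sup>+x. csum (\<lambda>j. F j x) \<partial>lborel) = csum (\<lambda>j. \<integral>\<^sup>+x. F j x \<partial>lborel)"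
  by (rule csum_commute[where L = "\<lambda>f. \<integral>\<^sup>+x. f x \<partial>lborel"]) (auto intro: nn_integral_suminf assms)

context finite_borel_measure begin

lemma mpow_zero: "mpow M n (\<lambda>_. 0) = (\<lambda>_. 0)"
  by (induction n) (auto simp: mpow_Suc mconv_def)

lemma rpot_zero: "rpot M (\<lambda>_. 0) t = 0"
  by (simp add: rpot_def mpow_zero)

lemma rpot_csum:
  fixes F :: "'a::countable \<Rightarrow> real \<Rightarrow> ennreal"
  assumes "\<And>j. F j \<in> borel_measurable borel"
  shows "rpot M (\<lambda>x. csum (\<lambda>j. F j x)) t = csum (\<lambda>j. rpot M (F j) t)"
  by (rule csum_commute[where L = "\<lambda>f. rpot M f t"]) (auto intro: rpot_suminf assms simp: rpot_zero)

lemma psum_suminf: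
  assumes [measurable]: "\<And>n. f n \<in> borel_measurable borel"
  shows "psum M N (\<lambda>x. \<Sum>n. f n x) t = (\<Sum>n. psum M N (f n) t)"
  unfolding psum_def mpow_suminf[OF assms] by (rule suminf_sum[symmetric]) simp

lemma rpot_unfold_psum:
  assumes [measurable]: "f \<in> borel_measurable borel"
  shows "rpot M f t = psum M m f t + mpow M m (rpot M f) t"
proof -
  have "rpot M f t = (\<Sum>n. mpow M (n + m) f t) + psum M m f t"
    unfolding rpot_def psum_def by (rule suminf_offset) simp
  also have "(\<Sum>n. mpow M (n + m) f t) = mpow M m (rpot M f) t"
    unfolding rpot_def[abs_def] by (subst mpow_suminf) (auto simp: mpow_add[symmetric] add.commute)
  finally show ?thesis by (simp add: add.commute)
qed

end

section \<open>Grid cells and direct Riemann integrability\<close>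

definition cell_sup :: "real \<Rightarrow> (real \<Rightarrow> ennreal) \<Rightarrow> int \<Rightarrow> ennreal" where
  "cell_sup e g n = (SUP x\<in>{of_int n * e<..(of_int n + 1) * e}. g x)"

lemma ceiling_cell:
  assumes "e > 0"
  shows "x \<in> {of_int n * e<..(of_int n + 1) * e} \<longleftrightarrow> n = \<lceil>x / e\<rceil> - 1"
proof -
  have "x \<in> {of_int n * e<..(of_int n + 1) * e} \<longleftrightarrow> of_int n < x / e \<and> x / e \<le> of_int n + 1"
    using assms by (auto simp: field_simps)
  also have "\<dots> \<longleftrightarrow> \<lceil>x / e\<rceil> = n + 1" by (simp add: ceiling_eq_iff)
  also have "\<dots> \<longleftrightarrow> n = \<lceil>x / e\<rceil> - 1" by linarith
  finally show ?thesis .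
qed

text \<open>The least majorant of \<open>g\<close> that is constant on the cells. These are open on
  the left, so that the ceiling gives the index.\<close>

definition cell_step :: "real \<Rightarrow> (real \<Rightarrow> ennreal) \<Rightarrow> real \<Rightarrow> ennreal" where
  "cell_step e g x = cell_sup e g (\<lceil>x / e\<rceil> - 1)"

lemma cell_step_eq_csum:
  assumes "e > 0"
  shows "cell_step e g x = csum (\<lambda>n. cell_sup e g n * indicator {of_int n * e<..(of_int n + 1) * e} x)"
proof -
  have "csum (\<lambda>n. cell_sup e g n * indicator {of_int n * e<..(of_int n + 1) * e} x) =
     (\<Sum>n\<in>{\<lceil>x / e\<rceil> - 1}. cell_sup e g n * indicator {of_int n * e<..(of_int n + 1) * e} x)"
    by (rule nn_integral_count_space') (use ceiling_cell[OF assms, of x] in \<open>auto simp: indicator_def\<close>)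
  also have "\<dots> = cell_step e g x"
    using ceiling_cell[OF assms, of x "\<lceil>x / e\<rceil> - 1"] by (simp add: cell_step_def)
  finally show ?thesis by simp
qed

lemma cell_step_measurable:
  assumes "e > 0"
  shows "cell_step e g \<in> borel_measurable borel"
proof -
  have "cell_step e g = (\<lambda>x. csum (\<lambda>n. cell_sup e g n * indicator {of_int n * e<..(of_int n + 1) * e} x))"
    by (rule ext) (rule cell_step_eq_csum[OF assms])
  then show ?thesis by simp
qed

lemma cell_step_ge: "e > 0 \<Longrightarrow> g x \<le> cell_step e g x"
  unfolding cell_step_def cell_sup_def
  by (rule SUP_upper) (subst ceiling_cell; simp)

lemma cell_step_integral:
  assumes e: "e > 0"
  shows "(\<integral>\<^sup>+x. cell_step e g x \<partial>lborel) = ennreal e * csum (cell_sup e g)"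
proof -
  have "(\<integral>\<^sup>+x. cell_step e g x \<partial>lborel) =
      csum (\<lambda>n. \<integral>\<^sup>+x. cell_sup e g n * indicator {of_int n * e<..(of_int n + 1) * e} x \<partial>lborel)"
    unfolding cell_step_eq_csum[OF e] by (rule nn_integral_csum) measurable
  also have "\<dots> = csum (\<lambda>n. ennreal e * cell_sup e g n)"
  proof (rule nn_integral_cong)
    fix n :: int
    have "(\<integral>\<^sup>+x. cell_sup e g n * indicator {of_int n * e<..(of_int n + 1) * e} x \<partial>lborel) =
        cell_sup e g n * emeasure lborel {of_int n * e<..(of_int n + 1) * e}"
      by (rule nn_integral_cmult_indicator) simp
    also have "emeasure lborel {of_int n * e<..(of_int n + 1) * e} = ennreal e"
      using e by (subst emeasure_lborel_Ioc) (auto simp: algebra_simps)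
    finally show "(\<integral>\<^sup>+x. cell_sup e g n * indicator {of_int n * e<..(of_int n + 1) * e} x \<partial>lborel) =
        ennreal e * cell_sup e g n" by (simp add: mult.commute)
  qed
  also have "\<dots> = ennreal e * csum (cell_sup e g)" by (rule nn_integral_cmult) simp
  finally show ?thesis .
qed

text \<open>Points at distance less than \<open>e\<close> lie in the same cell or in neighbouring
  ones, which are reached by shifting the argument by \<open>e\<close>.\<close>

lemma sup_ball_le_cell_step:
  assumes e: "e > 0"
  shows "sup_ball e g x \<le> cell_step e g (x - e) + cell_step e g x + cell_step e g (x + e)"
  unfolding sup_ball_def
proof (rule SUP_least)
  fix y assume "y \<in> ball x e"
  then have "\<bar>y / e - x / e\<bar> < 1" using e by (simp add: dist_real_def field_simps abs_if split: if_splits)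
  then consider "\<lceil>y / e\<rceil> = \<lceil>x / e\<rceil> - 1" | "\<lceil>y / e\<rceil> = \<lceil>x / e\<rceil>" | "\<lceil>y / e\<rceil> = \<lceil>x / e\<rceil> + 1" by linarith
  moreover have "\<lceil>(x - e) / e\<rceil> = \<lceil>x / e\<rceil> - 1" "\<lceil>(x + e) / e\<rceil> = \<lceil>x / e\<rceil> + 1"
    using e by (simp_all add: diff_divide_distrib add_divide_distrib)
  ultimately have "cell_step e g y \<le> cell_step e g (x - e) + cell_step e g x + cell_step e g (x + e)"
    by cases (auto simp: cell_step_def add_increasing add_increasing2)
  then show "g y \<le> cell_step e g (x - e) + cell_step e g x + cell_step e g (x + e)"
    using cell_step_ge[OF e, of g y] by simp
qed

context drift_walk begin

text \<open>The potential of one cell is at most \<open>of_nat m * B\<close>, wherever the walk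
  starts.\<close>

lemma rpot_cell_bound:
  assumes e: "e > 0" "e < real m"
  shows "rpot M g t \<le> of_nat m * B * csum (cell_sup e g)"
proof -
  have "rpot M g t \<le> rpot M (cell_step e g) t" by (rule rpot_mono) (rule cell_step_ge[OF e(1)])
  also have "\<dots> = csum (\<lambda>n. rpot M (\<lambda>x. cell_sup e g n * indicator {of_int n * e<..(of_int n + 1) * e} x) t)"
    unfolding cell_step_eq_csum[OF e(1), abs_def] by (rule rpot_csum) measurable
  also have "\<dots> \<le> csum (\<lambda>n. of_nat m * B * cell_sup e g n)"
  proof (rule nn_integral_mono)
    fix n :: int
    have "rpot M (\<lambda>x. cell_sup e g n * indicator {of_int n * e<..(of_int n + 1) * e} x) t
        = cell_sup e g n * rpot M (indicator {of_int n * e<..(of_int n + 1) * e}) t"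
      by (rule rpot_cmult) measurable
    also have "\<dots> \<le> cell_sup e g n * rpot M (indicator {of_int n * e..(of_int n + 1) * e}) t"
      by (intro mult_left_mono rpot_mono) (auto simp: indicator_def)
    also have "\<dots> \<le> cell_sup e g n * (of_nat m * B)"
      by (intro mult_left_mono rpot_Icc_le_B) (use e in \<open>auto simp: algebra_simps\<close>)
    finally show "rpot M (\<lambda>x. cell_sup e g n * indicator {of_int n * e<..(of_int n + 1) * e} x) t
        \<le> of_nat m * B * cell_sup e g n" by (simp add: mult.commute)
  qed
  also have "\<dots> = of_nat m * B * csum (cell_sup e g)" by (rule nn_integral_cmult) simp
  finally show ?thesis .
qed

lemma key_renewal_limit:
  assumes E: "direction E c" and t: "filterlim t E sequentially"
    and [measurable]: "g \<in> borel_measurable borel"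
    and e: "e > 0" and fin: "csum (cell_sup e g) < \<infinity>" and cont: "AE x in lborel. isCont g x"
  shows "(\<lambda>k. rpot M g (t k)) \<longlonglongrightarrow> c * (\<integral>\<^sup>+x. g x \<partial>lborel)"
proof (rule dominated_limit[OF E t _ _ e sup_ball_le_cell_step[OF e] _ cont])
  have [measurable]: "cell_step e g \<in> borel_measurable borel" using e by (rule cell_step_measurable)
  show "(\<lambda>x. cell_step e g (x - e) + cell_step e g x + cell_step e g (x + e)) \<in> borel_measurable borel"
    by measurable
  have "(\<integral>\<^sup>+x. cell_step e g (x - e) + cell_step e g x + cell_step e g (x + e) \<partial>lborel) =
     (\<integral>\<^sup>+x. cell_step e g (x - e) \<partial>lborel) + (\<integral>\<^sup>+x. cell_step e g x \<partial>lborel) +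
     (\<integral>\<^sup>+x. cell_step e g (x + e) \<partial>lborel)"
    by (simp add: nn_integral_add)
  also have "(\<integral>\<^sup>+x. cell_step e g (x - e) \<partial>lborel) = (\<integral>\<^sup>+x. cell_step e g x \<partial>lborel)"
    using nn_integral_real_affine[of "cell_step e g" 1 "-e"] by simp
  also have "(\<integral>\<^sup>+x. cell_step e g (x + e) \<partial>lborel) = (\<integral>\<^sup>+x. cell_step e g x \<partial>lborel)"
    using nn_integral_real_affine[of "cell_step e g" 1 e] by (simp add: add.commute)
  finally show "(\<integral>\<^sup>+x. cell_step e g (x - e) + cell_step e g x + cell_step e g (x + e) \<partial>lborel) < \<infinity>"
    using fin by (simp add: cell_step_integral[OF e] ennreal_mult_less_top)
qed measurable

end

section \<open>Spread-out walks\<close>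

text \<open>A weak form of Lebesgue's density theorem. If no interval were filled to 7/8, exhausting
  an open superset of at most 9/8 of the measure by grid cells would bound the measure of
  \<open>Y\<close> by 63/64 of itself.\<close>

lemma dense_interval:
  assumes Y [measurable]: "Y \<in> sets borel" and pos: "0 < emeasure lborel Y" and fin: "emeasure lborel Y < \<infinity>"
  obtains a b :: real where "a < b" "ennreal (7/8 * (b - a)) < emeasure lborel ({a<..b} \<inter> Y)"
proof (rule ccontr)
  assume no: "\<not> thesis"
  note outer = that
  have small: "emeasure lborel ({a<..b} \<inter> Y) \<le> ennreal (7/8) * emeasure lborel {a<..b}" if "a < b" for a b :: real
  proof -
    have "emeasure lborel ({a<..b} \<inter> Y) \<le> ennreal (7/8 * (b - a))"
      using no outer[OF that] by (auto simp: not_le[symmetric])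
    also have "\<dots> = ennreal (7/8) * ennreal (b - a)"
      by (rule ennreal_mult) (use \<open>a < b\<close> in auto)
    finally show ?thesis using \<open>a < b\<close> by simp
  qed
  define y where "y = enn2real (emeasure lborel Y)"
  have y: "ennreal y = emeasure lborel Y" "y > 0"
    using pos fin by (auto simp: y_def enn2real_positive_iff)
  obtain U where U: "open U" "Y \<subseteq> U" "emeasure lborel (U - Y) \<le> ennreal (y / 8)"
    using outer_regular_lborel_le[OF Y, of "y / 8"] y(2) by auto
  note [measurable] = borel_open[OF U(1)]
  \<comment> \<open>The mesh tends to 0, so each point of \<open>U\<close> lies in a cell inside
    \<open>U\<close> for all large n.\<close>
  define w where "w n = 1 / real (Suc n)" for n
  have w: "w n > 0" for n by (simp add: w_def)
  define C where "C n k = {of_int k * w n<..(of_int k + 1) * w n}" for n and k :: int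
  define P where "P n = {k. C n k \<subseteq> U}" for n
  define V where "V n = (\<Union>k\<in>P n. C n k)" for n
  have [measurable]: "C n k \<in> sets borel" for n k by (simp add: C_def)
  have [measurable]: "V n \<in> sets borel" for n unfolding V_def by (intro sets.countable_UN') auto
  have disj: "disjoint_family_on (C n) (P n)" for n
  proof -
    have "x \<in> C n k \<longleftrightarrow> k = \<lceil>x / w n\<rceil> - 1" for x k unfolding C_def by (rule ceiling_cell[OF w])
    then show ?thesis by (auto simp: disjoint_family_on_def)
  qed
  have Vle: "emeasure lborel (V n \<inter> Y) \<le> ennreal (7/8) * emeasure lborel U" for n
  proof -
    have "emeasure lborel (V n \<inter> Y) = emeasure lborel (\<Union>k\<in>P n. C n k \<inter> Y)" by (simp add: V_def)
    also have "\<dots> = (\<integral>\<^sup>+k. emeasure lborel (C n k \<inter> Y) \<partial>count_space (P n))"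
      by (rule emeasure_UN_countable) (use disj[of n] in \<open>auto simp: disjoint_family_on_def\<close>)
    also have "\<dots> \<le> (\<integral>\<^sup>+k. ennreal (7/8) * emeasure lborel (C n k) \<partial>count_space (P n))"
      using w[of n] unfolding C_def by (intro nn_integral_mono small) (simp add: algebra_simps)
    also have "\<dots> = ennreal (7/8) * (\<integral>\<^sup>+k. emeasure lborel (C n k) \<partial>count_space (P n))"
      by (rule nn_integral_cmult) simp
    also have "(\<integral>\<^sup>+k. emeasure lborel (C n k) \<partial>count_space (P n)) = emeasure lborel (V n)"
      unfolding V_def by (rule emeasure_UN_countable[symmetric]) (use disj[of n] in auto)
    also have "emeasure lborel (V n) \<le> emeasure lborel U"
      by (rule emeasure_mono) (auto simp: V_def P_def)
    finally show ?thesis by (simp add: mult_left_mono)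
  qed
  have "\<exists>n. \<forall>k\<ge>n. x \<in> V k" if xU: "x \<in> U" for x
  proof -
    obtain r where r: "r > 0" "ball x r \<subseteq> U" by (rule openE[OF U(1) xU])
    obtain n where n: "1 / real (Suc n) < r" by (rule nat_approx_posE[OF r(1)])
    have "x \<in> V k" if "k \<ge> n" for k
    proof -
      define j where "j = \<lceil>x / w k\<rceil> - 1"
      have xj: "x \<in> C k j" unfolding C_def using ceiling_cell[OF w] by (simp only: j_def)
      have "w k \<le> 1 / real (Suc n)" unfolding w_def using that by (intro divide_left_mono) auto
      then have "w k < r" using n by simp
      then have "C k j \<subseteq> ball x r" using xj by (auto simp: C_def dist_real_def algebra_simps)
      then show ?thesis using xj r(2) by (auto simp: V_def P_def)
    qed
    then show ?thesis by blast
  qed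
  \<comment> \<open>The sets \<open>V n\<close> need not increase, hence the intersections over all
    later indices.\<close>
  then have Yeq: "Y = (\<Union>n. \<Inter>k\<in>{n..}. V k \<inter> Y)" using U(2) by fastforce
  have "emeasure lborel Y = (SUP n. emeasure lborel (\<Inter>k\<in>{n..}. V k \<inter> Y))"
  proof (subst Yeq, rule SUP_emeasure_incseq[symmetric])
    show "range (\<lambda>n. \<Inter>k\<in>{n..}. V k \<inter> Y) \<subseteq> sets lborel" by (auto intro!: sets.countable_INT')
    show "incseq (\<lambda>n. \<Inter>k\<in>{n..}. V k \<inter> Y)" by (auto simp: incseq_def)
  qed
  also have "\<dots> \<le> ennreal (7/8) * emeasure lborel U"
  proof (rule SUP_least)
    fix n
    have "emeasure lborel (\<Inter>k\<in>{n..}. V k \<inter> Y) \<le> emeasure lborel (V n \<inter> Y)"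
      by (rule emeasure_mono) auto
    then show "emeasure lborel (\<Inter>k\<in>{n..}. V k \<inter> Y) \<le> ennreal (7/8) * emeasure lborel U"
      using Vle[of n] by (rule order_trans)
  qed
  also have "emeasure lborel U \<le> emeasure lborel Y + emeasure lborel (U - Y)"
    using emeasure_subadditive[of Y lborel "U - Y"] U(2) by (simp add: Un_absorb1)
  also have "\<dots> \<le> ennreal y + ennreal (y / 8)" using U(3) by (simp add: y add_left_mono)
  also have "\<dots> = ennreal (9/8 * y)" using y(2) by (simp add: ennreal_plus[symmetric] del: ennreal_plus)
  finally have "ennreal y \<le> ennreal (7/8) * ennreal (9/8 * y)" by (simp add: y mult_left_mono)
  also have "\<dots> = ennreal (63/64 * y)" using y(2) by (simp add: ennreal_mult[symmetric])
  finally show False using y(2) by (simp add: ennreal_le_iff)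
qed

text \<open>A Steinhaus argument: for \<open>z\<close> near \<open>p + q\<close> both
  \<open>Y\<close> and its reflection \<open>z - Y\<close> fill most of a common interval, so they
  overlap by an amount bounded below uniformly in \<open>z\<close>.\<close>

lemma self_convolution_minorant:
  assumes Y [measurable]: "Y \<in> sets borel" and pos: "0 < emeasure lborel Y" and fin: "emeasure lborel Y < \<infinity>"
  obtains a b e :: real where "a < b" "e > 0"
    "\<And>z. z \<in> {a..b} \<Longrightarrow> ennreal e \<le> emeasure lborel {x. x \<in> Y \<and> z - x \<in> Y}"
proof -
  obtain p q where pq: "p < q" "ennreal (7/8 * (q - p)) < emeasure lborel ({p<..q} \<inter> Y)"
    by (rule dense_interval[OF assms])
  define L where "L = q - p"
  have L: "L > 0" using pq by (simp add: L_def)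
  have bad: "emeasure lborel ({p<..q} - Y) \<le> ennreal (L / 8)"
  proof -
    have "emeasure lborel ({p<..q} \<inter> Y) + emeasure lborel ({p<..q} - Y) = emeasure lborel {p<..q}"
      by (subst plus_emeasure) (auto intro!: arg_cong[where f = "emeasure lborel"])
    also have "emeasure lborel {p<..q} = ennreal (7/8 * L + L / 8)"
      using pq by (subst emeasure_lborel_Ioc) (auto simp: L_def field_simps)
    also have "\<dots> = ennreal (7/8 * L) + ennreal (L / 8)" by (rule ennreal_plus) (use L in auto)
    finally have "ennreal (7/8 * L) + emeasure lborel ({p<..q} - Y) \<le> ennreal (7/8 * L) + ennreal (L / 8)"
      using pq(2) by (metis L_def add_right_mono less_imp_le)
    then show ?thesis by (subst (asm) ennreal_add_left_cancel_le) auto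
  qed
  show thesis
  \<comment> \<open>Moving \<open>z\<close> by at most \<open>L / 4\<close> leaves a common interval
    of length at least \<open>3 / 4 * L\<close>; the gaps of \<open>Y\<close> and of its reflection
    remove at most \<open>L / 8\<close> each.\<close>
  proof (rule that[of "p + q - L / 4" "p + q + L / 4" "L / 2"])
    fix z assume z: "z \<in> {p + q - L / 4..p + q + L / 4}"
    let ?S = "{x. x \<in> Y \<and> z - x \<in> Y}" and ?B = "{p<..q} - Y"
    let ?R = "{x. z - x \<in> ?B}"
    have [measurable]: "?S \<in> sets borel" "?R \<in> sets borel" by measurable
    define lo where "lo = max p (z - q)"
    define hi where "hi = min q (z - p)"
    have lohi: "hi - lo \<ge> 3 / 4 * L" using z by (auto simp: lo_def hi_def L_def max_def min_def field_simps)
    have sub: "{lo<..<hi} \<subseteq> ?S \<union> (?B \<union> ?R)" by (auto simp: lo_def hi_def)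
    have refl: "emeasure lborel ?R = emeasure lborel ?B"
    proof -
      have "emeasure lborel ?R = (\<integral>\<^sup>+x. indicator ?B (z - x) \<partial>lborel)"
      proof -
        have "(\<lambda>x. indicator ?B (z - x) :: ennreal) = indicator ?R"
          by (auto simp: indicator_def fun_eq_iff)
        then show ?thesis by (simp add: nn_integral_indicator)
      qed
      also have "\<dots> = (\<integral>\<^sup>+x. indicator ?B x \<partial>lborel)" by (rule nn_integral_lborel_reflect) measurable
      finally show ?thesis by simp
    qed
    have "ennreal (3/4 * L) \<le> emeasure lborel {lo<..<hi}"
      using lohi L by (subst emeasure_lborel_Ioo) (auto intro: ennreal_leI)
    also have "\<dots> \<le> emeasure lborel (?S \<union> (?B \<union> ?R))" by (rule emeasure_mono[OF sub]) measurable
    also have "\<dots> \<le> emeasure lborel ?S + emeasure lborel (?B \<union> ?R)"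
      by (rule emeasure_subadditive) measurable
    also have "\<dots> \<le> emeasure lborel ?S + (emeasure lborel ?B + emeasure lborel ?R)"
      by (intro add_left_mono emeasure_subadditive) measurable
    also have "\<dots> \<le> emeasure lborel ?S + (ennreal (L / 8) + ennreal (L / 8))"
      unfolding refl by (intro add_left_mono add_mono bad)
    also have "\<dots> = ennreal (L / 4) + emeasure lborel ?S"
      using L by (simp add: ennreal_plus[symmetric] add.commute del: ennreal_plus)
    finally have "ennreal (L / 4) + ennreal (L / 2) \<le> ennreal (L / 4) + emeasure lborel ?S"
      using L by (simp add: ennreal_plus[symmetric] del: ennreal_plus)
    then show "ennreal (L / 2) \<le> emeasure lborel ?S"
      by (subst (asm) ennreal_add_left_cancel_le) auto
  qed (use L in auto)
qed

text \<open>Compare \<open>M\<close> with small multiples of Lebesgue measure on growing intervals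
  by Hahn decomposition. If all the parts \<open>Y n\<close> where \<open>M\<close> dominates were
  Lebesgue null, then off their union \<open>M\<close> would lie below every late \<open>N n\<close>
  on bounded sets and hence vanish, so \<open>M\<close> would be singular.\<close>

lemma nonsingular_minorant:
  assumes M: "finite_borel_measure M" and ns: "\<not> lebesgue_singular M"
  obtains Y e where "Y \<in> sets borel" "e > 0" "0 < emeasure lborel Y" "emeasure lborel Y < \<infinity>"
    "\<And>X. X \<in> sets borel \<Longrightarrow> X \<subseteq> Y \<Longrightarrow> ennreal e * emeasure lborel X \<le> emeasure M X"
proof (rule ccontr)
  assume no: "\<not> thesis"
  interpret finite_borel_measure M by fact
  note [measurable_cong] = M_is_borel
  \<comment> \<open>The square makes \<open>e n\<close> times the length
    \<open>2 * real (Suc n)\<close> of the n-th interval tend to 0.\<close>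
  define e where "e n = 1 / (real (Suc n))\<^sup>2" for n
  have e: "e n > 0" for n by (simp add: e_def)
  define N :: "nat \<Rightarrow> real measure" where "N n = scale_measure (ennreal (e n)) lborel" for n
  have N: "emeasure (N n) X = ennreal (e n) * emeasure lborel X" for n X by (simp add: N_def)
  let ?A = "\<lambda>n. {- real (Suc n)..real (Suc n)}"
  have "\<exists>Y\<in>sets M. Y \<subseteq> ?A n \<and> (\<forall>X\<in>sets M. X \<subseteq> Y \<longrightarrow> N n X \<le> M X) \<and>
      (\<forall>X\<in>sets M. X \<subseteq> ?A n \<longrightarrow> X \<inter> Y = {} \<longrightarrow> M X \<le> N n X)" for n
    by (rule unsigned_Hahn_decomposition)
       (auto simp: N_def M_is_borel ennreal_mult_eq_top_iff)
  then obtain Y where Y: "\<And>n. Y n \<in> sets M" "\<And>n. Y n \<subseteq> ?A n"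
    "\<And>n X. X \<in> sets M \<Longrightarrow> X \<subseteq> Y n \<Longrightarrow> N n X \<le> M X"
    "\<And>n X. X \<in> sets M \<Longrightarrow> X \<subseteq> ?A n \<Longrightarrow> X \<inter> Y n = {} \<Longrightarrow> M X \<le> N n X" by metis
  have Yb [measurable]: "Y n \<in> sets borel" for n using Y(1)[of n] by (simp add: M_is_borel)
  have null: "emeasure lborel (Y n) = 0" for n
  proof (rule ccontr)
    assume "emeasure lborel (Y n) \<noteq> 0"
    then have "0 < emeasure lborel (Y n)" by (simp add: zero_less_iff_neq_zero)
    moreover have "emeasure lborel (Y n) < \<infinity>"
      using emeasure_mono[OF Y(2)[of n], of lborel] by (auto intro: le_less_trans)
    ultimately show False
      using no that[OF Yb[of n] e[of n]] Y(3)[of _ n] M_is_borel by (simp add: N)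
  qed
  define Z where "Z = (\<Union>n. Y n)"
  have [measurable]: "Z \<in> sets borel" unfolding Z_def by measurable
  have "emeasure lborel Z = 0"
    unfolding Z_def by (rule emeasure_UN_eq_0) (use null in auto)
  have box: "emeasure M (- Z \<inter> ?A k) = 0" for k
  proof -
    have le: "emeasure M (- Z \<inter> ?A k) \<le> ennreal (2 / real (Suc n))" if "n \<ge> k" for n
    proof -
      have "emeasure M (- Z \<inter> ?A k) \<le> N n (- Z \<inter> ?A k)"
        by (rule Y(4)) (use that in \<open>auto simp: Z_def M_is_borel intro!: sets.Int borel_comp sets.countable_UN'\<close>)
      also have "\<dots> \<le> ennreal (e n) * emeasure lborel (?A n)"
        unfolding N using that by (intro mult_left_mono emeasure_mono) auto
      also have "emeasure lborel (?A n) = ennreal (2 * real (Suc n))"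
        by (subst emeasure_lborel_Icc) (simp_all del: of_nat_Suc)
      also have "ennreal (e n) * ennreal (2 * real (Suc n)) = ennreal (e n * (2 * real (Suc n)))"
        by (rule ennreal_mult[symmetric]) (use e[of n] in auto)
      also have "e n * (2 * real (Suc n)) = 2 / real (Suc n)"
        by (simp add: e_def power2_eq_square del: of_nat_Suc)
      finally show ?thesis .
    qed
    have "(\<lambda>n. ennreal (2 / real (Suc n))) \<longlonglongrightarrow> ennreal 0"
      by (intro tendsto_ennrealI lim_const_over_n[THEN LIMSEQ_Suc])
    then have "emeasure M (- Z \<inter> ?A k) \<le> ennreal 0"
      by (rule LIMSEQ_le_const) (use le in auto)
    then show ?thesis by simp
  qed
  have "emeasure M (\<Union>k. - Z \<inter> ?A k) = 0"
    by (rule emeasure_UN_eq_0) (use box in \<open>auto simp: M_is_borel\<close>)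
  moreover have "(\<Union>k. - Z \<inter> ?A k) = - Z"
  proof -
    have "\<exists>k. x \<in> ?A k" for x :: real
    proof -
      obtain k :: nat where "\<bar>x\<bar> \<le> real k" using real_arch_simple by blast
      then show ?thesis by (intro exI[of _ k]) auto
    qed
    then show ?thesis by blast
  qed
  ultimately have "emeasure M (- Z) = 0" by simp
  with \<open>emeasure lborel Z = 0\<close> have "lebesgue_singular M" unfolding lebesgue_singular_def
    by (intro bexI[of _ Z]) auto
  with ns show False by simp
qed

text \<open>\<open>M\<close> dominates a multiple of Lebesgue measure on a set \<open>Y\<close>, and
  the self-convolution of that part has a density bounded below on an interval.\<close>

lemma nonsingular_convolution_minorant:
  assumes M: "finite_borel_measure M" and ns: "\<not> lebesgue_singular M"
  obtains a b e :: real where "a < b" "e > 0"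
    "\<And>f t. f \<in> borel_measurable borel \<Longrightarrow>
       ennreal e * mconv (density lborel (indicator {a..b})) f t \<le> mconv M (mconv M f) t"
proof -
  interpret finite_borel_measure M by fact
  note [measurable_cong] = M_is_borel
  obtain Y e where Y: "Y \<in> sets borel" "e > 0" "0 < emeasure lborel Y" "emeasure lborel Y < \<infinity>"
    "\<And>X. X \<in> sets borel \<Longrightarrow> X \<subseteq> Y \<Longrightarrow> ennreal e * emeasure lborel X \<le> emeasure M X"
    using nonsingular_minorant[OF assms] by blast
  note [measurable] = Y(1)
  obtain a b r where ab: "a < b" "r > 0"
    "\<And>z. z \<in> {a..b} \<Longrightarrow> ennreal r \<le> emeasure lborel {x. x \<in> Y \<and> z - x \<in> Y}"
    using self_convolution_minorant[OF Y(1,3,4)] by blast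
  define D where "D = density lborel (\<lambda>x. ennreal e * indicator Y x)"
  have sD: "sets D = sets M" by (simp add: D_def M_is_borel)
  have "D \<le> M"
    unfolding le_measure[OF sD]
  proof
    fix A assume "A \<in> sets D"
    then have A [measurable]: "A \<in> sets borel" by (simp add: D_def)
    have "emeasure D A = (\<integral>\<^sup>+x. ennreal e * indicator (Y \<inter> A) x \<partial>lborel)"
      unfolding D_def by (subst emeasure_density) (auto intro!: nn_integral_cong simp: indicator_def)
    also have "\<dots> = ennreal e * emeasure lborel (Y \<inter> A)" by (rule nn_integral_cmult_indicator) simp
    also have "\<dots> \<le> emeasure M (Y \<inter> A)" by (rule Y(5)) auto
    also have "\<dots> \<le> emeasure M A" by (rule emeasure_mono) (auto simp: M_is_borel)
    finally show "emeasure D A \<le> emeasure M A" .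
  qed
  then have DM: "mconv D f t \<le> mconv M f t" for f t
    unfolding mconv_def using nn_integral_mono_measure[OF sD] by blast
  show thesis
  \<comment> \<open>One factor \<open>e\<close> for each copy of the density on \<open>Y\<close>,
    and \<open>r\<close> for the overlap of \<open>Y\<close> with its reflections.\<close>
  proof (rule that[of a b "e * e * r"])
    fix f :: "real \<Rightarrow> ennreal" and t assume [measurable]: "f \<in> borel_measurable borel"
    have D: "mconv D g s = (\<integral>\<^sup>+x. ennreal e * (indicator Y x * g (s - x)) \<partial>lborel)"
      if [measurable]: "g \<in> borel_measurable borel" for g s
      unfolding D_def by (subst mconv_density) (auto simp: mult.assoc)
    have "ennreal (e * e * r) * mconv (density lborel (indicator {a..b})) f t =
        ennreal (e * e) * (\<integral>\<^sup>+z. ennreal r * (indicator {a..b} z * f (t - z)) \<partial>lborel)"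
      using Y(2) ab(2) by (subst mconv_density) (auto simp: nn_integral_cmult ennreal_mult mult.assoc)
    also have "\<dots> \<le> ennreal (e * e) * (\<integral>\<^sup>+z. (\<integral>\<^sup>+x. indicator Y x * indicator Y (z - x) \<partial>lborel) * f (t - z) \<partial>lborel)"
    proof (intro mult_left_mono nn_integral_mono)
      fix z
      have "(\<integral>\<^sup>+x. indicator Y x * indicator Y (z - x) \<partial>lborel) = emeasure lborel {x. x \<in> Y \<and> z - x \<in> Y}"
      proof -
        have "(\<lambda>x. indicator Y x * indicator Y (z - x) :: ennreal) = indicator {x. x \<in> Y \<and> z - x \<in> Y}"
          by (auto simp: indicator_def fun_eq_iff)
        moreover have "{x. x \<in> Y \<and> z - x \<in> Y} \<in> sets borel" by measurable
        ultimately show ?thesis by (simp add: nn_integral_indicator)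
      qed
      then show "ennreal r * (indicator {a..b} z * f (t - z)) \<le>
          (\<integral>\<^sup>+x. indicator Y x * indicator Y (z - x) \<partial>lborel) * f (t - z)"
        using ab(3)[of z] by (cases "z \<in> {a..b}") (auto intro: mult_right_mono)
    qed simp
    also have "\<dots> = ennreal (e * e) * (\<integral>\<^sup>+z. \<integral>\<^sup>+x. indicator Y x * (indicator Y (z - x) * f (t - z)) \<partial>lborel \<partial>lborel)"
      by (simp add: nn_integral_multc[symmetric] mult.assoc)
    also have "(\<integral>\<^sup>+z. \<integral>\<^sup>+x. indicator Y x * (indicator Y (z - x) * f (t - z)) \<partial>lborel \<partial>lborel) =
       (\<integral>\<^sup>+x. \<integral>\<^sup>+z. indicator Y x * (indicator Y (z - x) * f (t - z)) \<partial>lborel \<partial>lborel)"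
      by (rule lborel_pair.Fubini') measurable
    also have "\<dots> = (\<integral>\<^sup>+x. indicator Y x * (\<integral>\<^sup>+z. indicator Y z * f (t - x - z) \<partial>lborel) \<partial>lborel)"
    proof (rule nn_integral_cong)
      fix x
      have "(\<integral>\<^sup>+z. indicator Y (z - x) * f (t - z) \<partial>lborel) = (\<integral>\<^sup>+z. indicator Y z * f (t - x - z) \<partial>lborel)"
        using nn_integral_real_affine[of "\<lambda>z. indicator Y (z - x) * f (t - z)" 1 x]
        by (simp add: algebra_simps)
      then show "(\<integral>\<^sup>+z. indicator Y x * (indicator Y (z - x) * f (t - z)) \<partial>lborel) =
          indicator Y x * (\<integral>\<^sup>+z. indicator Y z * f (t - x - z) \<partial>lborel)"
        by (simp add: nn_integral_cmult)
    qed
    also have "ennreal (e * e) * \<dots> = mconv D (mconv D f) t"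
    proof -
      have "mconv D f = (\<lambda>s. \<integral>\<^sup>+x. ennreal e * (indicator Y x * f (s - x)) \<partial>lborel)"
        by (rule ext, rule D) measurable
      then have [measurable]: "mconv D f \<in> borel_measurable borel" by simp
      show ?thesis using Y(2)
        by (simp add: D nn_integral_cmult ennreal_mult mult_ac)
    qed
    also have "\<dots> \<le> mconv M (mconv M f) t" using DM by (meson mconv_mono order_trans)
    finally show "ennreal (e * e * r) * mconv (density lborel (indicator {a..b})) f t \<le> mconv M (mconv M f) t" .
  qed (use ab Y(2) in auto)
qed

lemma (in real_distribution) mpow_distribution:
  "\<exists>N. real_distribution N \<and> (\<forall>f\<in>borel_measurable borel. mpow M n f = mconv N f)"
proof (induction n)
  case 0
  have "real_distribution (return borel 0 :: real measure)"
    by (intro real_distribution.intro prob_space_return) (auto simp: real_distribution_axioms_def)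
  moreover have "mconv (return borel 0) f = f" if "f \<in> borel_measurable borel" for f
  proof
    fix t
    have "(\<lambda>x. f (t - x)) \<in> borel_measurable borel" using that by measurable
    then show "mconv (return borel 0) f t = f t" by (simp add: mconv_def nn_integral_return)
  qed
  ultimately show ?case by (intro exI[of _ "return borel 0"]) auto
next
  case (Suc n)
  then obtain N where N: "real_distribution N" "\<And>f. f \<in> borel_measurable borel \<Longrightarrow> mpow M n f = mconv N f"
    by blast
  interpret N: real_distribution N by fact
  have eq: "mconv (M \<star> N) f = mpow M (Suc n) f" if [measurable]: "f \<in> borel_measurable borel" for f
  proof
    fix t
    have "mconv (M \<star> N) f t = (\<integral>\<^sup>+x. \<integral>\<^sup>+y. f (t - (x + y)) \<partial>N \<partial>M)"
      unfolding mconv_def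
      by (rule nn_integral_convolution) (auto simp: sets_eq_borel N.sets_eq_borel finite_measure_axioms N.finite_measure_axioms)
    also have "\<dots> = mpow M (Suc n) f t"
      by (simp add: mpow_Suc N(2) mconv_def diff_diff_eq)
    finally show "mconv (M \<star> N) f t = mpow M (Suc n) f t" .
  qed
  have sets: "sets (M \<star> N) = sets borel" by (simp add: convolution_def)
  have "emeasure (M \<star> N) UNIV = mconv (M \<star> N) (\<lambda>_. 1) 0" using sets by (simp add: mconv_const)
  also have "\<dots> = 1" by (simp add: eq)
  finally have "real_distribution (M \<star> N)"
    using sets sets_eq_imp_space_eq[OF sets]
    by (intro real_distribution.intro prob_spaceI) (auto simp: real_distribution_axioms_def)
  with eq show ?case by metis
qed

section \<open>Splitting an absolutely continuous part off a convolution power\<close>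

locale minorized_walk = drift_walk +
  fixes m :: nat and w a b :: real
  assumes ab: "a < b" and w: "w > 0"
    and minor: "\<And>f t. f \<in> borel_measurable borel \<Longrightarrow>
      ennreal w * mconv (density lborel (indicator {a..b})) f t \<le> mpow M m f t"
begin

text \<open>\<open>D\<close> is the part with density \<open>J\<close> that is split off the law
  \<open>N\<close> of \<open>m\<close> steps, and \<open>R\<close> is the remainder. The loss of
  mass \<open>gap\<close> in \<open>R\<close> produces the geometric series.\<close>

definition "J x = ennreal w * indicator {a..b} x"
definition "D = density lborel J"
definition "N = (SOME N. real_distribution N \<and> (\<forall>f\<in>borel_measurable borel. mpow M m f = mconv N f))"
definition "R = diff_measure N D"
definition "gap = w * (b - a)"

lemma N: "real_distribution N" "f \<in> borel_measurable borel \<Longrightarrow> mpow M m f = mconv N f"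
  using someI_ex[OF mpow_distribution[of m]] by (auto simp: N_def)

lemma J_measurable [measurable]: "J \<in> borel_measurable borel" unfolding J_def[abs_def] by measurable

lemma J_integral: "(\<integral>\<^sup>+x. J x \<partial>lborel) = ennreal gap"
  using ab w by (simp add: J_def gap_def nn_integral_cmult_indicator ennreal_mult)

lemma gap_pos: "gap > 0" using ab w by (simp add: gap_def)

lemma finite_D: "finite_borel_measure D"
  unfolding D_def by (rule finite_borel_density) (auto simp: J_integral)

lemma mconv_D: "f \<in> borel_measurable borel \<Longrightarrow> mconv D f t = ennreal w * mconv (density lborel (indicator {a..b})) f t"
proof -
  assume [measurable]: "f \<in> borel_measurable borel"
  have "mconv D f t = (\<integral>\<^sup>+x. ennreal w * (indicator {a..b} x * f (t - x)) \<partial>lborel)"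
    unfolding D_def by (subst mconv_density) (auto simp: J_def mult.assoc)
  also have "\<dots> = ennreal w * (\<integral>\<^sup>+x. indicator {a..b} x * f (t - x) \<partial>lborel)"
    by (rule nn_integral_cmult) measurable
  finally show ?thesis by (subst mconv_density) auto
qed

text \<open>As \<open>mconv M f 0\<close> integrates \<open>f (- x)\<close>, the inequality
  \<open>minor\<close> is tested with reflected indicators.\<close>

lemma D_le_N: "A \<in> sets borel \<Longrightarrow> emeasure D A \<le> emeasure N A"
proof -
  assume [measurable]: "A \<in> sets borel"
  have eq: "(\<lambda>x. indicator (uminus -` A) (0 - x) :: ennreal) = indicator A"
    by (auto simp: indicator_def fun_eq_iff)
  have [measurable]: "uminus -` A \<in> sets borel"
    using measurable_sets[of "uminus :: real \<Rightarrow> real" borel borel A] by simp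
  interpret N: real_distribution N by (rule N)
  have "emeasure D A = mconv D (indicator (uminus -` A)) 0"
    unfolding mconv_def eq by (simp add: D_def)
  also have "\<dots> \<le> mpow M m (indicator (uminus -` A)) 0"
    by (subst mconv_D) (auto intro: minor)
  also have "\<dots> = emeasure N A"
    unfolding N(2)[OF borel_measurable_indicator[OF \<open>uminus -` A \<in> sets borel\<close>]] mconv_def eq
    by (simp add: N.sets_eq_borel)
  finally show ?thesis .
qed

lemma R_sets: "sets R = sets borel"
  using N(1) by (simp add: R_def real_distribution_def real_distribution_axioms_def)

lemma R_emeasure: "A \<in> sets borel \<Longrightarrow> emeasure D A + emeasure R A = emeasure N A"
proof -
  assume A: "A \<in> sets borel"
  interpret N: real_distribution N by (rule N)
  interpret D: finite_borel_measure D by (rule finite_D)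
  have "emeasure R A = emeasure N A - emeasure D A"
    unfolding R_def
    by (rule emeasure_diff_measure)
       (use A D_le_N in \<open>auto simp: N.sets_eq_borel D.M_is_borel N.finite_measure_axioms D.finite_measure_axioms\<close>)
  then show ?thesis using D_le_N[OF A] by (simp add: add_diff_inverse_ennreal)
qed

lemma R_mass: "gap \<le> 1" "emeasure R UNIV = ennreal (1 - gap)"
proof -
  interpret N: real_distribution N by (rule N)
  have D: "emeasure D UNIV = ennreal gap" unfolding D_def by (subst emeasure_density) (auto simp: J_integral)
  have "ennreal gap \<le> 1" using D_le_N[of UNIV] by (simp add: D)
  then show le: "gap \<le> 1" by (simp add: ennreal_le_1)
  have "ennreal gap + emeasure R UNIV = ennreal gap + ennreal (1 - gap)"
    using R_emeasure[of UNIV] gap_pos le by (simp add: D ennreal_plus[symmetric] del: ennreal_plus)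
  then show "emeasure R UNIV = ennreal (1 - gap)" by (subst (asm) ennreal_add_left_cancel) auto
qed

lemma finite_R: "finite_borel_measure R"
  by (intro finite_borel_measureI finite_measureI) 
     (use R_mass R_sets sets_eq_imp_space_eq[OF R_sets] in auto)

lemma mpow_split:
  assumes f: "f \<in> borel_measurable borel"
  shows "mpow M m f t = mconv D f t + mconv R f t"
proof -
  interpret N: real_distribution N by (rule N)
  interpret D: finite_borel_measure D by (rule finite_D)
  interpret R: finite_borel_measure R by (rule finite_R)
  note [measurable_cong] = D.M_is_borel R.M_is_borel
  let ?L = "\<lambda>g. (\<integral>\<^sup>+x. g x \<partial>D) + (\<integral>\<^sup>+x. g x \<partial>R)"
  have m: "(\<lambda>x. f (t - x)) \<in> borel_measurable borel" using f by measurable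
  have "?L (\<lambda>x. f (t - x)) = (\<integral>\<^sup>+x. f (t - x) \<partial>N)"
  proof (rule functional_eq_nn_integral[where L = "?L" and M = N, OF N.sets_eq_borel _ _ _ _ m])
    fix A :: "real set" assume "A \<in> sets borel"
    then show "?L (indicator A) = emeasure N A"
      using R_emeasure[of A] by (simp add: D.M_is_borel R.M_is_borel)
  next
    fix f g :: "real \<Rightarrow> ennreal" assume [measurable]: "f \<in> borel_measurable borel" "g \<in> borel_measurable borel"
    show "?L (\<lambda>x. f x + g x) = ?L f + ?L g" by (simp add: nn_integral_add add_ac)
  next
    fix c and f :: "real \<Rightarrow> ennreal" assume [measurable]: "f \<in> borel_measurable borel"
    show "?L (\<lambda>x. c * f x) = c * ?L f" by (simp add: nn_integral_cmult distrib_left)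
  next
    fix F :: "nat \<Rightarrow> real \<Rightarrow> ennreal"
    assume F: "\<And>n. F n \<in> borel_measurable borel" "incseq F"
    note [measurable] = F(1)
    have inc: "incseq (\<lambda>n. \<integral>\<^sup>+x. F n x \<partial>G)" for G
      using F(2) by (auto simp: incseq_def le_fun_def intro!: nn_integral_mono)
    show "?L (\<lambda>x. SUP n. F n x) = (SUP n. ?L (F n))"
      using F(2) by (simp add: nn_integral_monotone_convergence_SUP ennreal_SUP_add[OF inc inc])
  qed
  then show ?thesis by (simp add: N(2)[OF f] mconv_def)
qed

text \<open>The inhomogeneous term of a renewal equation for \<open>rpot M f\<close> with the
  defective kernel \<open>R\<close>: the first \<open>m\<close> summands and the smooth part of what
  follows.\<close>

definition "Y f t = psum M m f t + mconv D (rpot M f) t"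

lemma Y_measurable [measurable]:
  assumes [measurable]: "f \<in> borel_measurable borel"
  shows "Y f \<in> borel_measurable borel"
proof -
  interpret D: finite_borel_measure D by (rule finite_D)
  show ?thesis unfolding Y_def[abs_def] by measurable
qed

lemma rpot_split:
  assumes [measurable]: "f \<in> borel_measurable borel"
  shows "rpot M f t = Y f t + mconv R (rpot M f) t"
  using rpot_unfold_psum[OF assms, of t m] by (simp add: mpow_split Y_def add.assoc)

lemma mpow_R_const: "mpow R n (\<lambda>_. K) t = K * ennreal ((1 - gap) ^ n)"
proof (induction n arbitrary: t)
  case (Suc n)
  then have "mpow R n (\<lambda>_. K) = (\<lambda>_. K * ennreal ((1 - gap) ^ n))" by auto
  then show ?case
    using R_mass(1) by (simp add: mpow_Suc mconv_const[OF R_sets] R_mass(2) ennreal_mult mult_ac)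
qed simp

lemma geometric_tendsto_0: "(\<lambda>n. ennreal ((1 - gap) ^ n)) \<longlonglongrightarrow> 0"
proof -
  have "(\<lambda>n. (1 - gap) ^ n) \<longlonglongrightarrow> 0"
    using gap_pos R_mass(1) by (intro LIMSEQ_power_zero) auto
  then show ?thesis using tendsto_ennrealI by fastforce
qed

lemma geometric_suminf: "(\<Sum>n. ennreal ((1 - gap) ^ n)) = ennreal (1 / gap)"
proof -
  have "(\<lambda>n. (1 - gap) ^ n) sums (1 / (1 - (1 - gap)))"
    using gap_pos R_mass(1) by (intro geometric_sums) auto
  then have "(\<lambda>n. (1 - gap) ^ n) sums (1 / gap)" by simp
  then show ?thesis using R_mass(1) by (intro suminf_ennreal_eq) auto
qed

text \<open>After n iterations of \<open>rpot_split\<close> the remainder is at most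
  \<open>K * ennreal ((1 - gap) ^ n)\<close>.\<close>

lemma rpot_eq_bounded:
  assumes [measurable]: "f \<in> borel_measurable borel"
    and K: "\<And>x. rpot M f x \<le> K" "K < \<infinity>"
  shows "rpot M f t = rpot R (Y f) t"
proof -
  interpret R: finite_borel_measure R by (rule finite_R)
  have eq: "rpot M f t = psum R n (Y f) t + mpow R n (rpot M f) t" for n
  proof (induction n)
    case (Suc n)
    have "rpot M f = (\<lambda>t. Y f t + mconv R (rpot M f) t)" using rpot_split by auto
    then have "mpow R n (rpot M f) t = mpow R n (\<lambda>t. Y f t + mconv R (rpot M f) t) t" by simp
    also have "\<dots> = mpow R n (Y f) t + mpow R (Suc n) (rpot M f) t"
      by (simp add: R.mpow_add_fun mpow_Suc')
    finally show ?case unfolding Suc by (simp add: psum_def add.assoc)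
  qed (simp add: psum_def)
  have rest: "(\<lambda>n. mpow R n (rpot M f) t) \<longlonglongrightarrow> 0"
  proof (rule tendsto_sandwich[of "\<lambda>_. 0" _ _ "\<lambda>n. K * ennreal ((1 - gap) ^ n)"])
    have "mpow R n (rpot M f) t \<le> K * ennreal ((1 - gap) ^ n)" for n
      unfolding mpow_R_const[symmetric, of K n t] by (rule mpow_mono) (rule K)
    then show "\<forall>\<^sub>F n in sequentially. mpow R n (rpot M f) t \<le> K * ennreal ((1 - gap) ^ n)" by simp
    show "(\<lambda>n. K * ennreal ((1 - gap) ^ n)) \<longlonglongrightarrow> 0"
      using ennreal_tendsto_cmult[OF _ geometric_tendsto_0, of K] K(2) by simp
  qed auto
  have "(\<lambda>n. psum R n (Y f) t + mpow R n (rpot M f) t) \<longlonglongrightarrow> rpot R (Y f) t + 0"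
    by (intro tendsto_add psum_tendsto_rpot rest)
  then show ?thesis unfolding eq[symmetric] by (simp add: LIMSEQ_const_iff)
qed

text \<open>The potential of a bounded function may be infinite. Therefore \<open>f\<close> is cut
  into pieces living on n \<le> \<bar>x\<bar> < n + 1, which have bounded potentials, and both sides
  commute with the countable sum.\<close>

lemma rpot_eq:
  assumes [measurable]: "f \<in> borel_measurable borel" and bdd: "\<And>x. f x \<le> ennreal c"
  shows "rpot M f t = rpot R (Y f) t"
proof -
  interpret R: finite_borel_measure R by (rule finite_R)
  interpret D: finite_borel_measure D by (rule finite_D)
  define F where "F n x = f x * indicator {x. \<lfloor>\<bar>x\<bar>\<rfloor> = int n} x" for n x
  have Fm [measurable]: "F n \<in> borel_measurable borel" for n unfolding F_def[abs_def] by measurable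
  have f_eq: "f = (\<lambda>x. \<Sum>n. F n x)"
  proof
    fix x
    have "(\<Sum>n. F n x) = (\<Sum>n\<in>{nat \<lfloor>\<bar>x\<bar>\<rfloor>}. F n x)"
      by (rule suminf_finite) (auto simp: F_def indicator_def)
    also have "\<dots> = f x" by (simp add: F_def)
    finally show "f x = (\<Sum>n. F n x)" by simp
  qed
  have F_eq: "rpot M (F n) t = rpot R (Y (F n)) t" for n t
  proof (rule rpot_eq_bounded)
    let ?l = "real n + 1"
    have "F n x \<le> ennreal c * indicator {- ?l..?l} x" for x
    proof (cases "\<lfloor>\<bar>x\<bar>\<rfloor> = int n")
      case True
      then have "x \<in> {- ?l..?l}" by (auto simp: floor_eq_iff abs_if split: if_splits)
      then show ?thesis using bdd[of x] True by (simp add: F_def)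
    qed (simp add: F_def)
    then have "rpot M (F n) x \<le> rpot M (\<lambda>x. ennreal c * indicator {- ?l..?l} x) x" for x
      by (rule rpot_mono)
    \<comment> \<open>\<open>2 * n + 3\<close> exceeds the length \<open>2 * (real n + 1)\<close> of
      the interval, as the covering bound requires.\<close>
    also have "rpot M (\<lambda>x. ennreal c * indicator {- ?l..?l} x) x \<le> ennreal c * (of_nat (2 * n + 3) * B)" for x
    proof -
      have "rpot M (indicator {- ?l..?l}) x \<le> of_nat (2 * n + 3) * B"
        by (rule rpot_Icc_le_B) simp
      then show ?thesis by (subst rpot_cmult) (auto intro!: mult_left_mono simp del: of_nat_add of_nat_mult)
    qed
    finally show "rpot M (F n) x \<le> ennreal c * (of_nat (2 * n + 3) * B)" for x .
    show "ennreal c * (of_nat (2 * n + 3) * B) < \<infinity>"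
      using B_finite by (simp add: ennreal_mult_less_top ennreal_of_nat_eq_real_of_nat del: of_nat_add of_nat_mult)
  qed measurable
  have "Y f t = (\<Sum>n. Y (F n) t)" for t
  proof -
    have "psum M m f t = (\<Sum>n. psum M m (F n) t)"
      by (subst f_eq) (rule psum_suminf[OF Fm])
    moreover have "rpot M f = (\<lambda>t. \<Sum>n. rpot M (F n) t)"
      by (rule ext, subst f_eq) (rule rpot_suminf[OF Fm])
    then have "mconv D (rpot M f) t = (\<Sum>n. mconv D (rpot M (F n)) t)"
      by (simp add: D.mconv_suminf)
    ultimately show ?thesis by (simp add: Y_def suminf_add)
  qed
  then have "Y f = (\<lambda>t. \<Sum>n. Y (F n) t)" by (rule ext)
  then have "rpot R (Y f) t = (\<Sum>n. rpot R (Y (F n)) t)"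
    using R.rpot_suminf[of "\<lambda>n. Y (F n)" t] by simp
  moreover have "rpot M f t = (\<Sum>n. rpot M (F n) t)"
    by (subst f_eq) (rule rpot_suminf[OF Fm])
  ultimately show ?thesis by (simp add: F_eq)
qed

definition "cells = nat \<lceil>b - a\<rceil> + 1"

lemma rpot_J_le: "rpot M J x \<le> ennreal w * (of_nat cells * B)"
proof -
  have "b < a + real cells" using real_nat_ceiling_ge[of "b - a"] by (simp add: cells_def)
  then show ?thesis unfolding J_def[abs_def]
    by (subst rpot_cmult) (auto intro!: mult_left_mono rpot_Icc_le_B)
qed

lemma J_bound_finite: "ennreal w * (of_nat cells * B) < \<infinity>"
  using B_finite by (simp add: ennreal_mult_less_top ennreal_of_nat_eq_real_of_nat)

text \<open>Up to the factor \<open>w\<close> this is \<open>key_renewal_limit\<close> with mesh 1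
  for an interval indicator: finitely many cells meet the interval, and only its end points are
  discontinuities.\<close>

lemma rpot_J_limit:
  assumes "direction E c" "filterlim t E sequentially"
  shows "(\<lambda>k. rpot M J (t k)) \<longlonglongrightarrow> c * ennreal gap"
proof -
  have fin: "csum (cell_sup 1 (indicator {a..b})) < \<infinity>"
  proof -
    have "csum (cell_sup 1 (indicator {a..b})) \<le> csum (\<lambda>n. indicator {\<lfloor>a\<rfloor> - 1..\<lceil>b\<rceil>} n)"
    proof (rule nn_integral_mono)
      fix n :: int
      show "cell_sup 1 (indicator {a..b}) n \<le> indicator {\<lfloor>a\<rfloor> - 1..\<lceil>b\<rceil>} n"
      proof (cases "n \<in> {\<lfloor>a\<rfloor> - 1..\<lceil>b\<rceil>}")
        case True
        then show ?thesis by (auto simp: cell_sup_def indicator_def intro!: SUP_least)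
      next
        case False
        then have "x \<notin> {a..b}" if "x \<in> {real_of_int n<..real_of_int n + 1}" for x
          using that by auto linarith+
        then have "(indicator {a..b} x :: ennreal) = 0" if "x \<in> {real_of_int n<..real_of_int n + 1}" for x
          using that by simp
        then show ?thesis by (auto simp: cell_sup_def intro!: SUP_least)
      qed
    qed
    also have "\<dots> < \<infinity>" by (simp add: ennreal_of_nat_eq_real_of_nat)
    finally show ?thesis .
  qed
  have "AE x in lborel. x \<noteq> a" "AE x in lborel. x \<noteq> b" by (rule AE_lborel_singleton)+
  then have cont: "AE x in lborel. isCont (indicator {a..b} :: real \<Rightarrow> ennreal) x"
  proof eventually_elim
    case (elim x)
    have "\<forall>\<^sub>F y in nhds x. (indicator {a..b} y :: ennreal) = indicator {a..b} x"
    proof -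
      have "\<exists>T. open T \<and> x \<in> T \<and> (\<forall>y\<in>T. (indicator {a..b} y :: ennreal) = indicator {a..b} x)"
      proof -
        consider "x < a" | "a < x" "x < b" | "b < x" using elim by fastforce
        then show ?thesis
        proof cases
          case 1 then show ?thesis by (intro exI[of _ "{..<a}"]) (auto simp: indicator_def)
        next
          case 2 then show ?thesis by (intro exI[of _ "{a<..<b}"]) (auto simp: indicator_def)
        next
          case 3 then show ?thesis by (intro exI[of _ "{b<..}"]) (auto simp: indicator_def)
        qed
      qed
      then show ?thesis unfolding eventually_nhds by blast
    qed
    then have "\<forall>\<^sub>F y in at x. (indicator {a..b} y :: ennreal) = indicator {a..b} x"
      by (auto simp: eventually_at_filter elim: eventually_mono)
    then show ?case unfolding isCont_def by (rule tendsto_eventually)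
  qed
  have "(\<lambda>k. rpot M (indicator {a..b}) (t k)) \<longlonglongrightarrow> c * (\<integral>\<^sup>+x. indicator {a..b} x \<partial>lborel)"
    by (rule key_renewal_limit[OF assms _ zero_less_one fin cont]) measurable
  then have "(\<lambda>k. rpot M (indicator {a..b}) (t k)) \<longlonglongrightarrow> c * ennreal (b - a)" using ab by simp
  from ennreal_tendsto_cmult[OF _ this, of "ennreal w"] show ?thesis
    unfolding J_def[abs_def] using ab w by (simp add: rpot_cmult gap_def ennreal_mult mult_ac)
qed

text \<open>The constant from \<open>Y_le\<close> times the total \<open>1 / gap\<close> of the
  geometric series.\<close>

definition "C = (of_nat m + ennreal w * (of_nat cells * B)) * ennreal (1 / gap)"

lemma C_finite: "C < \<infinity>"
  unfolding C_def using J_bound_finite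
  by (simp add: ennreal_mult_less_top ennreal_of_nat_eq_real_of_nat)

context
  fixes f :: "real \<Rightarrow> ennreal" and s :: real
  assumes f [measurable]: "f \<in> borel_measurable borel" and f_le: "\<And>x. f x \<le> ennreal s"
    and f_int: "(\<integral>\<^sup>+x. f x \<partial>lborel) < \<infinity>"
begin

text \<open>The smooth part takes effect here: commuting moves the potential from \<open>f\<close>
  to \<open>J\<close>, whose limits are known, and \<open>f\<close> acts merely as an integrable
  density.\<close>

lemma mconv_D_rpot: "mconv D (rpot M f) t = mconv (density lborel f) (rpot M J) t"
proof -
  have F: "finite_borel_measure (density lborel f)" by (rule finite_borel_density) (use f_int in auto)
  have "mconv D (rpot M f) t = rpot M (mconv D f) t" by (rule rpot_mconv_commute[OF finite_D f, symmetric])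
  also have "mconv D f = mconv (density lborel f) J"
    unfolding D_def by (rule ext, rule mconv_density_swap) measurable
  also have "rpot M (mconv (density lborel f) J) t = mconv (density lborel f) (rpot M J) t"
    by (rule rpot_mconv_commute[OF F]) measurable
  finally show ?thesis .
qed

lemma Y_le: "Y f x \<le> (of_nat m + ennreal w * (of_nat cells * B)) * (ennreal s + (\<integral>\<^sup>+x. f x \<partial>lborel))"
proof -
  have "psum M m f x \<le> psum M m (\<lambda>_. ennreal s) x" by (rule psum_mono) (rule f_le)
  then have 1: "psum M m f x \<le> of_nat m * ennreal s" by (simp add: psum_def)
  have "mconv D (rpot M f) x \<le> mconv (density lborel f) (\<lambda>_. ennreal w * (of_nat cells * B)) x"
    unfolding mconv_D_rpot by (rule mconv_mono) (rule rpot_J_le)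
  also have "\<dots> = ennreal w * (of_nat cells * B) * (\<integral>\<^sup>+x. f x \<partial>lborel)"
    by (simp add: mconv_const emeasure_density)
  finally have "Y f x \<le> of_nat m * ennreal s + ennreal w * (of_nat cells * B) * (\<integral>\<^sup>+x. f x \<partial>lborel)"
    unfolding Y_def using 1 by (rule add_mono[rotated])
  also have "\<dots> \<le> (of_nat m + ennreal w * (of_nat cells * B)) * (ennreal s + (\<integral>\<^sup>+x. f x \<partial>lborel))"
    unfolding distrib_left distrib_right by (intro add_mono) (auto simp: add_increasing add_increasing2)
  finally show ?thesis .
qed

lemma rpot_spread_le: "rpot M f x \<le> C * (ennreal s + (\<integral>\<^sup>+x. f x \<partial>lborel))"
proof -
  let ?K = "(of_nat m + ennreal w * (of_nat cells * B)) * (ennreal s + (\<integral>\<^sup>+x. f x \<partial>lborel))"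
  have "rpot M f x = rpot R (Y f) x" by (rule rpot_eq[OF f f_le])
  also have "\<dots> \<le> (\<Sum>n. ?K * ennreal ((1 - gap) ^ n))"
    unfolding rpot_def mpow_R_const[symmetric, of _ _ x]
    by (intro suminf_le mpow_mono Y_le) auto
  also have "\<dots> = ?K * ennreal (1 / gap)" by (simp add: geometric_suminf)
  finally show ?thesis by (simp add: C_def mult_ac)
qed

text \<open>In \<open>Y f\<close> the finitely many powers applied to \<open>f\<close> vanish in the
  limit, and the smooth part tends to \<open>c * ennreal gap\<close> times the integral of
  \<open>f\<close>. The n-th power of \<open>R\<close> contributes a factor
  \<open>(1 - gap) ^ n\<close>; these factors sum to \<open>1 / gap\<close>, with dominated
  convergence over n.\<close>

lemma spread_out_limit:
  assumes E: "direction E c" and t: "filterlim t E sequentially"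
    and f0: "\<And>t. filterlim t E sequentially \<Longrightarrow> (\<lambda>k. f (t k)) \<longlonglongrightarrow> 0"
  shows "(\<lambda>k. rpot M f (t k)) \<longlonglongrightarrow> c * (\<integral>\<^sup>+x. f x \<partial>lborel)"
proof -
  let ?I = "\<integral>\<^sup>+x. f x \<partial>lborel"
  define K where "K = (of_nat m + ennreal w * (of_nat cells * B)) * (ennreal s + ?I)"
  have K: "K < \<infinity>" using J_bound_finite f_int
    by (simp add: K_def ennreal_mult_less_top ennreal_of_nat_eq_real_of_nat)
  have F: "finite_borel_measure (density lborel f)" by (rule finite_borel_density) (use f_int in auto)
  have Y_lim: "(\<lambda>k. Y f (t k)) \<longlonglongrightarrow> c * ennreal gap * ?I" if t: "filterlim t E sequentially" for t
  proof -
    have "(\<lambda>k. mpow M n f (t k)) \<longlonglongrightarrow> 0" if "filterlim t E sequentially" for n t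
      using that
    proof (induction n arbitrary: t)
      case 0
      then show ?case by (simp add: f0)
    next
      case (Suc n)
      have "mpow M n f x \<le> ennreal s" for x
        using mpow_mono[of f "\<lambda>_. ennreal s" M n x] f_le by simp
      then have "(\<lambda>k. mconv M (mpow M n f) (t k)) \<longlonglongrightarrow> 0 * emeasure M UNIV"
        using Suc direction_shift[OF E]
        by (intro mconv_tendsto[of M _ "ennreal s"] finite_borel_measure_M) auto
      then show ?case by (simp add: mpow_Suc)
    qed
    from this[OF t] have "(\<lambda>k. psum M m f (t k)) \<longlonglongrightarrow> (\<Sum>n<m. 0)" unfolding psum_def by (intro tendsto_sum)
    moreover have "(\<lambda>k. mconv D (rpot M f) (t k)) \<longlonglongrightarrow> c * ennreal gap * emeasure (density lborel f) UNIV"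
      unfolding mconv_D_rpot
      by (rule mconv_tendsto[OF F _ rpot_J_le J_bound_finite]) (auto intro!: rpot_J_limit[OF E] direction_shift[OF E t])
    ultimately have "(\<lambda>k. psum M m f (t k) + mconv D (rpot M f) (t k)) \<longlonglongrightarrow>
        (\<Sum>n<m. 0) + c * ennreal gap * emeasure (density lborel f) UNIV"
      by (rule tendsto_add)
    then show ?thesis by (simp add: Y_def emeasure_density)
  qed
  interpret R: finite_borel_measure R by (rule finite_R)
  have RY_le: "mpow R n (Y f) x \<le> K * ennreal ((1 - gap) ^ n)" for n x
    unfolding mpow_R_const[symmetric, of K n x] by (rule mpow_mono) (simp add: K_def Y_le)
  have R_lim: "(\<lambda>k. mpow R n (Y f) (t k)) \<longlonglongrightarrow> c * ennreal gap * ?I * ennreal ((1 - gap) ^ n)"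
    if "filterlim t E sequentially" for n t
    using that
  proof (induction n arbitrary: t)
    case 0
    then show ?case using Y_lim by simp
  next
    case (Suc n)
    have fin: "K * ennreal ((1 - gap) ^ n) < \<infinity>" using K by (simp add: ennreal_mult_less_top)
    have "(\<lambda>k. mconv R (mpow R n (Y f)) (t k)) \<longlonglongrightarrow> c * ennreal gap * ?I * ennreal ((1 - gap) ^ n) * emeasure R UNIV"
      using Suc direction_shift[OF E] by (intro mconv_tendsto[OF finite_R _ RY_le fin]) auto
    then show ?case using R_mass by (simp add: mpow_Suc ennreal_mult mult_ac)
  qed
  have "(\<lambda>k. \<integral>\<^sup>+n. mpow R n (Y f) (t k) \<partial>count_space UNIV) \<longlonglongrightarrow>
      (\<integral>\<^sup>+n. c * ennreal gap * ?I * ennreal ((1 - gap) ^ n) \<partial>count_space UNIV)"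
  proof (rule nn_integral_dominated_convergence[where w = "\<lambda>n. K * ennreal ((1 - gap) ^ n)"])
    show "(\<integral>\<^sup>+n. K * ennreal ((1 - gap) ^ n) \<partial>count_space UNIV) < \<infinity>"
      using K by (simp add: nn_integral_count_space_nat geometric_suminf ennreal_mult_less_top)
  qed (use RY_le R_lim[OF t] in auto)
  then have "(\<lambda>k. rpot R (Y f) (t k)) \<longlonglongrightarrow> c * ennreal gap * ?I * ennreal (1 / gap)"
    by (simp add: nn_integral_count_space_nat geometric_suminf rpot_def)
  moreover have "c * ennreal gap * ?I * ennreal (1 / gap) = c * ?I"
  proof -
    have "ennreal gap * ennreal (1 / gap) = 1"
      using gap_pos by (subst ennreal_mult[symmetric]) auto
    then show ?thesis by (metis mult.assoc mult.commute mult.right_neutral)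
  qed
  ultimately show ?thesis by (simp add: rpot_eq[OF f f_le])
qed

end

end

section \<open>Kernels on families of functions\<close>

type_synonym 's family = "'s \<Rightarrow> real \<Rightarrow> ennreal"

definition mfam :: "'s family \<Rightarrow> bool" where
  "mfam g \<longleftrightarrow> (\<forall>k. g k \<in> borel_measurable borel)"

definition single :: "'s \<Rightarrow> (real \<Rightarrow> ennreal) \<Rightarrow> 's family" where
  "single j f = (\<lambda>k. if k = j then f else (\<lambda>_. 0))"

definition off :: "'s \<Rightarrow> 's family \<Rightarrow> 's family" where
  "off i g = (\<lambda>k t. if k = i then 0 else g k t)"

text \<open>An axiomatic stand-in for a matrix of measures that acts by convolution. The axioms are
  stable under composition and series and determine the measures by \<open>ex_measure\<close>, so
  killed walks and their potentials can be built as operators.\<close>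

locale kernel_op =
  fixes L :: "'s::countable family \<Rightarrow> 's family"
  assumes meas: "mfam g \<Longrightarrow> mfam (L g)"
    and add: "mfam g \<Longrightarrow> mfam h \<Longrightarrow> L (\<lambda>k t. g k t + h k t) k t = L g k t + L h k t"
    and cmult: "mfam g \<Longrightarrow> L (\<lambda>k t. c * g k t) k t = c * L g k t"
    and SUP: "(\<And>n. mfam (G n)) \<Longrightarrow> (\<And>k. incseq (\<lambda>n. G n k)) \<Longrightarrow>
      L (\<lambda>k t. SUP n. G n k t) k t = (SUP n. L (G n) k t)"
    and shift: "mfam g \<Longrightarrow> L (\<lambda>k t. g k (t + s)) k t = L g k (t + s)"

lemma mfamD: "mfam g \<Longrightarrow> g k \<in> borel_measurable borel"
  by (simp add: mfam_def)

lemma mfam_add: "mfam g \<Longrightarrow> mfam h \<Longrightarrow> mfam (\<lambda>k t. g k t + h k t)"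
  unfolding mfam_def by (intro allI borel_measurable_add) auto

lemma mfam_diff:
  assumes "mfam g" "mfam h"
  shows "mfam (\<lambda>k t. g k t - h k t)"
proof -
  note [measurable] = assms[THEN mfamD]
  show ?thesis unfolding mfam_def by simp
qed

lemma mfam_suminf:
  assumes "\<And>n. mfam (G n)"
  shows "mfam (\<lambda>k t. \<Sum>n. G n k t)"
proof -
  note [measurable] = assms[THEN mfamD]
  show ?thesis unfolding mfam_def by simp
qed

lemma mfam_sum:
  assumes "\<And>n. mfam (G n)"
  shows "mfam (\<lambda>k t. \<Sum>n\<in>A. G n k t)"
proof -
  note [measurable] = assms[THEN mfamD]
  show ?thesis unfolding mfam_def by simp
qed

lemma mfam_const [simp]: "mfam (\<lambda>k t. c k)" unfolding mfam_def by simp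

lemma mfam_single: "f \<in> borel_measurable borel \<Longrightarrow> mfam (single j f)"
  unfolding mfam_def single_def by auto

lemma mfam_off:
  assumes "mfam g"
  shows "mfam (off i g)"
proof -
  note [measurable] = mfamD[OF assms]
  show ?thesis unfolding mfam_def off_def by simp
qed

lemma mfam_shift:
  assumes "mfam g"
  shows "mfam (\<lambda>k t. g k (t + s))"
proof -
  note [measurable] = mfamD[OF assms]
  show ?thesis unfolding mfam_def by simp
qed

context kernel_op begin

lemma zero: "L (\<lambda>k t. 0) k t = 0"
  using cmult[of "\<lambda>k t. 0" 0] by simp

text \<open>Additivity for the decomposition of \<open>h\<close> into \<open>g\<close> and
  \<open>h - g\<close>.\<close>

lemma mono:
  assumes "mfam g" "mfam h" "\<And>k t. g k t \<le> h k t"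
  shows "L g k t \<le> L h k t"
proof -
  have "h = (\<lambda>k t. g k t + (h k t - g k t))"
    using assms(3) by (auto simp: fun_eq_iff add_diff_inverse_ennreal)
  then have "L h k t = L g k t + L (\<lambda>k t. h k t - g k t) k t"
    using add[OF assms(1) mfam_diff[OF assms(2,1)], of k t] by simp
  then show ?thesis by (simp add: add_increasing2)
qed

lemma sum_lessThan: "(\<And>n. mfam (G n)) \<Longrightarrow> L (\<lambda>k t. \<Sum>n<N. G n k t) k t = (\<Sum>n<(N::nat). L (G n) k t)"
proof (induction N)
  case (Suc N)
  then show ?case using add[of "\<lambda>k t. \<Sum>n<N. G n k t" "G N"] by (simp add: mfam_sum)
qed (simp add: zero)

lemma suminf:
  assumes G: "\<And>n. mfam (G n)"
  shows "L (\<lambda>k t. \<Sum>n. G n k t) k t = (\<Sum>n. L (G n) k t)"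
proof -
  have "L (\<lambda>k t. \<Sum>n. G n k t) k t = L (\<lambda>k t. SUP N. \<Sum>n<N. G n k t) k t"
    by (simp add: suminf_eq_SUP)
  also have "\<dots> = (SUP N. L (\<lambda>k t. \<Sum>n<N. G n k t) k t)"
    by (rule SUP) (auto simp: incseq_def le_fun_def intro!: mfam_sum G sum_mono2)
  also have "\<dots> = (\<Sum>n. L (G n) k t)" by (simp add: sum_lessThan G suminf_eq_SUP)
  finally show ?thesis .
qed

lemma csum_pull:
  fixes G :: "'a::countable \<Rightarrow> 's family"
  assumes G: "\<And>j. mfam (G j)"
  shows "L (\<lambda>k t. csum (\<lambda>j. G j k t)) k t = csum (\<lambda>j. L (G j) k t)"
proof -
  define G' where "G' n = (if n \<in> range (to_nat :: 'a \<Rightarrow> nat) then G (from_nat n) else (\<lambda>_ _. 0))" for n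
  have "(\<lambda>k t. csum (\<lambda>j. G j k t)) = (\<lambda>k t. \<Sum>n. G' n k t)"
    by (auto simp: csum_eq_suminf G'_def fun_eq_iff intro!: suminf_cong)
  moreover have "csum (\<lambda>j. L (G j) k t) = (\<Sum>n. L (G' n) k t)"
    by (auto simp: csum_eq_suminf G'_def zero intro!: suminf_cong)
  moreover have "mfam (G' n)" for n by (auto simp: G'_def G)
  ultimately show ?thesis by (simp add: suminf)
qed

lemma expand_single:
  assumes g: "mfam g"
  shows "L g k t = csum (\<lambda>j. L (single j (g j)) k t)"
proof -
  have eq: "g = (\<lambda>k t. csum (\<lambda>j. single j (g j) k t))"
  proof (intro ext)
    fix k t
    have "csum (\<lambda>j. single j (g j) k t) = (\<Sum>j\<in>{k}. single j (g j) k t)"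
      by (rule nn_integral_count_space') (auto simp: single_def)
    then show "g k t = csum (\<lambda>j. single j (g j) k t)" by (simp add: single_def)
  qed
  have "L g k t = L (\<lambda>k t. csum (\<lambda>j. single j (g j) k t)) k t" by (subst eq) (rule refl)
  also have "\<dots> = csum (\<lambda>j. L (single j (g j)) k t)"
    by (rule csum_pull) (intro mfam_single mfamD g)
  finally show ?thesis .
qed

lemma single_shift: "single j (\<lambda>x. f (x + s)) = (\<lambda>k t. single j f k (t + s))"
  by (auto simp: single_def fun_eq_iff)

text \<open>Values at 0 on indicators of a single state form a measure by monotone continuity;
  translation invariance extends the representation to all \<open>t\<close>.\<close>

lemma ex_measure:
  "\<exists>M. sets M = sets borel \<and> (\<forall>f\<in>borel_measurable borel. \<forall>t. L (single j f) k t = mconv M f t)"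
proof -
  \<comment> \<open>The reflection compensates for \<open>mconv M f 0\<close> being the integral of
    \<open>f (- x)\<close>.\<close>
  define \<Lambda> where "\<Lambda> f = L (single j (\<lambda>x. f (- x))) k 0" for f :: "real \<Rightarrow> ennreal"
  have ms: "mfam (single j (\<lambda>x. f (- x)))" if [measurable]: "f \<in> borel_measurable borel" for f :: "real \<Rightarrow> ennreal"
    by (rule mfam_single) measurable
  define M where "M = measure_of UNIV (sets borel) (\<lambda>A. \<Lambda> (indicator A))"
  have \<Lambda>_suminf: "\<Lambda> (\<lambda>x. \<Sum>n. f n x) = (\<Sum>n. \<Lambda> (f n))" if "\<And>n. f n \<in> borel_measurable borel" for f
  proof -
    have "single j (\<lambda>x. \<Sum>n. f n (- x)) = (\<lambda>k t. \<Sum>n. single j (\<lambda>x. f n (- x)) k t)"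
      by (auto simp: single_def fun_eq_iff)
    then show ?thesis unfolding \<Lambda>_def using suminf[OF ms[OF that]] by simp
  qed
  have sets: "sets M = sets borel" unfolding M_def using sets.sets_measure_of_eq[of borel] by simp
  have em: "emeasure M A = \<Lambda> (indicator A)" if "A \<in> sets borel" for A
  proof (rule emeasure_measure_of[OF M_def])
    show "countably_additive (sets M) (\<lambda>A. \<Lambda> (indicator A))"
    proof (rule countably_additiveI)
      fix A :: "nat \<Rightarrow> real set" assume A: "range A \<subseteq> sets M" "disjoint_family A"
      have "indicator (\<Union>i. A i) = (\<lambda>x. \<Sum>i. indicator (A i) x :: ennreal)"
        using suminf_indicator[OF A(2)] by (auto simp: fun_eq_iff)
      then show "(\<Sum>i. \<Lambda> (indicator (A i))) = \<Lambda> (indicator (\<Union>i. A i))"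
        using A(1) sets by (subst \<Lambda>_suminf[symmetric]) auto
    qed
    have "\<Lambda> (indicator {}) = 0" using zero[of k 0] by (simp add: \<Lambda>_def single_def cong: if_cong)
    then show "positive (sets M) (\<lambda>A. \<Lambda> (indicator A))" by (simp add: positive_def)
  qed (use that sets in auto)
  have "L (single j f) k t = mconv M f t" if f [measurable]: "f \<in> borel_measurable borel" for f t
  proof -
    have "L (single j f) k (0 + t) = L (\<lambda>k s. single j f k (s + t)) k 0"
      by (rule shift[symmetric]) (rule mfam_single[OF f])
    also have "\<dots> = \<Lambda> (\<lambda>x. f (t - x))"
      unfolding \<Lambda>_def single_shift[symmetric] by (simp add: add.commute)
    also have "\<dots> = (\<integral>\<^sup>+x. f (t - x) \<partial>M)"
    proof (rule functional_eq_nn_integral[OF sets])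
      fix f g :: "real \<Rightarrow> ennreal" assume fg: "f \<in> borel_measurable borel" "g \<in> borel_measurable borel"
      have "single j (\<lambda>x. f (- x) + g (- x)) = (\<lambda>k t. single j (\<lambda>x. f (- x)) k t + single j (\<lambda>x. g (- x)) k t)"
        by (auto simp: single_def fun_eq_iff)
      then show "\<Lambda> (\<lambda>x. f x + g x) = \<Lambda> f + \<Lambda> g"
        unfolding \<Lambda>_def using add[OF ms[OF fg(1)] ms[OF fg(2)]] by simp
    next
      fix c and f :: "real \<Rightarrow> ennreal" assume f: "f \<in> borel_measurable borel"
      have "single j (\<lambda>x. c * f (- x)) = (\<lambda>k t. c * single j (\<lambda>x. f (- x)) k t)"
        by (auto simp: single_def fun_eq_iff)
      then show "\<Lambda> (\<lambda>x. c * f x) = c * \<Lambda> f"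
        unfolding \<Lambda>_def using cmult[OF ms[OF f]] by simp
    next
      fix F :: "nat \<Rightarrow> real \<Rightarrow> ennreal"
      assume F: "\<And>n. F n \<in> borel_measurable borel" "incseq F"
      have "single j (\<lambda>x. SUP n. F n (- x)) = (\<lambda>k t. SUP n. single j (\<lambda>x. F n (- x)) k t)"
        by (auto simp: single_def fun_eq_iff)
      then show "\<Lambda> (\<lambda>x. SUP n. F n x) = (SUP n. \<Lambda> (F n))"
        unfolding \<Lambda>_def using SUP[OF ms[OF F(1)]] F(2)
        by (auto simp: single_def incseq_def le_fun_def)
    qed (use em in auto)
    finally show ?thesis by (simp add: mconv_def)
  qed
  then show ?thesis using sets by blast
qed

end

lemma kernel_op_id: "kernel_op (\<lambda>g. g)"
  by unfold_locales auto

lemma kernel_op_comp: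
  assumes "kernel_op A" "kernel_op C"
  shows "kernel_op (\<lambda>g. A (C g))"
proof -
  interpret A: kernel_op A by fact
  interpret C: kernel_op C by fact
  show ?thesis
  proof
    fix g h :: "'a family" and k t assume g: "mfam g" and h: "mfam h"
    have "C (\<lambda>k t. g k t + h k t) = (\<lambda>k t. C g k t + C h k t)" using C.add[OF g h] by auto
    then show "A (C (\<lambda>k t. g k t + h k t)) k t = A (C g) k t + A (C h) k t"
      using A.add[OF C.meas[OF g] C.meas[OF h]] by simp
  next
    fix g :: "'a family" and c k t assume g: "mfam g"
    have "C (\<lambda>k t. c * g k t) = (\<lambda>k t. c * C g k t)" by (intro ext C.cmult g)
    then show "A (C (\<lambda>k t. c * g k t)) k t = c * A (C g) k t" using A.cmult[OF C.meas[OF g]] by simp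
  next
    fix G :: "nat \<Rightarrow> 'a family" and k t
    assume G: "\<And>n. mfam (G n)" "\<And>k. incseq (\<lambda>n. G n k)"
    have "C (\<lambda>k t. SUP n. G n k t) = (\<lambda>k t. SUP n. C (G n) k t)" using C.SUP[OF G] by auto
    moreover have "incseq (\<lambda>n. C (G n) k)" for k
      using G(2) by (auto simp: incseq_def le_fun_def intro!: C.mono G)
    ultimately show "A (C (\<lambda>k t. SUP n. G n k t)) k t = (SUP n. A (C (G n)) k t)"
      using A.SUP[of "\<lambda>n. C (G n)"] C.meas[OF G(1)] by simp
  next
    fix g :: "'a family" and s k t assume g: "mfam g"
    have "C (\<lambda>k t. g k (t + s)) = (\<lambda>k t. C g k (t + s))" by (intro ext C.shift g)
    then show "A (C (\<lambda>k t. g k (t + s))) k t = A (C g) k (t + s)" using A.shift[OF C.meas[OF g]] by simp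
  qed (auto intro: A.meas C.meas)
qed

lemma kernel_op_funpow: "kernel_op A \<Longrightarrow> kernel_op (A ^^ n)"
proof (induction n)
  case 0
  then show ?case using kernel_op_id by (simp add: id_def)
next
  case (Suc n)
  then show ?case using kernel_op_comp[of A "A ^^ n"] by (simp add: o_def)
qed

lemma kernel_op_suminf:
  assumes "\<And>n. kernel_op (A n)"
  shows "kernel_op (\<lambda>g k t. \<Sum>n::nat. A n g k t)"
proof -
  have A: "kernel_op (A n)" for n by (rule assms)
  show ?thesis
  proof
    fix G :: "nat \<Rightarrow> 'a family" and k t
    assume G: "\<And>n. mfam (G n)" "\<And>k. incseq (\<lambda>n. G n k)"
    have inc: "incseq (\<lambda>m. A n (G m) k t)" for n
      using G(2) by (auto simp: incseq_def le_fun_def intro!: kernel_op.mono[OF A] G)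
    have "(\<Sum>n. A n (\<lambda>k t. SUP m. G m k t) k t) = (\<Sum>n. SUP m. A n (G m) k t)"
      by (simp add: kernel_op.SUP[OF A G])
    also have "\<dots> = (SUP m. \<Sum>n. A n (G m) k t)"
      by (rule ennreal_suminf_SUP_eq) (rule inc)
    finally show "(\<Sum>n. A n (\<lambda>k t. SUP m. G m k t) k t) = (SUP m. \<Sum>n. A n (G m) k t)" .
  qed (auto intro!: mfam_suminf kernel_op.meas[OF A] suminf_add[symmetric]
       simp: kernel_op.add[OF A] kernel_op.cmult[OF A] kernel_op.shift[OF A])
qed

lemma kernel_op_off: "kernel_op (off i)"
  by unfold_locales (auto simp: mfam_off, auto simp: off_def)

lemma kernel_op_single_at: "kernel_op (\<lambda>g. single i (g i))"
  by unfold_locales (auto simp: mfam_single mfamD, auto simp: single_def)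

text \<open>By \<open>pot_unfold\<close> and \<open>pot_least\<close> this is the least solution of
  \<open>f = g + A f\<close>; several facts about excursions are comparisons of such least solutions
  with supersolutions.\<close>

definition pot :: "('s::countable family \<Rightarrow> 's family) \<Rightarrow> 's family \<Rightarrow> 's family" where
  "pot A g k t = (\<Sum>n. (A ^^ n) g k t)"

lemma kernel_op_pot:
  assumes "kernel_op A" shows "kernel_op (pot A)"
proof -
  have "pot A = (\<lambda>g k t. \<Sum>n. (A ^^ n) g k t)" by (auto simp: pot_def fun_eq_iff)
  then show ?thesis using kernel_op_suminf[of "\<lambda>n. A ^^ n"] kernel_op_funpow[OF assms] by simp
qed

context kernel_op begin

lemma pow_meas: "mfam g \<Longrightarrow> mfam ((L ^^ n) g)"
  by (rule kernel_op.meas[OF kernel_op_funpow[OF kernel_op_axioms]])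

lemma pot_meas: "mfam g \<Longrightarrow> mfam (pot L g)"
  by (rule kernel_op.meas[OF kernel_op_pot[OF kernel_op_axioms]])

lemma pot_unfold:
  assumes g: "mfam g"
  shows "pot L g k t = g k t + L (pot L g) k t"
proof -
  have "pot L g k t = (L ^^ 0) g k t + (\<Sum>n. (L ^^ Suc n) g k t)"
    unfolding pot_def using suminf_offset[of "\<lambda>n. (L ^^ n) g k t" 1] by simp
  also have "(\<Sum>n. (L ^^ Suc n) g k t) = L (\<lambda>k t. \<Sum>n. (L ^^ n) g k t) k t"
    by (subst suminf) (auto intro: pow_meas g)
  finally show ?thesis by (simp add: pot_def[abs_def])
qed

lemma pot_unfold_right:
  assumes g: "mfam g"
  shows "pot L g k t = g k t + pot L (L g) k t"
proof -
  have "pot L g k t = (L ^^ 0) g k t + (\<Sum>n. (L ^^ Suc n) g k t)"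
    unfolding pot_def using suminf_offset[of "\<lambda>n. (L ^^ n) g k t" 1] by simp
  then show ?thesis by (simp add: pot_def funpow_Suc_right del: funpow.simps(2))
qed

lemma pot_least:
  assumes f: "mfam f" and g: "mfam g" and le: "\<And>k t. g k t + L f k t \<le> f k t"
  shows "pot L g k t \<le> f k t"
proof -
  have "(\<Sum>n<N. (L ^^ n) g k t) \<le> f k t" for N k t
  proof (induction N arbitrary: k t)
    case (Suc N)
    have "(\<Sum>n<Suc N. (L ^^ n) g k t) = g k t + (\<Sum>n<N. L ((L ^^ n) g) k t)"
      by (subst sum.lessThan_Suc_shift) simp
    also have "(\<Sum>n<N. L ((L ^^ n) g) k t) = L (\<lambda>k t. \<Sum>n<N. (L ^^ n) g k t) k t"
      by (rule sum_lessThan[symmetric]) (rule pow_meas[OF g])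
    also have "\<dots> \<le> L f k t" by (rule mono) (auto intro!: mfam_sum pow_meas g f Suc)
    finally show ?case using le[of k t] by (meson add_left_mono order_trans)
  qed simp
  then show ?thesis unfolding pot_def suminf_eq_SUP by (intro SUP_least) auto
qed

lemma pow_pot_le: "mfam g \<Longrightarrow> (L ^^ n) (pot L g) k t \<le> pot L g k t"
proof (induction n arbitrary: k t)
  case (Suc n)
  have "L ((L ^^ n) (pot L g)) k t \<le> L (pot L g) k t"
    by (rule mono) (use Suc in \<open>auto intro: pow_meas pot_meas\<close>)
  also have "\<dots> \<le> pot L g k t"
    by (subst pot_unfold[OF Suc.prems, of k t]) (simp add: add_increasing)
  finally show ?case by simp
qed simp

lemma pot_pow_le: "mfam g \<Longrightarrow> pot L ((L ^^ n) g) k t \<le> pot L g k t"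
proof (induction n arbitrary: g)
  case (Suc n)
  have "pot L ((L ^^ n) (L g)) k t \<le> pot L (L g) k t" by (rule Suc) (rule meas[OF Suc.prems])
  also have "\<dots> \<le> pot L g k t"
    by (subst pot_unfold_right[OF Suc.prems, of k t]) (simp add: add_increasing)
  finally show ?case by (simp add: funpow_Suc_right del: funpow.simps(2))
qed simp

lemma pow_le_pot: "(L ^^ n) g k t \<le> pot L g k t"
  unfolding pot_def using sum_le_suminf[of "\<lambda>n. (L ^^ n) g k t" "{n}"] by simp

end

lemma (in finite_borel_measure) rpot_least:
  assumes [measurable]: "f \<in> borel_measurable borel" "g \<in> borel_measurable borel"
    and le: "\<And>t. g t + mconv M f t \<le> f t"
  shows "rpot M g t \<le> f t"
proof -
  have "psum M N g t \<le> f t" for N t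
  proof (induction N arbitrary: t)
    case (Suc N)
    have "psum M (Suc N) g t = g t + mconv M (psum M N g) t" by (rule psum_Suc) measurable
    also have "\<dots> \<le> g t + mconv M f t" by (intro add_left_mono mconv_mono Suc)
    finally show ?case using le[of t] by simp
  qed (simp add: psum_def)
  then show ?thesis unfolding rpot_eq_SUP_psum by (intro SUP_least) auto
qed

lemma (in finite_borel_measure) mconv_SUP:
  assumes [measurable]: "\<And>n. f n \<in> borel_measurable borel" and f: "incseq f"
  shows "mconv M (\<lambda>x. SUP n. f n x) t = (SUP n. mconv M (f n) t)"
proof -
  note [measurable_cong] = M_is_borel
  show ?thesis unfolding mconv_def
    by (rule nn_integral_monotone_convergence_SUP) (use f in \<open>auto simp: incseq_def le_fun_def\<close>)
qed

text \<open>One step of the walk that starts in \<open>(i, t)\<close> and moves to \<open>(k, t - x)\<close>.\<close>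

definition step_op :: "('s::countable \<Rightarrow> 's \<Rightarrow> real) \<Rightarrow> ('s \<Rightarrow> 's \<Rightarrow> real measure) \<Rightarrow> 's family \<Rightarrow> 's family" where
  "step_op q F g i t = csum (\<lambda>k. ennreal (q i k) * mconv (F i k) (g k) t)"

lemma kernel_op_step_op:
  assumes F: "\<And>i k. finite_borel_measure (F i k)"
  shows "kernel_op (step_op q F)"
proof
  fix g :: "'a family" assume g: "mfam g"
  then have [measurable]: "mconv (F i k) (g k) \<in> borel_measurable borel" for i k
    using finite_borel_measure.mconv_measurable[OF F] by (auto simp: mfam_def)
  show "mfam (step_op q F g)" unfolding mfam_def step_op_def[abs_def] by measurable
next
  fix g h :: "'a family" and k t assume g: "mfam g" "mfam h"
  then have "mconv (F i k) (\<lambda>t. g k t + h k t) t = mconv (F i k) (g k) t + mconv (F i k) (h k) t" for i k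
    by (intro finite_borel_measure.mconv_add[OF F]) (auto simp: mfam_def)
  then show "step_op q F (\<lambda>k t. g k t + h k t) k t = step_op q F g k t + step_op q F h k t"
    by (simp add: step_op_def distrib_left nn_integral_add)
next
  fix g :: "'a family" and c k t assume g: "mfam g"
  then have "mconv (F i k) (\<lambda>t. c * g k t) t = c * mconv (F i k) (g k) t" for i k
    by (intro finite_borel_measure.mconv_cmult[OF F]) (auto simp: mfam_def)
  then show "step_op q F (\<lambda>k t. c * g k t) k t = c * step_op q F g k t"
    by (simp add: step_op_def nn_integral_cmult[symmetric] mult_ac)
next
  fix G :: "nat \<Rightarrow> 'a family" and k t
  assume G: "\<And>n. mfam (G n)" "\<And>k. incseq (\<lambda>n. G n k)"
  have "mconv (F k j) (\<lambda>t. SUP n. G n j t) t = (SUP n. mconv (F k j) (G n j) t)" for j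
    using G by (intro finite_borel_measure.mconv_SUP[OF F]) (auto simp: mfam_def)
  then have "step_op q F (\<lambda>k t. SUP n. G n k t) k t =
      csum (\<lambda>j. SUP n. ennreal (q k j) * mconv (F k j) (G n j) t)"
    by (simp add: step_op_def SUP_mult_left_ennreal)
  also have "\<dots> = (SUP n. csum (\<lambda>j. ennreal (q k j) * mconv (F k j) (G n j) t))"
    using G(2) by (intro nn_integral_monotone_convergence_SUP)
      (auto simp: incseq_def le_fun_def intro!: mult_left_mono mconv_mono)
  finally show "step_op q F (\<lambda>k t. SUP n. G n k t) k t = (SUP n. step_op q F (G n) k t)"
    by (simp add: step_op_def)
next
  fix g :: "'a family" and s k t
  show "step_op q F (\<lambda>k t. g k (t + s)) k t = step_op q F g k (t + s)"
    by (simp add: step_op_def mconv_shift)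
qed

section \<open>Sums over a countable type\<close>

lemma csum_has_sum:
  assumes f: "(f has_sum s) UNIV" and nn: "\<And>k. 0 \<le> f (k::'a::countable)"
  shows "csum (\<lambda>k. ennreal (f k)) = ennreal s"
proof -
  have "((\<lambda>k. ennreal (f k)) has_sum ennreal s) UNIV"
  proof -
    have "sum (\<lambda>k. ennreal (f k)) = (\<lambda>X. ennreal (sum f X))"
      by (rule ext) (rule sum_ennreal, rule nn)
    then show ?thesis using tendsto_ennrealI[OF f[unfolded has_sum_def]] by (simp add: has_sum_def)
  qed
  then show ?thesis by (simp add: infsum_eq_csum[symmetric] infsumI)
qed

lemma csum_delta: "csum (\<lambda>k. if k = j then f k else 0) = f (j::'a::countable)"
proof -
  have "csum (\<lambda>k. if k = j then f k else 0) = (\<Sum>k\<in>{j}. if k = j then f k else 0)"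
    by (rule nn_integral_count_space') auto
  then show ?thesis by simp
qed

lemma csum_swap:
  fixes f :: "'a::countable \<Rightarrow> 'b::countable \<Rightarrow> ennreal"
  shows "csum (\<lambda>i. csum (\<lambda>k. f i k)) = csum (\<lambda>k. csum (\<lambda>i. f i k))"
proof -
  let ?g = "\<lambda>n i. if n \<in> range (to_nat :: 'b \<Rightarrow> nat) then f i (from_nat n) else 0"
  have "csum (\<lambda>i. csum (\<lambda>k. f i k)) = (\<Sum>n. csum (\<lambda>i. ?g n i))"
    unfolding csum_eq_suminf[where 'a = 'b] by (rule nn_integral_suminf) simp
  also have "\<dots> = csum (\<lambda>k. csum (\<lambda>i. f i k))"
    unfolding csum_eq_suminf[where 'a = 'b] by (intro suminf_cong) simp
  finally show ?thesis .
qed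

section \<open>Excursions of a recurrent chain\<close>

locale recurrent_chain =
  fixes q :: "'s::countable \<Rightarrow> 's \<Rightarrow> real" and u v :: "'s \<Rightarrow> real" and F :: "'s \<Rightarrow> 's \<Rightarrow> real measure"
  assumes q_nonneg: "\<And>i j. 0 \<le> q i j"
    and left: "positive_left_eigenvector q u"
    and right: "positive_right_eigenvector q v"
    and left_unique: "\<And>u'. positive_left_eigenvector q u' \<Longrightarrow> \<exists>c. \<forall>i. u' i = c * u i"
    and irr: "irreducible_matrix q"
    and F: "\<And>i j. real_distribution (F i j)"
    and rec: "\<exists>i. (\<Sum>n. ennreal (mat_power q (Suc n) i i)) = \<infinity>"
begin

abbreviation "P \<equiv> step_op q F"
abbreviation "V \<equiv> pot P"

lemma F_finite: "finite_borel_measure (F i j)"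
  by (rule real_distribution_finite_borel[OF F])

sublocale P: kernel_op "step_op q F" by (rule kernel_op_step_op[OF F_finite])
sublocale V: kernel_op "pot (step_op q F)" by (rule kernel_op_pot[OF P.kernel_op_axioms])

lemma u_pos: "u i > 0" using left by (simp add: positive_left_eigenvector_def)
lemma v_pos: "v i > 0" using right by (simp add: positive_right_eigenvector_def)

lemma u_sum: "csum (\<lambda>i. ennreal (u i) * ennreal (q i j)) = ennreal (u j)"
  using csum_has_sum[of "\<lambda>i. u i * q i j" "u j"] left u_pos q_nonneg
  by (simp add: positive_left_eigenvector_def ennreal_mult less_imp_le)

lemma v_sum: "csum (\<lambda>j. ennreal (q i j) * ennreal (v j)) = ennreal (v i)"
  using csum_has_sum[of "\<lambda>j. q i j * v j" "v i"] right v_pos q_nonneg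
  by (simp add: positive_right_eigenvector_def ennreal_mult less_imp_le)

lemma mconv_F_const [simp]: "mconv (F i k) (\<lambda>_. c) t = c"
proof -
  interpret real_distribution "F i k" by (rule F)
  show ?thesis by simp
qed

lemma P_const: "P (\<lambda>k t. c k) i t = csum (\<lambda>k. ennreal (q i k) * c k)"
  by (simp add: step_op_def)

lemma single_const: "single j (\<lambda>_. c) = (\<lambda>k t. if k = j then c else 0)"
  by (auto simp: single_def fun_eq_iff)


text \<open>On functions that are constant in \<open>t\<close> the displacements are invisible, and
  \<open>P\<close> acts as the matrix \<open>q\<close>.\<close>

lemma P_pow_mat: "(P ^^ n) (single j (\<lambda>_. 1)) i t = ennreal (mat_power q n i j)"
proof (induction n arbitrary: i t)
  case 0
  then show ?case by (simp add: single_def)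
next
  case (Suc n)
  have nn: "0 \<le> mat_power q n k j" for k using mat_power_bounds(1)[OF q_nonneg right] by blast
  have "(P ^^ n) (single j (\<lambda>_. 1)) = (\<lambda>k t. ennreal (mat_power q n k j))" using Suc by auto
  then have "(P ^^ Suc n) (single j (\<lambda>_. 1)) i t = csum (\<lambda>k. ennreal (q i k * mat_power q n k j))"
    by (simp add: P_const ennreal_mult q_nonneg nn)
  also have "\<dots> = ennreal (\<Sum>\<^sub>\<infinity>k. q i k * mat_power q n k j)"
    by (rule csum_has_sum[OF has_sum_infsum[OF mat_power_bounds(2)[OF q_nonneg right]]])
       (simp add: q_nonneg nn)
  finally show ?case by simp
qed

lemma single_scale: "single j (\<lambda>_. c) = (\<lambda>k t. c * single j (\<lambda>_. 1) k t)"
  by (auto simp: single_def fun_eq_iff)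

lemma reach: "\<exists>n. 0 < mat_power q n i j"
  using irr by (auto simp: irreducible_matrix_def)

text \<open>Recurrence is a class property: a path of positive weight from \<open>o'\<close> to
  \<open>r\<close> makes the weight of visits to \<open>r\<close> from \<open>o'\<close> infinite,
  and a path from \<open>r\<close> to \<open>o'\<close> carries this over to the start in
  \<open>r\<close>.\<close>

lemma V_recurrent: "V (single r (\<lambda>_. 1)) r t = \<infinity>"
proof -
  obtain o' where o': "(\<Sum>n. ennreal (mat_power q (Suc n) o' o')) = \<infinity>" using rec by blast
  obtain a where a: "0 < mat_power q a r o'" using reach by blast
  obtain b where b: "0 < mat_power q b o' r" using reach by blast
  let ?one = "\<lambda>j. single j (\<lambda>_::real. 1::ennreal)"
  have ms: "mfam (single j (\<lambda>_. c))" for j :: 's and c :: ennreal by (simp add: mfam_single)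
  have mp: "mfam ((P ^^ n) g)" if "mfam g" for n g by (rule P.pow_meas[OF that])
  have Vo: "V (?one o') o' t = \<infinity>" for t
  proof -
    have "(\<Sum>n. ennreal (mat_power q (Suc n) o' o')) \<le> (\<Sum>n. ennreal (mat_power q n o' o'))"
      using suminf_offset[of "\<lambda>n. ennreal (mat_power q n o' o')" 1] by simp
    then show ?thesis using o' by (simp add: pot_def P_pow_mat top_unique)
  qed
  define \<beta> where "\<beta> = ennreal (mat_power q b o' r)"
  have "V (single o' (\<lambda>_. \<beta>)) k t \<le> V ((P ^^ b) (?one r)) k t" for k t
    by (rule V.mono[OF ms mp[OF ms]]) (auto simp: P_pow_mat \<beta>_def, auto simp: single_def)
  then have "V (single o' (\<lambda>_. \<beta>)) k t \<le> V (?one r) k t" for k t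
    using P.pot_pow_le[OF ms, of b] order_trans by blast
  moreover have "V (single o' (\<lambda>_. \<beta>)) o' t = \<infinity>" for t
    unfolding single_scale[of o' \<beta>] using Vo b by (simp add: V.cmult ms \<beta>_def ennreal_mult_top)
  ultimately have top: "V (?one r) o' t = \<top>" for t by (metis infinity_ennreal_def top_unique)
  have "(P ^^ a) (single o' (\<lambda>_. \<top>)) r t \<le> (P ^^ a) (V (?one r)) r t"
  proof (rule kernel_op.mono[OF kernel_op_funpow[OF P.kernel_op_axioms] ms V.meas[OF ms]])
    show "single o' (\<lambda>_. \<top>) k t \<le> V (?one r) k t" for k t
      by (cases "k = o'") (simp_all add: single_def[of o' "\<lambda>_. \<top>"] top)
  qed
  also have "\<dots> \<le> V (?one r) r t" by (rule P.pow_pot_le[OF ms])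
  also have "(P ^^ a) (single o' (\<lambda>_. \<top>)) r t = \<top> * ennreal (mat_power q a r o')"
    unfolding single_scale[of o' \<top>]
    by (simp add: kernel_op.cmult[OF kernel_op_funpow[OF P.kernel_op_axioms]] ms P_pow_mat)
  also have "\<dots> = \<top>" using a by (simp add: ennreal_top_mult)
  finally show ?thesis by (simp add: top_unique)
qed

end

text \<open>The operator \<open>A\<close> below is one step of the walk killed on entering \<open>r\<close>; \<open>H\<close> is the law of the
  displacement at the return to \<open>r\<close>, and \<open>Occ j\<close> is the occupation measure of \<open>j\<close> during an excursion.
  They exist because every monotonically continuous additive operator is given by measures.\<close>

locale excursion = recurrent_chain q u v F
  for q :: "'s::countable \<Rightarrow> 's \<Rightarrow> real" and u v :: "'s \<Rightarrow> real" and F :: "'s \<Rightarrow> 's \<Rightarrow> real measure" +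
  fixes r :: 's
begin

definition A :: "'s family \<Rightarrow> 's family" where "A g = P (off r g)"

abbreviation "W \<equiv> pot A"

lemma kernel_op_A: "kernel_op A"
  using kernel_op_comp[OF P.kernel_op_axioms kernel_op_off[of r]] by (simp add: A_def[abs_def])

sublocale A: kernel_op A by (rule kernel_op_A)
sublocale W: kernel_op "pot A" by (rule kernel_op_pot[OF kernel_op_A])

definition H :: "real measure" where
  "H = (SOME M. sets M = sets borel \<and>
     (\<forall>f\<in>borel_measurable borel. \<forall>t. W (P (single r f)) r t = mconv M f t))"

definition Occ :: "'s \<Rightarrow> real measure" where
  "Occ j = (SOME M. sets M = sets borel \<and>
     (\<forall>f\<in>borel_measurable borel. \<forall>t. W (single j f) r t = mconv M f t))"

lemma H: "sets H = sets borel" "f \<in> borel_measurable borel \<Longrightarrow> W (P (single r f)) r t = mconv H f t"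
proof -
  have "kernel_op (\<lambda>g. W (P (single r (g r))))"
    by (rule kernel_op_comp[OF W.kernel_op_axioms kernel_op_comp[OF P.kernel_op_axioms kernel_op_single_at]])
  from kernel_op.ex_measure[OF this, of r r]
  have "\<exists>M. sets M = sets borel \<and> (\<forall>f\<in>borel_measurable borel. \<forall>t. W (P (single r f)) r t = mconv M f t)"
    by (simp add: single_def)
  from someI_ex[OF this]
  show "sets H = sets borel" "f \<in> borel_measurable borel \<Longrightarrow> W (P (single r f)) r t = mconv H f t"
    by (auto simp: H_def)
qed

lemma Occ: "sets (Occ j) = sets borel" "f \<in> borel_measurable borel \<Longrightarrow> W (single j f) r t = mconv (Occ j) f t"
  using someI_ex[OF W.ex_measure[of j r]] by (auto simp: Occ_def)

lemma split_off: "g k t = off r g k t + single r (g r) k t"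
  by (auto simp: off_def single_def)

lemma P_split: "mfam g \<Longrightarrow> P g k t = A g k t + P (single r (g r)) k t"
proof -
  assume g: "mfam g"
  have "P g k t = P (\<lambda>k t. off r g k t + single r (g r) k t) k t" by (simp flip: split_off)
  also have "\<dots> = A g k t + P (single r (g r)) k t"
    unfolding A_def by (rule P.add) (auto intro!: mfam_off mfam_single mfamD g)
  finally show ?thesis .
qed

text \<open>Splitting the entry to \<open>r\<close> off the equation \<open>v = P v\<close> exhibits
  \<open>v\<close> as a supersolution of the equation whose least solution is the left side.\<close>

lemma W_P_v: "W (P (single r (\<lambda>_. ennreal (v r)))) k t \<le> ennreal (v k)"
proof (rule A.pot_least)
  have m: "mfam (\<lambda>k (t::real). ennreal (v k))" by simp
  fix k t
  have "P (single r (\<lambda>_. ennreal (v r))) k t + A (\<lambda>k t. ennreal (v k)) k t = P (\<lambda>k t. ennreal (v k)) k t"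
    using P_split[OF m, of k t] by (simp add: add.commute)
  also have "\<dots> = ennreal (v k)" by (simp add: P_const v_sum)
  finally show "P (single r (\<lambda>_. ennreal (v r))) k t + A (\<lambda>k t. ennreal (v k)) k t \<le> ennreal (v k)" by simp
qed (auto intro!: P.meas mfam_single)

lemma H_le_1: "emeasure H UNIV \<le> 1"
proof -
  have "ennreal (v r) * emeasure H UNIV \<le> ennreal (v r) * 1"
    using W_P_v[of r 0] by (simp add: H mconv_const)
  then show ?thesis using v_pos[of r]
    by (subst (asm) ennreal_mult_le_mult_iff) auto
qed

lemma H_finite: "finite_borel_measure H"
proof (intro finite_borel_measureI finite_measureI H)
  have "space H = UNIV" using sets_eq_imp_space_eq[OF H(1)] by simp
  then show "emeasure H (space H) \<noteq> \<infinity>" using H_le_1 by (auto simp: top_unique)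
qed

sublocale H: finite_borel_measure H by (rule H_finite)

text \<open>Minimality is used twice. A step either avoids \<open>r\<close> or completes an
  excursion, so \<open>V g r\<close> is a supersolution of the renewal equation with kernel
  \<open>H\<close>. Conversely, the potential for \<open>H\<close> extends to all states and gives a
  supersolution for \<open>P\<close>.\<close>

lemma decomposition:
  assumes g: "mfam g"
  shows "V g r t = rpot H (W g r) t"
proof (rule antisym)
  let ?f = "V g"
  have f: "mfam ?f" by (rule V.meas[OF g])
  have mf: "mfam (single r (?f r))" by (rule mfam_single[OF mfamD[OF f]])
  have Wm [measurable]: "W g r \<in> borel_measurable borel" by (rule mfamD[OF W.meas[OF g]])
  have le: "W (\<lambda>k t. g k t + P (single r (?f r)) k t) k t \<le> ?f k t" for k t
  proof (rule A.pot_least[OF f])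
    show "g k t + P (single r (?f r)) k t + A ?f k t \<le> ?f k t" for k t
      using P.pot_unfold[OF g, of k t] P_split[OF f, of k t] by (simp add: add_ac)
  qed (intro mfam_add g P.meas mf)
  show "rpot H (W g r) t \<le> V g r t"
  proof (rule H.rpot_least)
    fix t
    have "W g r t + mconv H (?f r) t = W (\<lambda>k t. g k t + P (single r (?f r)) k t) r t"
      by (subst W.add) (auto intro!: g P.meas mf simp: H(2) mfamD[OF f])
    then show "W g r t + mconv H (?f r) t \<le> ?f r t" using le[of r t] by simp
  qed (auto simp: mfamD[OF f])
  define y where "y = rpot H (W g r)"
  have y [measurable]: "y \<in> borel_measurable borel" unfolding y_def by measurable
  have ym: "mfam (\<lambda>k t. g k t + P (single r y) k t)" by (intro mfam_add g P.meas mfam_single y)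
  \<comment> \<open>The extension to a general starting state: collect \<open>g\<close> until the
    entry to \<open>r\<close>, then \<open>y\<close>.\<close>
  define G where "G = W (\<lambda>k t. g k t + P (single r y) k t)"
  have G: "mfam G" unfolding G_def by (rule W.meas[OF ym])
  have "G r t = y t" for t
  proof -
    have "G r t = W g r t + mconv H y t"
      unfolding G_def by (subst W.add) (auto intro!: g P.meas mfam_single simp: H(2))
    also have "\<dots> = y t" unfolding y_def by (rule H.rpot_unfold[symmetric]) measurable
    finally show ?thesis .
  qed
  then have Gr: "G r = y" by auto
  have "V g k t \<le> G k t" for k t
  proof (rule P.pot_least[OF G g])
    fix k t
    have "g k t + P G k t = g k t + P (single r y) k t + A G k t"
      using P_split[OF G, of k t] by (simp add: Gr add_ac)
    also have "\<dots> = G k t" unfolding G_def using A.pot_unfold[OF ym, of k t] by simp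
    finally show "g k t + P G k t \<le> G k t" by simp
  qed
  from this[of r t] show "V g r t \<le> rpot H (W g r) t" by (simp add: Gr y_def)
qed

text \<open>The walk is killed on entering \<open>r\<close>, so \<open>r\<close> is occupied only at
  time 0.\<close>

lemma W_single_r:
  assumes f: "f \<in> borel_measurable borel"
  shows "W (single r f) k t = single r f k t"
proof -
  have "off r (single r f) = (\<lambda>k t. 0)" by (auto simp: off_def single_def fun_eq_iff)
  then have "A (single r f) = (\<lambda>k t. 0)" by (intro ext) (simp only: A_def P.zero)
  then have "W (single r f) k t = single r f k t + W (\<lambda>k t. 0) k t"
    using A.pot_unfold_right[OF mfam_single[OF f], of r k t] by simp
  then show ?thesis by (simp add: W.zero)
qed

text \<open>With return mass \<open>m < 1\<close> the visits to \<open>r\<close> would have the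
  finite total \<open>1 / (1 - m)\<close>, against recurrence.\<close>

lemma H_mass: "emeasure H UNIV = 1"
proof (rule ccontr)
  assume "emeasure H UNIV \<noteq> 1"
  then have lt: "emeasure H UNIV < 1" using H_le_1 by simp
  define m where "m = enn2real (emeasure H UNIV)"
  have m: "emeasure H UNIV = ennreal m" "0 \<le> m" "m < 1"
  proof -
    show eq: "emeasure H UNIV = ennreal m" using less_trans[OF lt ennreal_one_less_top] by (simp add: m_def)
    show "0 \<le> m" by (simp add: m_def)
    then show "m < 1" using lt unfolding eq by (simp add: ennreal_less_iff flip: ennreal_1)
  qed
  have "W (single r (\<lambda>_. 1)) r = (\<lambda>_. 1)"
    by (intro ext, subst W_single_r) (auto simp: single_def)
  then have "V (single r (\<lambda>_. 1)) r 0 = rpot H (\<lambda>_. 1) 0"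
    by (subst decomposition) (auto intro!: mfam_single)
  also have "\<dots> = (\<Sum>n. ennreal (m ^ n))"
  proof -
    have "mpow H n (\<lambda>_. 1) t = ennreal (m ^ n)" for n t
    proof (induction n arbitrary: t)
      case (Suc n)
      then have "mpow H n (\<lambda>_. 1) = (\<lambda>_. ennreal (m ^ n))" by auto
      then show ?case using m by (simp add: mpow_Suc mconv_const[OF H(1)] ennreal_mult[symmetric] mult.commute)
    qed simp
    then show ?thesis by (simp add: rpot_def)
  qed
  also have "\<dots> = ennreal (1 / (1 - m))"
    using m by (intro suminf_ennreal_eq) (auto intro!: geometric_sums)
  finally show False by (simp add: V_recurrent)
qed

lemma H_distribution: "real_distribution H"
  using H(1) H_mass sets_eq_imp_space_eq[OF H(1)]
  by (intro real_distribution.intro prob_spaceI) (auto simp: real_distribution_axioms_def)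

end

lemma csum_eq_has_sum:
  assumes f: "csum (\<lambda>k. ennreal (f k)) = ennreal s" and nn: "\<And>k. 0 \<le> f (k::'a::countable)" and s: "0 \<le> s"
  shows "(f has_sum s) UNIV"
proof -
  have "((\<lambda>k. ennreal (f k)) has_sum (\<Sum>\<^sub>\<infinity>k. ennreal (f k))) UNIV"
    by (intro has_sum_infsum nonneg_summable_on_complete) simp
  then have "((\<lambda>k. ennreal (f k)) has_sum ennreal s) UNIV" by (simp add: infsum_eq_csum f)
  moreover have "sum (\<lambda>k. ennreal (f k)) = (\<lambda>X. ennreal (sum f X))"
    by (rule ext) (rule sum_ennreal, rule nn)
  ultimately have "((\<lambda>X. ennreal (sum f X)) \<longlongrightarrow> ennreal s) (finite_subsets_at_top UNIV)"
    by (simp add: has_sum_def)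
  then show ?thesis unfolding has_sum_def
    using nn s by (subst (asm) tendsto_ennreal_iff) (auto intro!: always_eventually sum_nonneg)
qed

section \<open>Masses of the occupation measures\<close>

context excursion begin

sublocale H: real_distribution H by (rule H_distribution)

definition "occ j = emeasure (Occ j) UNIV"

lemma W_const: "W (single j (\<lambda>_. c)) r t = c * occ j"
  by (simp add: Occ(2) mconv_const[OF Occ(1)] occ_def)

text \<open>The matrix \<open>q\<close> with column \<open>r\<close> replaced by 0, the form of
  \<open>A\<close> on functions that are constant in \<open>t\<close>.\<close>

definition "Ac c = (\<lambda>i. csum (\<lambda>k. ennreal (q i k) * (if k = r then 0 else c k)))"

lemma A_const: "A (\<lambda>k t. c k) = (\<lambda>k t. Ac c k)"
proof -
  have "off r (\<lambda>k (t::real). c k) = (\<lambda>k t. if k = r then 0 else c k)" by (simp add: off_def)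
  then show ?thesis by (intro ext) (simp only: A_def P_const Ac_def)
qed

lemma A_pow_const: "(A ^^ n) (\<lambda>k t. c k) = (\<lambda>k t. (Ac ^^ n) c k)"
  by (induction n) (auto simp: A_const)

lemma u_csum_split: "csum (\<lambda>k. ennreal (u k) * c k) = ennreal (u r) * c r + csum (\<lambda>k. ennreal (u k) * Ac c k)"
proof -
  let ?c = "\<lambda>k. if k = r then 0 else c k"
  have "csum (\<lambda>k. ennreal (u k) * Ac c k) = csum (\<lambda>k. csum (\<lambda>l. ennreal (u k) * ennreal (q k l) * ?c l))"
    unfolding Ac_def by (simp add: nn_integral_cmult[symmetric] mult.assoc)
  also have "\<dots> = csum (\<lambda>l. csum (\<lambda>k. ennreal (u k) * ennreal (q k l) * ?c l))" by (rule csum_swap)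
  also have "\<dots> = csum (\<lambda>l. ennreal (u l) * ?c l)"
    by (simp add: nn_integral_multc u_sum del: mult_zero_right)
  finally have 1: "csum (\<lambda>k. ennreal (u k) * Ac c k) = csum (\<lambda>l. ennreal (u l) * ?c l)" .
  have "csum (\<lambda>k. ennreal (u k) * c k) = csum (\<lambda>k. (if k = r then ennreal (u k) * c k else 0) + ennreal (u k) * ?c k)"
    by (intro nn_integral_cong) auto
  also have "\<dots> = ennreal (u r) * c r + csum (\<lambda>l. ennreal (u l) * ?c l)"
    by (subst nn_integral_add) (auto simp: csum_delta[of r "\<lambda>k. ennreal (u k) * c k"])
  finally show ?thesis by (simp only: 1)
qed

text \<open>Iterate \<open>u_csum_split\<close> and drop the nonnegative remainder. In particular
  the masses are finite, which \<open>occ_eq\<close> needs before it can invoke uniqueness.\<close>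

lemma occ_le: "ennreal (u r) * occ j \<le> ennreal (u j)"
proof -
  have eq: "csum (\<lambda>k. ennreal (u k) * c k) = (\<Sum>n<N. ennreal (u r) * (Ac ^^ n) c r) + csum (\<lambda>k. ennreal (u k) * (Ac ^^ N) c k)" for c N
  proof (induction N)
    case (Suc N)
    then show ?case using u_csum_split[of "(Ac ^^ N) c"] by (simp add: add.assoc)
  qed simp
  have le: "(\<Sum>n<N. ennreal (u r) * (Ac ^^ n) c r) \<le> csum (\<lambda>k. ennreal (u k) * c k)" for c N
    by (subst eq[of c N]) (simp add: add_increasing2)
  let ?c = "\<lambda>k. if k = j then 1 else 0 :: ennreal"
  have "ennreal (u r) * occ j = ennreal (u r) * W (\<lambda>k t. ?c k) r 0"
    using W_const[of j 1 0] by (simp add: single_const)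
  also have "\<dots> = (\<Sum>n. ennreal (u r) * (Ac ^^ n) ?c r)" by (simp add: pot_def A_pow_const)
  also have "\<dots> \<le> csum (\<lambda>k. ennreal (u k) * ?c k)"
    unfolding suminf_eq_SUP by (intro SUP_least le)
  also have "\<dots> = csum (\<lambda>k. if k = j then ennreal (u k) else 0)" by (intro nn_integral_cong) auto
  also have "\<dots> = ennreal (u j)" by (rule csum_delta)
  finally show ?thesis .
qed

text \<open>Shifting the excursion by one step exchanges the initial visit to \<open>r\<close> for
  the final one; both contribute \<open>c r\<close>, as the return mass is 1.\<close>

lemma W_P_const: "W (P (\<lambda>k t. c k)) r t = W (\<lambda>k t. c k) r t"
proof -
  have m: "mfam (\<lambda>k (t::real). c k)" by simp
  have eq: "P (\<lambda>k t. c k) = (\<lambda>k t. A (\<lambda>k t. c k) k t + P (single r (\<lambda>_. c r)) k t)"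
    using P_split[OF m] by (auto simp: fun_eq_iff)
  have "W (P (\<lambda>k t. c k)) r t = W (A (\<lambda>k t. c k)) r t + W (P (single r (\<lambda>_. c r))) r t"
    unfolding eq by (rule W.add) (auto intro!: A.meas P.meas mfam_single)
  also have "W (P (single r (\<lambda>_. c r))) r t = c r" by (subst H(2)) auto
  finally show ?thesis using A.pot_unfold_right[OF m, of r t] by (simp add: add.commute)
qed

lemma occ_invariant: "csum (\<lambda>l. occ l * ennreal (q l j)) = occ j"
proof -
  let ?c = "\<lambda>k. if k = j then 1 else 0 :: ennreal"
  have Pc: "P (\<lambda>k t. ?c k) = (\<lambda>k t. ennreal (q k j))"
  proof (intro ext)
    fix k t
    have "P (\<lambda>k t. ?c k) k t = csum (\<lambda>l. if l = j then ennreal (q k l) else 0)"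
      unfolding P_const by (intro nn_integral_cong) auto
    then show "P (\<lambda>k t. ?c k) k t = ennreal (q k j)" by (simp add: csum_delta)
  qed
  have "occ j = W (\<lambda>k t. ?c k) r 0" using W_const[of j 1 0] by (simp add: single_const)
  also have "\<dots> = W (\<lambda>k t. ennreal (q k j)) r 0" using W_P_const[of ?c 0] by (simp add: Pc)
  also have "\<dots> = csum (\<lambda>l. W (single l (\<lambda>_. ennreal (q l j))) r 0)" by (rule W.expand_single) simp
  finally show ?thesis by (simp add: W_const mult.commute)
qed

text \<open>By invariance the occupation mass is at least the weight of any single step n, and some
  such weight is positive.\<close>

lemma occ_pos: "0 < occ j"
proof -
  obtain n where n: "0 < mat_power q n r j" using reach by blast
  have pow: "(P ^^ n) (single j (\<lambda>_. 1)) = (\<lambda>k t. ennreal (mat_power q n k j))" for n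
    by (auto simp: P_pow_mat fun_eq_iff)
  have inv: "W ((P ^^ n) (single j (\<lambda>_. 1))) r 0 = W (single j (\<lambda>_. 1)) r 0" for n
  proof (induction n)
    case (Suc n)
    have "W ((P ^^ Suc n) (single j (\<lambda>_. 1))) r 0 = W (P (\<lambda>k t. ennreal (mat_power q n k j))) r 0"
      by (simp add: pow)
    also have "\<dots> = W (\<lambda>k t. ennreal (mat_power q n k j)) r 0" by (rule W_P_const)
    finally show ?case using Suc by (simp add: pow)
  qed simp
  have "0 < ennreal (mat_power q n r j)" using n by simp
  also have "\<dots> \<le> W ((P ^^ n) (single j (\<lambda>_. 1))) r 0"
    using A.pow_le_pot[of 0 "(P ^^ n) (single j (\<lambda>_. 1))" r 0] by (simp add: P_pow_mat)
  finally show ?thesis by (simp add: inv W_const)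
qed

text \<open>The occupation masses form a positive left eigenvector, hence a multiple of
  \<open>u\<close>; \<open>occ r = 1\<close> fixes the factor.\<close>

lemma occ_eq: "occ j = ennreal (u j / u r)"
proof -
  have fin: "occ j < \<top>" for j
  proof (rule ccontr)
    assume "\<not> occ j < \<top>"
    then have "occ j = \<top>" using top.not_eq_extremum by metis
    then show False using occ_le[of j] u_pos[of r] by (simp add: ennreal_mult_top top_unique)
  qed
  define k where "k j = enn2real (occ j)" for j
  have k: "ennreal (k j) = occ j" for j using fin by (simp add: k_def)
  have kpos: "0 < k j" for j using occ_pos fin by (simp add: k_def enn2real_positive_iff)
  have "positive_left_eigenvector q k"
    unfolding positive_left_eigenvector_def
  proof (intro conjI allI kpos)
    fix j
    show "((\<lambda>i. k i * q i j) has_sum k j) UNIV"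
      by (rule csum_eq_has_sum)
         (use occ_invariant[of j] kpos q_nonneg in \<open>auto simp: ennreal_mult less_imp_le k\<close>)
  qed
  then obtain c where c: "\<And>i. k i = c * u i" using left_unique by blast
  have "occ r = 1" using W_const[of r 1 0] by (subst (asm) W_single_r) (auto simp: single_def)
  then have "k r = 1" by (simp add: k_def)
  then have "c = 1 / u r" using c[of r] u_pos[of r] by (simp add: field_simps)
  then show ?thesis using c[of j] by (simp add: k[symmetric])
qed

lemma Occ_finite: "finite_borel_measure (Occ j)"
  using occ_eq[of j] sets_eq_imp_space_eq[OF Occ(1)]
  by (intro finite_borel_measureI finite_measureI Occ) (simp add: occ_def)

lemma V_single:
  assumes [measurable]: "f \<in> borel_measurable borel"
  shows "V (single j f) r t = mconv (Occ j) (rpot H f) t"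
proof -
  have "W (single j f) r = mconv (Occ j) f" by (rule ext) (rule Occ(2)[OF assms])
  then have "V (single j f) r t = rpot H (mconv (Occ j) f) t"
    using decomposition[OF mfam_single[OF assms]] by simp
  then show ?thesis by (simp add: H.rpot_mconv_commute[OF Occ_finite])
qed

text \<open>The mean of \<open>H\<close> is found by integrating over \<open>t\<close> the identity that \<open>W\<close> turns
  the one-step tail identity for the family \<open>v k * 1{t \<ge> 0}\<close> into.\<close>

definition "Gpos k t = csum (\<lambda>l. ennreal (q k l) * ennreal (v l) * real_distribution.tail_pos (F k l) t)"
definition "Gneg k t = csum (\<lambda>l. ennreal (q k l) * ennreal (v l) * real_distribution.tail_neg (F k l) t)"
definition "vstep k t = ennreal (v k) * indicator {0..} (t :: real)"

lemma tail_measurable [measurable]: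
  "real_distribution.tail_pos (F k l) \<in> borel_measurable borel"
  "real_distribution.tail_neg (F k l) \<in> borel_measurable borel"
  by (rule real_distribution.tail_pos_measurable[OF F], rule real_distribution.tail_neg_measurable[OF F])

lemma G_mfam: "mfam Gpos" "mfam Gneg" "mfam vstep"
proof -
  have "Gpos k \<in> borel_measurable borel" for k unfolding Gpos_def[abs_def] by measurable
  then show "mfam Gpos" by (simp add: mfam_def)
  have "Gneg k \<in> borel_measurable borel" for k unfolding Gneg_def[abs_def] by measurable
  then show "mfam Gneg" by (simp add: mfam_def)
  have "vstep k \<in> borel_measurable borel" for k unfolding vstep_def[abs_def] by measurable
  then show "mfam vstep" by (simp add: mfam_def)
qed

lemma csum_distrib: "csum (\<lambda>l. w l * (x l + y l)) = csum (\<lambda>l. w l * x l) + csum (\<lambda>l. w l * (y l :: ennreal))"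
proof -
  have "csum (\<lambda>l. w l * (x l + y l)) = csum (\<lambda>l. w l * x l + w l * y l)" by (simp only: distrib_left)
  also have "\<dots> = csum (\<lambda>l. w l * x l) + csum (\<lambda>l. w l * y l)" by (rule nn_integral_add) auto
  finally show ?thesis .
qed

text \<open>The tail identities of the laws \<open>F k l\<close>, summed with the weights
  \<open>q k l * v l\<close>, whose total is \<open>v k\<close>.\<close>

lemma one_step: "vstep k t + Gneg k t = P vstep k t + Gpos k t"
proof -
  have "vstep k t = csum (\<lambda>l. ennreal (q k l) * ennreal (v l) * indicator {0..} t)"
  proof -
    have "vstep k t = csum (\<lambda>l. ennreal (q k l) * ennreal (v l)) * indicator {0..} t"
      by (simp only: vstep_def v_sum)
    also have "\<dots> = csum (\<lambda>l. ennreal (q k l) * ennreal (v l) * indicator {0..} t)"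
      by (rule nn_integral_multc[symmetric]) simp
    finally show ?thesis .
  qed
  moreover have "mconv (F k l) (vstep l) t = ennreal (v l) * mconv (F k l) (indicator {0..}) t" for l
    unfolding vstep_def[abs_def] by (rule finite_borel_measure.mconv_cmult[OF F_finite]) measurable
  then have "P vstep k t = csum (\<lambda>l. ennreal (q k l) * ennreal (v l) * mconv (F k l) (indicator {0..}) t)"
    by (simp only: step_op_def mult.assoc)
  ultimately show ?thesis
    unfolding Gneg_def Gpos_def
    by (simp only: csum_distrib[symmetric] real_distribution.tail_identity[OF F])
qed

text \<open>These are the \<open>v\<close>-weighted masses of excursions longer than n. They vanish
  because the weights of the returns add up to \<open>v r\<close>, the return mass being 1.\<close>

lemma A_pow_v: "(\<lambda>n. (A ^^ n) (\<lambda>k t. ennreal (v k)) r t) \<longlonglongrightarrow> 0"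
proof -
  let ?v = "\<lambda>k (t::real). ennreal (v k)" and ?h = "P (single r (\<lambda>_. ennreal (v r)))"
  have m: "mfam ?v" "mfam ?h" by (auto intro!: P.meas mfam_single)
  have base: "?v = (\<lambda>k t. A ?v k t + ?h k t)"
    using P_split[OF m(1)] by (auto simp: P_const v_sum fun_eq_iff)
  have "(A ^^ n) ?v k t = (A ^^ n) (\<lambda>k t. A ?v k t + ?h k t) k t" for n k t
    using base by simp
  then have pw: "(A ^^ n) ?v k t = (A ^^ Suc n) ?v k t + (A ^^ n) ?h k t" for n k t
    by (simp add: kernel_op.add[OF kernel_op_funpow[OF kernel_op_A]] A.meas m funpow_swap1)
  have eq: "ennreal (v r) = (\<Sum>n<N. (A ^^ n) ?h r t) + (A ^^ N) ?v r t" for N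
  proof (induction N)
    case (Suc N)
    then show ?case using pw[of N r t] by (simp add: add_ac)
  qed simp
  have sm: "(\<lambda>N. \<Sum>n<N. (A ^^ n) ?h r t) \<longlonglongrightarrow> ennreal (v r)"
  proof -
    have "(\<Sum>n. (A ^^ n) ?h r t) = ennreal (v r)"
      using H(2)[of "\<lambda>_. ennreal (v r)" t] by (simp add: pot_def)
    then show ?thesis using summable_LIMSEQ[of "\<lambda>n. (A ^^ n) ?h r t"] by simp
  qed
  have "(\<lambda>N. ennreal (v r) - (\<Sum>n<N. (A ^^ n) ?h r t)) \<longlonglongrightarrow> ennreal (v r) - ennreal (v r)"
    by (intro tendsto_diff_ennreal tendsto_const sm) auto
  moreover have "ennreal (v r) - (\<Sum>n<N. (A ^^ n) ?h r t) = (A ^^ N) ?v r t" for N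
  proof -
    have "(\<Sum>n<N. (A ^^ n) ?h r t) \<noteq> \<top>" using eq[of N] by (metis ennreal_add_eq_top ennreal_neq_top)
    moreover have "x = s + a \<Longrightarrow> s \<noteq> \<top> \<Longrightarrow> x - s = a" for x s a :: ennreal by simp
    ultimately show ?thesis using eq[of N] by blast
  qed
  ultimately show ?thesis by simp
qed

text \<open>Apply the powers of \<open>A\<close> to \<open>one_step\<close> and sum: the step
  functions telescope except for the entries to \<open>r\<close>, which add up to \<open>H\<close>,
  and the boundary term vanishes by \<open>A_pow_v\<close>.\<close>

lemma excursion_identity:
  "vstep r t + W Gneg r t = ennreal (v r) * mconv H (indicator {0..}) t + W Gpos r t"
proof -
  let ?h = "P (single r (vstep r))"
  have m: "mfam vstep" "mfam Gneg" "mfam Gpos" "mfam ?h"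
    using G_mfam by (auto intro!: P.meas mfam_single mfamD)
  have base: "(\<lambda>k t. vstep k t + Gneg k t) = (\<lambda>k t. (A vstep k t + ?h k t) + Gpos k t)"
    using P_split[OF m(1)] by (auto simp: one_step fun_eq_iff)
  note kp = kernel_op.add[OF kernel_op_funpow[OF kernel_op_A]]
  have "(A ^^ n) (\<lambda>k t. vstep k t + Gneg k t) r t = (A ^^ n) (\<lambda>k t. (A vstep k t + ?h k t) + Gpos k t) r t" for n
    unfolding base ..
  then have pw: "(A ^^ n) vstep r t + (A ^^ n) Gneg r t =
      (A ^^ Suc n) vstep r t + (A ^^ n) ?h r t + (A ^^ n) Gpos r t" for n
    by (simp add: kp A.meas m mfam_add funpow_swap1)
  have eq: "vstep r t + (\<Sum>n<N. (A ^^ n) Gneg r t) =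
      (A ^^ N) vstep r t + (\<Sum>n<N. (A ^^ n) ?h r t) + (\<Sum>n<N. (A ^^ n) Gpos r t)" for N
  proof (induction N)
    case (Suc N)
    have "vstep r t + (\<Sum>n<Suc N. (A ^^ n) Gneg r t) =
        (\<Sum>n<N. (A ^^ n) ?h r t) + (\<Sum>n<N. (A ^^ n) Gpos r t) + ((A ^^ N) vstep r t + (A ^^ N) Gneg r t)"
      using Suc by (simp add: add_ac)
    also have "\<dots> = (A ^^ Suc N) vstep r t + (\<Sum>n<Suc N. (A ^^ n) ?h r t) + (\<Sum>n<Suc N. (A ^^ n) Gpos r t)"
      unfolding pw by (simp add: add_ac)
    finally show ?case .
  qed simp
  have lim: "(\<lambda>N. \<Sum>n<N. (A ^^ n) g r t) \<longlonglongrightarrow> W g r t" for g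
    unfolding pot_def by (rule summable_LIMSEQ) simp
  have "(\<lambda>n. (A ^^ n) vstep r t) \<longlonglongrightarrow> 0"
  proof (rule tendsto_sandwich[of "\<lambda>_. 0" _ _ "\<lambda>n. (A ^^ n) (\<lambda>k t. ennreal (v k)) r t"])
    have "(A ^^ n) vstep r t \<le> (A ^^ n) (\<lambda>k t. ennreal (v k)) r t" for n
      by (rule kernel_op.mono[OF kernel_op_funpow[OF kernel_op_A]])
         (use m in \<open>auto simp: vstep_def indicator_def\<close>)
    then show "\<forall>\<^sub>F n in sequentially. (A ^^ n) vstep r t \<le> (A ^^ n) (\<lambda>k t. ennreal (v k)) r t" by simp
  qed (auto intro: A_pow_v)
  then have "(\<lambda>N. (A ^^ N) vstep r t + (\<Sum>n<N. (A ^^ n) ?h r t) + (\<Sum>n<N. (A ^^ n) Gpos r t)) \<longlonglongrightarrow>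
      0 + W ?h r t + W Gpos r t"
    by (intro tendsto_add lim)
  moreover have "(\<lambda>N. vstep r t + (\<Sum>n<N. (A ^^ n) Gneg r t)) \<longlonglongrightarrow> vstep r t + W Gneg r t"
    by (intro tendsto_add tendsto_const lim)
  ultimately have "vstep r t + W Gneg r t = 0 + W ?h r t + W Gpos r t"
    unfolding eq by (rule LIMSEQ_unique[rotated])
  also have "W ?h r t = mconv H (vstep r) t" by (rule H(2)[OF mfamD[OF m(1)]])
  also have "\<dots> = ennreal (v r) * mconv H (indicator {0..}) t"
  proof -
    have "vstep r = (\<lambda>t. ennreal (v r) * indicator {0..} t)" by (auto simp: vstep_def)
    then show ?thesis by (simp add: H.mconv_cmult)
  qed
  finally show ?thesis by simp
qed


lemma excursion_tail:
  "ennreal (v r) * H.tail_pos t + W Gneg r t = ennreal (v r) * H.tail_neg t + W Gpos r t"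
proof -
  let ?v = "ennreal (v r)" and ?c = "mconv H (indicator {0..}) t"
  have c: "?c < \<top>"
  proof -
    have "mconv H (indicator {0..}) t \<le> mconv H (\<lambda>_. 1) t"
      by (rule mconv_mono) (simp split: split_indicator)
    also have "mconv H (\<lambda>_. 1) t = 1" by (rule H.mconv_const1)
    finally show ?thesis using ennreal_one_less_top by (rule le_less_trans)
  qed
  have "(?v * indicator {0..} t + ?v * ?c) + (?v * H.tail_pos t + W Gneg r t) =
      (?v * (?c + H.tail_pos t)) + (?v * indicator {0..} t + W Gneg r t)"
    by (simp add: distrib_left add_ac)
  also have "\<dots> = ?v * (indicator {0..} t + H.tail_neg t) + (?v * ?c + W Gpos r t)"
    using excursion_identity[of t] by (simp add: H.tail_identity vstep_def)
  also have "\<dots> = (?v * indicator {0..} t + ?v * ?c) + (?v * H.tail_neg t + W Gpos r t)"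
    by (simp add: distrib_left add_ac)
  finally have eq: "(?v * indicator {0..} t + ?v * ?c) + (?v * H.tail_pos t + W Gneg r t) =
      (?v * indicator {0..} t + ?v * ?c) + (?v * H.tail_neg t + W Gpos r t)" .
  have "?v * indicator {0..} t + ?v * ?c \<noteq> \<top>"
    using c by (auto simp: ennreal_mult_eq_top_iff split: split_indicator)
  then show ?thesis using eq by (simp only: ennreal_add_left_cancel infinity_ennreal_def) blast
qed

text \<open>Convolution with \<open>Occ j\<close> multiplies a Lebesgue integral by the mass
  \<open>u j / u r\<close>.\<close>

lemma W_integral:
  assumes g: "mfam g"
  shows "ennreal (u r) * (\<integral>\<^sup>+t. W g r t \<partial>lborel) = csum (\<lambda>j. ennreal (u j) * (\<integral>\<^sup>+t. g j t \<partial>lborel))"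
proof -
  have "W g r t = csum (\<lambda>j. mconv (Occ j) (g j) t)" for t
    by (subst W.expand_single[OF g]) (simp add: Occ(2) mfamD[OF g])
  then have "(\<integral>\<^sup>+t. W g r t \<partial>lborel) = csum (\<lambda>j. \<integral>\<^sup>+t. mconv (Occ j) (g j) t \<partial>lborel)"
    by (simp add: nn_integral_csum finite_borel_measure.mconv_measurable[OF Occ_finite] mfamD[OF g])
  also have "\<dots> = csum (\<lambda>j. occ j * (\<integral>\<^sup>+t. g j t \<partial>lborel))"
    by (simp add: nn_integral_mconv_lborel[OF Occ_finite] mfamD[OF g] occ_def)
  finally have "ennreal (u r) * (\<integral>\<^sup>+t. W g r t \<partial>lborel) = csum (\<lambda>j. ennreal (u r) * (occ j * (\<integral>\<^sup>+t. g j t \<partial>lborel)))"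
    by (simp add: nn_integral_cmult)
  also have "\<dots> = csum (\<lambda>j. ennreal (u j) * (\<integral>\<^sup>+t. g j t \<partial>lborel))"
  proof (rule nn_integral_cong)
    fix j
    have "ennreal (u r) * occ j = ennreal (u j)"
      unfolding occ_eq using u_pos[of r] u_pos[of j] by (subst ennreal_mult[symmetric]) auto
    then show "ennreal (u r) * (occ j * (\<integral>\<^sup>+t. g j t \<partial>lborel)) = ennreal (u j) * (\<integral>\<^sup>+t. g j t \<partial>lborel)"
      by (simp add: mult.assoc[symmetric])
  qed
  finally show ?thesis .
qed

lemma csum_prod:
  fixes f :: "'a::countable \<Rightarrow> 'b::countable \<Rightarrow> ennreal"
  shows "csum (\<lambda>(i, j). f i j) = csum (\<lambda>i. csum (\<lambda>j. f i j))"
  using nn_integral_fst_count_space[of "\<lambda>(i, j). f i j"] by simp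

lemma drift_eqs:
  "ennreal (u r) * (\<integral>\<^sup>+t. W Gpos r t \<partial>lborel) = drift_pos q u v F"
  "ennreal (u r) * (\<integral>\<^sup>+t. W Gneg r t \<partial>lborel) = drift_neg q u v F"
proof -
  have w: "ennreal (u i * q i j * v j) = ennreal (u i) * (ennreal (q i j) * ennreal (v j))" for i j
    using u_pos[of i] v_pos[of j] q_nonneg[of i j] by (simp add: ennreal_mult mult.assoc)
  have "(\<integral>\<^sup>+t. Gpos j t \<partial>lborel) = csum (\<lambda>l. ennreal (q j l) * ennreal (v l) * real_distribution.mean_pos (F j l))" for j
    unfolding Gpos_def by (subst nn_integral_csum, measurable)
      (simp add: nn_integral_cmult real_distribution.mean_pos_def[OF F])
  then show "ennreal (u r) * (\<integral>\<^sup>+t. W Gpos r t \<partial>lborel) = drift_pos q u v F"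
    unfolding W_integral[OF G_mfam(1)] drift_pos_def infsum_eq_csum csum_prod w
      real_distribution.mean_pos_eq[OF F, symmetric]
    by (simp add: nn_integral_cmult mult.assoc)
  have "(\<integral>\<^sup>+t. Gneg j t \<partial>lborel) = csum (\<lambda>l. ennreal (q j l) * ennreal (v l) * real_distribution.mean_neg (F j l))" for j
    unfolding Gneg_def by (subst nn_integral_csum, measurable)
      (simp add: nn_integral_cmult real_distribution.mean_neg_def[OF F])
  then show "ennreal (u r) * (\<integral>\<^sup>+t. W Gneg r t \<partial>lborel) = drift_neg q u v F"
    unfolding W_integral[OF G_mfam(2)] drift_neg_def infsum_eq_csum csum_prod w
      real_distribution.mean_neg_eq[OF F, symmetric]
    by (simp add: nn_integral_cmult mult.assoc)
qed

text \<open>This is \<open>excursion_tail\<close> integrated. The identity between the mean of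
  \<open>H\<close> and the drift is additive because positive parts may be infinite; the second
  claim comes from the half-line where \<open>tail_pos\<close> vanishes.\<close>

lemma mean_drift:
  "ennreal (u r * v r) * H.mean_pos + drift_neg q u v F = ennreal (u r * v r) * H.mean_neg + drift_pos q u v F"
  "ennreal (u r * v r) * H.mean_neg \<le> drift_neg q u v F"
proof -
  have Wm [measurable]: "W Gneg r \<in> borel_measurable borel" "W Gpos r \<in> borel_measurable borel"
    using W.meas[OF G_mfam(2)] W.meas[OF G_mfam(1)] by (auto intro: mfamD)
  have uv: "ennreal (u r * v r) = ennreal (u r) * ennreal (v r)"
    using u_pos[of r] v_pos[of r] by (simp add: ennreal_mult)
  have "(\<integral>\<^sup>+t. ennreal (v r) * H.tail_pos t + W Gneg r t \<partial>lborel) =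
      (\<integral>\<^sup>+t. ennreal (v r) * H.tail_neg t + W Gpos r t \<partial>lborel)"
    by (simp only: excursion_tail)
  then have "ennreal (v r) * H.mean_pos + (\<integral>\<^sup>+t. W Gneg r t \<partial>lborel) =
      ennreal (v r) * H.mean_neg + (\<integral>\<^sup>+t. W Gpos r t \<partial>lborel)"
    by (simp add: nn_integral_add nn_integral_cmult H.mean_pos_def H.mean_neg_def)
  then have "ennreal (u r) * (ennreal (v r) * H.mean_pos + (\<integral>\<^sup>+t. W Gneg r t \<partial>lborel)) =
      ennreal (u r) * (ennreal (v r) * H.mean_neg + (\<integral>\<^sup>+t. W Gpos r t \<partial>lborel))" by simp
  then show "ennreal (u r * v r) * H.mean_pos + drift_neg q u v F = ennreal (u r * v r) * H.mean_neg + drift_pos q u v F"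
    by (simp add: distrib_left drift_eqs uv mult.assoc)
  have "ennreal (v r) * H.tail_neg t \<le> W Gneg r t" for t
  proof (cases "t < 0")
    case True
    then have "H.tail_pos t = 0" by (simp add: H.tail_pos_def)
    then show ?thesis using excursion_tail[of t] by (simp add: add_increasing2)
  qed (simp add: H.tail_neg_def)
  then have "(\<integral>\<^sup>+t. ennreal (v r) * H.tail_neg t \<partial>lborel) \<le> (\<integral>\<^sup>+t. W Gneg r t \<partial>lborel)"
    by (rule nn_integral_mono)
  then have "ennreal (u r) * (ennreal (v r) * H.mean_neg) \<le> ennreal (u r) * (\<integral>\<^sup>+t. W Gneg r t \<partial>lborel)"
    by (intro mult_left_mono) (auto simp: nn_integral_cmult H.mean_neg_def)
  then show "ennreal (u r * v r) * H.mean_neg \<le> drift_neg q u v F"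
    by (simp add: drift_eqs uv mult.assoc)
qed

end

section \<open>Lattice type of the return law\<close>

definition lattice :: "real \<Rightarrow> real set" where "lattice d = range (\<lambda>k::int. d * of_int k)"

lemma lattice_zero: "0 \<in> lattice d" by (auto simp: lattice_def intro: image_eqI[of _ _ 0])

lemma lattice_diff: "x \<in> lattice d \<Longrightarrow> y \<in> lattice d \<Longrightarrow> x - y \<in> lattice d"
proof -
  assume "x \<in> lattice d" "y \<in> lattice d"
  then obtain k l :: int where "x = d * of_int k" "y = d * of_int l" by (auto simp: lattice_def)
  then have "x - y = d * of_int (k - l)" by (simp add: algebra_simps)
  then show ?thesis unfolding lattice_def by blast
qed

lemma lattice_neg: "x \<in> lattice d \<Longrightarrow> - x \<in> lattice d"
  using lattice_diff[OF lattice_zero] by simp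

lemma lattice_borel [measurable]: "lattice d \<in> sets borel"
  unfolding lattice_def by (rule sets.countable) auto

lemma coset_borel: "range (\<lambda>m::int. c + d * of_int m) \<in> sets (borel :: real measure)"
  by (rule sets.countable) auto

lemma nn_integral_eq_0_AE:
  "finite_borel_measure M \<Longrightarrow> f \<in> borel_measurable borel \<Longrightarrow> mconv M f t = 0 \<Longrightarrow> AE x in M. f (t - x) = 0"
proof -
  assume M: "finite_borel_measure M" and [measurable]: "f \<in> borel_measurable borel" and 0: "mconv M f t = 0"
  interpret finite_borel_measure M by fact
  note [measurable_cong] = M_is_borel
  show ?thesis using 0 unfolding mconv_def by (subst (asm) nn_integral_0_iff_AE) auto
qed

lemma AE_nonnull_ex:
  assumes "AE x in M. Q x" "emeasure M (space M) \<noteq> 0"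
  shows "\<exists>x. Q x"
proof (rule ccontr)
  assume "\<not> (\<exists>x. Q x)"
  with assms(1) have "AE x in M. False" by auto
  then have "emeasure M (space M) = 0" by (subst (asm) AE_iff_measurable[of "space M"]) auto
  with assms(2) show False by simp
qed

context excursion begin

lemma V_single_r:
  assumes f: "f \<in> borel_measurable borel"
  shows "V (single r f) r t = rpot H f t"
proof -
  have "W (single r f) r = f" using W_single_r[OF f, of r] by (auto simp: single_def)
  then show ?thesis using decomposition[OF mfam_single[OF f]] by simp
qed

text \<open>The zeros of \<open>V (single r f)\<close> propagate along paths that have positive weight.\<close>

lemma zero_reach:
  assumes f: "f \<in> borel_measurable borel" and zero: "V (single r f) r t = 0"
  shows "\<exists>s. V (single r f) j s = 0"
proof -
  let ?e = "V (single r f)"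
  have m: "mfam (single r f)" by (rule mfam_single[OF f])
  have em: "mfam ?e" by (rule V.meas[OF m])
  have "(P ^^ n) (single j (?e j)) r t = 0" for n
  proof -
    have "(P ^^ n) (single j (?e j)) r t \<le> (P ^^ n) ?e r t"
      by (rule kernel_op.mono[OF kernel_op_funpow[OF P.kernel_op_axioms]])
         (auto intro!: mfam_single mfamD em, simp add: single_def)
    also have "\<dots> \<le> ?e r t" by (rule P.pow_pot_le[OF m])
    finally show ?thesis using zero by simp
  qed
  then have "V (single j (?e j)) r t = 0" by (simp add: pot_def[of P "single j (?e j)"])
  then have "mconv (Occ j) (rpot H (?e j)) t = 0" by (simp add: V_single mfamD[OF em])
  moreover have "mconv (Occ j) (?e j) t \<le> mconv (Occ j) (rpot H (?e j)) t"
    by (rule mconv_mono) (subst H.rpot_unfold[OF mfamD[OF em]], simp add: add_increasing2)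
  ultimately have "mconv (Occ j) (?e j) t = 0" by simp
  from nn_integral_eq_0_AE[OF Occ_finite mfamD[OF em] this]
  have "AE x in Occ j. ?e j (t - x) = 0" .
  moreover have "emeasure (Occ j) (space (Occ j)) \<noteq> 0"
    using occ_pos[of j] sets_eq_imp_space_eq[OF Occ(1)[of j]] by (simp add: occ_def)
  ultimately show ?thesis using AE_nonnull_ex by blast
qed

lemma V_single_r_pos: "0 < V (single r (\<lambda>_. 1)) k t"
proof -
  obtain n where "0 < mat_power q n k r" using reach by blast
  then have "0 < (P ^^ n) (single r (\<lambda>_. 1)) k t" by (simp add: P_pow_mat)
  also have "\<dots> \<le> V (single r (\<lambda>_. 1)) k t" by (rule P.pow_le_pot)
  finally show ?thesis .
qed

text \<open>With the value \<infinity> off the lattice, an inequality \<open>P f \<le> f\<close>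
  concerns lattice points only, and a vanishing integral means that the measure is carried by the
  lattice.\<close>

definition lat_ind :: "real \<Rightarrow> real \<Rightarrow> ennreal" where
  "lat_ind d t = (if t \<in> lattice d then 0 else \<infinity>)"

lemma lat_ind_measurable [measurable]: "lat_ind d \<in> borel_measurable borel"
  unfolding lat_ind_def[abs_def] by measurable

text \<open>Shifted by \<open>\<gamma>\<close>, the functions \<open>lat_ind d\<close> form a
  supersolution for \<open>P\<close>, since steps of positive weight respect the shifted lattices.
  Minimality then bounds the return potential.\<close>

lemma span_imp_H_lattice:
  assumes span: "lattice_span q u v F d"
  shows "H.prob (lattice d) = 1"
proof -
  obtain \<gamma> where \<gamma>: "\<And>i j. u i * q i j * v j > 0 \<Longrightarrow>
      measure (F i j) (range (\<lambda>k::int. \<gamma> j - \<gamma> i + d * of_int k)) = 1"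
    using span by (auto simp: lattice_span_def)
  define f where "f k t = lat_ind d (t + (\<gamma> k - \<gamma> r))" for k t
  have fm: "mfam f" unfolding mfam_def f_def[abs_def] by measurable
  have Pf: "P f k t \<le> f k t" for k t
  proof (cases "t + (\<gamma> k - \<gamma> r) \<in> lattice d")
    case True
    have z: "ennreal (q k l) * mconv (F k l) (f l) t = 0" for l
    proof (cases "q k l > 0")
      case q: True
      interpret Fkl: real_distribution "F k l" by (rule F)
      have "u k * q k l * v l > 0" using q u_pos v_pos by simp
      from \<gamma>[OF this] have "AE x in F k l. x \<in> range (\<lambda>m::int. \<gamma> l - \<gamma> k + d * of_int m)"
        by (subst (asm) Fkl.prob_eq_1) (simp_all add: Fkl.sets_eq_borel coset_borel)
      then have "AE x in F k l. f l (t - x) = 0"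
      proof eventually_elim
        case (elim x)
        then obtain m :: int where x: "x = \<gamma> l - \<gamma> k + d * of_int m" by auto
        have "d * of_int m \<in> lattice d" by (auto simp: lattice_def)
        from lattice_diff[OF True this] have "t - x + (\<gamma> l - \<gamma> r) \<in> lattice d"
          by (simp add: x algebra_simps)
        then show ?case by (simp add: f_def lat_ind_def)
      qed
      then have "mconv (F k l) (f l) t = 0" unfolding mconv_def by (rule nn_integral_zero')
      then show ?thesis by simp
    next
      case False
      then show ?thesis using q_nonneg[of k l] by simp
    qed
    show ?thesis by (simp only: step_op_def z) simp
  qed (simp add: f_def lat_ind_def)
  have "W (P (single r (f r))) k t \<le> f k t" for k t
  proof (rule A.pot_least[OF fm])
    show "P (single r (f r)) k t + A f k t \<le> f k t" for k t
      using P_split[OF fm, of k t] Pf[of k t] by (simp add: add.commute)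
  qed (intro P.meas mfam_single mfamD fm)
  from this[of r 0] have "mconv H (f r) 0 \<le> f r 0" by (simp add: H(2) mfamD[OF fm])
  also have "f r 0 = 0" by (simp add: f_def lat_ind_def lattice_zero)
  finally have "mconv H (f r) 0 = 0" by simp
  from nn_integral_eq_0_AE[OF H_finite mfamD[OF fm] this]
  have "AE x in H. x \<in> lattice d"
  proof eventually_elim
    case (elim x)
    then have "- x \<in> lattice d" by (simp add: f_def lat_ind_def split: if_splits)
    then show ?case using lattice_neg by fastforce
  qed
  then show ?thesis by (subst H.prob_eq_1) (auto simp: H.sets_eq_borel)
qed

text \<open>Zeros of \<open>V (single r (lat_ind d))\<close> are starting points from which
  \<open>r\<close> is visited at lattice points only. Every state has zeros, they lie in one coset
  per state, and these cosets supply \<open>\<gamma>\<close>.\<close>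

lemma H_lattice_imp_span:
  assumes d: "d > 0" and lat: "H.prob (lattice d) = 1"
  shows "lattice_span q u v F d"
proof -
  let ?f = "lat_ind d" and ?e = "V (single r (lat_ind d))"
  have m: "mfam (single r ?f)" by (rule mfam_single) measurable
  have em: "mfam ?e" by (rule V.meas[OF m])
  have AE: "AE x in H. x \<in> lattice d" using lat by (subst (asm) H.prob_eq_1) (auto simp: H.sets_eq_borel)
  have "mpow H n ?f t = 0" if "t \<in> lattice d" for n t
    using that
  proof (induction n arbitrary: t)
    case (Suc n)
    have "AE x in H. mpow H n ?f (t - x) = 0"
      using AE by eventually_elim (intro Suc lattice_diff)
    then show ?case unfolding mpow_Suc mconv_def by (rule nn_integral_zero')
  qed (simp add: lat_ind_def)
  then have "?e r 0 = 0" by (simp add: V_single_r rpot_def lattice_zero)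
  from zero_reach[OF lat_ind_measurable this] obtain \<tau> where \<tau>: "\<And>k. ?e k (\<tau> k) = 0" by metis
  \<comment> \<open>If \<open>s - s'\<close> were off the lattice, the two shifted functions would
    add up to at least 1 everywhere, whereas \<open>r\<close> is reached from \<open>l\<close> with
    positive weight.\<close>
  have coset: "s - s' \<in> lattice d" if "?e l s = 0" "?e l s' = 0" for l s s'
  proof (rule ccontr)
    assume not: "s - s' \<notin> lattice d"
    have ge: "1 \<le> ?f (y + s) + ?f (y + s')" for y
    proof (rule ccontr)
      assume "\<not> 1 \<le> ?f (y + s) + ?f (y + s')"
      then have "y + s \<in> lattice d" "y + s' \<in> lattice d" by (auto simp: lat_ind_def split: if_splits)
      from lattice_diff[OF this] not show False by simp
    qed
    have ms: "mfam (\<lambda>k y. single r ?f k (y + s))" "mfam (\<lambda>k y. single r ?f k (y + s'))"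
      by (intro mfam_shift m)+
    have "V (single r (\<lambda>_. 1)) l 0 \<le> V (\<lambda>k y. single r ?f k (y + s) + single r ?f k (y + s')) l 0"
      by (rule V.mono) (auto intro!: mfam_single mfam_add ms, auto simp: single_def ge)
    also have "\<dots> = ?e l (0 + s) + ?e l (0 + s')"
      by (simp only: V.add[OF ms] V.shift[OF m])
    also have "\<dots> = 0" using that by simp
    finally show False using V_single_r_pos[of l 0] by simp
  qed
  \<comment> \<open>\<open>- \<tau> k\<close> reduced modulo \<open>d\<close>; the sign fits steps
    from \<open>k\<close> to \<open>l\<close> lying in \<open>\<gamma> l - \<gamma> k\<close> plus
    the lattice.\<close>
  define \<gamma> where "\<gamma> k = - \<tau> k - d * of_int \<lfloor>- \<tau> k / d\<rfloor>" for k
  have "\<gamma> k \<in> {0..<d}" for k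
    using floor_divide_lower[OF d, of "- \<tau> k"] floor_divide_upper[OF d, of "- \<tau> k"]
    by (auto simp: \<gamma>_def algebra_simps)
  moreover have "measure (F k l) (range (\<lambda>m::int. \<gamma> l - \<gamma> k + d * of_int m)) = 1"
    if "u k * q k l * v l > 0" for k l
  proof -
    interpret Fkl: real_distribution "F k l" by (rule F)
    have q: "q k l > 0" using that u_pos[of k] v_pos[of l] q_nonneg[of k l] by (auto simp: less_le)
    have "P ?e k (\<tau> k) \<le> ?e k (\<tau> k)" using P.pow_pot_le[OF m, of 1] by simp
    then have "csum (\<lambda>l. ennreal (q k l) * mconv (F k l) (?e l) (\<tau> k)) = 0" by (simp add: step_op_def \<tau>)
    then have "ennreal (q k l) * mconv (F k l) (?e l) (\<tau> k) = 0"
      by (subst (asm) nn_integral_0_iff_AE) (auto simp: AE_count_space)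
    then have "mconv (F k l) (?e l) (\<tau> k) = 0" using q by simp
    from nn_integral_eq_0_AE[OF F_finite mfamD[OF em] this]
    have "AE x in F k l. x \<in> range (\<lambda>m::int. \<gamma> l - \<gamma> k + d * of_int m)"
    proof eventually_elim
      case (elim x)
      from coset[OF elim \<tau>] obtain j :: int where j: "\<tau> k - x - \<tau> l = d * of_int j"
        by (auto simp: lattice_def)
      have "x = \<gamma> l - \<gamma> k + d * of_int (\<lfloor>- \<tau> l / d\<rfloor> - \<lfloor>- \<tau> k / d\<rfloor> - j)"
        using j by (simp add: \<gamma>_def algebra_simps)
      then show ?case by blast
    qed
    then show ?thesis
      by (subst Fkl.prob_eq_1) (simp_all add: Fkl.sets_eq_borel coset_borel)
  qed
  ultimately show ?thesis using d unfolding lattice_span_def by blast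
qed

text \<open>\<open>nonarithmetic\<close> denies a largest span, so one span \<open>d\<close> is not
  yet a contradiction. An atom \<open>z \<noteq> 0\<close> of \<open>H\<close> forces every span to
  be \<open>\<bar>z\<bar>\<close> divided by a natural number, and the least such number gives a
  largest span.\<close>

lemma H_nonarithmetic:
  assumes nonar: "nonarithmetic q u v F" and drift: "H.mean_neg < H.mean_pos" and d: "d > 0"
  shows "H.prob (range (\<lambda>k::int. d * of_int k)) < 1"
proof (rule ccontr)
  assume "\<not> ?thesis"
  then have lat: "H.prob (lattice d) = 1"
    using H.prob_le_1[of "lattice d"] unfolding lattice_def by linarith
  \<comment> \<open>A law concentrated at 0 would have \<open>mean_pos = 0\<close>, against the
    drift; hence the lattice carries an atom other than 0.\<close>
  have z0: "H.prob {0} < 1"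
  proof (rule ccontr)
    assume "\<not> H.prob {0} < 1"
    then have "H.prob {0} = 1" using H.prob_le_1[of "{0}"] by simp
    then have "AE x in H. x = 0" by (subst (asm) H.prob_eq_1) (auto simp: H.sets_eq_borel)
    then have "AE x in H. ennreal (max x 0) = 0" by eventually_elim simp
    then have "H.mean_pos = 0" unfolding H.mean_pos_eq by (rule nn_integral_zero')
    then show False using drift by simp
  qed
  have "\<exists>z\<in>lattice d. z \<noteq> 0 \<and> H.prob {z} > 0"
  proof (rule ccontr)
    assume "\<not> ?thesis"
    then have null: "{z} \<in> null_sets H" if "z \<in> lattice d - {0}" for z
      using that by (auto simp: null_sets_def H.sets_eq_borel H.emeasure_eq_measure less_le)
    have "countable (lattice d - {0})" by (auto simp: lattice_def)
    then have "(\<Union>z\<in>lattice d - {0}. {z}) \<in> null_sets H" by (rule null_sets_UN') (rule null)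
    then have "H.prob (lattice d - {0}) = 0" by (simp add: measure_def null_sets_def)
    moreover have "H.prob (lattice d) = H.prob ({0} \<union> (lattice d - {0}))"
      using lattice_zero[of d] by (intro arg_cong[where f = H.prob]) auto
    moreover have "\<dots> \<le> H.prob {0} + H.prob (lattice d - {0})"
      by (rule measure_Un_le) (auto simp: H.sets_eq_borel)
    ultimately show False using lat z0 by simp
  qed
  then obtain z where z: "z \<noteq> 0" "H.prob {z} > 0" by blast
  define Q where "Q n \<longleftrightarrow> n \<ge> 1 \<and> lattice_span q u v F (\<bar>z\<bar> / real n)" for n :: nat
  have multiple: "\<exists>n. Q n \<and> d' = \<bar>z\<bar> / real n" if span: "lattice_span q u v F d'" for d'
  proof -
    have d': "d' > 0" using span by (simp add: lattice_span_def)
    have "z \<in> lattice d'"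
    proof (rule ccontr)
      assume "z \<notin> lattice d'"
      then have "H.prob ({z} \<union> lattice d') = H.prob {z} + H.prob (lattice d')"
        by (intro H.finite_measure_Union) (auto simp: H.sets_eq_borel)
      then show False using H.prob_le_1[of "{z} \<union> lattice d'"] z(2) span_imp_H_lattice[OF span] by simp
    qed
    then obtain k :: int where k: "z = d' * of_int k" by (auto simp: lattice_def)
    define n where "n = nat \<bar>k\<bar>"
    have "k \<noteq> 0" using k z(1) by auto
    then have n: "n \<ge> 1" by (simp add: n_def)
    have "\<bar>z\<bar> = d' * real n" using d' by (simp add: k abs_mult n_def)
    then have "d' = \<bar>z\<bar> / real n" using n by simp
    then show ?thesis using n span by (auto simp: Q_def)
  qed
  have "lattice_span q u v F d" by (rule H_lattice_imp_span[OF d lat])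
  then obtain n where "Q n" using multiple by blast
  define n0 where "n0 = (LEAST n. Q n)"
  have n0: "Q n0" "\<And>n. Q n \<Longrightarrow> n0 \<le> n"
    unfolding n0_def using \<open>Q n\<close> by (auto intro: LeastI Least_le)
  have "d_arithmetic q u v F (\<bar>z\<bar> / real n0)"
    unfolding d_arithmetic_def
  proof (intro conjI allI impI)
    show "lattice_span q u v F (\<bar>z\<bar> / real n0)" using n0(1) by (simp add: Q_def)
    fix d' assume "lattice_span q u v F d'"
    from multiple[OF this] obtain n where n: "Q n" "d' = \<bar>z\<bar> / real n" by blast
    then show "d' \<le> \<bar>z\<bar> / real n0"
      using n0(2)[OF n(1)] n0(1) by (simp add: Q_def frac_le)
  qed
  with nonar show False by (auto simp: nonarithmetic_def)
qed

end

section \<open>The matrix renewal measure\<close>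

text \<open>Both measures agree on half-open intervals. This links the Stieltjes measures of the
  definitions with the measures recovered from operators.\<close>

lemma interval_measure_eqI:
  assumes M: "finite_borel_measure M" and G: "\<And>t. emeasure M {..t} = ennreal (G t)" "\<And>t. 0 \<le> G t"
  shows "interval_measure G = M"
proof -
  interpret finite_borel_measure M by fact
  have "G t = cdf M t" for t using G by (simp add: cdf_def measure_def)
  then have G_eq: "G = cdf M" by auto
  have Ioc: "emeasure (interval_measure G) {a<..b} = emeasure M {a<..b}" for a b
  proof (cases "a \<le> b")
    case True
    then show ?thesis unfolding G_eq
      by (subst emeasure_interval_measure_Ioc) (auto intro: cdf_nondecreasing cdf_is_right_cont simp: emeasure_Ioc)
  qed simp
  show ?thesis
  proof (rule measure_eqI_generator_eq)
    show "Int_stable (range (\<lambda>(a, b). {a<..b::real}))" by (auto simp: Int_stable_def)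
    show "range (\<lambda>(a, b). {a<..b::real}) \<subseteq> Pow UNIV" by auto
    show "sets (interval_measure G) = sigma_sets UNIV (range (\<lambda>(a, b). {a<..b}))"
      by (simp add: borel_sigma_sets_Ioc)
    show "sets M = sigma_sets UNIV (range (\<lambda>(a, b). {a<..b}))"
      by (simp add: M_is_borel borel_sigma_sets_Ioc)
    show "range (\<lambda>n::nat. {- real n<..real n}) \<subseteq> range (\<lambda>(a, b). {a<..b::real})" by auto
    show "(\<Union>n::nat. {- real n<..real n}) = UNIV" by (rule UN_Ioc_eq_UNIV)
    show "emeasure (interval_measure G) X = emeasure M X" if "X \<in> range (\<lambda>(a, b). {a<..b})" for X
      using that Ioc by auto
    show "emeasure (interval_measure G) {- real n<..real n} \<noteq> \<infinity>" for n using Ioc by simp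
  qed
qed

context recurrent_chain begin

lemma conv_power_nonneg: "0 \<le> conv_power q F n i j t"
  using conv_power_props(1)[of q v F, OF q_nonneg right F] by blast

lemma conv_power_le: "conv_power q F n i j t \<le> mat_power q n i j"
  using conv_power_props(1)[of q v F, OF q_nonneg right F] by blast

text \<open>The recursion of \<open>conv_power\<close> is the action of \<open>P\<close> on
  Heaviside steps, once its integrals and sums are known to converge.\<close>

lemma P_pow_conv_power: "(P ^^ n) (single j (indicator {0..})) i t = ennreal (conv_power q F n i j t)"
proof (induction n arbitrary: i t)
  case 0
  then show ?case by (simp add: single_def)
next
  case (Suc n)
  have step: "mconv (F i k) (\<lambda>t. ennreal (conv_power q F n k j t)) t =
      ennreal (LINT x|F i k. conv_power q F n k j (t - x))" for k
  proof -
    interpret real_distribution "F i k" by (rule F)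
    have mono: "mono (conv_power q F n k j)" by (rule conv_power_props(2)[OF q_nonneg right F])
    have "mconv (F i k) (\<lambda>t. ennreal (conv_power q F n k j t)) t = ennreal (avg (F i k) (conv_power q F n k j) t)"
      by (rule ennreal_avg[OF borel_measurable_mono[OF mono] conv_power_nonneg conv_power_le])
    then show ?thesis by (simp add: avg_def)
  qed
  have nn: "0 \<le> (LINT x|F i k. conv_power q F n k j (t - x))" for k
    by (simp add: conv_power_nonneg)
  have le: "(LINT x|F i k. conv_power q F n k j (t - x)) \<le> mat_power q n k j" for k
  proof -
    interpret real_distribution "F i k" by (rule F)
    have "mono (conv_power q F n k j)" by (rule conv_power_props(2)[OF q_nonneg right F])
    then have "\<bar>avg (F i k) (conv_power q F n k j) t\<bar> \<le> mat_power q n k j"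
      using conv_power_nonneg conv_power_le by (intro avg_bounded borel_measurable_mono) auto
    then show ?thesis by (simp add: avg_def)
  qed
  have sm: "(\<lambda>k. q i k * (LINT x|F i k. conv_power q F n k j (t - x))) summable_on UNIV"
    by (rule summable_on_comparison_test[OF mat_power_bounds(2)[OF q_nonneg right, of i n j]])
       (auto intro!: mult_left_mono mult_nonneg_nonneg le nn q_nonneg)
  have "(P ^^ n) (single j (indicator {0..})) = (\<lambda>k t. ennreal (conv_power q F n k j t))"
    using Suc by auto
  then have "(P ^^ Suc n) (single j (indicator {0..})) i t =
      csum (\<lambda>k. ennreal (q i k * (LINT x|F i k. conv_power q F n k j (t - x))))"
    by (simp add: step_op_def step ennreal_mult q_nonneg nn)
  also have "\<dots> = ennreal (\<Sum>\<^sub>\<infinity>k. q i k * (LINT x|F i k. conv_power q F n k j (t - x)))"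
    by (rule csum_has_sum[OF has_sum_infsum[OF sm]]) (simp add: q_nonneg nn)
  finally show ?case by simp
qed

lemma P_pow_measure:
  "\<exists>M. finite_borel_measure M \<and> emeasure M UNIV = ennreal (mat_power q n i j) \<and>
     (\<forall>f\<in>borel_measurable borel. \<forall>t. (P ^^ n) (single j f) i t = mconv M f t) \<and>
     interval_measure (conv_power q F n i j) = M"
proof -
  obtain M where M: "sets M = sets borel"
    "\<And>f t. f \<in> borel_measurable borel \<Longrightarrow> (P ^^ n) (single j f) i t = mconv M f t"
    using kernel_op.ex_measure[OF kernel_op_funpow[OF P.kernel_op_axioms], of n j i] by blast
  have mass: "emeasure M UNIV = ennreal (mat_power q n i j)"
    using M(2)[of "\<lambda>_. 1" 0] by (simp add: P_pow_mat mconv_const[OF M(1)])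
  have fin: "finite_borel_measure M"
    using mass sets_eq_imp_space_eq[OF M(1)] by (intro finite_borel_measureI finite_measureI M) simp
  have "interval_measure (conv_power q F n i j) = M"
  proof (rule interval_measure_eqI[OF fin _ conv_power_nonneg])
    fix t :: real
    have "(\<lambda>x. indicator {0..} (t - x) :: ennreal) = indicator {..t}"
      by (auto simp: indicator_def fun_eq_iff)
    then have "mconv M (indicator {0..}) t = emeasure M {..t}" by (simp add: mconv_def M(1))
    then show "emeasure M {..t} = ennreal (conv_power q F n i j t)"
      using M(2)[of "indicator {0..}" t] by (simp add: P_pow_conv_power)
  qed
  with fin mass M(2) show ?thesis by blast
qed

text \<open>The bridge from the renewal measure to the operators: the measure representing
  \<open>V\<close> has the same series of convolution powers on every Borel set.\<close>

lemma nn_integral_renewal_measure: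
  assumes f: "f \<in> borel_measurable borel"
  shows "(\<integral>\<^sup>+x. f (t - x) \<partial>renewal_measure q F i j) = V (single j f) i t"
proof -
  obtain M where M: "sets M = sets borel"
    "\<And>f t. f \<in> borel_measurable borel \<Longrightarrow> V (single j f) i t = mconv M f t"
    using V.ex_measure[of j i] by blast
  have "renewal_measure q F i j = M"
  proof (rule measure_eqI)
    fix A assume "A \<in> sets (renewal_measure q F i j)"
    then have A [measurable]: "A \<in> sets borel" by simp
    have g: "(\<lambda>x. indicator A (- x) :: ennreal) \<in> borel_measurable borel" by measurable
    have eq: "mconv N (\<lambda>x. indicator A (- x)) 0 = emeasure N A" if "sets N = sets borel" for N
      using that by (simp add: mconv_def)
    have "emeasure M A = V (single j (\<lambda>x. indicator A (- x))) i 0" by (simp add: M(2)[OF g] eq M(1))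
    also have "\<dots> = (\<Sum>n. emeasure (interval_measure (conv_power q F n i j)) A)"
      unfolding pot_def
    proof (rule suminf_cong)
      fix n
      obtain N where N: "finite_borel_measure N"
        "\<And>f t. f \<in> borel_measurable borel \<Longrightarrow> (P ^^ n) (single j f) i t = mconv N f t"
        "interval_measure (conv_power q F n i j) = N" using P_pow_measure[of n i j] by blast
      show "(P ^^ n) (single j (\<lambda>x. indicator A (- x))) i 0 = emeasure (interval_measure (conv_power q F n i j)) A"
        unfolding N(3) N(2)[OF g] by (rule eq) (rule finite_borel_measure.M_is_borel[OF N(1)])
    qed
    finally show "emeasure (renewal_measure q F i j) A = emeasure M A"
      by (simp add: emeasure_renewal_measure[OF A])
  qed (simp add: M(1))
  then show ?thesis using M(2)[OF f] by (simp add: mconv_def)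
qed

end

section \<open>Spread-out return laws\<close>

context excursion begin

text \<open>If all powers of \<open>H\<close> were singular, one Lebesgue null set \<open>Z\<close>
  would carry them all, and from some point \<open>(k, s)\<close> the visits to \<open>r\<close>
  would avoid its complement. From almost every position in \<open>l\<close>, however, visits off
  \<open>Z\<close> have positive weight, so the n-step measure from \<open>k\<close> to
  \<open>l\<close> would be carried by a null set.\<close>

lemma H_spread_out:
  assumes spread: "spread_out q u v F"
  shows "\<exists>m N. real_distribution N \<and> (\<forall>f\<in>borel_measurable borel. mpow H m f = mconv N f) \<and> \<not> lebesgue_singular N"
proof (rule ccontr)
  assume no: "\<not> ?thesis"
  obtain n k l where nkl: "u k * mat_power q n k l * v l > 0"
    "\<not> lebesgue_singular (normalized_conv_power q F n k l)"
    using spread by (auto simp: spread_out_def)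
  have "\<forall>m. \<exists>N. real_distribution N \<and> (\<forall>f\<in>borel_measurable borel. mpow H m f = mconv N f)"
    using H.mpow_distribution by blast
  then obtain N where N: "\<And>m. real_distribution (N m)"
    "\<And>m f. f \<in> borel_measurable borel \<Longrightarrow> mpow H m f = mconv (N m) f" by metis
  have "\<forall>m. lebesgue_singular (N m)" using no N by blast
  then obtain S where S: "\<And>m. S m \<in> sets borel" "\<And>m. emeasure lborel (S m) = 0" "\<And>m. emeasure (N m) (- S m) = 0"
    unfolding lebesgue_singular_def by metis
  define Z where "Z = (\<Union>m. S m)"
  have Z [measurable]: "Z \<in> sets borel" unfolding Z_def using S(1) by auto
  have Z0: "emeasure lborel Z = 0" unfolding Z_def by (rule emeasure_UN_eq_0) (use S in auto)
  \<comment> \<open>The sign turns the position \<open>0 - x\<close> of the walk started at 0 into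
    the displacement \<open>x\<close>.\<close>
  define f :: "real \<Rightarrow> ennreal" where "f t = indicator (- Z) (- t)" for t
  define f' :: "real \<Rightarrow> ennreal" where "f' t = indicator Z (- t)" for t
  have [measurable]: "f \<in> borel_measurable borel" "f' \<in> borel_measurable borel"
    unfolding f_def[abs_def] f'_def[abs_def] by measurable
  have "mpow H m f 0 = 0" for m
  proof -
    interpret Nm: real_distribution "N m" by (rule N)
    have "mpow H m f 0 = emeasure (N m) (- Z)" by (simp add: N(2) mconv_def f_def Nm.sets_eq_borel)
    also have "\<dots> \<le> emeasure (N m) (- S m)"
      by (rule emeasure_mono) (use S(1)[of m] in \<open>auto simp: Z_def Nm.sets_eq_borel\<close>)
    finally show ?thesis using S(3)[of m] by simp
  qed
  then have "V (single r f) r 0 = 0" by (simp add: V_single_r rpot_def)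
  let ?e = "V (single r f)"
  have m: "mfam (single r f)" by (rule mfam_single) measurable
  have em: "mfam ?e" by (rule V.meas[OF m])
  note [measurable] = mfamD[OF em]
  obtain s where s: "?e k s = 0" using zero_reach[OF _ \<open>V (single r f) r 0 = 0\<close>, of k] by auto
  have "(P ^^ n) (single l (?e l)) k s \<le> (P ^^ n) ?e k s"
    by (rule kernel_op.mono[OF kernel_op_funpow[OF P.kernel_op_axioms]])
       (auto intro!: mfam_single mfamD em, simp add: single_def)
  also have "\<dots> \<le> ?e k s" by (rule P.pow_pot_le[OF m])
  finally have 0: "(P ^^ n) (single l (?e l)) k s = 0" using s by simp
  obtain \<Lambda> where \<Lambda>: "finite_borel_measure \<Lambda>" "emeasure \<Lambda> UNIV = ennreal (mat_power q n k l)"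
    "\<And>f t. f \<in> borel_measurable borel \<Longrightarrow> (P ^^ n) (single l f) k t = mconv \<Lambda> f t"
    "interval_measure (conv_power q F n k l) = \<Lambda>" using P_pow_measure[of n k l] by blast
  interpret \<Lambda>: finite_borel_measure \<Lambda> by fact
  obtain b where b: "0 < mat_power q b l r" using reach by blast
  obtain \<Theta> where \<Theta>: "finite_borel_measure \<Theta>" "emeasure \<Theta> UNIV = ennreal (mat_power q b l r)"
    "\<And>f t. f \<in> borel_measurable borel \<Longrightarrow> (P ^^ b) (single r f) l t = mconv \<Theta> f t"
    using P_pow_measure[of b l r] by blast
  interpret \<Theta>: finite_borel_measure \<Theta> by fact
  have "(\<integral>\<^sup>+t. f' t \<partial>lborel) = 0"
    using nn_integral_lborel_reflect[of "indicator Z" 0] Z0 by (simp add: f'_def)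
  \<comment> \<open>Averaged over Lebesgue measure the translates of a null set have
    \<open>\<Theta>\<close>-measure 0, hence so do almost all of them; for those \<open>t\<close>
    the whole mass of \<open>\<Theta>\<close> lies in the complement.\<close>
  then have "(\<integral>\<^sup>+t. mconv \<Theta> f' t \<partial>lborel) = 0" by (simp add: nn_integral_mconv_lborel[OF \<Theta>(1)])
  then have "AE t in lborel. mconv \<Theta> f' t = 0" by (subst (asm) nn_integral_0_iff_AE) auto
  then have nz: "AE t in lborel. ?e l t \<noteq> 0"
  proof eventually_elim
    case (elim t)
    have "(\<lambda>t. f t + f' t) = (\<lambda>_. 1)" by (auto simp: f_def f'_def indicator_def)
    then have "mconv \<Theta> f t + mconv \<Theta> f' t = mconv \<Theta> (\<lambda>_. 1) t" by (simp flip: \<Theta>.mconv_add)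
    then have "mconv \<Theta> f t = ennreal (mat_power q b l r)"
      using elim \<Theta>(2) by (simp add: mconv_const[OF \<Theta>.M_is_borel])
    then have "0 < (P ^^ b) (single r f) l t" using b by (simp add: \<Theta>(3))
    also have "\<dots> \<le> ?e l t" by (rule P.pow_le_pot)
    finally show ?case by simp
  qed
  define Bs where "Bs = {x. ?e l (s - x) = 0}"
  have Bs [measurable]: "Bs \<in> sets borel" unfolding Bs_def by measurable
  have "emeasure lborel Bs = 0"
  proof -
    have "emeasure lborel Bs = (\<integral>\<^sup>+x. indicator {t. ?e l t = 0} (s - x) \<partial>lborel)"
    proof -
      have "(\<lambda>x. indicator {t. ?e l t = 0} (s - x) :: ennreal) = indicator Bs"
        by (auto simp: Bs_def indicator_def fun_eq_iff)
      then show ?thesis by simp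
    qed
    also have "\<dots> = (\<integral>\<^sup>+t. indicator {t. ?e l t = 0} t \<partial>lborel)"
      by (rule nn_integral_lborel_reflect) measurable
    also have "\<dots> = 0" by (rule nn_integral_zero') (use nz in \<open>auto elim!: eventually_mono\<close>)
    finally show ?thesis .
  qed
  moreover have "emeasure \<Lambda> (- Bs) = 0"
  proof -
    have "AE x in \<Lambda>. ?e l (s - x) = 0"
      using 0 by (intro nn_integral_eq_0_AE[OF \<Lambda>(1) mfamD[OF em]]) (simp add: \<Lambda>(3))
    then have "AE x in \<Lambda>. x \<notin> - Bs" by eventually_elim (simp add: Bs_def)
    then show ?thesis by (subst (asm) AE_iff_measurable[of "- Bs"]) (auto simp: \<Lambda>.M_is_borel \<Lambda>.borel_UNIV)
  qed
  moreover have "normalized_conv_power q F n k l = scale_measure (ennreal (1 / mat_power q n k l)) \<Lambda>"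
    unfolding normalized_conv_power_def
  proof (rule interval_measure_eqI)
    have mp: "0 \<le> mat_power q n k l" using mat_power_bounds(1)[OF q_nonneg right] by blast
    show "finite_borel_measure (scale_measure (ennreal (1 / mat_power q n k l)) \<Lambda>)"
      by (intro finite_borel_measureI finite_measureI)
         (auto simp: \<Lambda>.M_is_borel ennreal_mult_eq_top_iff)
    fix t :: real
    show "0 \<le> conv_power q F n k l t / mat_power q n k l" by (simp add: conv_power_nonneg mp)
    have "(\<lambda>x. indicator {0..} (t - x) :: ennreal) = indicator {..t}"
      by (auto simp: indicator_def fun_eq_iff)
    then have "emeasure \<Lambda> {..t} = mconv \<Lambda> (indicator {0..}) t" by (simp add: mconv_def \<Lambda>.M_is_borel)
    also have "\<dots> = ennreal (conv_power q F n k l t)" by (simp add: \<Lambda>(3)[symmetric] P_pow_conv_power)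
    finally show "emeasure (scale_measure (ennreal (1 / mat_power q n k l)) \<Lambda>) {..t} =
        ennreal (conv_power q F n k l t / mat_power q n k l)"
      using mp conv_power_nonneg by (simp add: ennreal_mult[symmetric] mult.commute)
  qed
  ultimately have "lebesgue_singular (normalized_conv_power q F n k l)"
    unfolding lebesgue_singular_def by (intro bexI[of _ Bs]) auto
  with nkl(2) show False by simp
qed

end

section \<open>The Markov renewal theorem\<close>

lemma csum_ge: "f j \<le> csum f" for j :: "'a::countable"
proof -
  have "f j = csum (\<lambda>k. if k = j then f k else 0)" by (simp add: csum_delta)
  also have "\<dots> \<le> csum f" by (intro nn_integral_mono) auto
  finally show ?thesis .
qed

lemma csum_enn2real:
  assumes "csum a < \<infinity>"
  shows "((\<lambda>j. enn2real (a j)) has_sum enn2real (csum a)) (UNIV :: 'a::countable set)"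
proof (rule csum_eq_has_sum)
  have "a j < \<top>" for j using le_less_trans[OF csum_ge[of a j]] assms by simp
  then show "csum (\<lambda>j. ennreal (enn2real (a j))) = ennreal (enn2real (csum a))" using assms by simp
qed auto

lemma csum_ennreal_less_top:
  assumes "csum (\<lambda>j. ennreal (w j) * a j) < \<infinity>" "0 < w j"
  shows "a (j::'a::countable) < \<infinity>"
proof -
  have "ennreal (w j) * a j < \<top>"
    using le_less_trans[OF csum_ge[of "\<lambda>j. ennreal (w j) * a j" j]] assms(1) by simp
  then show ?thesis using assms(2) by (auto simp: ennreal_mult_less_top)
qed

lemma has_sum_diff:
  fixes f g :: "'a \<Rightarrow> real"
  assumes "(f has_sum a) A" "(g has_sum b) A"
  shows "((\<lambda>x. f x - g x) has_sum (a - b)) A"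
  using has_sum_add[OF assms(1), of "\<lambda>x. - g x" "- b"] assms(2) by (simp add: has_sum_uminus)

lemma real_integral_eq_parts:
  assumes "integrable M f"
  shows "(LINT x|M. f x) = enn2real (\<integral>\<^sup>+x. ennreal (max (f x) 0) \<partial>M) - enn2real (\<integral>\<^sup>+x. ennreal (max (- f x) 0) \<partial>M)"
proof -
  have "ennreal (max y 0) = ennreal y" for y by (simp add: max_def ennreal_neg)
  then show ?thesis using real_lebesgue_integral_def[OF assms] by simp
qed

text \<open>The common interface of the two classes of integrands: what is used of \<open>g\<close>
  once the renewal theorem for the return law has been applied to each component. The bounds
  \<open>b\<close> dominate the sum over states.\<close>

definition (in recurrent_chain) admissible :: "'s \<Rightarrow> ('s \<Rightarrow> real \<Rightarrow> real) \<Rightarrow> bool" where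
  "admissible r g \<longleftrightarrow>
     (\<forall>j. g j \<in> borel_measurable borel) \<and>
     csum (\<lambda>j. ennreal (u j) * (\<integral>\<^sup>+x. ennreal \<bar>g j x\<bar> \<partial>lborel)) < \<infinity> \<and>
     (\<exists>b. csum (\<lambda>j. ennreal (u j) * b j) < \<infinity> \<and>
       (\<forall>j t. rpot (excursion.H q F r) (\<lambda>x. ennreal \<bar>g j x\<bar>) t \<le> b j)) \<and>
     (\<forall>E c t j. drift_walk.direction (excursion.H q F r) E c \<longrightarrow> filterlim t E sequentially \<longrightarrow>
       (\<lambda>k. rpot (excursion.H q F r) (\<lambda>x. ennreal (max (g j x) 0)) (t k)) \<longlonglongrightarrow>
          c * (\<integral>\<^sup>+x. ennreal (max (g j x) 0) \<partial>lborel) \<and>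
       (\<lambda>k. rpot (excursion.H q F r) (\<lambda>x. ennreal (max (- g j x) 0)) (t k)) \<longlonglongrightarrow>
          c * (\<integral>\<^sup>+x. ennreal (max (- g j x) 0) \<partial>lborel))"

locale drifting_excursion = excursion q u v F r
  for q :: "'s::countable \<Rightarrow> 's \<Rightarrow> real" and u v :: "'s \<Rightarrow> real" and F :: "'s \<Rightarrow> 's \<Rightarrow> real measure" and r :: 's +
  assumes dex: "drift_exists q u v F" and dpos: "drift q u v F > 0" and nonar: "nonarithmetic q u v F"
begin

lemma uv_pos: "0 < u r * v r" using u_pos v_pos by simp

text \<open>If the negative part were infinite, \<open>drift_exists\<close> would keep the positive
  part finite and the drift would be \<open>- \<infinity>\<close>.\<close>

lemma drift_neg_finite: "drift_neg q u v F < \<infinity>"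
proof (rule ccontr)
  assume "\<not> ?thesis"
  then have "drift_neg q u v F = \<top>" using top.not_eq_extremum infinity_ennreal_def by metis
  moreover then have "drift_pos q u v F \<noteq> \<top>" using dex by (auto simp: drift_exists_def)
  ultimately show False using dpos by (cases "drift_pos q u v F") (auto simp: drift_def top_ereal_def enn2ereal_ennreal)
qed

lemma drift_neg_less: "drift_neg q u v F < drift_pos q u v F"
proof -
  obtain n where n: "drift_neg q u v F = ennreal n" "0 \<le> n"
    using drift_neg_finite by (cases "drift_neg q u v F") auto
  show ?thesis
  proof (cases "drift_pos q u v F")
    case (real p)
    then show ?thesis using dpos n by (simp add: drift_def enn2ereal_ennreal ennreal_less_iff)
  qed (simp add: n)
qed

lemma H_mean_neg_finite: "H.mean_neg < \<infinity>"
  using le_less_trans[OF mean_drift(2) drift_neg_finite] uv_pos by (auto simp: ennreal_mult_less_top)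

lemma H_drift: "H.mean_neg < H.mean_pos"
proof (rule ccontr)
  assume "\<not> ?thesis"
  then have "ennreal (u r * v r) * H.mean_pos \<le> ennreal (u r * v r) * H.mean_neg" by (intro mult_left_mono) auto
  then have "ennreal (u r * v r) * H.mean_pos + drift_neg q u v F \<le> ennreal (u r * v r) * H.mean_neg + drift_neg q u v F"
    by (rule add_right_mono)
  also have "\<dots> < ennreal (u r * v r) * H.mean_neg + drift_pos q u v F"
    using H_mean_neg_finite drift_neg_less
    by (auto simp: ennreal_add_left_cancel_less ennreal_mult_less_top less_top)
  finally show False using mean_drift(1) by simp
qed

sublocale H: drift_walk H
  by unfold_locales (use H_nonarithmetic[OF nonar H_drift] H_mean_neg_finite H_drift in auto)

definition "\<rho> = real_of_ereal (1 / drift q u v F)"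

lemma \<rho>_nonneg: "0 \<le> \<rho>"
  using dpos by (auto simp: \<rho>_def intro!: real_of_ereal_pos)

text \<open>By \<open>mean_drift\<close> the mean of \<open>H\<close> is the drift divided by
  \<open>u r * v r\<close>; for infinite drift both sides are 0.\<close>

lemma rate_eq: "H.rate = ennreal (u r * v r * \<rho>)"
proof -
  obtain n where n: "drift_neg q u v F = ennreal n" "0 \<le> n"
    using drift_neg_finite by (cases "drift_neg q u v F") auto
  obtain a where a: "H.mean_neg = ennreal a" "0 \<le> a"
    using H_mean_neg_finite by (cases "H.mean_neg") auto
  show ?thesis
  proof (cases "drift_pos q u v F")
    case (real p)
    have "H.mean_pos < \<infinity>"
    proof (rule ccontr)
      assume "\<not> ?thesis"
      then have "H.mean_pos = \<top>" using top.not_eq_extremum infinity_ennreal_def by metis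
      moreover have "u r \<noteq> 0" "v r \<noteq> 0" using u_pos[of r] v_pos[of r] by simp_all
      ultimately show False using mean_drift(1) uv_pos
        by (simp add: real a n ennreal_mult_top ennreal_mult[symmetric] ennreal_plus[symmetric] del: ennreal_plus)
    qed
    then obtain b where b: "H.mean_pos = ennreal b" "0 \<le> b" by (cases "H.mean_pos") auto
    have ab: "a < b" using H_drift a b by (simp add: ennreal_less_iff)
    have "ennreal (u r * v r * b + n) = ennreal (u r * v r * a + p)"
      using mean_drift(1) uv_pos real a b n by (simp add: ennreal_mult ennreal_plus)
    then have eq: "u r * v r * (b - a) = p - n"
      using uv_pos real a b n by (subst (asm) ennreal_inj) (auto simp: algebra_simps)
    have d: "drift q u v F = ereal (p - n)" using real n by (simp add: drift_def enn2ereal_ennreal)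
    have pn: "p - n > 0" using dpos d by simp
    have "\<rho> = 1 / (p - n)" using pn by (simp add: \<rho>_def d one_ereal_def)
    then have "u r * v r * \<rho> = (u r * v r * 1) / (u r * v r * (b - a))" by (simp add: eq)
    also have "\<dots> = 1 / (b - a)" using mult_divide_mult_cancel_left[OF less_imp_neq[OF uv_pos, symmetric]] .
    finally have \<rho>: "u r * v r * \<rho> = 1 / (b - a)" .
    have "H.mean_pos - H.mean_neg = ennreal (b - a)" using a b by (simp add: ennreal_minus)
    then show ?thesis using ab by (simp add: H.rate_def \<rho> inverse_ennreal inverse_eq_divide)
  next
    case top
    have "H.mean_pos = \<top>"
    proof (rule ccontr)
      assume "H.mean_pos \<noteq> \<top>"
      then obtain b where b: "H.mean_pos = ennreal b" "0 \<le> b" by (cases "H.mean_pos") auto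
      show False using mean_drift(1) uv_pos by (simp add: top b n ennreal_mult[symmetric] ennreal_plus[symmetric] del: ennreal_plus)
    qed
    moreover have "drift q u v F = \<infinity>" using top n by (simp add: drift_def top_ereal_def enn2ereal_ennreal)
    ultimately show ?thesis using a by (simp add: H.rate_def \<rho>_def ennreal_top_minus)
  qed
qed

lemma V_bound:
  assumes g: "mfam g" and b: "\<And>j t. rpot H (g j) t \<le> b j"
  shows "V (single j (g j)) r t \<le> occ j * b j"
proof -
  have "V (single j (g j)) r t = mconv (Occ j) (rpot H (g j)) t" by (rule V_single[OF mfamD[OF g]])
  also have "\<dots> \<le> mconv (Occ j) (\<lambda>_. b j) t" by (rule mconv_mono) (rule b)
  finally show ?thesis by (simp add: mconv_const[OF Occ(1)] occ_def mult.commute)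
qed

lemma occ_sum_finite:
  assumes "csum (\<lambda>j. ennreal (u j) * b j) < \<infinity>"
  shows "csum (\<lambda>j. occ j * b j) < \<infinity>"
proof -
  have "csum (\<lambda>j. occ j * b j) = csum (\<lambda>j. ennreal (1 / u r) * (ennreal (u j) * b j))"
    using u_pos[of r] u_pos by (intro nn_integral_cong) (simp add: occ_eq ennreal_mult[symmetric] mult.assoc[symmetric] less_imp_le)
  also have "\<dots> < \<infinity>" using assms by (simp add: nn_integral_cmult ennreal_mult_less_top)
  finally show ?thesis .
qed

text \<open>Dominated convergence twice: over the occupation measure of each state, and over the
  states with majorant \<open>occ j * b j\<close>.\<close>

lemma V_limit:
  assumes g: "mfam g" and b: "\<And>j t. rpot H (g j) t \<le> b j" and bs: "csum (\<lambda>j. ennreal (u j) * b j) < \<infinity>"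
    and E: "H.direction E c" and t: "filterlim t E sequentially"
    and lim: "\<And>j t. filterlim t E sequentially \<Longrightarrow> (\<lambda>k. rpot H (g j) (t k)) \<longlonglongrightarrow> y j"
  shows "(\<lambda>k. csum (\<lambda>j. V (single j (g j)) r (t k))) \<longlonglongrightarrow> csum (\<lambda>j. occ j * y j)"
proof (rule nn_integral_dominated_convergence[where w = "\<lambda>j. occ j * b j"])
  show "csum (\<lambda>j. occ j * b j) < \<infinity>" by (rule occ_sum_finite[OF bs])
  have "(\<lambda>k. V (single j (g j)) r (t k)) \<longlonglongrightarrow> occ j * y j" for j
  proof -
    have "(\<lambda>k. mconv (Occ j) (rpot H (g j)) (t k)) \<longlonglongrightarrow> y j * emeasure (Occ j) UNIV"
    proof (rule mconv_tendsto[OF Occ_finite _ b])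
      show "b j < \<infinity>" by (rule csum_ennreal_less_top[OF bs u_pos])
      show "rpot H (g j) \<in> borel_measurable borel" by (rule H.rpot_measurable[OF mfamD[OF g]])
      show "(\<lambda>k. rpot H (g j) (t k - x)) \<longlonglongrightarrow> y j" for x by (rule lim[OF H.direction_shift[OF E t]])
    qed
    then show ?thesis by (simp add: V_single[OF mfamD[OF g]] occ_def mult.commute)
  qed
  then show "AE j in count_space UNIV. (\<lambda>k. V (single j (g j)) r (t k)) \<longlonglongrightarrow> occ j * y j" by simp
  show "AE j in count_space UNIV. V (single j (g j)) r (t k) \<le> occ j * b j" for k
    using V_bound[OF g b] by simp
qed auto

lemma renewal_conv_limits:
  assumes adm: "admissible r g"
  shows "renewal_conv_exists q F g r t"
    and "bounded (range (renewal_conv q F g r))"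
    and "(renewal_conv q F g r \<longlongrightarrow> v r * \<rho> * (\<Sum>\<^sub>\<infinity>j. u j * (LINT x|lborel. g j x))) at_top"
    and "(renewal_conv q F g r \<longlongrightarrow> 0) at_bot"
proof -
  let ?R = "\<lambda>j. renewal_measure q F r j"
  define ga where "ga j x = ennreal \<bar>g j x\<bar>" for j x
  define gp where "gp j x = ennreal (max (g j x) 0)" for j x
  define gn where "gn j x = ennreal (max (- g j x) 0)" for j x
  have [measurable]: "g j \<in> borel_measurable borel" for j using adm by (simp add: admissible_def)
  have m: "mfam ga" "mfam gp" "mfam gn"
    unfolding mfam_def ga_def[abs_def] gp_def[abs_def] gn_def[abs_def] by auto
  obtain b where b: "csum (\<lambda>j. ennreal (u j) * b j) < \<infinity>" "\<And>j t. rpot H (ga j) t \<le> b j"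
    using adm by (auto simp: admissible_def ga_def[abs_def])
  have int: "csum (\<lambda>j. ennreal (u j) * (\<integral>\<^sup>+x. ga j x \<partial>lborel)) < \<infinity>"
    using adm by (simp add: admissible_def ga_def)
  have pn_le: "gp j x \<le> ga j x" "gn j x \<le> ga j x" for j x
    by (auto simp: gp_def gn_def ga_def intro!: ennreal_leI)
  have bp: "rpot H (gp j) t \<le> b j" and bn: "rpot H (gn j) t \<le> b j" for j t
    using rpot_mono[of "gp j" "ga j" H t] rpot_mono[of "gn j" "ga j" H t] pn_le b(2)[of j t]
    by (auto intro: order_trans)
  have R: "(\<integral>\<^sup>+x. f (t - x) \<partial>?R j) = V (single j f) r t" if "f \<in> borel_measurable borel" for f j t
    by (rule nn_integral_renewal_measure[OF that])
  have Va: "(\<integral>\<^sup>+x. ennreal \<bar>g j (t - x)\<bar> \<partial>?R j) = V (single j (ga j)) r t" for j t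
    using R[OF mfamD[OF m(1)], of j j t] by (simp add: ga_def)
  have Vp: "(\<integral>\<^sup>+x. ennreal (max (g j (t - x)) 0) \<partial>?R j) = V (single j (gp j)) r t" for j t
    using R[OF mfamD[OF m(2)], of j j t] by (simp add: gp_def)
  have Vn: "(\<integral>\<^sup>+x. ennreal (max (- g j (t - x)) 0) \<partial>?R j) = V (single j (gn j)) r t" for j t
    using R[OF mfamD[OF m(3)], of j j t] by (simp add: gn_def)
  define K where "K = csum (\<lambda>j. occ j * b j)"
  have K: "K < \<infinity>" unfolding K_def by (rule occ_sum_finite[OF b(1)])
  have le: "csum (\<lambda>j. V (single j (h j)) r t) \<le> K" if "mfam h" "\<And>j t. rpot H (h j) t \<le> b j" for h t
    unfolding K_def by (intro nn_integral_mono) (rule V_bound[OF that])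
  have fin: "csum (\<lambda>j. V (single j (h j)) r t) < \<infinity>" if "mfam h" "\<And>j t. rpot H (h j) t \<le> b j" for h t
    using le_less_trans[OF le[OF that] K] .
  have integrable: "integrable (?R j) (\<lambda>x. g j (t - x))" for j t
  proof (rule integrableI_bounded)
    have "V (single j (ga j)) r t < \<infinity>"
      using le_less_trans[OF csum_ge fin[OF m(1) b(2)]] by blast
    then show "(\<integral>\<^sup>+x. ennreal (norm (g j (t - x))) \<partial>?R j) < \<infinity>" by (simp add: Va)
  qed measurable
  have abs_int: "(LINT x|?R j. \<bar>g j (t - x)\<bar>) = enn2real (V (single j (ga j)) r t)" for j t
    using integral_eq_nn_integral[of "\<lambda>x. \<bar>g j (t - x)\<bar>" "?R j"] by (simp add: Va)
  show "renewal_conv_exists q F g r t" for t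
    unfolding renewal_conv_exists_def abs_int
    using integrable has_sum_imp_summable[OF csum_enn2real[OF fin[OF m(1) b(2)]]] by blast
  have conv: "renewal_conv q F g r t = enn2real (csum (\<lambda>j. V (single j (gp j)) r t)) - enn2real (csum (\<lambda>j. V (single j (gn j)) r t))" for t
  proof -
    have "((\<lambda>j. enn2real (V (single j (gp j)) r t) - enn2real (V (single j (gn j)) r t)) has_sum
        enn2real (csum (\<lambda>j. V (single j (gp j)) r t)) - enn2real (csum (\<lambda>j. V (single j (gn j)) r t))) UNIV"
      by (intro has_sum_diff csum_enn2real fin m bp bn)
    then show ?thesis
      unfolding renewal_conv_def real_integral_eq_parts[OF integrable] Vp Vn by (rule infsumI)
  qed
  show "bounded (range (renewal_conv q F g r))"
  proof (rule boundedI)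
    fix y assume "y \<in> range (renewal_conv q F g r)"
    then obtain t where y: "y = renewal_conv q F g r t" by auto
    have "enn2real (csum (\<lambda>j. V (single j (gp j)) r t)) \<le> enn2real K"
      "enn2real (csum (\<lambda>j. V (single j (gn j)) r t)) \<le> enn2real K"
      using K by (auto intro!: enn2real_mono le m bp bn)
    moreover have "0 \<le> enn2real (csum (\<lambda>j. V (single j (gp j)) r t))" "0 \<le> enn2real (csum (\<lambda>j. V (single j (gn j)) r t))" by auto
    ultimately show "norm y \<le> enn2real K" unfolding y conv real_norm_def by linarith
  qed
  have lim: "(\<lambda>k. renewal_conv q F g r (t k)) \<longlonglongrightarrow>
      enn2real (csum (\<lambda>j. occ j * (c * (\<integral>\<^sup>+x. gp j x \<partial>lborel)))) -
      enn2real (csum (\<lambda>j. occ j * (c * (\<integral>\<^sup>+x. gn j x \<partial>lborel))))"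
    if E: "H.direction E c" and t: "filterlim t E sequentially" for E c t
  proof -
    have part: "(\<lambda>k. enn2real (csum (\<lambda>j. V (single j (h j)) r (t k)))) \<longlonglongrightarrow> enn2real (csum (\<lambda>j. occ j * (c * (\<integral>\<^sup>+x. h j x \<partial>lborel))))"
      if h: "mfam h" "\<And>j t. rpot H (h j) t \<le> b j"
        and l: "\<And>j t. filterlim t E sequentially \<Longrightarrow> (\<lambda>k. rpot H (h j) (t k)) \<longlonglongrightarrow> c * (\<integral>\<^sup>+x. h j x \<partial>lborel)" for h
    proof -
      have L: "(\<lambda>k. csum (\<lambda>j. V (single j (h j)) r (t k))) \<longlonglongrightarrow> csum (\<lambda>j. occ j * (c * (\<integral>\<^sup>+x. h j x \<partial>lborel)))"
        by (rule V_limit[OF h b(1) E t l])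
      have "csum (\<lambda>j. occ j * (c * (\<integral>\<^sup>+x. h j x \<partial>lborel))) \<le> K"
        by (rule LIMSEQ_le_const2[OF L]) (use le[OF h] in auto)
      then have f: "csum (\<lambda>j. occ j * (c * (\<integral>\<^sup>+x. h j x \<partial>lborel))) < \<top>" using K by (simp add: le_less_trans)
      have "(\<lambda>k. ennreal (enn2real (csum (\<lambda>j. V (single j (h j)) r (t k))))) \<longlonglongrightarrow>
          ennreal (enn2real (csum (\<lambda>j. occ j * (c * (\<integral>\<^sup>+x. h j x \<partial>lborel)))))"
        using L f fin[OF h] by simp
      then show ?thesis by simp
    qed
    have adl: "(\<lambda>k. rpot H (gp j) (t k)) \<longlonglongrightarrow> c * (\<integral>\<^sup>+x. gp j x \<partial>lborel)"
       "(\<lambda>k. rpot H (gn j) (t k)) \<longlonglongrightarrow> c * (\<integral>\<^sup>+x. gn j x \<partial>lborel)" if "filterlim t E sequentially" for j t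
      using adm E that unfolding admissible_def gp_def[abs_def] gn_def[abs_def] by blast+
    show ?thesis unfolding conv
      by (intro tendsto_diff part m bp bn adl)
  qed
  have ifin: "(\<integral>\<^sup>+x. ga j x \<partial>lborel) < \<infinity>" for j by (rule csum_ennreal_less_top[OF int u_pos])
  have gi: "integrable lborel (g j)" for j
    by (rule integrableI_bounded) (use ifin[of j] in \<open>auto simp: ga_def\<close>)
  \<comment> \<open>\<open>u r\<close> cancels between the occupation mass \<open>u j / u r\<close>
    and the rate \<open>u r * v r * \<rho>\<close>.\<close>
  have val: "enn2real (csum (\<lambda>j. occ j * (H.rate * (\<integral>\<^sup>+x. gp j x \<partial>lborel)))) -
      enn2real (csum (\<lambda>j. occ j * (H.rate * (\<integral>\<^sup>+x. gn j x \<partial>lborel)))) = v r * \<rho> * (\<Sum>\<^sub>\<infinity>j. u j * (LINT x|lborel. g j x))"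
  proof -
    have pull: "enn2real (csum (\<lambda>j. occ j * (H.rate * (\<integral>\<^sup>+x. h j x \<partial>lborel)))) =
        v r * \<rho> * enn2real (csum (\<lambda>j. ennreal (u j) * (\<integral>\<^sup>+x. h j x \<partial>lborel)))" for h
    proof -
      have "occ j * (H.rate * y) = ennreal (v r * \<rho>) * (ennreal (u j) * y)" for j y
      proof -
        have "occ j * H.rate = ennreal (v r * \<rho>) * ennreal (u j)"
          unfolding occ_eq rate_eq using u_pos[of r] u_pos[of j] v_pos[of r] \<rho>_nonneg
          by (simp add: ennreal_mult[symmetric] less_imp_le)
        then show ?thesis by (simp add: mult.assoc[symmetric])
      qed
      then show ?thesis using v_pos[of r] \<rho>_nonneg
        by (simp add: nn_integral_cmult enn2real_mult less_imp_le)
    qed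
    have hs: "((\<lambda>j. u j * enn2real (\<integral>\<^sup>+x. h j x \<partial>lborel)) has_sum
        enn2real (csum (\<lambda>j. ennreal (u j) * (\<integral>\<^sup>+x. h j x \<partial>lborel)))) UNIV" if "\<And>j x. h j x \<le> ga j x" for h
    proof -
      have "csum (\<lambda>j. ennreal (u j) * (\<integral>\<^sup>+x. h j x \<partial>lborel)) \<le> csum (\<lambda>j. ennreal (u j) * (\<integral>\<^sup>+x. ga j x \<partial>lborel))"
        by (intro nn_integral_mono mult_left_mono that) auto
      from csum_enn2real[OF le_less_trans[OF this int]]
      show ?thesis using u_pos by (simp add: enn2real_mult less_imp_le)
    qed
    have "((\<lambda>j. u j * enn2real (\<integral>\<^sup>+x. gp j x \<partial>lborel) - u j * enn2real (\<integral>\<^sup>+x. gn j x \<partial>lborel)) has_sum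
        enn2real (csum (\<lambda>j. ennreal (u j) * (\<integral>\<^sup>+x. gp j x \<partial>lborel))) -
        enn2real (csum (\<lambda>j. ennreal (u j) * (\<integral>\<^sup>+x. gn j x \<partial>lborel)))) UNIV"
      by (intro has_sum_diff hs pn_le)
    moreover have "u j * (LINT x|lborel. g j x) = u j * enn2real (\<integral>\<^sup>+x. gp j x \<partial>lborel) - u j * enn2real (\<integral>\<^sup>+x. gn j x \<partial>lborel)" for j
      by (simp add: real_integral_eq_parts[OF gi] gp_def gn_def right_diff_distrib)
    ultimately have "(\<Sum>\<^sub>\<infinity>j. u j * (LINT x|lborel. g j x)) =
        enn2real (csum (\<lambda>j. ennreal (u j) * (\<integral>\<^sup>+x. gp j x \<partial>lborel))) -
        enn2real (csum (\<lambda>j. ennreal (u j) * (\<integral>\<^sup>+x. gn j x \<partial>lborel)))" by (simp add: infsumI)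
    then show ?thesis by (simp add: pull right_diff_distrib)
  qed
  show "(renewal_conv q F g r \<longlongrightarrow> v r * \<rho> * (\<Sum>\<^sub>\<infinity>j. u j * (LINT x|lborel. g j x))) at_top"
    unfolding val[symmetric]
    by (rule tendsto_at_topI_sequentially, rule lim[of at_top]) (auto simp: H.direction_def)
  have "((\<lambda>x. renewal_conv q F g r (- x)) \<longlongrightarrow> 0) at_top"
  proof (rule tendsto_at_topI_sequentially)
    fix X :: "nat \<Rightarrow> real" assume "filterlim X at_top sequentially"
    then have "filterlim (\<lambda>k. - X k) at_bot sequentially" by (simp add: filterlim_uminus_at_top)
    from lim[of at_bot 0, OF _ this] show "(\<lambda>k. renewal_conv q F g r (- X k)) \<longlonglongrightarrow> 0"
      by (simp add: H.direction_def)
  qed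
  then show "(renewal_conv q F g r \<longlongrightarrow> 0) at_bot" by (simp add: filterlim_at_bot_mirror)
qed

lemma H_admissible_dRi:
  assumes dri: "directly_Riemann_integrable u g"
  shows "admissible r g"
proof -
  have gm [measurable]: "g j \<in> borel_measurable borel" for j
    using dri measurable_Pair2[of "\<lambda>(i, x). g i x" "count_space UNIV" borel borel j]
    by (simp add: directly_Riemann_integrable_def measurable_family_def)
  have cont: "AE x in lborel. isCont (g j) x" for j using dri by (simp add: directly_Riemann_integrable_def)
  define ga where "ga j x = ennreal \<bar>g j x\<bar>" for j x
  have [measurable]: "ga j \<in> borel_measurable borel" for j unfolding ga_def[abs_def] by measurable
  obtain e where e: "e > 0" "csum (\<lambda>j. ennreal (u j) * csum (cell_sup e (ga j))) < \<infinity>"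
    using dri by (auto simp: directly_Riemann_integrable_def infsum_eq_csum cell_sup_def[abs_def] ga_def)
  have fin: "csum (cell_sup e (ga j)) < \<infinity>" for j by (rule csum_ennreal_less_top[OF e(2) u_pos])
  obtain n :: nat where n: "e < real n" using reals_Archimedean2 by blast
  have B: "of_nat n * H.B < \<infinity>"
    using H.B_finite by (simp add: ennreal_mult_less_top ennreal_of_nat_eq_real_of_nat)
  define b where "b j = of_nat n * H.B * csum (cell_sup e (ga j))" for j
  have "csum (\<lambda>j. ennreal (u j) * b j) = of_nat n * H.B * csum (\<lambda>j. ennreal (u j) * csum (cell_sup e (ga j)))"
    by (simp add: b_def nn_integral_cmult[symmetric] mult_ac)
  also have "\<dots> < \<infinity>" using B e(2) by (simp only: ennreal_mult_less_top infinity_ennreal_def) simp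
  finally have bs: "csum (\<lambda>j. ennreal (u j) * b j) < \<infinity>" .
  have bb: "rpot H (ga j) t \<le> b j" for j t unfolding b_def by (rule H.rpot_cell_bound[OF e(1) n])
  have "csum (\<lambda>j. ennreal (u j) * (\<integral>\<^sup>+x. ga j x \<partial>lborel)) \<le> csum (\<lambda>j. ennreal e * (ennreal (u j) * csum (cell_sup e (ga j))))"
  proof (rule nn_integral_mono)
    fix j
    have "(\<integral>\<^sup>+x. ga j x \<partial>lborel) \<le> (\<integral>\<^sup>+x. cell_step e (ga j) x \<partial>lborel)"
      by (intro nn_integral_mono cell_step_ge e)
    then have "(\<integral>\<^sup>+x. ga j x \<partial>lborel) \<le> ennreal e * csum (cell_sup e (ga j))" by (simp add: cell_step_integral[OF e(1)])
    then show "ennreal (u j) * (\<integral>\<^sup>+x. ga j x \<partial>lborel) \<le> ennreal e * (ennreal (u j) * csum (cell_sup e (ga j)))"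
      using mult_left_mono[of _ _ "ennreal (u j)"] by (fastforce simp: mult_ac)
  qed
  also have "\<dots> < \<infinity>" using e(2) by (simp add: nn_integral_cmult ennreal_mult_less_top)
  finally have gsum: "csum (\<lambda>j. ennreal (u j) * (\<integral>\<^sup>+x. ga j x \<partial>lborel)) < \<infinity>" .
  have lim: "(\<lambda>k. rpot H h (t k)) \<longlonglongrightarrow> c * (\<integral>\<^sup>+x. h x \<partial>lborel)"
    if E: "H.direction E c" "filterlim t E sequentially" and [measurable]: "h \<in> borel_measurable borel"
      and h: "\<And>x. h x \<le> ga j x" "\<And>x. isCont (g j) x \<Longrightarrow> isCont h x" for E c t h j
  proof (rule H.key_renewal_limit[OF E _ e(1)])
    have "cell_sup e h n \<le> cell_sup e (ga j) n" for n
      unfolding cell_sup_def by (rule SUP_mono) (use h(1) in blast)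
    then have "csum (cell_sup e h) \<le> csum (cell_sup e (ga j))" by (intro nn_integral_mono) auto
    then show "csum (cell_sup e h) < \<infinity>" using fin by (rule le_less_trans)
    show "AE x in lborel. isCont h x" using cont[of j] by eventually_elim (rule h(2))
  qed measurable
  show ?thesis
    unfolding admissible_def
  proof (intro conjI allI impI exI[of _ b] gm)
    show "csum (\<lambda>j. ennreal (u j) * (\<integral>\<^sup>+x. ennreal \<bar>g j x\<bar> \<partial>lborel)) < \<infinity>" using gsum by (simp add: ga_def)
    show "csum (\<lambda>j. ennreal (u j) * b j) < \<infinity>" by (rule bs)
    show "rpot H (\<lambda>x. ennreal \<bar>g j x\<bar>) t \<le> b j" for j t using bb by (simp add: ga_def[abs_def])
    fix E c t j assume E: "H.direction E c" "filterlim t E sequentially"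
    show "(\<lambda>k. rpot H (\<lambda>x. ennreal (max (g j x) 0)) (t k)) \<longlonglongrightarrow> c * (\<integral>\<^sup>+x. ennreal (max (g j x) 0) \<partial>lborel)"
      by (rule lim[OF E, of _ j]) (auto simp: ga_def isCont_def intro!: ennreal_leI tendsto_intros)
    show "(\<lambda>k. rpot H (\<lambda>x. ennreal (max (- g j x) 0)) (t k)) \<longlonglongrightarrow> c * (\<integral>\<^sup>+x. ennreal (max (- g j x) 0) \<partial>lborel)"
      by (rule lim[OF E, of _ j]) (auto simp: ga_def isCont_def intro!: ennreal_leI tendsto_intros)
  qed
qed

lemma H_admissible_spread:
  assumes spread: "spread_out q u v F" and wb: "weighted_bounded_L1 u g"
  shows "admissible r g"
proof -
  have gm [measurable]: "g j \<in> borel_measurable borel" for j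
    using wb measurable_Pair2[of "\<lambda>(i, x). g i x" "count_space UNIV" borel borel j]
    by (simp add: weighted_bounded_L1_def measurable_family_def)
  define ga where "ga j x = ennreal \<bar>g j x\<bar>" for j x
  have [measurable]: "ga j \<in> borel_measurable borel" for j unfolding ga_def[abs_def] by measurable
  obtain m N where N: "real_distribution N" "\<And>f. f \<in> borel_measurable borel \<Longrightarrow> mpow H m f = mconv N f"
    "\<not> lebesgue_singular N" using H_spread_out[OF spread] by blast
  obtain a b w where abw: "a < b" "w > 0" "\<And>f t. f \<in> borel_measurable borel \<Longrightarrow>
      ennreal w * mconv (density lborel (indicator {a..b})) f t \<le> mconv N (mconv N f) t"
    using nonsingular_convolution_minorant[OF real_distribution_finite_borel[OF N(1)] N(3)] by blast
  have NN: "mpow H (m + m) f = mconv N (mconv N f)" if [measurable]: "f \<in> borel_measurable borel" for f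
  proof -
    have "mconv N f \<in> borel_measurable borel"
      by (rule finite_borel_measure.mconv_measurable[OF real_distribution_finite_borel[OF N(1)] that])
    then show ?thesis by (simp add: mpow_add N(2))
  qed
  \<comment> \<open>The minorant is one for \<open>N\<close> convolved with itself, hence for
    \<open>m + m\<close> steps.\<close>
  interpret mw: minorized_walk H "m + m" w a b
    by unfold_locales (use abw in \<open>auto simp: NN\<close>)
  define S where "S j = (SUP x. ga j x)" for j
  have S: "csum (\<lambda>j. ennreal (u j) * S j) < \<infinity>" and I: "csum (\<lambda>j. ennreal (u j) * (\<integral>\<^sup>+x. ga j x \<partial>lborel)) < \<infinity>"
    using wb by (auto simp: weighted_bounded_L1_def infsum_eq_csum S_def ga_def)
  have Sfin: "S j < \<infinity>" and Ifin: "(\<integral>\<^sup>+x. ga j x \<partial>lborel) < \<infinity>" for j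
    using csum_ennreal_less_top[OF S u_pos] csum_ennreal_less_top[OF I u_pos] by auto
  define s where "s j = enn2real (S j)" for j
  have s: "ennreal (s j) = S j" for j using Sfin[of j] by (simp add: s_def)
  have ga_le: "ga j x \<le> ennreal (s j)" for j x unfolding s S_def by (rule SUP_upper) simp
  define bb where "bb j = mw.C * (ennreal (s j) + (\<integral>\<^sup>+x. ga j x \<partial>lborel))" for j
  have bs: "csum (\<lambda>j. ennreal (u j) * bb j) < \<infinity>"
  proof -
    have "csum (\<lambda>j. ennreal (u j) * bb j) = csum (\<lambda>j. mw.C * (ennreal (u j) * S j + ennreal (u j) * (\<integral>\<^sup>+x. ga j x \<partial>lborel)))"
      unfolding bb_def s by (intro nn_integral_cong) (simp add: distrib_left distrib_right mult_ac)
    also have "\<dots> = mw.C * (csum (\<lambda>j. ennreal (u j) * S j) + csum (\<lambda>j. ennreal (u j) * (\<integral>\<^sup>+x. ga j x \<partial>lborel)))"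
      by (simp add: nn_integral_cmult nn_integral_add)
    also have "\<dots> < \<infinity>" using S I mw.C_finite by (simp add: ennreal_mult_less_top)
    finally show ?thesis .
  qed
  have lim: "(\<lambda>k. rpot H h (t k)) \<longlonglongrightarrow> c * (\<integral>\<^sup>+x. h x \<partial>lborel)"
    if E: "H.direction E c" "filterlim t E sequentially" and hm: "h \<in> borel_measurable borel"
      and h: "\<And>x. h x \<le> ga j x" for E c t h j
  proof (rule mw.spread_out_limit[OF hm _ _ E])
    show "h x \<le> ennreal (s j)" for x using h ga_le by (rule order_trans)
    show "(\<integral>\<^sup>+x. h x \<partial>lborel) < \<infinity>" using nn_integral_mono[of lborel h "ga j"] h Ifin by (auto intro: le_less_trans)
    fix t :: "nat \<Rightarrow> real" assume t: "filterlim t E sequentially"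
    have "(g j \<longlongrightarrow> 0) at_infinity" using wb by (simp add: weighted_bounded_L1_def)
    moreover have "E \<le> at_infinity"
      using E(1) at_top_le_at_infinity at_bot_le_at_infinity by (auto simp: H.direction_def)
    ultimately have "(g j \<longlongrightarrow> 0) E" by (rule tendsto_mono[rotated])
    then have "(\<lambda>k. g j (t k)) \<longlonglongrightarrow> 0" using t by (rule filterlim_compose)
    then have "(\<lambda>k. ga j (t k)) \<longlonglongrightarrow> ennreal \<bar>0\<bar>" unfolding ga_def by (intro tendsto_intros)
    then show "(\<lambda>k. h (t k)) \<longlonglongrightarrow> 0"
      by (intro tendsto_sandwich[of "\<lambda>_. 0" "\<lambda>k. h (t k)" sequentially "\<lambda>k. ga j (t k)" 0]) (auto simp: h)
  qed
  show ?thesis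
    unfolding admissible_def
  proof (intro conjI allI impI exI[of _ bb] gm)
    show "csum (\<lambda>j. ennreal (u j) * (\<integral>\<^sup>+x. ennreal \<bar>g j x\<bar> \<partial>lborel)) < \<infinity>" using I by (simp add: ga_def)
    show "csum (\<lambda>j. ennreal (u j) * bb j) < \<infinity>" by (rule bs)
    have "rpot H (ga j) t \<le> bb j" for j t
      unfolding bb_def using mw.rpot_spread_le[of "ga j" "s j" t] ga_le Ifin by simp
    then show "rpot H (\<lambda>x. ennreal \<bar>g j x\<bar>) t \<le> bb j" for j t by (simp add: ga_def[abs_def])
    fix E c t j assume E: "H.direction E c" "filterlim t E sequentially"
    show "(\<lambda>k. rpot H (\<lambda>x. ennreal (max (g j x) 0)) (t k)) \<longlonglongrightarrow> c * (\<integral>\<^sup>+x. ennreal (max (g j x) 0) \<partial>lborel)"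
      by (rule lim[OF E, of _ j]) (auto simp: ga_def intro!: ennreal_leI)
    show "(\<lambda>k. rpot H (\<lambda>x. ennreal (max (- g j x) 0)) (t k)) \<longlonglongrightarrow> c * (\<integral>\<^sup>+x. ennreal (max (- g j x) 0) \<partial>lborel)"
      by (rule lim[OF E, of _ j]) (auto simp: ga_def intro!: ennreal_leI)
  qed
qed

end

theorem theorem1p3:
  fixes q :: "'s::countable \<Rightarrow> 's \<Rightarrow> real"
    and u v :: "'s \<Rightarrow> real"
    and F :: "'s \<Rightarrow> 's \<Rightarrow> real measure"
  assumes "quasi_stochastic q"
    and "positive_left_eigenvector q u"
    and "positive_right_eigenvector q v"
    and "\<And>i j. real_distribution (F i j)"
    and "\<exists>i. (\<Sum>n. ennreal (mat_power q (Suc n) i i)) = \<infinity>"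
    and "drift_exists q u v F"
    and "drift q u v F > 0"
    and "nonarithmetic q u v F"
  shows "\<forall>g :: 's \<Rightarrow> real \<Rightarrow> real.
    directly_Riemann_integrable u g \<or> (spread_out q u v F \<and> weighted_bounded_L1 u g) \<longrightarrow>
    (\<forall>i. (\<forall>t. renewal_conv_exists q F g i t) \<and>
         bounded (range (renewal_conv q F g i)) \<and>
         (renewal_conv q F g i \<longlongrightarrow>
            v i * real_of_ereal (1 / drift q u v F) *
              (\<Sum>\<^sub>\<infinity>j. u j * (LINT x|lborel. g j x))) at_top \<and>
         (renewal_conv q F g i \<longlongrightarrow> 0) at_bot)"
proof (intro allI impI)
  fix g :: "'s \<Rightarrow> real \<Rightarrow> real" and i
  assume g: "directly_Riemann_integrable u g \<or> (spread_out q u v F \<and> weighted_bounded_L1 u g)"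
  obtain w where w: "positive_left_eigenvector q w"
    "\<And>u'. positive_left_eigenvector q u' \<Longrightarrow> \<exists>c. \<forall>i. u' i = c * w i"
    using assms(1) unfolding quasi_stochastic_def by blast
  interpret recurrent_chain q u v F
  proof (rule recurrent_chain.intro)
    show "\<And>i j. 0 \<le> q i j" "irreducible_matrix q" using assms(1) by (auto simp: quasi_stochastic_def)
    \<comment> \<open>\<open>quasi_stochastic\<close> gives uniqueness relative to some eigenvector
      \<open>w\<close>; as \<open>u\<close> is a nonzero multiple of \<open>w\<close>, it holds
      relative to \<open>u\<close>.\<close>
    fix u' assume "positive_left_eigenvector q u'"
    then obtain c' where c': "\<And>i. u' i = c' * w i" using w(2) by blast
    obtain c where c: "\<And>i. u i = c * w i" using w(2) assms(2) by blast
    have "0 < u i" using assms(2) unfolding positive_left_eigenvector_def by blast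
    then have "c \<noteq> 0" using c[of i] by auto
    then have "u' i = (c' / c) * u i" for i by (simp add: c c')
    then show "\<exists>c. \<forall>i. u' i = c * u i" by blast
  qed (rule assms)+
  \<comment> \<open>The excursions start from \<open>i\<close> itself, because
    \<open>decomposition\<close> describes the component of the reference state.\<close>
  interpret drifting_excursion q u v F i
    by (intro drifting_excursion.intro excursion.intro drifting_excursion_axioms.intro recurrent_chain_axioms assms)
  from g have "admissible i g"
    by (elim disjE conjE) (rule H_admissible_dRi H_admissible_spread; assumption)+
  note L = renewal_conv_limits[OF this, unfolded \<rho>_def]
  show "(\<forall>t. renewal_conv_exists q F g i t) \<and> bounded (range (renewal_conv q F g i)) \<and>
      (renewal_conv q F g i \<longlongrightarrow> v i * real_of_ereal (1 / drift q u v F) *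
         (\<Sum>\<^sub>\<infinity>j. u j * (LINT x|lborel. g j x))) at_top \<and>
      (renewal_conv q F g i \<longlongrightarrow> 0) at_bot"
    by (intro conjI allI L)
qed

end
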